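(* Under the standing assumptions (1)–(6) of the context, the following hold. (i) The environment seen by the perturbed walker, $(\tau_{X^{(\varepsilon)}_t}\sigma_t)_{t\ge 0}$, admits a unique distribution $\mu_\varepsilon$ on $\Omega$ which is invariant and absolutely continuous w.r.t. $\mu$. Whenever the environment seen by the perturbed walker has initial distribution absolutely continuous w.r.t. $\mu$, its distribution at time $t$ converges weakly to $\mu_\varepsilon$ as $t\to\infty$. Moreover, $\mu_\varepsilon$ is ergodic w.r.t. time translations and $$\mu_\varepsilon(f)=\mu(f)+\sum_{n=0}^\infty\int_0^\infty \mu\big(\hat L_\varepsilon S^{(n)}_\varepsilon(s)f\big)\,ds,\qquad f\in L^2(\mu),$$ where $\int_0^\infty\big|\mu\big(\hat L_\varepsilon S^{(n)}_\varepsilon(s)f\big)\big|\,ds\le(\varepsilon/\gamma)^{n+1}\|f-\mu(f)\|$. (ii) If for all $y\in\mathbb Z^d$, $\eta\in\Omega$ one has $r(y,\eta)>0\Rightarrow r_\varepsilon(y,\eta)>0$, then $\mu$ and $\mu_\varepsilon$ are mutually absolutely continuous. Alternatively, if there exist subsets $V,V_\varepsilon\subset\mathbb Z^d$ such that (a) $r(y,\eta)>0$ iff $y\in V$, (b) $\hat r_\varepsilon(y,\eta)>0$ iff $y\in V_\varepsilon$, (c) each vector in $V$ can be written as a sum of vectors in $V_\varepsilon$, then $\mu$ and $\mu_\varepsilon$ are mutually absolutely continuous. (iii) Suppose the moment condition in (3) holds with $n=2$. Let $j^{(\varepsilon)}(\eta):=\sum_{y\in\mathbb Z^d}y\,r_\varepsilon(y,\eta)$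 and $v(\varepsilon):=\mu_\varepsilon(j^{(\varepsilon)})$. Then $$P^{(\varepsilon)}_{\eta,0}\Big(\lim_{t\to\infty}\frac{X^{(\varepsilon)}_t}{t}=v(\varepsilon)\Big)=1\qquad( * )$$ for $\mu_\varepsilon$-a.e. $\eta$, and for $\eta$ varying in a set of $\mu$-probability at least $1-\varepsilon^2/(\gamma-\varepsilon)^2$. If $\mu$ and $\mu_\varepsilon$ are mutually absolutely continuous as in item (ii), then $( * )$ holds for $\mu$-a.e. $\eta$. (iv) The asymptotic velocity $v(\varepsilon)=\mu_\varepsilon(j^{(\varepsilon)})$ can be expressed as $$v(\varepsilon)=\mu(j^{(\varepsilon)})+\sum_{n=0}^\infty\int_0^\infty\mu\big(\hat L_\varepsilon S^{(n)}_\varepsilon(s)j^{(\varepsilon)}\big)\,ds,$$ and moreover $\big|\mu\big(\hat L_\varepsilon S^{(n)}_\varepsilon(s)j^{(\varepsilon)}\big)\big|\le\varepsilon^{n+1}e^{-\gamma s}s^n\|j^{(\varepsilon)}\|_\infty/n!$ for all $n\ge0$ (and $s\ge 0$).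
   Context: $S$ is a compact Polish space, $\Omega=S^{\mathbb Z^d}$ with the product topology, $(\tau_x\eta)(y)=\eta(x+y)$; $C(\Omega)$ is the space of real continuous functions with sup norm. For a measure $\nu$, $\nu(f)=\int f\,d\nu$. $\|\cdot\|$ is the norm of $L^2(\mu)$ and the associated operator norm; $\|\cdot\|_\infty$ is the sup norm. Operators act on vector-valued functions componentwise. Standing assumptions. (1) The dynamic random environment $(\sigma_t)_{t\ge0}$ is a Feller Markov process on $\Omega$ with càdlàg paths, stationary w.r.t. a probability measure $\mu$ which is translation invariant. Its expectation when started at $\sigma$ is $\mathbb E^{\rm env}_\sigma$; $S_{\rm env}(t)f(\sigma)=\mathbb E^{\rm env}_\sigma[f(\sigma_t)]$ is its semigroup on $L^2(\mu)$, with generator $L_{\rm env}$ of domain $\mathcal D(L_{\rm env})$; its generator on $C(\Omega)$ is $\mathcal L_{\rm env}$, with domain $\mathcal D(\mathcal L_{\rm env})$. (2) $S_{\rm env}(t)(f\circ\tau_x)=(S_{\rm env}(t)f)\circ\tau_x$ for all $f\in L^2(\mu)$, $t\ge0$, $x\in\mathbb Z^d$; and for some $\gamma>0$ the Poincaré inequality $\gamma\|f\|^2\le-\mu(fL_{\rm env}f)$ holds for all $f\in\mathcal D(L_{\rm env})$ with $\mu(f)=0$. (3) There are continuous functions $r_\varepsilon(y,\cdot),r(y,\cdot),\hat r_\varepsilon(y,\cdot)$ on $\Omega$, $y\in\mathbb Z^d$, which vanish for $y=0$, with $r_\varepsilon,r\ge0$ and $r_\varepsilon=r+\hat r_\varepsilon$,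 such that for some $n\ge1$ the moment condition holds: $\sum_y|y|^n\sup_\eta r(y,\eta)<\infty$ and $\sum_y|y|^n\sup_\eta|\hat r_\varepsilon(y,\eta)|<\infty$. The unperturbed walker $(X_t)$ on $\mathbb Z^d$ jumps from $x$ to $x+y$ at rate $r(y,\tau_x\eta)$ when the (autonomous) environment is in state $\eta$, so that $(\sigma_t,X_t)$ is Markov with formal generator $L_{\rm env}f(\cdot,x)(\eta)+\sum_yr(y,\tau_x\eta)[f(\eta,x+y)-f(\eta,x)]$. The perturbed walker $(X^{(\varepsilon)}_t)$ is defined in the same way with $r_\varepsilon$ in place of $r$; $P^{(\varepsilon)}_{\eta,x}$ is the law of $(\sigma_t,X^{(\varepsilon)}_t)_{t\ge0}$ started at $(\eta,x)$. (Concretely: take a rate-$\lambda$ Poisson process with $\lambda$ large, independent of the environment; at each of its times $s$ the walker at $z$ jumps by $y$ with probability $r_\varepsilon(y,\tau_z\sigma_{s-})/\lambda$ and otherwise stays put.) (4) The environments seen from the walkers, $(\tau_{X_t}\sigma_t)_{t\ge0}$ and $(\tau_{X^{(\varepsilon)}_t}\sigma_t)_{t\ge0}$, are Feller processes on $\Omega$ with generators on $C(\Omega)$ given by $\mathcal L_{\rm env}+\mathcal L_{\rm jump}$ and $\mathcal L_{\rm env}+\mathcal L_{\rm jump}+\hat{\mathcal L}_\varepsilon$ respectively, both with domain $\mathcal D(\mathcal L_{\rm env})$, where $\mathcal L_{\rm jump}f(\eta)=\sum_yr(y,\eta)[f(\tau_y\eta)-f(\eta)]$ and $\hat{\mathcal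 L}_\varepsilon f(\eta)=\sum_y\hat r_\varepsilon(y,\eta)[f(\tau_y\eta)-f(\eta)]$. (5) $\mu$ is invariant for $(\tau_{X_t}\sigma_t)_{t\ge0}$. (6) The bounded operator $\hat L_\varepsilon$ on $L^2(\mu)$, $\hat L_\varepsilon f(\eta)=\sum_y\hat r_\varepsilon(y,\eta)[f(\tau_y\eta)-f(\eta)]$, has norm $\varepsilon:=\|\hat L_\varepsilon\|<\gamma$. Notation. $S(t)$ is the $L^2(\mu)$-semigroup of the environment seen by the unperturbed walker. The operators $S^{(n)}_\varepsilon(t)$ are defined by $S^{(0)}_\varepsilon(t)=S(t)$, $S^{(n+1)}_\varepsilon(t)=\int_0^tS(t-s)\hat L_\varepsilon S^{(n)}_\varepsilon(s)\,ds$. Ergodicity of $\mu_\varepsilon$ w.r.t. time translations means: under the law of the environment seen by the perturbed walker started from $\mu_\varepsilon$, every Borel set of càdlàg paths invariant under all time shifts $(\theta_t\eta)_s=\eta_{t+s}$ has probability $0$ or $1$. *)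

theory Defs
  imports "HOL-Probability.Probability"
begin

subsection \<open>Configurations and translations\<close>

text \<open>
  \<open>\<Omega> = S\<^sup>\<int>\<^sup>d\<close>, with \<open>S\<close> the type \<open>'s :: polish_space\<close>.  The topology on the function type is the product
  topology, and since the index type is countable this is again a Polish space.  Compactness of
  \<open>S\<close> is a hypothesis wherever it is needed.
\<close>

type_synonym 'd lattice = "(int, 'd) vec"
type_synonym ('s, 'd) config = "'d lattice \<Rightarrow> 's"

definition translate :: "('d::finite) lattice \<Rightarrow> ('s, 'd) config \<Rightarrow> ('s, 'd) config" where
  "translate x \<eta> = (\<lambda>y. \<eta> (x + y))"

definition zvec :: "('d::finite) lattice \<Rightarrow> real ^ 'd" where
  "zvec y = (\<chi> i. real_of_int (y $ i))"


subsection \<open>Path space and Feller processes\<close>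

definition cadlag :: "(real \<Rightarrow> 'a::topological_space) \<Rightarrow> bool" where
  "cadlag w \<longleftrightarrow>
     (\<forall>t\<ge>0. continuous (at_right t) w) \<and> (\<forall>t>0. \<exists>l. (w \<longlongrightarrow> l) (at_left t))"

text \<open>
  Paths have time set \<open>[0,\<infinity>)\<close>; as elements of the extensional product they are \<open>undefined\<close> at
  negative times.  On a Polish state space the \<open>\<sigma>\<close>-algebra generated by the coordinates is the
  Borel \<open>\<sigma>\<close>-algebra of the Skorokhod topology.
\<close>

definition path_space :: "(real \<Rightarrow> 'a::topological_space) measure" where
  "path_space = restrict_space (\<Pi>\<^sub>M t\<in>{0..}. borel) {w. cadlag w}"

definition past :: "real \<Rightarrow> (real \<Rightarrow> 'a::topological_space) measure" where
  "past s = vimage_algebra (space path_space) (\<lambda>w. restrict w {0..s}) (\<Pi>\<^sub>M u\<in>{0..s}. borel)"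

definition shift :: "real \<Rightarrow> (real \<Rightarrow> 'a) \<Rightarrow> real \<Rightarrow> 'a" where
  "shift t w = (\<lambda>s\<in>{0..}. w (t + s))"

text \<open>
  \<open>markov_semigroup P t f x = E\<^sub>x[f(w\<^sub>t)]\<close>.  For \<open>f\<close> in \<open>C(\<Omega>)\<close> this is the semigroup on \<open>C(\<Omega>)\<close>.  For \<open>f\<close> a
  representative of an element of \<open>L\<^sup>2(\<mu>)\<close>, with \<open>\<mu>\<close> invariant, the integral exists for \<open>\<mu>\<close>-almost
  every \<open>x\<close> and gives a representative of the image of \<open>f\<close> under the semigroup on \<open>L\<^sup>2(\<mu>)\<close>.  The
  value type is arbitrary so that the operator acts componentwise on vector-valued functions.
\<close>

definition markov_semigroup ::
  "('a \<Rightarrow> (real \<Rightarrow> 'a) measure) \<Rightarrow> real \<Rightarrow> ('a \<Rightarrow> 'b) \<Rightarrow> 'a \<Rightarrow> 'b::{banach, second_countable_topology}"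
where
  "markov_semigroup P t f x = (\<integral>w. f (w t) \<partial>P x)"

definition feller_process :: "('a::topological_space \<Rightarrow> (real \<Rightarrow> 'a) measure) \<Rightarrow> bool" where
  "feller_process P \<longleftrightarrow>
     P \<in> borel \<rightarrow>\<^sub>M prob_algebra path_space \<and>
     (\<forall>x. AE w in P x. w 0 = x) \<and>
     (\<forall>x. \<forall>s\<ge>0. \<forall>A\<in>sets (past s). \<forall>B\<in>sets path_space.
        measure (P x) {w \<in> A. shift s w \<in> B} = (\<integral>w. indicator A w * measure (P (w s)) B \<partial>P x)) \<and>
     (\<forall>t\<ge>0. \<forall>f :: 'a \<Rightarrow> real. continuous_on UNIV f \<longrightarrow> continuous_on UNIV (markov_semigroup P t f)) \<and>
     (\<forall>f :: 'a \<Rightarrow> real. continuous_on UNIV f \<longrightarrow>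
        uniform_limit UNIV (\<lambda>t. markov_semigroup P t f) f (at_right 0))"

text \<open>
  \<open>C_generator P f g\<close>: \<open>f\<close> is in the domain of the generator on \<open>C(\<Omega>)\<close>, which maps it to \<open>g\<close>.
\<close>

definition C_generator ::
  "('a::topological_space \<Rightarrow> (real \<Rightarrow> 'a) measure) \<Rightarrow> ('a \<Rightarrow> real) \<Rightarrow> ('a \<Rightarrow> real) \<Rightarrow> bool" where
  "C_generator P f g \<longleftrightarrow> continuous_on UNIV f \<and> continuous_on UNIV g \<and>
     uniform_limit UNIV (\<lambda>t x. (markov_semigroup P t f x - f x) / t) g (at_right 0)"

definition law_from ::
  "('a \<Rightarrow> (real \<Rightarrow> 'a) measure) \<Rightarrow> 'a measure \<Rightarrow> (real \<Rightarrow> 'a::topological_space) measure" where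
  "law_from P \<nu> = \<nu> \<bind> P"

definition dist_at ::
  "('a \<Rightarrow> (real \<Rightarrow> 'a) measure) \<Rightarrow> 'a measure \<Rightarrow> real \<Rightarrow> 'a::topological_space measure" where
  "dist_at P \<nu> t = distr (law_from P \<nu>) borel (\<lambda>w. w t)"

definition distribution :: "'a::topological_space measure \<Rightarrow> bool" where
  "distribution \<nu> \<longleftrightarrow> prob_space \<nu> \<and> sets \<nu> = sets borel"

definition invariant ::
  "('a \<Rightarrow> (real \<Rightarrow> 'a) measure) \<Rightarrow> 'a::topological_space measure \<Rightarrow> bool" where
  "invariant P \<nu> \<longleftrightarrow> (\<forall>t\<ge>0. dist_at P \<nu> t = \<nu>)"

definition time_ergodic ::
  "('a \<Rightarrow> (real \<Rightarrow> 'a) measure) \<Rightarrow> 'a::topological_space measure \<Rightarrow> bool" where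
  "time_ergodic P \<nu> \<longleftrightarrow>
     (\<forall>A\<in>sets path_space. (\<forall>t\<ge>0. {w \<in> space path_space. shift t w \<in> A} = A) \<longrightarrow>
        measure (law_from P \<nu>) A \<in> {0, 1})"

definition weakly_converges ::
  "('i \<Rightarrow> 'a::topological_space measure) \<Rightarrow> 'a measure \<Rightarrow> 'i filter \<Rightarrow> bool" where
  "weakly_converges M N F \<longleftrightarrow>
     (\<forall>f :: 'a \<Rightarrow> real. continuous_on UNIV f \<and> bounded (range f) \<longrightarrow>
        ((\<lambda>i. \<integral>x. f x \<partial>M i) \<longlongrightarrow> (\<integral>x. f x \<partial>N)) F)"


subsection \<open>The space \<open>L\<^sup>2\<close>\<close>

text \<open>
  Elements of \<open>L\<^sup>2(\<mu>)\<close> are handled through representatives; equality in \<open>L\<^sup>2(\<mu>)\<close> is equality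
  almost everywhere.
\<close>

definition L2 :: "'a measure \<Rightarrow> ('a \<Rightarrow> real) set" where
  "L2 M = {f \<in> borel_measurable M. integrable M (\<lambda>x. (f x)\<^sup>2)}"

definition L2_norm :: "'a measure \<Rightarrow> ('a \<Rightarrow> real) \<Rightarrow> real" where
  "L2_norm M f = sqrt (\<integral>x. (f x)\<^sup>2 \<partial>M)"

definition L2_opnorm :: "'a measure \<Rightarrow> (('a \<Rightarrow> real) \<Rightarrow> 'a \<Rightarrow> real) \<Rightarrow> real" where
  "L2_opnorm M A = Sup {L2_norm M (A f) | f. f \<in> L2 M \<and> L2_norm M f \<le> 1}"

definition L2_generator ::
  "'a measure \<Rightarrow> ('a \<Rightarrow> (real \<Rightarrow> 'a) measure) \<Rightarrow> ('a \<Rightarrow> real) \<Rightarrow> ('a \<Rightarrow> real) \<Rightarrow> bool" where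
  "L2_generator M P f g \<longleftrightarrow> f \<in> L2 M \<and> g \<in> L2 M \<and>
     ((\<lambda>t. L2_norm M (\<lambda>x. (markov_semigroup P t f x - f x) / t - g x)) \<longlongrightarrow> 0) (at_right 0)"


subsection \<open>The walker in the dynamic environment\<close>

definition moment_condition ::
  "nat \<Rightarrow> (('d::finite) lattice \<Rightarrow> ('s, 'd) config \<Rightarrow> real) \<Rightarrow> bool" where
  "moment_condition n f \<longleftrightarrow>
     (\<lambda>y. norm (zvec y) ^ n * (SUP \<eta>. \<bar>f y \<eta>\<bar>)) summable_on UNIV"

text \<open>
  Applied to a uniform variable \<open>u\<close> on \<open>[0,1]\<close>, \<open>jump p u\<close> equals \<open>y \<noteq> 0\<close> with probability \<open>p y\<close> and \<open>0\<close>
  otherwise, when \<open>p \<ge> 0\<close> vanishes at \<open>0\<close> and has sum at most \<open>1\<close>: the interval \<open>[0,1)\<close> is cut into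
  consecutive pieces of lengths \<open>p y\<close>, in the order of the enumeration \<open>to_nat\<close> of the lattice.
\<close>

definition jump_piece :: "('d::finite lattice \<Rightarrow> real) \<Rightarrow> 'd lattice \<Rightarrow> real set" where
  "jump_piece p y =
     {(\<Sum>z | to_nat z < to_nat y. p z)..<(\<Sum>z | to_nat z \<le> to_nat y. p z)}"

definition jump :: "('d::finite lattice \<Rightarrow> real) \<Rightarrow> real \<Rightarrow> 'd lattice" where
  "jump p u =
     (if \<exists>y. u \<in> jump_piece p y then THE y. u \<in> jump_piece p y else 0)"

text \<open>
  \<open>e\<close> is the sequence of waiting times of the Poisson process, whose points are \<open>arrival e n\<close>; the
  case distinction in \<open>num_arrivals\<close> excludes a null set on which the points accumulate.
\<close>

definition arrival :: "(nat \<Rightarrow> real) \<Rightarrow> nat \<Rightarrow> real" where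
  "arrival e n = (\<Sum>k\<le>n. e k)"

definition num_arrivals :: "(nat \<Rightarrow> real) \<Rightarrow> real \<Rightarrow> nat" where
  "num_arrivals e t =
     (if filterlim (arrival e) at_top sequentially then card {n. arrival e n \<le> t} else 0)"

text \<open>\<open>skeleton \<dots> n\<close> is the position of the walker after the first \<open>n\<close> points of the Poisson process.\<close>

primrec skeleton ::
  "real \<Rightarrow> (('d::finite) lattice \<Rightarrow> ('s::polish_space, 'd) config \<Rightarrow> real) \<Rightarrow> 'd lattice \<Rightarrow>
   (real \<Rightarrow> ('s, 'd) config) \<Rightarrow> (nat \<Rightarrow> real) \<Rightarrow> (nat \<Rightarrow> real) \<Rightarrow> nat \<Rightarrow> 'd lattice" where
  "skeleton rate r x \<sigma> e u 0 = x"
| "skeleton rate r x \<sigma> e u (Suc n) =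
     (let z = skeleton rate r x \<sigma> e u n
      in z + jump (\<lambda>y. r y (translate z (Lim (at_left (arrival e n)) \<sigma>)) / rate) (u n))"

definition driving_measure ::
  "('a \<Rightarrow> (real \<Rightarrow> 'a) measure) \<Rightarrow> real \<Rightarrow> 'a \<Rightarrow> ((real \<Rightarrow> 'a) \<times> (nat \<Rightarrow> real) \<times> (nat \<Rightarrow> real)) measure" where
  "driving_measure P rate \<eta> =
     P \<eta> \<Otimes>\<^sub>M (\<Pi>\<^sub>M n\<in>UNIV. density lborel (exponential_density rate)) \<Otimes>\<^sub>M
     (\<Pi>\<^sub>M n\<in>UNIV. uniform_measure lborel {0..1})"

text \<open>
  \<open>walker_law P rate r \<eta> x\<close> is the law of \<open>(\<sigma>\<^sub>t, X\<^sub>t)\<close> started at \<open>(\<eta>, x)\<close>, where the environment has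
  laws \<open>P\<close> and the walker has jump rates \<open>r\<close>.
\<close>

definition walker_law ::
  "(('s::polish_space, 'd::finite) config \<Rightarrow> (real \<Rightarrow> ('s, 'd) config) measure) \<Rightarrow> real \<Rightarrow>
   ('d lattice \<Rightarrow> ('s, 'd) config \<Rightarrow> real) \<Rightarrow> ('s, 'd) config \<Rightarrow> 'd lattice \<Rightarrow>
   (real \<Rightarrow> ('s, 'd) config \<times> 'd lattice) measure" where
  "walker_law P rate r \<eta> x =
     distr (driving_measure P rate \<eta>) path_space
       (\<lambda>(\<sigma>, e, u). \<lambda>t\<in>{0..}. (\<sigma> t, skeleton rate r x \<sigma> e u (num_arrivals e t)))"

definition seen_from_walker ::
  "(('s::polish_space, 'd::finite) config \<Rightarrow> (real \<Rightarrow> ('s, 'd) config) measure) \<Rightarrow> real \<Rightarrow>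
   ('d lattice \<Rightarrow> ('s, 'd) config \<Rightarrow> real) \<Rightarrow> ('s, 'd) config \<Rightarrow> (real \<Rightarrow> ('s, 'd) config) measure" where
  "seen_from_walker P rate r \<eta> =
     distr (walker_law P rate r \<eta> 0) path_space (\<lambda>w. \<lambda>t\<in>{0..}. translate (snd (w t)) (fst (w t)))"

definition has_velocity ::
  "(real \<Rightarrow> ('s, 'd::finite) config \<times> 'd lattice) measure \<Rightarrow> real ^ 'd \<Rightarrow> bool" where
  "has_velocity M v \<longleftrightarrow> (AE w in M. ((\<lambda>t. zvec (snd (w t)) /\<^sub>R t) \<longlongrightarrow> v) at_top)"

definition drift ::
  "(('d::finite) lattice \<Rightarrow> ('s, 'd) config \<Rightarrow> real) \<Rightarrow> ('s, 'd) config \<Rightarrow> real ^ 'd" where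
  "drift r \<eta> = (\<Sum>\<^sub>\<infinity>y. r y \<eta> *\<^sub>R zvec y)"

definition jump_op ::
  "(('d::finite) lattice \<Rightarrow> ('s, 'd) config \<Rightarrow> real) \<Rightarrow> (('s, 'd) config \<Rightarrow> 'b::banach) \<Rightarrow>
   ('s, 'd) config \<Rightarrow> 'b" where
  "jump_op r f \<eta> = (\<Sum>\<^sub>\<infinity>y. r y \<eta> *\<^sub>R (f (translate y \<eta>) - f \<eta>))"

text \<open>
  \<open>dyson Q h n t\<close> is \<open>S\<^sup>(\<^sup>n\<^sup>)(t)\<close>, where \<open>Q\<close> is the unperturbed process and \<open>h\<close> the perturbation of the
  rates.  The integral of \<open>L\<^sup>2(\<mu>)\<close>-valued functions is evaluated pointwise on representatives; it
  exists for \<open>\<mu>\<close>-almost every \<open>\<eta>\<close> and agrees with the Bochner integral in \<open>L\<^sup>2(\<mu>)\<close>.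
\<close>

primrec dyson ::
  "(('s, 'd::finite) config \<Rightarrow> (real \<Rightarrow> ('s, 'd) config) measure) \<Rightarrow>
   ('d lattice \<Rightarrow> ('s, 'd) config \<Rightarrow> real) \<Rightarrow> nat \<Rightarrow> real \<Rightarrow>
   (('s, 'd) config \<Rightarrow> 'b::{banach, second_countable_topology}) \<Rightarrow> ('s, 'd) config \<Rightarrow> 'b" where
  "dyson Q h 0 = markov_semigroup Q"
| "dyson Q h (Suc n) = (\<lambda>t f \<eta>.
     LINT s:{0..t}|lborel. markov_semigroup Q (t - s) (jump_op h (dyson Q h n s f)) \<eta>)"

definition mutually_ac :: "'a measure \<Rightarrow> 'a measure \<Rightarrow> bool" where
  "mutually_ac M N \<longleftrightarrow> absolutely_continuous M N \<and> absolutely_continuous N M"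

end

theory Submission
 imports Defs
begin

text \<open>
The unperturbed process seen from the walker, with semigroup \<open>S(t)\<close>, and the perturbed one, with semigroup \<open>S\<^sub>\<epsilon>(t)\<close>,
have generators which differ by the bounded operator \<open>J = jump_op rh\<close>, of norm \<open>\<epsilon> < \<gamma>\<close> on \<open>L\<^sup>2(\<mu>)\<close>.
On functions centred under \<open>\<mu>\<close>, the Poincare inequality for the environment, together with the fact that the unperturbed jumps
only dissipate (\<open>\<mu>\<close> is invariant for them), makes the \<open>\<mu>\<close>-variance decay at rate \<open>\<gamma>\<close> along \<open>S\<close>. The perturbation
spoils at most \<open>\<epsilon>\<close> of this, hence the \<open>\<mu>\<close>-variance decays at rate \<open>\<gamma> - \<epsilon>\<close> along \<open>S\<^sub>\<epsilon>\<close>. The measure \<open>\<mu>\<close> is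
not invariant for \<open>S\<^sub>\<epsilon>\<close>, but the mean \<open>\<mu>(S\<^sub>\<epsilon>(t)f)\<close> moves at a speed bounded by \<open>\<epsilon>\<close> times a standard
deviation which decays exponentially. So it converges (\<open>limit_mean\<close>), the limit is controlled by the \<open>L\<^sup>2(\<mu>)\<close> norm of \<open>f\<close>,
and it is the integral of \<open>f\<close> against a measure \<open>\<mu>\<^sub>\<epsilon>\<close>, absolutely continuous with respect to \<open>\<mu>\<close> and invariant.
Moreover \<open>S\<^sub>\<epsilon>(t)f\<close> converges in \<open>L\<^sup>2(\<mu>)\<close> to the constant \<open>\<mu>\<^sub>\<epsilon>(f)\<close>; this gives weak convergence, uniqueness and ergodicity.

The series comes from the Duhamel identity \<open>\<mu>\<^sub>\<epsilon>(f) = \<mu>(f) + \<integral>\<^sub>0\<^sup>\<infinity> \<mu>\<^sub>\<epsilon>(J S(s) f) ds\<close> (\<open>duhamel\<close>), iterated by replacing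
\<open>f\<close> with \<open>J S\<^sup>(\<^sup>n\<^sup>)\<^sub>\<epsilon>(s) f\<close>; the remainder is of order \<open>(\<epsilon>/\<gamma>)\<^sup>n\<close>. Expansion of the velocity is the same statement,
component by component (\<open>vector_series_expansion\<close>).

For mutual absolute continuity one argument serves both criteria (\<open>mutually_ac_of_domination\<close>). The Poisson clock does not ring
before \<open>t\<close> with probability \<open>exp (- t * rate)\<close>, hence the perturbed process dominates a multiple of the environment
(\<open>no_arrival\<close>). The set \<open>A\<close> where the density of \<open>\<mu>\<^sub>\<epsilon>\<close> vanishes is therefore
invariant under the environment, its centred indicator lies in the kernel of the generator, and by the Poincare inequality \<open>\<mu>(A)\<close> is
\<open>0\<close> or \<open>1\<close>; it is not \<open>1\<close>, because \<open>\<mu>\<^sub>\<epsilon>\<close> has mass \<open>1\<close>.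

The velocity exists for \<open>\<mu>\<close>-almost every initial environment, which gives the three almost sure statements. The displacement minus the
integrated drift along the path is a sum of martingale differences with bounded second moments, hence \<open>o(t)\<close>
(\<open>displacement_limit\<close>). The time average of the drift converges because its correlations under the process started from \<open>\<mu>\<close>
decay exponentially (\<open>time_average\<close>). Both use one law of large numbers, \<open>second_moment_law_of_large_numbers\<close>.
\<close>

abbreviation (input) borel_fun :: "('a::topological_space => 'b::topological_space) => bool" where
 "borel_fun f == f \<in> borel_measurable borel"

abbreviation (input) product_measure :: "'a measure => 'b measure => ('a \<times> 'b) measure" (infixr "\<otimes>" 80) where
 "M \<otimes> N == M \<Otimes>\<^sub>M N"

abbreviation (input) measurable_maps :: "'a measure => 'b measure => ('a => 'b) set" (infixr "\<leadsto>" 60) where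
 "M \<leadsto> N == measurable M N"

abbreviation (input) tends_to :: "('b => 'a::topological_space) => 'a => 'b filter => bool" (infixr "--->" 55) where
 "f ---> l == (f \<longlongrightarrow> l)"

abbreviation (input) converges_to :: "(nat => 'a::topological_space) => 'a => bool" ("(_)/ ----> (_)" [60, 60] 60) where
 "X ----> L == X \<longlonglongrightarrow> L"

type_synonym 'a path = "real => 'a"

type_synonym ('s, 'd) driving = "(real => ('s, 'd) config) \<times> (nat => real) \<times> (nat => real)"

lemmas integrable_dominated = Bochner_Integration.integrable_bound
lemmas bochner_cong = Bochner_Integration.integral_cong
lemmas bochner_nonneg = Bochner_Integration.integral_nonneg

section \<open>Path space\<close>

lemma space_path_space:
 "space path_space = {w \<in> extensional {0..}. cadlag (w :: real => 'a::topological_space)}" by (auto simp: path_space_def space_restrict_space space_PiM PiE_def)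

lemma path_coordinate_measurable [measurable]:
 "(%w. w t) \<in> (path_space :: 'a::topological_space path measure) \<leadsto> borel"
proof (cases "t >= 0")
 case True
 thus ?thesis
  unfolding path_space_def by (intro measurable_restrict_space1 measurable_component_singleton) auto
next
 case False
 hence "w t = undefined" if "w \<in> space path_space" for w :: "real => 'a" using that by (auto simp: space_path_space extensional_def)
 thus ?thesis by (subst measurable_cong[of _ _ "%_. undefined"]) auto
qed

lemma measurable_path_spaceI:
 assumes "!!t. t >= 0 ==> (%x. f x t) \<in> M \<leadsto> borel"
  and "!!x. x \<in> space M ==> f x \<in> extensional {0..}"
  and "!!x. x \<in> space M ==> cadlag (f x)"
 shows "f \<in> M \<leadsto> path_space"
 unfolding path_space_def
proof (intro measurable_restrict_space2)
 show "f \<in> space M \<rightarrow> {w. cadlag w}" using assms(3) by auto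
 show "f \<in> M \<leadsto> Pi\<^sub>M {0..} (%t. borel)"
 proof (rule measurable_PiM_single')
  show "(%omega. f omega i) \<in> borel_measurable M" if "i \<in> {0..}" for i using assms(1) that by auto
  show "f \<in> space M \<rightarrow> {0..} \<rightarrow>\<^sub>E space borel" using assms(2) by (auto simp: PiE_def)
 qed
qed

text \<open>A path is constant on the negative half-line, so that it has one-sided limits at all real times.\<close>

lemma path_right_continuous:
 assumes "w \<in> space (path_space :: 'a::topological_space path measure)"
 shows "(w ---> w t) (at_right t)"
proof (cases "t >= 0")
 case True
 thus ?thesis using assms by (auto simp: space_path_space cadlag_def continuous_within)
next
 case False
 have "\<forall>\<^sub>F s in at_right t. w s = w t"
 proof -
  have "\<forall>\<^sub>F s in at_right t. s < 0" using False by (intro eventually_at_right_less order_tendstoD(2)[OF tendsto_ident_at]) auto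
  thus ?thesis by eventually_elim (use False assms in "auto simp: space_path_space extensional_def")
 qed
 thus ?thesis by (rule tendsto_eventually)
qed

lemma path_left_limit:
 assumes w: "w \<in> space (path_space :: 'a::t2_space path measure)"
 shows "(w ---> Lim (at_left t) w) (at_left t)"
proof -
 have "EX l. (w ---> l) (at_left t)"
 proof (cases "t > 0")
  case True
  thus ?thesis using assms by (auto simp: space_path_space cadlag_def)
 next
  case False
  have "\<forall>\<^sub>F s in at_left t. s < t" by (simp add: eventually_at_filter)
  hence "\<forall>\<^sub>F s in at_left t. w s = undefined" by eventually_elim (use False assms in "auto simp: space_path_space extensional_def")
  thus ?thesis by (blast intro: tendsto_eventually)
 qed
 then obtain l where "(w ---> l) (at_left t)" by blast
 moreover from this have "Lim (at_left t) w = l" by (intro tendsto_Lim) auto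
 ultimately show ?thesis by simp
qed

text \<open>
Right continuity makes evaluation jointly measurable: \<open>w t\<close> is the limit of the values of \<open>w\<close> at the multiples of \<open>1 / (n + 1)\<close> just above \<open>t\<close>.
\<close>

lemma path_evaluation_measurable:
 "(%p. fst p (snd p)) \<in> (path_space :: 'a::metric_space path measure) \<otimes> borel \<leadsto> borel"
proof (rule borel_measurable_LIMSEQ_metric)
 fix n :: nat
 show "(%p. fst p ((of_int \<lfloor>real (Suc n) * snd p\<rfloor> + 1) / real (Suc n)))
   \<in> borel_measurable ((path_space :: 'a path measure) \<otimes> borel)"
 proof (rule measurable_compose_countable[where f = "%i p. fst p ((of_int i + 1) / real (Suc n))"])
  show "(%p. fst p ((of_int i + 1) / real (Suc n)))
   \<in> borel_measurable ((path_space :: 'a path measure) \<otimes> borel)" for i :: int by (rule measurable_compose[OF measurable_fst path_coordinate_measurable])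
  show "(%p. \<lfloor>real (Suc n) * snd p\<rfloor>) \<in> (path_space :: 'a path measure) \<otimes> borel \<leadsto> count_space UNIV" by measurable
 qed
next
 fix p :: "(real => 'a) \<times> real" assume p: "p \<in> space (path_space \<otimes> borel)"
 obtain w t where wt: "p = (w, t)" by force
 have w: "w \<in> space path_space" using p wt by (auto simp: space_pair_measure)
 have "filterlim (%n. (of_int \<lfloor>real (Suc n) * t\<rfloor> + 1) / real (Suc n)) (at_right t) sequentially"
  unfolding filterlim_at
 proof (intro conjI)
  have b: "t < (of_int \<lfloor>real (Suc n) * t\<rfloor> + 1) / real (Suc n)"
   "(of_int \<lfloor>real (Suc n) * t\<rfloor> + 1) / real (Suc n) <= t + 1 / real (Suc n)" for n
  proof -
   have "real (Suc n) * t < of_int \<lfloor>real (Suc n) * t\<rfloor> + 1" by linarith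
   thus "t < (of_int \<lfloor>real (Suc n) * t\<rfloor> + 1) / real (Suc n)" by (simp add: field_simps)
   have "of_int \<lfloor>real (Suc n) * t\<rfloor> + 1 <= real (Suc n) * t + 1" by linarith
   hence "(of_int \<lfloor>real (Suc n) * t\<rfloor> + 1) / real (Suc n) <= (real (Suc n) * t + 1) / real (Suc n)" by (intro divide_right_mono) auto
   also have "... = t + 1 / real (Suc n)" by (simp add: add_divide_distrib del: of_nat_Suc)
   finally show "(of_int \<lfloor>real (Suc n) * t\<rfloor> + 1) / real (Suc n) <= t + 1 / real (Suc n)" .
  qed
  show "\<forall>\<^sub>F n in sequentially. (of_int \<lfloor>real (Suc n) * t\<rfloor> + 1) / real (Suc n) \<in> {t<..} &
   (of_int \<lfloor>real (Suc n) * t\<rfloor> + 1) / real (Suc n) ~= t" using b(1) by (intro always_eventually allI) (metis greaterThan_iff less_irrefl)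
  have "(%n. t + 1 / real (Suc n)) ----> t + 0" by (intro tendsto_intros LIMSEQ_Suc lim_1_over_n)
  hence "(%n. t + 1 / real (Suc n)) ----> t" by simp
  thus "(%n. (of_int \<lfloor>real (Suc n) * t\<rfloor> + 1) / real (Suc n)) ----> t" by (rule tendsto_sandwich[OF always_eventually always_eventually tendsto_const, rotated 2])
    (use b(2) less_imp_le[OF b(1)] in blast)+
 qed
 from filterlim_compose[OF path_right_continuous[OF w] this]
 show "(%n. fst p ((of_int \<lfloor>real (Suc n) * snd p\<rfloor> + 1) / real (Suc n))) ----> fst p (snd p)" by (simp add: wt)
qed

lemma path_evaluation_measurable':
 assumes "f \<in> M \<leadsto> (path_space :: 'a::metric_space path measure)" "g \<in> M \<leadsto> borel"
 shows "(%x. f x (g x)) \<in> M \<leadsto> borel" using measurable_compose[OF measurable_Pair[OF assms] path_evaluation_measurable] by simp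

lemma path_left_limit_sequence:
 assumes w: "w \<in> space (path_space :: 'a::t2_space path measure)"
 shows "(%n. w (t - 1 / real (Suc n))) ----> Lim (at_left t) w"
proof -
 have "filterlim (%n. t - 1 / real (Suc n)) (at_left t) sequentially"
  unfolding filterlim_at
 proof
  have "(%n. t - 1 / real (Suc n)) ----> t - 0" by (intro tendsto_intros LIMSEQ_Suc lim_1_over_n)
  thus "(%n. t - 1 / real (Suc n)) ----> t" by simp
 qed (auto intro!: always_eventually)
 from filterlim_compose[OF path_left_limit[OF w] this] show ?thesis by simp
qed

lemma path_left_limit_measurable' [measurable (raw)]:
 assumes [measurable]: "f \<in> M \<leadsto> (path_space :: 'a::metric_space path measure)" "g \<in> M \<leadsto> borel"
 shows "(%x. Lim (at_left (g x)) (f x)) \<in> M \<leadsto> borel"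
proof (rule borel_measurable_LIMSEQ_metric)
 show "(%x. f x (g x - 1 / real (Suc n))) \<in> borel_measurable M" for n by (rule path_evaluation_measurable') measurable
 show "(%n. f x (g x - 1 / real (Suc n))) ----> Lim (at_left (g x)) (f x)" if "x \<in> space M" for x using measurable_space[OF assms(1) that] by (rule path_left_limit_sequence)
qed

lemma shift_in_path_space:
 assumes "w \<in> space (path_space :: 'a::metric_space path measure)" "s >= 0"
 shows "shift s w \<in> space (path_space :: 'a path measure)"
proof -
 have "cadlag (shift s w)"
  unfolding cadlag_def
 proof (intro conjI allI impI)
  fix t :: real assume t: "t >= 0"
  have "((%u. w (s + u)) ---> w (s + t)) (at_right t)" using path_right_continuous[OF assms(1), of "s + t"]
   by (simp add: filterlim_at_right_to_0[of _ _ t] filterlim_at_right_to_0[of _ _ "s + t"] add_ac)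
  moreover have "\<forall>\<^sub>F u in at_right t. shift s w u = w (s + u)" using t by (auto simp: shift_def eventually_at_filter)
  ultimately have "(shift s w ---> w (s + t)) (at_right t)" by (simp add: tendsto_cong)
  thus "continuous (at_right t) (shift s w)" using t by (simp add: continuous_within shift_def)
 next
  fix t :: real assume t: "t > 0"
  have "((%u. w (s + u)) ---> Lim (at_left (s + t)) w) (at_left t)"
  proof (rule filterlim_compose[OF path_left_limit[OF assms(1)]])
   show "filterlim (%u. s + u) (at_left (s + t)) (at_left t)" by (auto simp: filterlim_at eventually_at_filter intro!: tendsto_eq_intros)
  qed
  moreover have "\<forall>\<^sub>F u in at_left t. shift s w u = w (s + u)" using t eventually_at_left_real[of 0 t] by (auto simp: shift_def elim!: eventually_mono)
  ultimately show "EX l. (shift s w ---> l) (at_left t)" by (auto simp: tendsto_cong)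
 qed
 thus ?thesis by (simp add: space_path_space shift_def)
qed

lemma space_past: "space (past s) = space path_space" by (simp add: past_def)

lemma coordinate_past_measurable:
 assumes "0 <= u" "u <= s"
 shows "(%w. w u) \<in> (past s :: (real => 'a::topological_space) measure) \<leadsto> borel"
proof -
 have 1: "(%w. restrict w {0..s}) \<in> (past s :: (real => 'a) measure) \<leadsto> (\<Pi>\<^sub>M u\<in>{0..s}. borel)"
  unfolding past_def by (rule measurable_vimage_algebra1) (auto simp: space_PiM)
 have "(%w. (restrict w {0..s}) u) \<in> (past s :: (real => 'a) measure) \<leadsto> borel"
  by (rule measurable_compose[OF 1 measurable_component_singleton]) (use assms in auto)
 thus ?thesis using assms by simp
qed

lemma sets_past_subset: "sets (past s) \<subseteq> sets (path_space :: 'a::topological_space path measure)"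
proof -
 have [measurable]: "(%w. restrict w {0..s}) \<in> (path_space :: 'a path measure) \<leadsto> (\<Pi>\<^sub>M u\<in>{0..s}. borel)"
  by (rule measurable_PiM_single') (auto simp: path_coordinate_measurable)
 have "{x. restrict x {0..s} \<in> A} \<inter> space path_space \<in> sets (path_space :: 'a path measure)"
  if "A \<in> sets (\<Pi>\<^sub>M u\<in>{0..s}. borel)" for A using measurable_sets[OF _ that, of "%w. restrict w {0..s}" path_space] by (simp add: vimage_def)
 thus ?thesis
  unfolding past_def sets_vimage_algebra vimage_def by (intro sets.sigma_sets_subset) auto
qed

section \<open>Feller processes and their transition kernels\<close>

lemma integral_bounded:
 fixes f :: "'a => 'b::{banach, second_countable_topology}"
 assumes "prob_space M" "!!x. norm (f x) <= B"
 shows "norm (LINT x|M. f x) <= B"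
proof (cases "integrable M f")
 case True
 interpret prob_space M by fact
 have "norm (LINT x|M. f x) <= LINT x|M. norm (f x)" by (rule integral_norm_bound)
 also have "... <= LINT x|M. B" using True assms(2) by (intro integral_mono) auto
 finally show ?thesis by (simp add: prob_space)
next
 case False
 have "0 <= B" using norm_ge_zero[of "f undefined"] assms(2)[of undefined] by linarith
 thus ?thesis using False by (simp add: not_integrable_integral_eq)
qed

lemma integrable_bounded:
 fixes f :: "'a => 'b::{banach, second_countable_topology}"
 assumes "prob_space M" "f \<in> borel_measurable M" "!!x. norm (f x) <= B"
 shows "integrable M f"
proof -
 interpret prob_space M by fact
 show ?thesis using assms by (intro integrable_const_bound[where B = B]) auto
qed

lemma distributionD:
 assumes "distribution nu"
 shows "prob_space nu" "sets nu = sets borel" "space nu = UNIV" "measurable nu N = measurable borel N"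
 using assms sets_eq_imp_space_eq[of nu borel] measurable_cong_sets[of nu borel N N] by (auto simp: distribution_def)

locale feller =
 fixes P :: "'a::polish_space => (real => 'a) measure"
 assumes feller: "feller_process P" and compact_UNIV: "compact (UNIV :: 'a set)"
begin

abbreviation "S \<equiv> markov_semigroup P"

lemma kernel [measurable]: "P \<in> borel \<leadsto> prob_algebra path_space" using feller by (auto simp: feller_process_def)

lemma kernel_subprob [measurable]: "P \<in> borel \<leadsto> subprob_algebra path_space" by (rule measurable_prob_algebraD[OF kernel])

lemma sets_P [simp, measurable_cong]: "sets (P x) = sets path_space" using measurable_space[OF kernel, of x] by (simp add: space_prob_algebra)

lemma space_P [simp]: "space (P x) = space path_space" by (rule sets_eq_imp_space_eq[OF sets_P])

lemma measurable_P1 [simp]: "measurable (P x) N = measurable path_space N" by (rule measurable_cong_sets[OF sets_P refl])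

lemma prob_space_P [simp, intro]: "prob_space (P x)" using measurable_space[OF kernel, of x] by (simp add: space_prob_algebra)

lemma starts_at: "AE w in P x. w 0 = x" using feller by (auto simp: feller_process_def)

lemma markov_property:
 assumes "s >= 0" "A \<in> sets (past s)" "B \<in> sets path_space"
 shows "measure (P x) {w \<in> A. shift s w \<in> B} = LINT w|P x. indicator A w * measure (P (w s)) B" using feller assms by (auto simp: feller_process_def)

definition law :: "real => 'a => 'a measure" where
 "law t x = distr (P x) borel (%w. w t)"

lemma coordinate_measurable [measurable]: "(%w. w t) \<in> P x \<leadsto> borel" using path_coordinate_measurable[of t] by simp

lemma sets_law [simp, measurable_cong]: "sets (law t x) = sets borel" by (simp add: law_def)

lemma measurable_law1 [simp]: "measurable (law t x) N = measurable borel N" by (rule measurable_cong_sets[OF sets_law refl])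

lemma space_law [simp]: "space (law t x) = UNIV" by (simp add: law_def)

lemma prob_space_law [simp, intro]: "prob_space (law t x)"
 unfolding law_def by (rule prob_space.prob_space_distr[OF prob_space_P coordinate_measurable])

lemma law_measurable [measurable (raw)]:
 assumes [measurable]: "g \<in> N \<leadsto> borel" "h \<in> N \<leadsto> borel"
 shows "(%x. law (g x) (h x)) \<in> N \<leadsto> prob_algebra borel"
 unfolding law_def
proof (rule measurable_distr_prob_space2[where M = path_space])
 show "(%(x, w). w (g x)) \<in> borel_measurable (N \<otimes> (path_space :: 'a path measure))"
  unfolding split_def by (rule path_evaluation_measurable') measurable
qed (rule measurable_compose[OF assms(2) kernel])

lemma law_measurable_subprob [measurable (raw)]:
 assumes [measurable]: "g \<in> N \<leadsto> borel" "h \<in> N \<leadsto> borel"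
 shows "(%x. law (g x) (h x)) \<in> N \<leadsto> subprob_algebra borel" by (intro measurable_prob_algebraD law_measurable assms)

lemma law_kernel [measurable]: "law t \<in> borel \<leadsto> subprob_algebra borel" using law_measurable_subprob[OF measurable_const measurable_ident] by (simp add: id_def)

lemma S_eq_law:
 fixes f :: "'a => 'b::{banach, second_countable_topology}"
 assumes "borel_fun f"
 shows "S t f x = LINT y|law t x. f y"
 unfolding markov_semigroup_def law_def by (rule integral_distr[OF coordinate_measurable assms, symmetric])

lemma S_measurable:
 fixes f :: "'c => 'a => 'b::{banach, second_countable_topology}"
 assumes f: "(%(x, y). f x y) \<in> borel_measurable (N \<otimes> borel)"
  and g [measurable]: "g \<in> N \<leadsto> borel" and h [measurable]: "h \<in> N \<leadsto> borel"
 shows "(%x. S (g x) (f x) (h x)) \<in> borel_measurable N"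
proof -
 have *: "(%x. LINT z|(distr (law (g x) (h x)) (N \<otimes> borel) (%y. (x, y))). (%(x, y). f x y) z) \<in> borel_measurable N"
 proof (rule measurable_compose[OF _ integral_measurable_subprob_algebra])
  show "(%x. distr (law (g x) (h x)) (N \<otimes> borel) (Pair x)) \<in> N \<leadsto> subprob_algebra (N \<otimes> borel)"
   by (rule measurable_distr2[where M = borel]) measurable
 qed (rule f)
 have **: "LINT z|(distr (law (g x) (h x)) (N \<otimes> borel) (%y. (x, y))). (%(x, y). f x y) z = S (g x) (f x) (h x)"
  if x: "x \<in> space N" for x
 proof -
  have "borel_fun (f x)" using measurable_compose[OF measurable_Pair1'[OF x] f] by simp
  hence "S (g x) (f x) (h x) = LINT y|law (g x) (h x). f x y" by (rule S_eq_law)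
  moreover have "Pair x \<in> law (g x) (h x) \<leadsto> N \<otimes> borel"
   unfolding measurable_law1 using x by (rule measurable_Pair1')
  note integral_distr[OF this f]
  ultimately show ?thesis by (simp only: prod.case)
 qed
 show ?thesis by (rule measurable_cong[THEN iffD1, OF ** *])
qed

lemma S_measurable' [measurable]:
 fixes f :: "'a => 'b::{banach, second_countable_topology}"
 assumes [measurable]: "borel_fun f"
 shows "borel_fun (S t f)"
proof -
 have "borel_fun (%x. S ((%_. t) x) ((%_. f) x) ((%x. x) x))" by (rule S_measurable) measurable
 thus ?thesis by simp
qed

lemma S_bounded:
 fixes f :: "'a => 'b::{banach, second_countable_topology}"
 shows "(!!x. norm (f x) <= B) ==> norm (S t f x) <= B"
 unfolding markov_semigroup_def by (intro integral_bounded) auto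

lemma law_integrable:
 fixes f :: "'a => 'b::{banach, second_countable_topology}"
 assumes "borel_fun f" "!!x. norm (f x) <= B"
 shows "integrable (law t x) f" using assms by (intro integrable_bounded[where B = B]) auto

lemma S_diff:
 fixes f g :: "'a => real"
 assumes [measurable]: "borel_fun f" "borel_fun g"
  and "!!x. abs (f x) <= B" "!!x. abs (g x) <= B'"
 shows "S t (%x. f x - g x) x = S t f x - S t g x"
proof -
 have "integrable (law t x) f" "integrable (law t x) g" using law_integrable[OF assms(1), unfolded real_norm_def, OF assms(3)]
   law_integrable[OF assms(2), unfolded real_norm_def, OF assms(4)] by auto
 note 1 = Bochner_Integration.integral_diff[OF this]
 show ?thesis by (subst (1 2 3) S_eq_law) (measurable, rule 1)
qed

lemma S_add:
 fixes f g :: "'a => real"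
 assumes [measurable]: "borel_fun f" "borel_fun g"
  and "!!x. abs (f x) <= B" "!!x. abs (g x) <= B'"
 shows "S t (%x. f x + g x) x = S t f x + S t g x"
proof -
 have "integrable (law t x) f" "integrable (law t x) g" using law_integrable[OF assms(1), unfolded real_norm_def, OF assms(3)]
   law_integrable[OF assms(2), unfolded real_norm_def, OF assms(4)] by auto
 note 1 = Bochner_Integration.integral_add[OF this]
 show ?thesis by (subst (1 2 3) S_eq_law) (measurable, rule 1)
qed

lemma S_cmult:
 fixes f :: "'a => real"
 shows "S t (%x. c * f x) x = c * S t f x" by (simp add: markov_semigroup_def)

lemma S_const [simp]:
 fixes c :: "'b::{banach, second_countable_topology}"
 shows "S t (%_. c) x = c"
 unfolding markov_semigroup_def using prob_space.prob_space[OF prob_space_P[of x]] by simp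

lemma S_zero_time:
 fixes f :: "'a => 'b::{banach, second_countable_topology}"
 assumes [measurable]: "borel_fun f"
 shows "S 0 f x = f x"
proof -
 have "S 0 f x = LINT w|P x. f x"
  unfolding markov_semigroup_def using starts_at[of x] by (intro integral_cong_AE) auto
 thus ?thesis using prob_space.prob_space[OF prob_space_P[of x]] by simp
qed

lemma joint_law_two_times:
 assumes s: "s >= 0" and t: "t >= 0"
 shows "distr (P x) (borel \<otimes> borel) (%w. (w s, w (s + t)))
  = law s x \<bind> (%y. distr (law t y) (borel \<otimes> borel) (Pair y))" (is "?L = ?R")
proof -
 have K: "(%y. distr (law t y) (borel \<otimes> borel) (Pair y)) \<in> borel \<leadsto> prob_algebra (borel \<otimes> borel)"
  by (rule measurable_distr_prob_space2[where M = borel]) measurable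
 note K' = measurable_prob_algebraD[OF K]
 let ?E = "{A \<times> B |A B. A \<in> sets (borel :: 'a measure) & B \<in> sets (borel :: 'a measure)}"
 interpret L: prob_space ?L by (intro prob_space.prob_space_distr) auto
 show ?thesis
 proof (rule measure_eqI_generator_eq[OF Int_stable_pair_measure_generator[of borel borel], of "UNIV"])
  show "sets ?L = sigma_sets UNIV ?E" by (simp add: sets_pair_measure)
  have "sets ?R = sets (borel \<otimes> borel)" by (rule sets_bind) (auto simp: subprob_measurableD(2)[OF K'])
  thus "sets ?R = sigma_sets UNIV ?E" by (simp add: sets_pair_measure)
  show "range (%_::nat. UNIV \<times> UNIV) \<subseteq> ?E" by (intro image_subsetI CollectI exI[of _ UNIV] conjI refl) auto
  show "emeasure ?L (UNIV \<times> UNIV) ~= \<infinity>" using L.emeasure_finite by (simp add: top.not_eq_extremum)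
 next
  fix X assume "X \<in> ?E"
  then obtain A B where X: "X = A \<times> B" and A[measurable]: "A \<in> sets borel" and B[measurable]: "B \<in> sets borel" by auto
  define A' where "A' = {w \<in> space path_space. w s \<in> A}"
  define B' where "B' = {w \<in> space path_space. w t \<in> B}"
  have B'[measurable]: "B' \<in> sets path_space"
   unfolding B'_def using measurable_sets[OF path_coordinate_measurable B, of t] by (simp add: vimage_def Int_def conj_commute)
  have A'1: "A' \<in> sets (past s)"
   unfolding A'_def using measurable_sets[OF coordinate_past_measurable A, of s s] s by (simp add: vimage_def Int_def conj_commute space_past)
  have A'[measurable]: "A' \<in> sets path_space" using A'1 sets_past_subset by blast
  have mB: "measure (P y) B' = measure (law t y) B" for y
   unfolding law_def B'_def by (subst measure_distr) (auto intro!: arg_cong[where f = "measure (P y)"])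
  interpret Px: prob_space "P x" by auto
  have mm: "borel_fun (%y. measure (law t y) B)" by (rule measurable_compose[OF law_measurable_subprob measurable_measure_subprob_algebra]) auto
  have "emeasure ?L X = measure (P x) {w \<in> A'. shift s w \<in> B'}"
  proof -
   have "(%w. (w s, w (s + t))) -` X \<inter> space (P x) = {w \<in> A'. shift s w \<in> B'}" using s t by (auto simp: X A'_def B'_def shift_in_path_space) (auto simp: shift_def)
   thus ?thesis by (subst emeasure_distr) (auto simp: X Px.emeasure_eq_measure)
  qed
  also have "... = ennreal (LINT w|P x. indicator A' w * measure (law t (w s)) B)" using markov_property[OF s A'1 B', of x] by (simp add: mB)
  also have "... = ennreal (LINT w|P x. indicator A (w s) * measure (law t (w s)) B)" by (intro arg_cong[where f = ennreal] bochner_cong) (auto simp: A'_def indicator_def)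
  also have "... = nn_integral (P x) (%w. ennreal (indicator A (w s) * measure (law t (w s)) B))"
  proof (rule nn_integral_eq_integral[symmetric])
   have [measurable]: "(%w. measure (law t (w s)) B) \<in> borel_measurable (P x)" by (rule measurable_compose[OF coordinate_measurable mm])
   show "integrable (P x) (%w. indicator A (w s) * measure (law t (w s)) B)" by (intro Px.integrable_const_bound[where B = 1])
     (auto simp: indicator_def prob_space.prob_le_1 intro!: measure_nonneg)
  qed auto
  also have "... = nn_integral (law s x) (%y. ennreal (indicator A y * measure (law t y) B))"
   unfolding law_def[of s x] using mm by (subst nn_integral_distr) auto
  also have "... = nn_integral (law s x) (%y. emeasure (distr (law t y) (borel \<otimes> borel) (Pair y)) X)"
  proof (intro nn_integral_cong)
   fix y
   interpret Ly: prob_space "law t y" by auto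
   have "Pair y -` X = (if y \<in> A then B else {})" by (auto simp: X)
   thus "ennreal (indicator A y * measure (law t y) B) = emeasure (distr (law t y) (borel \<otimes> borel) (Pair y)) X" by (subst emeasure_distr) (auto simp: X Ly.emeasure_eq_measure)
  qed
  also have "... = emeasure ?R X" by (rule emeasure_bind[symmetric, where N = "borel \<otimes> borel"]) (use K' in "auto simp: X")
  finally show "emeasure ?L X = emeasure ?R X" .
 qed auto
qed

text \<open>
The Markov property at one time, for functions of two coordinates that need not factorise.
\<close>

lemma two_times_integral:
 fixes f :: "'a \<times> 'a => real"
 assumes s: "s >= 0" and t: "t >= 0"
  and f [measurable]: "f \<in> borel_measurable (borel \<otimes> borel)" and B: "!!z. abs (f z) <= B"
 shows "LINT w|P x. f (w s, w (s + t)) = S s (%y. S t (%z. f (y, z)) y) x"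
proof -
 have K: "(%y. distr (law t y) (borel \<otimes> borel) (Pair y)) \<in> borel \<leadsto> subprob_algebra (borel \<otimes> borel)"
  by (rule measurable_distr2[where M = borel]) measurable
 have K1: "(%y. distr (law t y) (borel \<otimes> borel) (Pair y)) \<in> law s x \<leadsto> subprob_algebra (borel \<otimes> borel)"
  unfolding measurable_law1 by (rule K)
 interpret Lx: prob_space "law s x" by auto
 have "LINT w|P x. f (w s, w (s + t)) = integral\<^sup>L (distr (P x) (borel \<otimes> borel) (%w. (w s, w (s + t)))) f" by (subst integral_distr) auto
 also have "... = LINT y|law s x. integral\<^sup>L (distr (law t y) (borel \<otimes> borel) (Pair y)) f"
  unfolding joint_law_two_times[OF s t]
 proof (rule integral_bind[where K = "borel \<otimes> borel" and B' = 1, OF f _ K1])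
  show "abs (f z) <= B" for z by (rule B)
  show "AE y in law s x. emeasure (distr (law t y) (borel \<otimes> borel) (Pair y))
     (space (distr (law t y) (borel \<otimes> borel) (Pair y))) <= ennreal 1" using subprob_space.subprob_emeasure_le_1[OF subprob_space_kernel[OF K]] by simp
 qed unfold_locales
 also have "... = LINT y|law s x. S t (%z. f (y, z)) y" by (intro bochner_cong refl) (subst integral_distr, auto simp: S_eq_law)
 also have "... = S s (%y. S t (%z. f (y, z)) y) x" by (rule S_eq_law[symmetric], rule S_measurable) auto
 finally show ?thesis .
qed

lemma S_semigroup:
 fixes f :: "'a => real"
 assumes "s >= 0" "t >= 0" "borel_fun f" "!!z. abs (f z) <= B"
 shows "S (s + t) f x = S s (S t f) x" using two_times_integral[of s t "%z. f (snd z)" B x] assms by (simp add: markov_semigroup_def)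

lemma S_continuous:
 fixes f :: "'a => real"
 assumes "t >= 0" "continuous_on UNIV f"
 shows "continuous_on UNIV (S t f)" using feller assms by (auto simp: feller_process_def)

lemma S_uniform_limit:
 fixes f :: "'a => real"
 assumes "continuous_on UNIV f"
 shows "uniform_limit UNIV (%t. S t f) f (at_right 0)" using feller assms by (auto simp: feller_process_def)

subsection \<open>Initial distributions\<close>

lemma dist_at_eq_bind:
 assumes "distribution nu"
 shows "dist_at P nu t = nu \<bind> law t"
proof -
 show ?thesis
  unfolding dist_at_def law_from_def law_def by (subst distr_bind[where K = path_space])
   (auto simp: distributionD[OF assms] path_coordinate_measurable kernel_subprob)
qed

lemma distribution_dist_at:
 assumes "distribution nu"
 shows "distribution (dist_at P nu t)"
proof -
 have 1: "nu \<in> space (prob_algebra borel)" using distributionD[OF assms] by (simp add: space_prob_algebra)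
 have 2: "law t \<in> borel \<leadsto> prob_algebra borel" by measurable
 show ?thesis unfolding dist_at_eq_bind[OF assms] distribution_def using prob_space_bind'[OF 1 2] sets_bind'[OF 1 2] by auto
qed

lemma nn_integral_dist_at:
 assumes "distribution nu" "borel_fun f"
 shows "nn_integral (dist_at P nu t) (%x. f x) = nn_integral nu (%x. nn_integral (law t x) (%y. f y))"
proof -
 show ?thesis unfolding dist_at_eq_bind[OF assms(1)] by (rule nn_integral_bind[OF assms(2)]) (simp add: distributionD[OF assms(1)])
qed

lemma integral_dist_at:
 fixes f :: "'a => real"
 assumes nu: "distribution nu" and f: "borel_fun f" and B: "!!x. abs (f x) <= B"
 shows "LINT x|dist_at P nu t. f x = LINT x|nu. S t f x"
proof -
 interpret prob_space nu by (rule distributionD[OF nu])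
 have "LINT x|dist_at P nu t. f x = LINT x|nu. LINT y|law t x. f y"
  unfolding dist_at_eq_bind[OF nu]
 proof (rule integral_bind[where K = borel and B' = 1, OF f])
  show "AE x in nu. emeasure (law t x) (space (law t x)) <= ennreal 1" using prob_space.emeasure_space_1[OF prob_space_law] by (simp del: space_law)
 qed (use B in "auto simp: distributionD[OF nu] intro: finite_measure_axioms")
 thus ?thesis by (simp add: S_eq_law[OF f])
qed

lemma law_from_kernel:
 assumes "distribution nu"
 shows "prob_space (law_from P nu)" "sets (law_from P nu) = sets path_space"
  and "space (law_from P nu) = space path_space"
proof -
 have 1: "nu \<in> space (prob_algebra borel)" using distributionD[OF assms] by (simp add: space_prob_algebra)
 show "prob_space (law_from P nu)" "sets (law_from P nu) = sets path_space"
  unfolding law_from_def using prob_space_bind'[OF 1 kernel] sets_bind'[OF 1 kernel] by auto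
 thus "space (law_from P nu) = space path_space" by (rule_tac sets_eq_imp_space_eq)
qed

lemma integral_law_from:
 fixes f :: "(real => 'a) => real"
 assumes nu: "distribution nu" and f: "f \<in> borel_measurable path_space" and B: "!!x. x \<in> space path_space ==> abs (f x) <= B"
 shows "LINT w|law_from P nu. f w = LINT x|nu. LINT w|P x. f w"
proof -
 interpret prob_space nu by (rule distributionD[OF nu])
 show ?thesis
  unfolding law_from_def
 proof (rule integral_bind[where K = path_space and B' = 1, OF f])
  show "AE x in nu. emeasure (P x) (space (P x)) <= ennreal 1" using prob_space.emeasure_space_1[OF prob_space_P] by (simp del: space_P)
 qed (use B in "auto simp: distributionD[OF nu] intro: finite_measure_axioms")
qed

end

section \<open>Approximation of bounded Borel functions\<close>

lemma continuous_approximation_closed: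
 fixes K :: "'a::metric_space set"
 assumes "closed K"
 obtains f :: "nat => 'a => real" where "!!n. continuous_on UNIV (f n)" "!!n x. 0 <= f n x & f n x <= 1"
  "!!x. (%n. f n x) ----> indicator K x"
proof (cases "K = {}")
 case True
 thus ?thesis by (intro that[of "%_ _. 0"]) auto
next
 case False
 define f where "f n x = max 0 (1 - real n * infdist x K)" for n x
 show ?thesis
 proof (rule that[of f])
  show "continuous_on UNIV (f n)" for n unfolding f_def by (intro continuous_intros)
  show "0 <= f n x & f n x <= 1" for n x by (auto simp: f_def infdist_nonneg)
  show "(%n. f n x) ----> indicator K x" for x
  proof (cases "x \<in> K")
   case True
   thus ?thesis by (simp add: f_def)
  next
   case x: False
   hence pos: "infdist x K > 0" using assms False infdist_pos_not_in_closed by blast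
   have "\<forall>\<^sub>F n in sequentially. f n x = 0"
   proof -
    obtain N :: nat where N: "1 / infdist x K < real N" using reals_Archimedean2 by blast
    have "f n x = 0" if "n >= N" for n
    proof -
     have "1 / infdist x K < real n" using N that by linarith
     hence "1 < real n * infdist x K" using pos by (simp add: field_simps)
     thus ?thesis by (simp add: f_def)
    qed
    thus ?thesis by (auto simp: eventually_sequentially)
   qed
   thus ?thesis using x by (auto intro: tendsto_eventually)
  qed
 qed
qed

text \<open>
The smallest class that contains the bounded continuous functions and is closed under bounded pointwise limits. It turns out to be
the class of all bounded Borel functions, and its induction rule transfers closed properties from continuous to Borel functions even
if they are not linear in the function.
\<close>

inductive baire :: "('a::metric_space => real) => bool" where
 baire_continuous: "continuous_on UNIV f ==> ALL x. abs (f x) <= B ==> baire f"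
| baire_limit: "ALL n. baire (u n) ==> ALL n x. abs (u n x) <= B ==> ALL x. (%n. u n x) ----> f x ==> baire f"

lemma baire_bounded: "baire f ==> EX B. ALL x. abs (f x) <= B"
proof (induction rule: baire.induct)
 case (baire_limit u B f)
 have "abs (f x) <= B" for x by (rule LIMSEQ_le_const2[OF tendsto_rabs, of "%n. u n x"]) (use baire_limit in blast)+
 thus ?case by blast
qed blast

lemma baire_compose:
 assumes "continuous_on UNIV (k :: real => real)"
 shows "baire f ==> baire (%x. k (f x))"
proof (induction rule: baire.induct)
 have k: "EX C. ALL y. abs y <= B --> abs (k y) <= C" for B using compact_imp_bounded[OF compact_continuous_image[OF continuous_on_subset[OF assms subset_UNIV] compact_Icc, of "- B" B]]
  by (simp add: bounded_iff) (metis abs_le_iff atLeastAtMost_iff minus_le_iff)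
 { case (baire_continuous f B)
  obtain C where "ALL y. abs y <= B --> abs (k y) <= C" using k[of B] by blast
  thus ?case using baire_continuous by (intro baire.baire_continuous[OF continuous_on_compose2[OF assms], of _ C]) auto }
 { case (baire_limit u B f)
  obtain C where "ALL y. abs y <= B --> abs (k y) <= C" using k[of B] by blast
  moreover have "(%n. k (u n x)) ----> k (f x)" for x by (rule continuous_on_tendsto_compose[OF assms]) (use baire_limit in auto)
  ultimately show ?case using baire_limit by (intro baire.baire_limit[of "%n x. k (u n x)" C]) auto }
qed

text \<open>
Two nested inductions: first with a continuous second summand, then for an arbitrary one.
\<close>

lemma baire_add:
 assumes f: "baire f" and g: "baire g"
 shows "baire (%x. f x + g x)"
proof -
 have step: "baire (%x. f x + g x)"
  if f: "baire f" and g: "EX C. ALL x. abs (g x) <= C"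
   and base: "!!f B. continuous_on UNIV f ==> ALL x. abs (f x) <= B ==> baire (%x. f x + g x)" for f g :: "'a => real" using f
 proof (induction rule: baire.induct)
  case (baire_limit u B f)
  obtain C where C: "!!x. abs (g x) <= C" using g by blast
  have "abs (u n x + g x) <= B + C" for n x using abs_triangle_ineq[of "u n x" "g x"] baire_limit(2) C[of x] by (metis add_mono order_trans)
  thus ?case using baire_limit by (intro baire.baire_limit[of "%n x. u n x + g x" "B + C"]) (auto intro: tendsto_intros)
 qed (rule base)
 have "baire (%x. h x + g x)" if h: "continuous_on UNIV h" "ALL x. abs (h x) <= B" for h B
 proof -
  have "baire (%x. g x + h x)"
  proof (rule step[OF g])
   show "baire (%x. k x + h x)" if k: "continuous_on UNIV k" "ALL x. abs (k x) <= C" for k C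
    using h k by (intro baire_continuous[of _ "C + B"] continuous_intros) (auto intro!: order.trans[OF abs_triangle_ineq] add_mono)
  qed (use h in blast)
  thus ?thesis by (simp add: add.commute)
 qed
 thus ?thesis by (intro step[OF f baire_bounded[OF g]])
qed

lemma baire_cmult: "baire f ==> baire (%x. c * f x)" by (rule baire_compose[where k = "%y. c * y"]) (intro continuous_intros)

lemma baire_const: "baire (%x. c)" by (rule baire_continuous[of _ "abs c"]) auto

lemma baire_mult:
 assumes "baire f" "baire g"
 shows "baire (%x. f x * g x)"
proof -
 have sq: "baire (%x. (h x)^2)" if "baire h" for h :: "'a => real" by (rule baire_compose[OF _ that, of "%y. y^2"]) (intro continuous_intros)
 have "baire (%x. (1/2) * ((f x + g x)^2 + (-1) * ((f x)^2 + (g x)^2)))" by (intro baire_cmult baire_add sq assms)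
 thus ?thesis by (simp add: power2_eq_square algebra_simps)
qed

lemma baire_indicator:
 assumes "A \<in> sets (borel :: 'a::metric_space measure)"
 shows "baire (indicator A)"
proof -
 have "A \<in> sigma_sets UNIV (Collect closed)" using assms by (simp add: borel_eq_closed)
 thus ?thesis
proof (induction rule: sigma_sets.induct)
 case (Basic K)
 hence "closed K" by simp
 from continuous_approximation_closed[OF this]
 obtain f :: "nat => 'a => real" where f: "!!n. continuous_on UNIV (f n)" "!!n x. 0 <= f n x & f n x <= 1"
  "!!x. (%n. f n x) ----> indicator K x" by blast
 have b: "abs (f n x) <= 1" for n x using f(2)[of n x] by simp
 show ?case by (rule baire_limit[of f 1]) (use f b baire_continuous in blast)+
next
 case Empty
 thus ?case using baire_const[of 0] by (simp add: indicator_def)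
next
 case (Compl A)
 have "baire (%x. 1 + (-1) * indicator A x)" by (intro baire_add baire_const baire_cmult Compl.IH)
 thus ?case by (rule back_subst[of baire]) (auto simp: indicator_def)
next
 case (Union A)
 have fin: "baire (indicator (\<Union>i<n. A i))" for n :: nat
 proof (induction n)
  case 0
  thus ?case using baire_const[of 0] by (simp add: indicator_def)
 next
  case (Suc n)
  have "baire (%x. indicator (\<Union>i<n. A i) x + (indicator (A n) x + (-1) * (indicator (\<Union>i<n. A i) x * indicator (A n) x)))"
   by (intro baire_add baire_cmult baire_mult Suc Union.IH)
  thus ?case by (rule back_subst[of baire]) (auto simp: indicator_def lessThan_Suc)
 qed
 show ?case
 proof (rule baire_limit[where B = 1])
  show "ALL n. baire (indicator (\<Union>i<n. A i))" using fin by blast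
  show "ALL n x. abs (indicator (\<Union>i<n. A i) x :: real) <= 1" by (simp split: split_indicator)
  show "ALL x. (%n. indicator (\<Union>i<n. A i) x :: real) ----> indicator (\<Union>i. A i) x" by (intro allI LIMSEQ_indicator_UN)
 qed
qed
qed

text \<open>
A class that is linear and closed under bounded limits needs to contain only the indicators.
\<close>

lemma bounded_measurable_class:
 fixes f :: "'a::topological_space => real"
 assumes f: "borel_fun f" and B: "!!x. abs (f x) <= B"
  and ind: "!!A. A \<in> sets borel ==> R (indicator A)"
  and lin: "!!g h c C. g \<in> borel_measurable borel ==> borel_fun h ==> (!!x. abs (g x) <= C) ==>
   (!!x. abs (h x) <= C) ==> R g ==> R h ==> R (%x. g x + c * h x)"
  and limit: "!!u g B. (!!n. u n \<in> borel_measurable borel) ==> (!!n x. abs (u n x) <= B) ==> (!!n. R (u n)) ==>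
   (!!x. (%n. u n x) ----> g x) ==> R g"
 shows "R f"
proof -
 have e: "indicator {} = (%x::'a. 0::real)" "indicator UNIV = (%x::'a. 1::real)" by auto
 have R01: "R (%x. 0)" "R (%x. 1)" using ind[of "{}"] ind[of UNIV] unfolding e by auto
 have "(EX C. ALL x. u x <= C) --> R u" if "borel_fun u" "!!x. 0 <= u x" for u :: "'a => real" using that
 proof (induction rule: borel_measurable_induct_real)
  case (set A)
  thus ?case using ind by blast
 next
  case (mult u c)
  show ?case
  proof (cases "c = 0")
   case False
   show ?thesis
   proof (intro impI, elim exE)
    fix C assume "ALL x. c * u x <= C"
    hence b: "u x <= C / c" for x using mult False by (simp add: field_simps)
    hence "R (%x. 0 + c * u x)" using mult by (intro lin[of "%x. 0" u "C / c"] R01) (auto intro: order.trans[of 0 "u _"])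
    thus "R (%x. c * u x)" by simp
   qed
  qed (simp add: R01)
 next
  case (add u v)
  show ?case
  proof (intro impI, elim exE)
   fix C assume C: "ALL x. v x + u x <= C"
   have b: "u x <= C" "v x <= C" for x using C[rule_format, of x] add(2)[of x] add(4)[of x] by linarith+
   hence "abs (u x) <= C" "abs (v x) <= C" for x using add(2)[of x] add(4)[of x] by (simp_all add: abs_of_nonneg)
   moreover have "R u" "R v" using add b by blast+
   ultimately have "R (%x. v x + 1 * u x)" using add by (intro lin[of v u C]) auto
   thus "R (%x. v x + u x)" by simp
  qed
 next
  case (seq U)
  show ?case
  proof (intro impI, elim exE)
   fix C assume C: "ALL x. u x <= C"
   have lim: "(%i. U i x) ----> u x" and nn: "0 <= U i x" for i x using seq by auto
   have "U i x <= u x" for i x by (rule LIMSEQ_le_const[OF lim]) (use seq in "auto simp: incseq_def le_fun_def intro!: exI[of _ i]")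
   hence b: "U i x <= C" for i x using C by (meson order_trans)
   hence "R (U i)" for i using seq by blast
   thus "R u" using b nn lim seq by (intro limit[of U C u]) (auto simp: abs_of_nonneg)
  qed
 qed
 moreover have g: "borel_fun (%x. f x + B)" using f by measurable
 moreover have b: "f x + B <= 2 * B" "0 <= f x + B" for x using B[of x] by (simp_all add: abs_le_iff)
 ultimately have "R (%x. f x + B)" by blast
 hence "R (%x. (f x + B) + (- B) * 1)" using b order.trans[OF b(2,1)] g by (intro lin[of "%x. f x + B" "%x. 1" "2 * B + 1"] R01) (auto simp: abs_of_nonneg intro: add_increasing2)
 thus ?thesis by simp
qed

lemma borel_imp_baire:
 fixes f :: "'a::metric_space => real"
 assumes "borel_fun f" "!!x. abs (f x) <= B"
 shows "baire f"
proof (rule bounded_measurable_class[OF assms])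
 show "baire g" if "!!n x. abs (u n x) <= C" "!!n. baire (u n)" "!!x. (%n. u n x) ----> g x" for u g and C :: real by (rule baire_limit[of u C]) (use that in auto)
qed (simp_all add: baire_indicator baire_add baire_cmult)

text \<open>
 Bounded Borel functions arise from bounded continuous ones by iterated pointwise limits of uniformly bounded sequences.
\<close>

lemma bounded_borel_induct:
 fixes f :: "'a::metric_space => real"
 assumes f: "borel_fun f" and B: "!!x. abs (f x) <= B"
  and base: "!!g B. continuous_on UNIV g ==> ALL x. abs (g x) <= B ==> R g"
  and limit: "!!u g B. (!!n. u n \<in> borel_measurable borel) ==> (!!n x. abs (u n x) <= B) ==> (!!n. R (u n)) ==>
   (!!x. (%n. u n x) ----> g x) ==> R g"
 shows "R f"
proof -
 have "baire f" by (rule borel_imp_baire[OF f B])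
 hence "R f & f \<in> borel_measurable borel"
 proof (induction rule: baire.induct)
  case (baire_limit u B f)
  thus ?case using limit[of u B f] by (auto intro: borel_measurable_LIMSEQ_real)
 qed (use base in "auto intro: borel_measurable_continuous_onI")
 thus ?thesis ..
qed

lemma distribution_eqI:
 fixes M N :: "'a::metric_space measure"
 assumes M: "distribution M" and N: "distribution N"
  and eq: "!!f :: 'a => real. continuous_on UNIV f ==> bounded (range f) ==> (LINT x|M. f x) = LINT x|N. f x"
 shows "M = N"
proof (rule measure_eqI)
 note d = distributionD[OF M] distributionD[OF N]
 interpret M: prob_space M by (rule d)
 interpret N: prob_space N by (rule d)
 show "sets M = sets N" by (simp add: d)
 fix A assume "A \<in> sets M"
 hence A: "A \<in> sets borel" by (simp add: d)
 have "LINT x|M. (indicator A x :: real) = LINT x|N. indicator A x"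
 proof (rule bounded_borel_induct[where f = "indicator A :: 'a => real" and B = 1 and R = "%f. LINT x|M. f x = LINT x|N. f x"])
  fix u g and B :: real
  assume u: "!!n. u n \<in> borel_measurable borel" "!!n x. abs (u n x) <= B" "!!n. (LINT x|M. u n x) = LINT x|N. u n x"
   "!!x. (%n. u n x) ----> (g :: 'a => real) x"
  have l: "(%n. LINT x|M. u n x) ----> (LINT x|M. g x)" "(%n. LINT x|N. u n x) ----> (LINT x|N. g x)"
   using u(1,2,4) borel_measurable_LIMSEQ_real[of borel u g] by (auto intro!: integral_dominated_convergence[where w = "%_. B"] simp: d)
  show "LINT x|M. g x = LINT x|N. g x" using LIMSEQ_unique[OF l(1)] l(2) by (simp only: u(3))
 qed (use A eq in "auto simp: bounded_iff indicator_def")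
 thus "emeasure M A = emeasure N A" using A by (simp add: d M.emeasure_eq_measure N.emeasure_eq_measure)
qed

section \<open>Contraction semigroups on Banach spaces\<close>

text \<open>
The generator is defined by right difference quotients, while the fundamental theorem of calculus gives derivatives within an interval.
\<close>

lemma right_difference_quotient:
 fixes F :: "real => 'x::real_normed_vector"
 assumes D: "(F has_vector_derivative D) (at t within {t..b})" and b: "t < b"
 shows "((%h. (F (t + h) - F t) /\<^sub>R h) ---> D) (at_right 0)"
proof (rule tendstoI)
 fix e :: real assume "e > 0"
 hence e: "e / 2 > 0" by simp
 obtain d where d: "d > 0" "!!y. y \<in> {t..b} ==> norm (y - t) < d ==>
   norm (F y - F t - (y - t) *\<^sub>R D) <= e / 2 * norm (y - t)" using D[unfolded has_vector_derivative_def has_derivative_within_alt] e by metis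
 have "dist ((F (t + h) - F t) /\<^sub>R h) D < e" if h: "h > 0" "h < min d (b - t)" for h
 proof -
  have "(F (t + h) - F t) /\<^sub>R h - D = (F (t + h) - F t - h *\<^sub>R D) /\<^sub>R h" using h by (simp add: scaleR_diff_right)
  hence "norm ((F (t + h) - F t) /\<^sub>R h - D) = norm (F (t + h) - F t - h *\<^sub>R D) / h" using h by (simp add: divide_inverse_commute)
  moreover have "norm (F (t + h) - F t - h *\<^sub>R D) <= e / 2 * h" using d(2)[of "t + h"] h by simp
  ultimately have "norm ((F (t + h) - F t) /\<^sub>R h - D) <= e / 2" using h by (simp add: pos_divide_le_eq)
  thus ?thesis using e by (simp add: dist_norm)
 qed
 thus "\<forall>\<^sub>F h in at_right 0. dist ((F (t + h) - F t) /\<^sub>R h) D < e"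
  unfolding eventually_at_right_field using d(1) b by (intro exI[of _ "min d (b - t)"]) auto
qed

text \<open>
From the Hille-Yosida theory: the domain of the generator is dense and invariant, and orbits of its elements are
differentiable.
\<close>

locale contraction_semigroup =
 fixes T :: "real => 'x::banach => 'x"
 assumes linear_T: "t >= 0 ==> linear (T t)"
  and contraction: "t >= 0 ==> norm (T t x) <= norm x"
  and T_zero: "T 0 x = x"
  and T_add: "s >= 0 ==> t >= 0 ==> T (s + t) x = T s (T t x)"
  and strongly_continuous: "((%t. T t x) ---> x) (at_right 0)"
begin

definition generator :: "'x => 'x => bool" where
 "generator f g \<longleftrightarrow> ((%t. (T t f - f) /\<^sub>R t) ---> g) (at_right 0)"

lemma bounded_linear_T: "t >= 0 ==> bounded_linear (T t)" using linear_T[of t] contraction[of t] by (intro bounded_linear_intro[where K = 1]) (auto simp: linear_iff)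

lemma T_diff: "t >= 0 ==> T t (x - y) = T t x - T t y" using linear_T by (rule linear_diff)

lemma T_scaleR: "t >= 0 ==> T t (c *\<^sub>R x) = c *\<^sub>R T t x" using linear_T by (rule linear_scale)

lemma norm_T_diff:
 assumes "s >= 0" "t >= 0"
 shows "norm (T t x - T s x) <= norm (T (abs (t - s)) x - x)"
proof -
 have *: "norm (T b x - T a x) <= norm (T (b - a) x - x)" if "0 <= a" "a <= b" for a b
 proof -
  have "T b x - T a x = T a (T (b - a) x - x)" using that T_add[of a "b - a" x] by (simp add: T_diff)
  thus ?thesis using contraction[of a "T (b - a) x - x"] that by simp
 qed
 show ?thesis
 proof (cases "s <= t")
  case True
  thus ?thesis using *[of s t] assms by simp
 next
  case False
  thus ?thesis using *[of t s] assms by (simp add: norm_minus_commute abs_if)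
 qed
qed

lemma continuous_T: "continuous_on {0..} (%t. T t x)"
 unfolding continuous_on_iff
proof (intro ballI allI impI)
 fix s e :: real assume s: "s \<in> {0..}" and e: "e > 0"
 have "\<forall>\<^sub>F t in at_right 0. norm (T t x - x) < e" using tendstoD[OF strongly_continuous e] by (simp add: dist_norm)
 then obtain d where d: "d > 0" "!!t. 0 < t ==> t < d ==> norm (T t x - x) < e" by (auto simp: eventually_at_right[of 0 1])
 show "EX d>0. \<forall>t\<in>{0..}. dist t s < d --> dist (T t x) (T s x) < e"
 proof (intro exI[of _ d] conjI d ballI impI)
  fix t :: real assume "t \<in> {0..}" and t: "dist t s < d"
  hence "norm (T t x - T s x) <= norm (T (abs (t - s)) x - x)" using s by (intro norm_T_diff) auto
  also have "... < e" using d(2)[of "abs (t - s)"] t e by (cases "t = s") (auto simp: dist_real_def T_zero)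
  finally show "dist (T t x) (T s x) < e" by (simp add: dist_norm)
 qed
qed

lemma generator_T:
 assumes "generator f g" "t >= 0"
 shows "generator (T t f) (T t g)"
 unfolding generator_def
proof (rule Lim_transform_eventually)
 show "((%h. T t ((T h f - f) /\<^sub>R h)) ---> T t g) (at_right 0)" using assms by (auto simp: generator_def intro: bounded_linear.tendsto[OF bounded_linear_T])
 have "\<forall>\<^sub>F h in at_right (0::real). h > 0" by (simp add: eventually_at_right_less)
 thus "\<forall>\<^sub>F h in at_right 0. T t ((T h f - f) /\<^sub>R h) = (T h (T t f) - T t f) /\<^sub>R h"
 proof eventually_elim
  case (elim h)
  thus ?case using assms(2) T_add[of t h f] T_add[of h t f] by (simp add: T_diff T_scaleR add.commute)
 qed
qed

lemma has_vector_derivative_T: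
 assumes g: "generator f g" and t: "t >= 0"
 shows "((%t. T t f) has_vector_derivative T t g) (at t within {0..})"
 unfolding has_vector_derivative_def has_derivative_within_alt
proof (intro conjI allI impI)
 show "bounded_linear (%x. x *\<^sub>R T t g)" by (rule bounded_linear_scaleR_left)
 fix e :: real assume e: "e > 0"
 have "\<forall>\<^sub>F h in at_right 0. norm ((T h f - f) /\<^sub>R h - g) < e / 2" using tendstoD[OF g[unfolded generator_def], of "e / 2"] e by (simp add: dist_norm)
 then obtain d1 where d1: "d1 > 0" "!!h. 0 < h ==> h < d1 ==> norm ((T h f - f) /\<^sub>R h - g) < e / 2" by (auto simp: eventually_at_right[of 0 1])
 obtain d2 where d2: "d2 > 0" "!!s. s >= 0 ==> abs (s - t) < d2 ==> norm (T s g - T t g) < e / 2"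
  using continuous_T[of g, unfolded continuous_on_iff, rule_format, of t "e / 2"] e t by (auto simp: dist_norm)
 show "EX d>0. \<forall>y\<in>{0..}. norm (y - t) < d -->
   norm (T y f - T t f - (y - t) *\<^sub>R T t g) <= e * norm (y - t)"
 proof (intro exI[of _ "min d1 d2"] conjI ballI impI)
  show "min d1 d2 > 0" using d1 d2 by simp
  fix y :: real assume y: "y \<in> {0..}" and yt: "norm (y - t) < min d1 d2"
  show "norm (T y f - T t f - (y - t) *\<^sub>R T t g) <= e * norm (y - t)"
  proof (cases "y = t")
   case False
   define m h where "m = min y t" and "h = abs (y - t)"
   have mh: "m >= 0" "h > 0" "h < d1" "abs (m - t) < d2"
   proof -
    have "abs (y - t) < d1" "abs (y - t) < d2" using yt by auto
    thus "m >= 0" "h > 0" "h < d1" "abs (m - t) < d2" using y t False d2(1) by (auto simp: m_def h_def min_def)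
   qed
   define D where "D = T m ((T h f - f) /\<^sub>R h - g) + (T m g - T t g)"
   have "norm D <= norm (T m ((T h f - f) /\<^sub>R h - g)) + norm (T m g - T t g)"
    unfolding D_def by (rule norm_triangle_ineq)
   also have "... <= e / 2 + e / 2" using contraction[OF mh(1), of "(T h f - f) /\<^sub>R h - g"] d1(2)[OF mh(2,3)] d2(2)[OF mh(1,4)] by linarith
   finally have "norm D <= e" by simp
   have "T (max y t) f - T m f = T m (T h f - f)" using T_add[of m h f] mh by (simp add: T_diff m_def h_def max_def min_def abs_if split: if_splits)
   also have "... = h *\<^sub>R T m ((T h f - f) /\<^sub>R h)" using mh by (simp add: T_scaleR)
   finally have "T (max y t) f - T m f - h *\<^sub>R T t g = h *\<^sub>R D"
    unfolding D_def T_diff[OF mh(1), of "(T h f - f) /\<^sub>R h" g] by (simp add: scaleR_diff_right[of h])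
   moreover have "norm (T y f - T t f - (y - t) *\<^sub>R T t g) = norm (T (max y t) f - T m f - h *\<^sub>R T t g)"
   proof (cases "y <= t")
    case True
    hence "T y f - T t f - (y - t) *\<^sub>R T t g = - (T (max y t) f - T m f - h *\<^sub>R T t g)" by (simp add: m_def h_def algebra_simps)
    thus ?thesis by (simp only: norm_minus_cancel)
   qed (simp add: m_def h_def)
   ultimately show ?thesis using \<open>norm D <= e\<close> mh(2) by (simp add: h_def mult.commute mult_right_mono)
  qed simp
 qed
qed

text \<open>
The averages of the orbit of \<open>x\<close> over \<open>[0, t]\<close> lie in the domain and tend to \<open>x\<close>.
\<close>

lemma dense_generator:
 assumes e: "e > 0"
 obtains f' g where "generator f' g" "norm (f' - f) < e"
proof -
 define F where "F t = integral {0..t} (%s. T s f)" for t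
 have DF: "(F has_vector_derivative T t f) (at t within {0..b})" if "t \<in> {0..b}" for t b
  unfolding F_def by (rule integral_has_vector_derivative[OF continuous_on_subset[OF continuous_T] that]) auto
 have F0: "F 0 = 0" by (simp add: F_def)
 have shift: "T h (F t) = F (t + h) - F h" if h: "h >= 0" and t: "t >= 0" for h t
 proof -
  have "((%s. T (s + h) f) has_integral F (t + h) - F (0 + h)) {0..t}"
  proof (rule fundamental_theorem_of_calculus[OF t])
   fix s assume s: "s \<in> {0..t}"
   have "(F has_vector_derivative T (s + h) f) (at (s + h) within (%s. s + h) ` {0..t})" by (rule has_vector_derivative_within_subset[OF DF[of "s + h" "t + h"]]) (use s h in auto)
   moreover have "((%s. s + h) has_vector_derivative 1) (at s within {0..t})" by (auto intro!: derivative_eq_intros)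
   ultimately have "((F \<circ> (%s. s + h)) has_vector_derivative 1 *\<^sub>R T (s + h) f) (at s within {0..t})" by (intro vector_diff_chain_within)
   thus "((%s. F (s + h)) has_vector_derivative T (s + h) f) (at s within {0..t})" by (simp add: o_def)
  qed
  moreover have "((%s. T (s + h) f) has_integral T h (F t)) {0..t}"
  proof -
   have "((%s. T s f) has_integral F t) {0..t}"
    unfolding F_def by (intro integrable_integral integrable_continuous_interval continuous_on_subset[OF continuous_T]) auto
   from has_integral_linear[OF this bounded_linear_T[OF h]]
   have "((%s. T h (T s f)) has_integral T h (F t)) {0..t}" by (simp add: o_def)
   thus ?thesis by (rule has_integral_eq[rotated]) (use h T_add[of h _ f] in "auto simp: add.commute[of _ h]")
  qed
  ultimately have "F (t + h) - F (0 + h) = T h (F t)" by (rule has_integral_unique)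
  thus ?thesis by simp
 qed
 have lim: "((%h. (F (t + h) - F t) /\<^sub>R h) ---> T t f) (at_right 0)" if t: "t >= 0" for t
  using t by (intro right_difference_quotient[where b = "t + 1"] has_vector_derivative_within_subset[OF DF[of t "t + 1"]]) auto
 have "((%t. F t /\<^sub>R t) ---> f) (at_right 0)" using lim[of 0] by (simp add: F0 T_zero)
 from tendstoD[OF this e] have "\<forall>\<^sub>F t in at_right 0. norm (F t /\<^sub>R t - f) < e" by (simp add: dist_norm)
 then obtain b where b: "b > 0" "!!y. 0 < y ==> y < b ==> norm (F y /\<^sub>R y - f) < e" by (auto simp: eventually_at_right[of 0 1])
 obtain t where t: "t > 0" "t < b" using dense b(1) by blast
 note t = t(1) b(2)[OF t]
 have "generator (F t /\<^sub>R t) ((T t f - f) /\<^sub>R t)"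
  unfolding generator_def
 proof (rule Lim_transform_eventually)
  show "((%h. ((F (t + h) - F t) /\<^sub>R h - (F (0 + h) - F 0) /\<^sub>R h) /\<^sub>R t) ---> (T t f - f) /\<^sub>R t) (at_right 0)"
   using lim[of t] lim[of 0] t by (intro tendsto_intros) (auto simp: T_zero)
  have "\<forall>\<^sub>F h in at_right (0::real). h > 0" by (simp add: eventually_at_right_less)
  thus "\<forall>\<^sub>F h in at_right 0. ((F (t + h) - F t) /\<^sub>R h - (F (0 + h) - F 0) /\<^sub>R h) /\<^sub>R t
    = (T h (F t /\<^sub>R t) - F t /\<^sub>R t) /\<^sub>R h"
  proof eventually_elim
   case (elim h)
   thus ?case using t by (simp add: T_scaleR shift F0 algebra_simps)
  qed
 qed
 thus ?thesis using t that by blast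
qed

end

section \<open>The semigroup on continuous functions\<close>

instance bcontfun :: (metric_space, banach) banach ..

context feller
begin

lemma continuous_bounded:
 fixes f :: "'a => real"
 assumes "continuous_on UNIV f"
 obtains B where "B >= 0" "!!x. abs (f x) <= B"
proof -
 have "bounded (range f)" using compact_continuous_image[OF assms compact_UNIV] by (rule compact_imp_bounded)
 then obtain B where B: "!!x. abs (f x) <= B" by (auto simp: bounded_iff)
 moreover from this[of undefined] have "B >= 0" by linarith
 ultimately show ?thesis using that by blast
qed

lemma continuous_bcontfun:
 fixes f :: "'a => real"
 assumes "continuous_on UNIV f"
 shows "f \<in> bcontfun" using continuous_bounded[OF assms] assms by (metis bcontfun_normI real_norm_def)

lemma continuous_measurable:
 fixes f :: "'a => real"
 assumes "continuous_on UNIV f"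
 shows "borel_fun f" using assms by (rule borel_measurable_continuous_onI)

lemma bcontfun_borel [measurable]: "apply_bcontfun (F :: 'a \<Rightarrow>\<^sub>C real) \<in> borel_measurable borel" by (rule continuous_measurable) simp

lemma abs_le_norm: "abs (apply_bcontfun (F :: 'a \<Rightarrow>\<^sub>C real) x) <= norm F" using norm_bounded[of F x] by simp

definition Tc :: "real => ('a \<Rightarrow>\<^sub>C real) => ('a \<Rightarrow>\<^sub>C real)" where
 "Tc t F = Bcontfun (S t (apply_bcontfun F))"

lemma apply_Tc: "t >= 0 ==> apply_bcontfun (Tc t F) = S t (apply_bcontfun F)"
 unfolding Tc_def by (intro Bcontfun_inverse continuous_bcontfun S_continuous) simp_all

lemma semigroup_axioms: "contraction_semigroup Tc"
proof (rule contraction_semigroup.intro)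
 fix t :: real and F :: "'a \<Rightarrow>\<^sub>C real" assume t: "t >= 0"
 show "linear (Tc t)"
 proof (rule linearI)
  fix F G :: "'a \<Rightarrow>\<^sub>C real" and c :: real
  show "Tc t (F + G) = Tc t F + Tc t G"
  proof (rule bcontfun_eqI)
   fix x
   have "S t (%x. apply_bcontfun F x + apply_bcontfun G x) x = S t (apply_bcontfun F) x + S t (apply_bcontfun G) x"
    by (rule S_add[OF bcontfun_borel bcontfun_borel abs_le_norm abs_le_norm])
   thus "apply_bcontfun (Tc t (F + G)) x = apply_bcontfun (Tc t F + Tc t G) x" using t by (simp add: apply_Tc plus_bcontfun.rep_eq)
  qed
  show "Tc t (c *\<^sub>R F) = c *\<^sub>R Tc t F" by (rule bcontfun_eqI) (use t in "simp add: apply_Tc scaleR_bcontfun.rep_eq S_cmult")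
 qed
 show "norm (Tc t F) <= norm F"
 proof (rule norm_bound)
  show "norm (apply_bcontfun (Tc t F) x) <= norm F" for x
   unfolding apply_Tc[OF t] by (rule S_bounded) (rule norm_bounded)
 qed
next
 fix F :: "'a \<Rightarrow>\<^sub>C real"
 show "Tc 0 F = F" by (rule bcontfun_eqI) (simp add: apply_Tc S_zero_time)
next
 fix s t :: real and F :: "'a \<Rightarrow>\<^sub>C real" assume st: "s >= 0" "t >= 0"
 show "Tc (s + t) F = Tc s (Tc t F)"
 proof (rule bcontfun_eqI)
  show "apply_bcontfun (Tc (s + t) F) x = apply_bcontfun (Tc s (Tc t F)) x" for x using S_semigroup[OF st bcontfun_borel abs_le_norm, of F x] st by (simp add: apply_Tc)
 qed
next
 fix F :: "'a \<Rightarrow>\<^sub>C real"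
 show "((%t. Tc t F) ---> F) (at_right 0)"
 proof (rule tendstoI)
  fix e :: real assume "e > 0"
  hence "\<forall>\<^sub>F t in at_right 0. \<forall>x\<in>UNIV. dist (S t (apply_bcontfun F) x) (apply_bcontfun F x) < e / 2"
   using uniform_limitD[OF S_uniform_limit[of "apply_bcontfun F"], of "e / 2"] by simp
  moreover have "\<forall>\<^sub>F t in at_right (0::real). t > 0" by (simp add: eventually_at_right_less)
  ultimately show "\<forall>\<^sub>F t in at_right 0. dist (Tc t F) F < e"
  proof eventually_elim
   case (elim t)
   hence "dist (apply_bcontfun (Tc t F) x) (apply_bcontfun F x) <= e / 2" for x by (auto simp: apply_Tc intro: less_imp_le)
   hence "dist (Tc t F) F <= e / 2" by (rule dist_bound)
   thus ?case using \<open>e > 0\<close> by simp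
  qed
 qed
qed

sublocale C: contraction_semigroup Tc by (rule semigroup_axioms)

lemma generator_iff:
 "C.generator F G \<longleftrightarrow> C_generator P (apply_bcontfun F) (apply_bcontfun G)"
proof
 assume "C.generator F G"
 hence lim: "((%t. (Tc t F - F) /\<^sub>R t) ---> G) (at_right 0)" by (simp add: C.generator_def)
 have ul: "uniform_limit UNIV (%t. apply_bcontfun ((Tc t F - F) /\<^sub>R t)) (apply_bcontfun G) (at_right 0)" by (rule tendsto_bcontfun_uniform_limit[OF lim])
 have "\<forall>\<^sub>F t in at_right (0::real). t > 0" by (simp add: eventually_at_right_less)
 hence ev: "\<forall>\<^sub>F t in at_right 0. \<forall>x\<in>UNIV. apply_bcontfun ((Tc t F - F) /\<^sub>R t) x
   = (S t (apply_bcontfun F) x - apply_bcontfun F x) / t" by eventually_elim (simp add: scaleR_bcontfun.rep_eq minus_bcontfun.rep_eq apply_Tc divide_inverse_commute)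
 have "uniform_limit UNIV (%t x. (S t (apply_bcontfun F) x - apply_bcontfun F x) / t) (apply_bcontfun G) (at_right 0)" by (rule uniform_limit_cong[THEN iffD1, OF ev refl ul])
 thus "C_generator P (apply_bcontfun F) (apply_bcontfun G)" by (simp add: C_generator_def)
next
 assume "C_generator P (apply_bcontfun F) (apply_bcontfun G)"
 hence lim: "uniform_limit UNIV (%t x. (S t (apply_bcontfun F) x - apply_bcontfun F x) / t) (apply_bcontfun G) (at_right 0)" by (simp add: C_generator_def)
 show "C.generator F G"
  unfolding C.generator_def
 proof (rule tendstoI)
  fix e :: real assume "e > 0"
  hence "\<forall>\<^sub>F t in at_right 0. \<forall>x\<in>UNIV. dist ((S t (apply_bcontfun F) x - apply_bcontfun F x) / t) (apply_bcontfun G x) < e / 2"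
   using uniform_limitD[OF lim, of "e / 2"] by simp
  moreover have "\<forall>\<^sub>F t in at_right (0::real). t > 0" by (simp add: eventually_at_right_less)
  ultimately show "\<forall>\<^sub>F t in at_right 0. dist ((Tc t F - F) /\<^sub>R t) G < e"
  proof eventually_elim
   case (elim t)
   have "dist (apply_bcontfun ((Tc t F - F) /\<^sub>R t) x) (apply_bcontfun G x) <= e / 2" for x
   proof -
    have "apply_bcontfun ((Tc t F - F) /\<^sub>R t) x = (S t (apply_bcontfun F) x - apply_bcontfun F x) / t"
     using elim(2) by (simp add: scaleR_bcontfun.rep_eq minus_bcontfun.rep_eq apply_Tc divide_inverse_commute)
    moreover have "dist ((S t (apply_bcontfun F) x - apply_bcontfun F x) / t) (apply_bcontfun G x) < e / 2" using elim(1) by blast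
    ultimately show ?thesis by (simp only: order.strict_implies_order)
   qed
   hence "dist ((Tc t F - F) /\<^sub>R t) G <= e / 2" by (rule dist_bound)
   thus ?case using \<open>e > 0\<close> by simp
  qed
 qed
qed

lemma generator_Bcontfun:
 assumes "C_generator P f g"
 obtains F G where "f = apply_bcontfun F" "g = apply_bcontfun G" "C.generator F G"
proof -
 have fg: "f \<in> bcontfun" "g \<in> bcontfun" using assms unfolding C_generator_def by (blast intro: continuous_bcontfun)+
 show ?thesis
 proof (rule that)
  show "f = apply_bcontfun (Bcontfun f)" "g = apply_bcontfun (Bcontfun g)" using fg by (simp_all add: Bcontfun_inverse)
  show "C.generator (Bcontfun f) (Bcontfun g)" using assms fg by (simp add: generator_iff Bcontfun_inverse)
 qed
qed

lemma C_generator_dense: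
 fixes f :: "'a => real"
 assumes "continuous_on UNIV f" "e > 0"
 obtains f' g where "C_generator P f' g" "!!x. abs (f' x - f x) <= e"
proof -
 define F where "F = Bcontfun f"
 have F: "f = apply_bcontfun F" using assms by (simp add: F_def Bcontfun_inverse continuous_bcontfun)
 obtain F' G where FG: "C.generator F' G" "norm (F' - F) < e" using C.dense_generator[OF assms(2)] by blast
 have "abs (apply_bcontfun F' x - f x) <= e" for x using abs_le_norm[of "F' - F" x] FG(2) by (simp add: F minus_bcontfun.rep_eq)
 thus ?thesis using FG(1) that generator_iff by blast
qed

lemma C_generator_S:
 assumes "C_generator P f g" "t >= 0"
 shows "C_generator P (S t f) (S t g)"
proof -
 obtain F G where "f = apply_bcontfun F" "g = apply_bcontfun G" "C.generator F G" using generator_Bcontfun[OF assms(1)] by metis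
 thus ?thesis using C.generator_T[of F G t] assms(2) by (simp add: generator_iff apply_Tc)
qed

lemma C_generator_continuous:
 assumes "C_generator P f g"
 shows "continuous_on UNIV f" "continuous_on UNIV g" using assms by (auto simp: C_generator_def)

lemma bcontfun_integrable:
 assumes "distribution nu"
 shows "integrable nu (apply_bcontfun (F :: 'a \<Rightarrow>\<^sub>C real))" using abs_le_norm[of F]
 by (intro integrable_bounded[where B = "norm F"]) (auto simp: distributionD[OF assms])

lemma continuous_integrable:
 fixes f :: "'a => real"
 assumes "distribution nu" "continuous_on UNIV f"
 shows "integrable nu f" using bcontfun_integrable[OF assms(1), of "Bcontfun f"] assms(2) by (simp add: Bcontfun_inverse continuous_bcontfun)

lemma bounded_linear_integral:
 assumes "distribution nu"
 shows "bounded_linear (%F :: 'a \<Rightarrow>\<^sub>C real. LINT x|nu. apply_bcontfun F x)"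
proof (rule bounded_linear_intro[where K = 1])
 fix F G :: "'a \<Rightarrow>\<^sub>C real" and c :: real
 show "LINT x|nu. apply_bcontfun (F + G) x = (LINT x|nu. apply_bcontfun F x) + (LINT x|nu. apply_bcontfun G x)" by (simp add: plus_bcontfun.rep_eq bcontfun_integrable[OF assms])
 show "LINT x|nu. apply_bcontfun (c *\<^sub>R F) x = c *\<^sub>R (LINT x|nu. apply_bcontfun F x)" by (simp add: scaleR_bcontfun.rep_eq)
 show "norm (LINT x|nu. apply_bcontfun F x) <= norm F * 1" using integral_bounded[OF distributionD(1)[OF assms], of "apply_bcontfun F" "norm F"] norm_bounded[of F] by simp
qed

lemma bcontfun_mult_integrable:
 assumes "distribution nu"
 shows "integrable nu (%x. apply_bcontfun (F :: 'a \<Rightarrow>\<^sub>C real) x * apply_bcontfun (G :: 'a \<Rightarrow>\<^sub>C real) x)"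
 by (intro continuous_integrable[OF assms] continuous_intros) auto

lemma bounded_bilinear_integral:
 assumes "distribution nu"
 shows "bounded_bilinear (%F G :: 'a \<Rightarrow>\<^sub>C real. LINT x|nu. apply_bcontfun F x * apply_bcontfun G x)"
proof
 fix F F' G :: "'a \<Rightarrow>\<^sub>C real" and c :: real
 show "LINT x|nu. apply_bcontfun (F + F') x * apply_bcontfun G x
  = (LINT x|nu. apply_bcontfun F x * apply_bcontfun G x) + (LINT x|nu. apply_bcontfun F' x * apply_bcontfun G x)"
  by (simp add: plus_bcontfun.rep_eq bcontfun_mult_integrable[OF assms] distrib_right)
 show "LINT x|nu. apply_bcontfun G x * apply_bcontfun (F + F') x
  = (LINT x|nu. apply_bcontfun G x * apply_bcontfun F x) + (LINT x|nu. apply_bcontfun G x * apply_bcontfun F' x)"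
  by (simp add: plus_bcontfun.rep_eq bcontfun_mult_integrable[OF assms] distrib_left)
 show "LINT x|nu. apply_bcontfun (c *\<^sub>R F) x * apply_bcontfun G x = c *\<^sub>R (LINT x|nu. apply_bcontfun F x * apply_bcontfun G x)"
  by (simp add: scaleR_bcontfun.rep_eq mult.assoc)
 show "LINT x|nu. apply_bcontfun F x * apply_bcontfun (c *\<^sub>R G) x = c *\<^sub>R (LINT x|nu. apply_bcontfun F x * apply_bcontfun G x)"
  by (simp add: scaleR_bcontfun.rep_eq mult.left_commute)
 show "EX K. ALL F G :: 'a \<Rightarrow>\<^sub>C real. norm (LINT x|nu. apply_bcontfun F x * apply_bcontfun G x) <= norm F * norm G * K"
 proof (intro exI[of _ 1] allI)
  fix F G :: "'a \<Rightarrow>\<^sub>C real"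
  have "norm (LINT x|nu. apply_bcontfun F x * apply_bcontfun G x) <= norm F * norm G" by (rule integral_bounded[OF distributionD(1)[OF assms]])
    (simp add: abs_mult mult_mono abs_le_norm)
  thus "norm (LINT x|nu. apply_bcontfun F x * apply_bcontfun G x) <= norm F * norm G * 1" by simp
 qed
qed

lemma derivative_integral_S:
 assumes nu: "distribution nu" and g: "C_generator P f g" and t: "t >= 0"
 shows "((%t. LINT x|nu. S t f x) has_real_derivative (LINT x|nu. S t g x)) (at t within {0..})"
proof -
 obtain F G where FG: "f = apply_bcontfun F" "g = apply_bcontfun G" "C.generator F G" using generator_Bcontfun[OF g] by metis
 have "((%t. LINT x|nu. apply_bcontfun (Tc t F) x) has_vector_derivative (LINT x|nu. apply_bcontfun (Tc t G) x)) (at t within {0..})"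
  by (rule bounded_linear.has_vector_derivative[OF bounded_linear_integral[OF nu] C.has_vector_derivative_T[OF FG(3) t]])
 hence "((%t. LINT x|nu. apply_bcontfun (Tc t F) x) has_real_derivative (LINT x|nu. S t g x)) (at t within {0..})"
  using t by (simp add: has_real_derivative_iff_has_vector_derivative apply_Tc FG)
 thus ?thesis by (rule has_field_derivative_transform_within[OF _ zero_less_one]) (use t in "auto simp: apply_Tc FG")
qed

lemma derivative_integral_square_S:
 assumes nu: "distribution nu" and g: "C_generator P f g" and t: "t >= 0"
 shows "((%t. LINT x|nu. (S t f x)^2) has_real_derivative (2 * (LINT x|nu. S t f x * S t g x))) (at t within {0..})"
proof -
 obtain F G where FG: "f = apply_bcontfun F" "g = apply_bcontfun G" "C.generator F G" using generator_Bcontfun[OF g] by metis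
 note D = C.has_vector_derivative_T[OF FG(3) t]
 have "((%t. LINT x|nu. apply_bcontfun (Tc t F) x * apply_bcontfun (Tc t F) x) has_vector_derivative
  ((LINT x|nu. apply_bcontfun (Tc t F) x * apply_bcontfun (Tc t G) x) + (LINT x|nu. apply_bcontfun (Tc t G) x * apply_bcontfun (Tc t F) x)))
  (at t within {0..})" by (rule bounded_bilinear.has_vector_derivative[OF bounded_bilinear_integral[OF nu] D D])
 hence "((%t. LINT x|nu. apply_bcontfun (Tc t F) x * apply_bcontfun (Tc t F) x) has_real_derivative (2 * (LINT x|nu. S t f x * S t g x))) (at t within {0..})"
  using t by (simp add: has_real_derivative_iff_has_vector_derivative apply_Tc FG mult.commute)
 thus ?thesis by (rule has_field_derivative_transform_within[OF _ zero_less_one]) (use t in "auto simp: apply_Tc FG power2_eq_square")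
qed

lemma continuous_integral_S:
 fixes f :: "'a => real"
 assumes nu: "distribution nu" and f: "continuous_on UNIV f"
 shows "continuous_on {0..} (%t. LINT x|nu. S t f x)"
proof -
 have F: "f = apply_bcontfun (Bcontfun f)" using f by (simp add: Bcontfun_inverse continuous_bcontfun)
 have "continuous_on {0..} (%t. LINT x|nu. apply_bcontfun (Tc t (Bcontfun f)) x)" by (rule bounded_linear.continuous_on[OF bounded_linear_integral[OF nu] C.continuous_T])
 thus ?thesis by (rule continuous_on_eq) (subst F, simp add: apply_Tc)
qed

end

section \<open>Square-integrable functions\<close>

lemma L2_measurable: "f \<in> L2 M ==> f \<in> borel_measurable M" by (simp add: L2_def)

lemma L2_integrable_square: "f \<in> L2 M ==> integrable M (%x. (f x)^2)" by (simp add: L2_def)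

lemma L2_norm_nonneg [simp]: "0 <= L2_norm M f" by (simp add: L2_norm_def)

lemma L2_norm_square: "(L2_norm M f)^2 = LINT x|M. (f x)^2" by (simp add: L2_norm_def)

lemma L2_integrable_mult:
 assumes f: "f \<in> L2 M" and g: "g \<in> L2 M"
 shows "integrable M (%x. f x * g x)"
proof (rule integrable_dominated)
 show "integrable M (%x. (f x)^2 + (g x)^2)" using assms by (auto simp: L2_def)
 show "(%x. f x * g x) \<in> borel_measurable M" using assms by (auto simp: L2_def)
 have "abs (f x * g x) <= (f x)^2 + (g x)^2" for x
 proof -
  have "0 <= (abs (f x) - abs (g x))^2" by simp
  hence "2 * abs (f x * g x) <= (f x)^2 + (g x)^2" by (simp add: power2_diff abs_mult)
  thus ?thesis by (smt (verit) sum_power2_ge_zero)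
 qed
 thus "AE x in M. norm (f x * g x) <= norm ((f x)^2 + (g x)^2)" by simp
qed

lemma L2_add: "f \<in> L2 M ==> g \<in> L2 M ==> (%x. f x + g x) \<in> L2 M" using L2_integrable_mult[of f M g] by (auto simp: L2_def power2_sum mult.assoc)

lemma L2_cmult: "f \<in> L2 M ==> (%x. c * f x) \<in> L2 M" by (auto simp: L2_def power_mult_distrib)

lemma L2_diff: "f \<in> L2 M ==> g \<in> L2 M ==> (%x. f x - g x) \<in> L2 M" using L2_add[of f M "%x. - 1 * g x"] L2_cmult[of g M "- 1"] by simp

lemma L2_const: "finite_measure M ==> (%x. c) \<in> L2 M" by (auto simp: L2_def finite_measure.integrable_const)

lemma L2_abs: "f \<in> L2 M ==> (%x. abs (f x)) \<in> L2 M" by (auto simp: L2_def)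

lemma L2_Cauchy_Schwarz:
 assumes f: "f \<in> L2 M" and g: "g \<in> L2 M"
 shows "abs (LINT x|M. f x * g x) <= L2_norm M f * L2_norm M g"
proof -
 define A B C where "A = LINT x|M. (f x)^2" and "B = LINT x|M. (g x)^2" and "C = LINT x|M. f x * g x"
 note int = L2_integrable_square[OF f] L2_integrable_square[OF g] L2_integrable_mult[OF f g]
 have q: "0 <= A - 2 * l * C + l^2 * B" for l
 proof -
  have "0 <= LINT x|M. (f x - l * g x)^2" by simp
  also have "... = LINT x|M. (f x)^2 - 2 * l * (f x * g x) + l^2 * (g x)^2" by (intro bochner_cong) (auto simp: power2_diff power_mult_distrib)
  also have "... = A - 2 * l * C + l^2 * B" using int by (simp add: A_def B_def C_def)
  finally show ?thesis .
 qed
 have "C^2 <= A * B"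
 proof (cases "B = 0")
  case True
  have "(%x. (g x)^2) = (%x. 0) \<or> True" by simp
  have "AE x in M. (g x)^2 = 0" using int(2) True unfolding B_def by (subst (asm) integral_nonneg_eq_0_iff_AE) auto
  hence "C = LINT x|M. 0"
   unfolding C_def using L2_measurable[OF f] L2_measurable[OF g] by (intro integral_cong_AE) auto
  thus ?thesis using True by simp
 next
  case False
  moreover have "B >= 0" by (simp add: B_def)
  ultimately have "B > 0" by simp
  thus ?thesis using q[of "C / B"] by (simp add: power2_eq_square field_simps)
 qed
 hence "sqrt (C^2) <= sqrt (A * B)" by (rule real_sqrt_le_mono)
 thus ?thesis by (simp add: A_def B_def C_def L2_norm_def real_sqrt_mult)
qed

lemma L2_norm_triangle:
 assumes f: "f \<in> L2 M" and g: "g \<in> L2 M"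
 shows "L2_norm M (%x. f x + g x) <= L2_norm M f + L2_norm M g"
proof -
 note int = L2_integrable_square[OF f] L2_integrable_square[OF g] L2_integrable_mult[OF f g]
 have "(L2_norm M (%x. f x + g x))^2 = LINT x|M. (f x)^2 + (g x)^2 + 2 * (f x * g x)"
  unfolding L2_norm_square by (simp add: power2_sum mult.assoc)
 also have "... = (L2_norm M f)^2 + (L2_norm M g)^2 + 2 * (LINT x|M. f x * g x)" using int by (simp add: L2_norm_square)
 also have "... <= (L2_norm M f + L2_norm M g)^2" using L2_Cauchy_Schwarz[OF f g] by (simp add: power2_sum)
 finally show ?thesis by (rule power2_le_imp_le) simp
qed

lemma L2_norm_cong_AE:
 assumes "f \<in> borel_measurable M" "g \<in> borel_measurable M" "AE x in M. f x = g x"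
 shows "L2_norm M f = L2_norm M g"
 unfolding L2_norm_def using assms by (intro arg_cong[where f = sqrt] integral_cong_AE) auto

lemma L2_norm_uminus: "L2_norm M (%x. f x - g x) = L2_norm M (%x. g x - f x)" by (simp add: L2_norm_def power2_commute)

lemma L2_norm_cmult: "L2_norm M (%x. c * f x) = abs c * L2_norm M f" by (simp add: L2_norm_def power_mult_distrib real_sqrt_mult)

lemma L2_norm_triangle_diff:
 assumes "f \<in> L2 M" and "g \<in> L2 M"
 shows "L2_norm M f <= L2_norm M g + L2_norm M (%x. f x - g x)" using L2_norm_triangle[OF assms(2) L2_diff[OF assms]] by simp

lemma L2_norm_mono:
 assumes "f \<in> borel_measurable M" "g \<in> L2 M" "AE x in M. abs (f x) <= abs (g x)"
 shows "f \<in> L2 M" "L2_norm M f <= L2_norm M g"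
proof -
 have *: "AE x in M. (f x)^2 <= (g x)^2" using assms(3) by eventually_elim (simp add: abs_le_square_iff)
 have "integrable M (%x. (f x)^2)" by (rule integrable_dominated[OF L2_integrable_square[OF assms(2)]])
   (use assms(1) * in auto)
 thus "f \<in> L2 M" using assms(1) by (simp add: L2_def)
 thus "L2_norm M f <= L2_norm M g"
  unfolding L2_norm_def by (intro real_sqrt_le_mono integral_mono_AE * L2_integrable_square assms)
qed

abbreviation centered_norm :: "'a measure => ('a => real) => real" where
 "centered_norm M f \<equiv> L2_norm M (%x. f x - (LINT y|M. f y))"

context prob_space
begin

lemma L2_integrable:
 assumes "f \<in> L2 M"
 shows "integrable M f" using L2_integrable_mult[OF assms L2_const[of M 1]] finite_measure_axioms by simp

lemma L2_norm_const: "L2_norm M (%x. c) = abs c" by (simp add: L2_norm_def prob_space)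

lemma L2_integral_le:
 assumes "f \<in> L2 M"
 shows "abs (LINT x|M. f x) <= L2_norm M f" using L2_Cauchy_Schwarz[OF assms L2_const[of M 1]] finite_measure_axioms by (simp add: L2_norm_const)

lemma L2_bounded:
 assumes "f \<in> borel_measurable M" "!!x. abs (f x) <= B"
 shows "f \<in> L2 M" "L2_norm M f <= B"
proof -
 have "B >= 0" using assms(2)[of undefined] by linarith
 thus "f \<in> L2 M" "L2_norm M f <= B" using L2_norm_mono[OF assms(1) L2_const[of M B]] finite_measure_axioms assms(2) by (auto simp: L2_norm_const)
qed

lemma centered_norm_square:
 assumes f: "f \<in> L2 M"
 shows "(centered_norm M f)^2 = (LINT x|M. (f x)^2) - (LINT x|M. f x)^2"
proof -
 have "(centered_norm M f)^2 = LINT x|M. (f x)^2 - 2 * (LINT x|M. f x) * f x + (LINT x|M. f x)^2"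
  unfolding L2_norm_square by (intro bochner_cong) (auto simp: power2_diff)
 also have "... = (LINT x|M. (f x)^2) - (LINT x|M. f x)^2" using L2_integrable_square[OF f] L2_integrable[OF f] by (simp add: prob_space) (simp add: power2_eq_square)
 finally show ?thesis .
qed

lemma centered_L2: "f \<in> L2 M ==> (%x. f x - c) \<in> L2 M" using L2_diff[OF _ L2_const] finite_measure_axioms by blast

lemma centered_norm_le:
 assumes f: "f \<in> L2 M"
 shows "centered_norm M f <= L2_norm M f"
proof (rule power2_le_imp_le)
 show "(centered_norm M f)^2 <= (L2_norm M f)^2" using centered_norm_square[OF f] L2_norm_square[of M f] by simp
qed simp

lemma centered_norm_triangle:
 assumes f: "f \<in> L2 M" and g: "g \<in> L2 M"
 shows "centered_norm M f <= centered_norm M g + L2_norm M (%x. f x - g x)"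
proof -
 have "centered_norm M f <= centered_norm M g +
   L2_norm M (%x. (f x - (LINT y|M. f y)) - (g x - (LINT y|M. g y)))" by (rule L2_norm_triangle_diff) (intro centered_L2 f g)+
 also have "(%x. (f x - (LINT y|M. f y)) - (g x - (LINT y|M. g y))) = (%x. (f x - g x) - (LINT y|M. f y - g y))" using L2_integrable[OF f] L2_integrable[OF g] by auto
 finally show ?thesis using centered_norm_le[OF L2_diff[OF f g]] by linarith
qed

lemma L2_norm_le_centered:
 assumes f: "f \<in> L2 M"
 shows "L2_norm M f <= abs (LINT x|M. f x) + centered_norm M f" using L2_norm_triangle_diff[OF f L2_const[of M "LINT x|M. f x"]] finite_measure_axioms by (simp add: L2_norm_const)

end

section \<open>Exponential decay of the variance\<close>

lemma nonincreasing_within: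
 fixes h :: "real => real"
 assumes D: "!!t. t >= 0 ==> (h has_real_derivative h' t) (at t within {0..})"
  and neg: "!!t. t >= 0 ==> h' t <= 0" and st: "0 <= s" "s <= t"
 shows "h t <= h s" using st(2)
proof (rule DERIV_nonpos_imp_decreasing_open)
 show "EX y. DERIV h x :> y & y <= 0" if "s < x" "x < t" for x
 proof -
  have "at x within {0..} = at x" using that st by (intro at_within_interior) auto
  thus ?thesis using D[of x] neg[of x] that st by auto
 qed
 have "continuous_on {0..} h"
  unfolding continuous_on_eq_continuous_within using D by (auto intro: DERIV_continuous)
 thus "continuous_on {s..t} h" by (rule continuous_on_subset) (use st in auto)
qed

text \<open>
The two inequalities are the infinitesimal form of what is known about the processes seen from the walkers: variance is lost
at rate \<open>\<kappa>\<close>, and the mean drifts at most at speed \<open>\<epsilon>\<close> times the standard deviation. For \<open>\<epsilon> = 0\<close> the measure is invariant.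
\<close>

locale dissipative = feller P for P :: "'a::polish_space => (real => 'a) measure" +
 fixes mu :: "'a measure" and kappa epsilon :: real
 assumes distribution_mu: "distribution mu" and kappa_pos: "kappa > 0" and epsilon_nonneg: "epsilon >= 0"
  and dissipation: "!!f g. C_generator P f g ==>
   (LINT x|mu. f x * g x) - (LINT x|mu. f x) * (LINT x|mu. g x) <= - kappa * (centered_norm mu f)^2"
  and mean_drift: "!!f g. C_generator P f g ==> abs (LINT x|mu. g x) <= epsilon * centered_norm mu f"
begin

sublocale mu: prob_space mu by (rule distributionD[OF distribution_mu])

lemmas mu_measurable [simp] = distributionD(4)[OF distribution_mu]
lemmas sets_mu [simp] = distributionD(2)[OF distribution_mu]
lemmas space_mu [simp] = distributionD(3)[OF distribution_mu]

lemma bounded_L2: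
 assumes "borel_fun f" "!!x. abs (f x) <= B"
 shows "f \<in> L2 mu" using assms by (intro mu.L2_bounded(1)[where B = B]) simp_all

lemma continuous_L2:
 fixes f :: "'a => real"
 assumes "continuous_on UNIV f"
 shows "f \<in> L2 mu" using continuous_bounded[OF assms] bounded_L2[OF continuous_measurable[OF assms]] by metis

text \<open>
By the first inequality, the derivative of \<open>exp (2 \<kappa> t)\<close> times the variance of \<open>S t f\<close> is not positive.
\<close>

lemma centered_norm_decay_generator:
 assumes g: "C_generator P f g" and t: "t >= 0"
 shows "centered_norm mu (S t f) <= exp (- kappa * t) * centered_norm mu f"
proof -
 note cont = C_generator_continuous[OF g]
 define v where "v t = (LINT x|mu. (S t f x)^2) - (LINT x|mu. S t f x)^2" for t
 have v: "v t = (centered_norm mu (S t f))^2" if "t >= 0" for t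
  unfolding v_def using mu.centered_norm_square[OF continuous_L2[OF S_continuous[OF that cont(1)]]] by simp
 define v' where "v' t = 2 * (LINT x|mu. S t f x * S t g x) - 2 * (LINT x|mu. S t f x) * (LINT x|mu. S t g x)" for t
 have dv: "(v has_real_derivative v' t) (at t within {0..})" if "t >= 0" for t
  unfolding v_def v'_def using derivative_integral_S[OF distribution_mu g that] derivative_integral_square_S[OF distribution_mu g that]
  by (auto intro!: derivative_eq_intros)
 have v': "v' t <= - 2 * kappa * v t" if "t >= 0" for t using dissipation[OF C_generator_S[OF g that]] v[OF that] by (simp add: v'_def)
 define h where "h t = exp (2 * kappa * t) * v t" for t
 have "h t <= h 0"
 proof (rule nonincreasing_within[OF _ _ _ t])
  fix t :: real assume t: "t >= 0"
  show "(h has_real_derivative (exp (2 * kappa * t) * (2 * kappa) * v t + exp (2 * kappa * t) * v' t)) (at t within {0..})"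
   unfolding h_def using dv[OF t] by (auto intro!: derivative_eq_intros)
  have "exp (2 * kappa * t) * v' t <= exp (2 * kappa * t) * (- 2 * kappa * v t)" using v'[OF t] by (intro mult_left_mono) auto
  thus "exp (2 * kappa * t) * (2 * kappa) * v t + exp (2 * kappa * t) * v' t <= 0" by (simp add: algebra_simps)
 qed simp
 hence "exp (2 * kappa * t) * v t <= v 0" by (simp add: h_def)
 hence "v t <= exp (- 2 * kappa * t) * v 0" by (simp add: exp_minus field_simps)
 moreover have "S 0 f = f" using S_zero_time[OF continuous_measurable[OF cont(1)]] by auto
 ultimately have "(centered_norm mu (S t f))^2 <= exp (- 2 * kappa * t) * (centered_norm mu f)^2" using v[OF t] v[of 0] by simp
 also have "... = (exp (- kappa * t) * centered_norm mu f)^2" by (simp add: power_mult_distrib exp_double[symmetric] mult.assoc)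
 finally show ?thesis by (rule power2_le_imp_le) simp
qed

text \<open>
The speed of the mean is at most \<open>\<epsilon> exp (- \<kappa> t)\<close> times the initial standard deviation; this is integrated from \<open>s\<close> to \<open>t\<close>.
\<close>

lemma mean_cauchy_generator:
 assumes g: "C_generator P f g" and st: "0 <= s" "s <= t"
 shows "abs ((LINT x|mu. S t f x) - (LINT x|mu. S s f x)) <= epsilon / kappa * exp (- kappa * s) * centered_norm mu f"
proof -
 define V where "V = centered_norm mu f"
 have V: "V >= 0" by (simp add: V_def)
 have b: "abs (LINT x|mu. S t g x) <= epsilon * (exp (- kappa * t) * V)" if "t >= 0" for t
  using mean_drift[OF C_generator_S[OF g that]] mult_left_mono[OF centered_norm_decay_generator[OF g that] epsilon_nonneg] by (simp add: V_def)
 have "c * (LINT x|mu. S t f x) + epsilon / kappa * V * exp (- kappa * t) <= c * (LINT x|mu. S s f x) + epsilon / kappa * V * exp (- kappa * s)"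
  if c: "abs c = 1" for c
 proof (rule nonincreasing_within[OF _ _ st])
  fix t :: real assume t: "t >= 0"
  show "((%t. c * (LINT x|mu. S t f x) + epsilon / kappa * V * exp (- kappa * t)) has_real_derivative
   (c * (LINT x|mu. S t g x) - epsilon * (exp (- kappa * t) * V))) (at t within {0..})" using derivative_integral_S[OF distribution_mu g t] kappa_pos
   by (auto intro!: derivative_eq_intros)
  have "c * (LINT x|mu. S t g x) <= abs c * abs (LINT x|mu. S t g x)" by (metis abs_ge_self abs_mult)
  thus "c * (LINT x|mu. S t g x) - epsilon * (exp (- kappa * t) * V) <= 0" using b[OF t] c by simp
 qed
 from this[of 1] this[of "- 1"] have
  "abs ((LINT x|mu. S t f x) - (LINT x|mu. S s f x)) <= epsilon / kappa * V * exp (- kappa * s) - epsilon / kappa * V * exp (- kappa * t)" by (simp add: abs_le_iff)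
 also have "... <= epsilon / kappa * V * exp (- kappa * s)" using V epsilon_nonneg kappa_pos by simp
 finally show ?thesis by (simp add: V_def mult.commute mult.left_commute)
qed

end

lemma (in prob_space) bounded_limits:
 fixes u :: "nat => 'a => real"
 assumes u: "!!n. u n \<in> borel_measurable M" and B: "!!n x. abs (u n x) <= B" and lim: "!!x. (%n. u n x) ----> f x"
 shows "(%n. LINT x|M. u n x) ----> (LINT x|M. f x)"
  and "(%n. L2_norm M (u n)) ----> L2_norm M f"
  and "(%n. centered_norm M (u n)) ----> centered_norm M f"
proof -
 have f: "f \<in> borel_measurable M" by (rule borel_measurable_LIMSEQ_real[OF lim u])
 have fB: "abs (f x) <= B" for x by (rule LIMSEQ_le_const2[OF tendsto_rabs[OF lim]]) (use B in blast)
 show 1: "(%n. LINT x|M. u n x) ----> (LINT x|M. f x)" by (rule integral_dominated_convergence[where w = "%_. B"]) (use u B lim f in auto)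
 have "(%n. LINT x|M. (u n x)^2) ----> (LINT x|M. (f x)^2)"
 proof (rule integral_dominated_convergence[where w = "%_. B^2"])
  show "AE x in M. norm ((u n x)^2) <= B^2" for n using power_mono[OF B abs_ge_zero, of n _ 2] by simp
  show "AE x in M. (%n. (u n x)^2) ----> (f x)\<^sup>2" by (intro AE_I2 tendsto_intros lim)
 qed (use u f in auto)
 note 2 = this
 show "(%n. L2_norm M (u n)) ----> L2_norm M f" unfolding L2_norm_def by (intro tendsto_intros 2)
 have c: "centered_norm M h = sqrt ((LINT x|M. (h x)^2) - (LINT x|M. h x)^2)"
  if "h \<in> borel_measurable M" "!!x. abs (h x) <= B" for h using centered_norm_square[OF L2_bounded(1)[OF that]] by (metis L2_norm_nonneg real_sqrt_unique)
 show "(%n. centered_norm M (u n)) ----> centered_norm M f"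
  unfolding c[OF u B] c[OF f fB] by (intro tendsto_intros 1 2)
qed

context feller
begin

lemma S_tendsto:
 fixes u :: "nat => 'a => real"
 assumes u: "!!n. u n \<in> borel_measurable borel" and B: "!!n x. abs (u n x) <= B" and lim: "!!x. (%n. u n x) ----> f x"
 shows "(%n. S t (u n) x) ----> S t f x"
 unfolding markov_semigroup_def by (rule prob_space.bounded_limits(1)[OF prob_space_P]) (use u B lim in "auto intro: measurable_compose[OF path_coordinate_measurable]")

text \<open>
 To extend a closed property of the semigroup to all bounded Borel functions, it is enough to check it on the domain of the generator.
\<close>

lemma generator_induct:
 fixes f :: "'a => real"
 assumes f: "borel_fun f" and B: "!!x. abs (f x) <= B"
  and base: "!!f g. C_generator P f g ==> R f"
  and limit: "!!u g B. (!!n. u n \<in> borel_measurable borel) ==> (!!n x. abs (u n x) <= B) ==> (!!n. R (u n)) ==>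
   (!!x. (%n. u n x) ----> g x) ==> R g"
 shows "R f"
proof (rule bounded_borel_induct[OF f B _ limit])
 fix h :: "'a => real" and B assume h: "continuous_on UNIV h" "ALL x. abs (h x) <= B"
 have "ALL n. EX u g. C_generator P u g & (ALL x. abs (u x - h x) <= 1 / real (Suc n))"
  using C_generator_dense[OF h(1)] by (metis divide_pos_pos of_nat_0_less_iff zero_less_Suc zero_less_one)
 then obtain u g where u: "!!n. C_generator P (u n) (g n)" "!!n x. abs (u n x - h x) <= 1 / real (Suc n)" by metis
 show "R h"
 proof (rule limit[of u "B + 1"])
  show "borel_fun (u n)" "R (u n)" for n using C_generator_continuous[OF u(1)] base[OF u(1)] by (auto intro: continuous_measurable)
  show "abs (u n x) <= B + 1" for n x using u(2)[of n x] spec[OF h(2), of x] divide_le_eq_1_pos[of "real (Suc n)" 1] by linarith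
  have "(%n. u n x - h x) ----> 0" for x by (rule Lim_null_comparison[OF _ LIMSEQ_Suc[OF lim_1_over_n]]) (use u(2) in simp)
  thus "(%n. u n x) ----> h x" for x by (simp add: LIM_zero_iff)
 qed
qed

lemma L2_dense_generator:
 fixes f :: "'a => real"
 assumes nu: "distribution nu" and f: "f \<in> L2 nu" and e: "e > 0"
 obtains f' g where "C_generator P f' g" "f' \<in> L2 nu" "L2_norm nu (%x. f x - f' x) <= e"
proof -
 interpret nu: prob_space nu by (rule distributionD[OF nu])
 note [simp] = distributionD(4)[OF nu]
 have L: "h \<in> L2 nu" if h: "C_generator P h g" for h g using continuous_bounded[OF C_generator_continuous(1)[OF h]] continuous_measurable[OF C_generator_continuous(1)[OF h]]
  by (metis nu.L2_bounded(1) distributionD(4)[OF nu])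
 have bounded: "ALL e>0. EX f' g. C_generator P f' g & L2_norm nu (%x. h x - f' x) <= e"
  if "borel_fun h" "!!x. abs (h x) <= B" for h B
 proof (rule generator_induct[OF that])
  fix u g B assume u: "!!n. u n \<in> borel_measurable borel" "!!n x. abs (u n x) <= B"
   and IH: "!!n. ALL e>0. EX f' g. C_generator P f' g & L2_norm nu (%x. u n x - f' x) <= e"
   and lim: "!!x. (%n. u n x) ----> g x"
  note g = borel_measurable_LIMSEQ_real[OF lim u(1)]
  have gB: "abs (g x) <= B" for x by (rule LIMSEQ_le_const2[OF tendsto_rabs[OF lim]]) (use u(2) in blast)
  show "ALL e>0. EX f' k. C_generator P f' k & L2_norm nu (%x. g x - f' x) <= e"
  proof (intro allI impI)
   fix e :: real assume e: "e > 0"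
   have "(%n. L2_norm nu (%x. g x - u n x)) ----> L2_norm nu (%x. g x - g x)"
   proof (rule nu.bounded_limits(2)[where B = "B + B"])
    show "abs (g x - u n x) <= B + B" for n x using gB[of x] u(2)[of n x] by linarith
    show "(%n. g x - u n x) ----> g x - g x" for x by (intro tendsto_diff tendsto_const lim)
   qed (use u g in simp)
   hence "\<forall>\<^sub>F n in sequentially. L2_norm nu (%x. g x - u n x) < e / 2" using e by (intro order_tendstoD(2)) (auto simp: L2_norm_def)
   then obtain n where n: "L2_norm nu (%x. g x - u n x) < e / 2" by (auto simp: eventually_sequentially)
   obtain f' k where f': "C_generator P f' k" "L2_norm nu (%x. u n x - f' x) <= e / 2" using IH[of n] e by (meson half_gt_zero)
   have gu: "g \<in> L2 nu" "u n \<in> L2 nu" by (rule nu.L2_bounded(1)[OF _ gB], simp add: g) (rule nu.L2_bounded(1)[OF _ u(2)], simp add: u)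
   have "L2_norm nu (%x. g x - f' x) <= L2_norm nu (%x. g x - u n x) + L2_norm nu (%x. u n x - f' x)" using L2_norm_triangle[OF L2_diff[OF gu] L2_diff[OF gu(2) L[OF f'(1)]]] by simp
   thus "EX f' k. C_generator P f' k & L2_norm nu (%x. g x - f' x) <= e" using n f' by (intro exI[of _ f'] exI[of _ k]) auto
  qed
 qed (auto simp: L2_norm_def intro!: exI)
 have fm [measurable]: "borel_fun f" using L2_measurable[OF f] by simp
 define c where "c n x = max (- real n) (min (real n) (f x))" for n x
 have [measurable]: "borel_fun (c n)" for n unfolding c_def by measurable
 have cb: "abs (c n x) <= real n" for n x by (auto simp: c_def)
 have "(%n. LINT x|nu. (f x - c n x)^2) ----> (LINT x|nu. 0)"
 proof (rule integral_dominated_convergence[where w = "%x. (f x)^2"])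
  show "AE x in nu. (%n. (f x - c n x)^2) ----> 0"
  proof (intro AE_I2 tendsto_eventually)
   fix x
   obtain N where N: "abs (f x) <= real N" using real_arch_simple by blast
   hence "(f x - c n x)^2 = 0" if "n >= N" for n using that by (auto simp: c_def)
   thus "\<forall>\<^sub>F n in sequentially. (f x - c n x)^2 = 0" by (auto simp: eventually_sequentially)
  qed
  have "abs (f x - c n x) <= abs (f x)" for n x by (auto simp: c_def)
  thus "AE x in nu. norm ((f x - c n x)^2) <= (f x)^2" for n by (simp add: abs_le_square_iff)
 qed (use L2_integrable_square[OF f] in auto)
 hence "(%n. L2_norm nu (%x. f x - c n x)) ----> 0"
  unfolding L2_norm_def using tendsto_real_sqrt by fastforce
 hence "\<forall>\<^sub>F n in sequentially. L2_norm nu (%x. f x - c n x) < e / 2" using e by (intro order_tendstoD(2)) auto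
 then obtain n where n: "L2_norm nu (%x. f x - c n x) < e / 2" by (auto simp: eventually_sequentially)
 obtain f' g where f': "C_generator P f' g" "L2_norm nu (%x. c n x - f' x) <= e / 2"
  using bounded[of "c n" "real n", OF \<open>!!n. c n \<in> borel_measurable borel\<close> cb, rule_format, OF half_gt_zero[OF e]] by blast
 have cL: "c n \<in> L2 nu" by (rule nu.L2_bounded(1)[OF _ cb]) simp
 have "L2_norm nu (%x. f x - f' x) <= L2_norm nu (%x. f x - c n x) + L2_norm nu (%x. c n x - f' x)" using L2_norm_triangle[OF L2_diff[OF f cL] L2_diff[OF cL L[OF f'(1)]]] by simp
 thus ?thesis using that[OF f'(1) L[OF f'(1)]] n f'(2) by linarith
qed

end

context dissipative
begin

lemma bounded_decay:
 assumes f: "borel_fun f" and B: "!!x. abs (f x) <= B"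
 shows "t >= 0 ==> centered_norm mu (S t f) <= exp (- kappa * t) * centered_norm mu f"
  and "0 <= s ==> s <= t ==>
   abs ((LINT x|mu. S t f x) - (LINT x|mu. S s f x)) <= epsilon / kappa * exp (- kappa * s) * centered_norm mu f"
proof -
 have "(ALL t>=0. centered_norm mu (S t f) <= exp (- kappa * t) * centered_norm mu f) &
  (ALL s t. 0 <= s & s <= t -->
   abs ((LINT x|mu. S t f x) - (LINT x|mu. S s f x)) <= epsilon / kappa * exp (- kappa * s) * centered_norm mu f)"
 proof (rule generator_induct[OF f B], goal_cases)
  case (2 u g B)
  have S: "S t (u n) \<in> borel_measurable mu" "abs (S t (u n) x) <= B" for t n x using 2(1) S_bounded[of "u n" B t x] 2(2) by simp_all
  note lim = mu.bounded_limits[OF S S_tendsto[OF 2(1,2,4)]] mu.bounded_limits[OF _ 2(2,4)]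
  have "centered_norm mu (S t g) <= exp (- kappa * t) * centered_norm mu g" if "t >= 0" for t
   by (rule LIMSEQ_le[OF lim(3) tendsto_mult[OF tendsto_const lim(6)]]) (use 2(1,3) that in auto)
  moreover have "abs ((LINT x|mu. S t g x) - (LINT x|mu. S s g x)) <= epsilon / kappa * exp (- kappa * s) * centered_norm mu g" if "0 <= s" "s <= t" for s t
   by (rule LIMSEQ_le[OF tendsto_rabs[OF tendsto_diff[OF lim(1) lim(1)]] tendsto_mult[OF tendsto_const lim(6)]]) (use 2(1,3) that in auto)
  ultimately show ?case by blast
 qed (use centered_norm_decay_generator mean_cauchy_generator in blast)
 thus "t >= 0 ==> centered_norm mu (S t f) <= exp (- kappa * t) * centered_norm mu f"
  "0 <= s ==> s <= t ==> abs ((LINT x|mu. S t f x) - (LINT x|mu. S s f x)) <= epsilon / kappa * exp (- kappa * s) * centered_norm mu f" by blast+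
qed

lemma start_mean_le:
 assumes h: "borel_fun h" and B: "!!x. abs (h x) <= B" and s: "s >= 0"
 shows "abs (LINT x|mu. S s h x) <= (1 + epsilon / kappa) * L2_norm mu h"
proof -
 have hL: "h \<in> L2 mu" by (rule bounded_L2[OF h B])
 have "abs ((LINT x|mu. S s h x) - (LINT x|mu. S 0 h x)) <= epsilon / kappa * exp (- kappa * 0) * centered_norm mu h" by (rule bounded_decay(2)[OF h B]) (use s in auto)
 moreover have "epsilon / kappa * centered_norm mu h <= epsilon / kappa * L2_norm mu h" using epsilon_nonneg kappa_pos by (intro mult_left_mono mu.centered_norm_le[OF hL]) auto
 moreover have "abs (LINT x|mu. h x) <= L2_norm mu h" by (rule mu.L2_integral_le[OF hL])
 ultimately show ?thesis by (simp add: S_zero_time[OF h] algebra_simps)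
qed

lemma decay_tendsto: "((%t. c * exp (- kappa * t)) ---> 0) at_top"
proof -
 have "filterlim (%t. kappa * t) at_top at_top" using kappa_pos by (intro filterlim_tendsto_pos_mult_at_top[OF tendsto_const]) (auto simp: filterlim_ident)
 hence "((%t. exp (- (kappa * t))) ---> 0) at_top" by (intro filterlim_compose[OF exp_at_bot]) (simp add: filterlim_uminus_at_bot)
 from tendsto_mult_left[OF this, of c] show ?thesis by simp
qed

definition limit_mean :: "('a => real) => real" where
 "limit_mean f = lim (%n. LINT x|mu. S (real n) f x)"

lemma limit_mean:
 assumes f: "borel_fun f" and B: "!!x. abs (f x) <= B"
 shows "(%n. LINT x|mu. S (real n) f x) ----> limit_mean f"
  and "((%t. LINT x|mu. S t f x) ---> limit_mean f) at_top"
  and "abs (limit_mean f) <= (1 + epsilon / kappa) * L2_norm mu f"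
proof -
 let ?m = "%t. LINT x|mu. S t f x"
 define c where "c t = epsilon / kappa * centered_norm mu f * exp (- kappa * t)" for t
 have c: "(c ---> 0) at_top" unfolding c_def by (rule decay_tendsto)
 have close: "abs (?m t - ?m s) <= c s" if "0 <= s" "s <= t" for s t using bounded_decay(2)[OF f B that] by (simp add: c_def mult_ac)
 have cn: "(%n. c (real n)) ----> 0" by (rule filterlim_compose[OF c filterlim_real_sequentially])
 have "Cauchy (%n. ?m (real n))"
 proof (rule metric_CauchyI)
  fix e :: real assume "e > 0"
  hence "\<forall>\<^sub>F n in sequentially. c (real n) < e / 2" using order_tendstoD(2)[OF cn, of "e / 2"] by simp
  then obtain n0 where n0: "c (real n0) < e / 2" by (auto simp: eventually_sequentially)
  have "abs (?m (real m) - ?m (real n)) < e" if "m >= n0" "n >= n0" for m n using close[of "real n0" "real m"] close[of "real n0" "real n"] that n0 by simp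
  thus "EX M. ALL m>=M. ALL n>=M. dist (?m (real m)) (?m (real n)) < e" by (auto simp: dist_real_def)
 qed
 thus lim: "(%n. ?m (real n)) ----> limit_mean f"
  unfolding limit_mean_def by (simp add: Cauchy_convergent_iff convergent_LIMSEQ_iff)
 have "abs (limit_mean f - ?m t) <= c t" if t: "0 <= t" for t
 proof (rule LIMSEQ_le_const2[OF tendsto_rabs[OF tendsto_diff[OF lim tendsto_const]]])
  have "t <= real n" if "nat \<lceil>t\<rceil> <= n" for n using that by linarith
  thus "EX N. ALL n>=N. abs (?m (real n) - ?m t) <= c t" using close[OF t] by blast
 qed
 hence "\<forall>\<^sub>F t in at_top. norm (?m t - limit_mean f) <= c t" by (intro eventually_at_top_linorderI[of 0]) (simp add: abs_minus_commute)
 from Lim_null_comparison[OF this c] show "(?m ---> limit_mean f) at_top" by (simp add: LIM_zero_iff)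
 show "abs (limit_mean f) <= (1 + epsilon / kappa) * L2_norm mu f" by (rule LIMSEQ_le_const2[OF tendsto_rabs[OF lim]]) (use start_mean_le[OF f B] in auto)
qed

lemma limit_mean_linear:
 fixes f g :: "'a => real" and B C c :: real
 assumes f: "borel_fun f" "!!x. abs (f x) <= B" and g: "borel_fun g" "!!x. abs (g x) <= C"
 shows "limit_mean (%x. f x + c * g x) = limit_mean f + c * limit_mean g"
proof (rule LIMSEQ_unique[OF limit_mean(1)])
 show "borel_fun (%x. f x + c * g x)" using f g by measurable
 show "abs (f x + c * g x) <= B + abs c * C" for x using f(2)[of x] mult_left_mono[OF g(2)[of x] abs_ge_zero[of c]] abs_triangle_ineq[of "f x" "c * g x"] by (simp add: abs_mult)
 have S: "S t (%x. f x + c * g x) x = S t f x + c * S t g x" for t x using S_add[of f "%x. c * g x" B "abs c * C" t x] S_cmult f g by (simp add: abs_mult mult_left_mono)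
 have "integrable mu (S t h)" if "borel_fun h" "!!x. abs (h x) <= D" for t and h :: "'a => real" and D
  using that S_bounded[of h D t] by (intro mu.integrable_const_bound[where B = D]) auto
 hence "LINT x|mu. S t (%x. f x + c * g x) x = (LINT x|mu. S t f x) + c * (LINT x|mu. S t g x)" for t
  unfolding S using f g by (subst Bochner_Integration.integral_add) auto
 thus "(%n. LINT x|mu. S (real n) (%x. f x + c * g x) x) ----> limit_mean f + c * limit_mean g" by (auto intro!: tendsto_intros limit_mean(1)[OF f] limit_mean(1)[OF g])
qed

lemma limit_mean_nonneg: "borel_fun f ==> (!!x. abs (f x) <= B) ==> (!!x. 0 <= f x) ==> 0 <= limit_mean f" by (rule LIMSEQ_le_const[OF limit_mean(1)[of f B]])
  (auto simp: markov_semigroup_def intro!: bochner_nonneg)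

lemma limit_mean_tendsto_zero:
 assumes "!!n. u n \<in> borel_measurable borel" "!!n x. abs (u n x) <= B" "!!x. (%n. u n x) ----> 0"
 shows "(%n. limit_mean (u n)) ----> 0"
proof (rule Lim_null_comparison[OF always_eventually])
 show "ALL n. norm (limit_mean (u n)) <= (1 + epsilon / kappa) * L2_norm mu (u n)" using limit_mean(3)[OF assms(1,2)] by simp
 have "(%n. L2_norm mu (u n)) ----> L2_norm mu (%x. 0)" by (rule mu.bounded_limits(2)[OF _ assms(2,3)]) (simp add: assms)
 from tendsto_mult[OF tendsto_const this] show "(%n. (1 + epsilon / kappa) * L2_norm mu (u n)) ----> 0" by (simp add: L2_norm_def)
qed

text \<open>
\<open>limit_mean\<close> is a positive linear functional bounded by a multiple of the \<open>L\<^sup>2(\<mu>)\<close> norm. Sequences decreasing to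
the empty set have vanishing norm, so that it is countably additive on indicators.
\<close>

lemma invariant_distribution_exists:
 obtains mue where "distribution mue"
  "!!f B. f \<in> borel_measurable borel ==> (!!x. abs (f x) <= B) ==> (LINT x|mue. f x) = limit_mean f"
proof -
 define L where "L A = limit_mean (indicator A)" for A
 have ib: "abs (indicator A x :: real) <= 1" for A :: "'a set" and x by (simp split: split_indicator)
 have L0: "0 <= L A" if "A \<in> sets borel" for A
  unfolding L_def by (rule limit_mean_nonneg[OF _ ib]) (use that in auto)
 have const: "limit_mean (%x. c) = c" for c :: real
 proof -
  have "S t (%x. c) = (%x. c)" for t by (rule ext) simp
  thus ?thesis unfolding limit_mean_def using mu.prob_space by simp
 qed
 have L_empty: "L {} = 0" using const[of 0] unfolding L_def by (metis indicator_simps(2) empty_iff ext)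
 have Ladd: "L (A \<union> B) = L A + L B" if "A \<in> sets borel" "B \<in> sets borel" "A \<inter> B = {}" for A B
 proof -
  have "(indicator (A \<union> B) :: 'a => real) = (%x. indicator A x + 1 * indicator B x)" using that(3) by (auto simp: fun_eq_iff split: split_indicator)
  thus ?thesis unfolding L_def using limit_mean_linear[where f = "indicator A" and g = "indicator B" and c = 1, OF _ ib _ ib] that by simp
 qed
 define N where "N = measure_of UNIV (sets borel) (%A. ennreal (L A))"
 have pos: "positive (sets borel) (%A. ennreal (L A))" by (simp add: positive_def L_empty)
 have ca: "countably_additive (sets borel) (%A. ennreal (L A))"
 proof (rule ring_of_sets.empty_continuous_imp_countably_additive)
  show "ring_of_sets UNIV (sets (borel :: 'a measure))" using sets.ring_of_sets_axioms[of "borel :: 'a measure"] by simp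
  show "additive (sets borel) (%A. ennreal (L A))" by (auto simp: additive_def Ladd L0)
  fix A :: "nat => 'a set"
  assume A: "range A \<subseteq> sets borel" "decseq A" "(\<Inter>i. A i) = {}"
  have "(%i. L (A i)) ----> 0"
   unfolding L_def
  proof (rule limit_mean_tendsto_zero[OF _ ib])
   show "(%n. indicator (A n) x :: real) ----> 0" for x using LIMSEQ_indicator_decseq[OF A(2), of x] A(3) by simp
  qed (use A in auto)
  thus "(%i. ennreal (L (A i))) ----> 0" using tendsto_ennrealI by fastforce
 qed (simp_all add: pos)
 have sN: "sets N = sets borel" unfolding N_def by (simp add: sets.sigma_sets_eq[of borel, simplified])
 have eN: "emeasure N A = ennreal (L A)" if A: "A \<in> sets borel" for A by (rule emeasure_measure_of[OF N_def]) (use A sN pos ca in auto)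
 have dN: "distribution N"
  unfolding distribution_def
 proof
  have "space N = UNIV" unfolding N_def by (rule space_measure_of) auto
  moreover have "L UNIV = 1" using const[of 1] unfolding L_def by (metis indicator_simps(1) UNIV_I ext)
  ultimately show "prob_space N" by (intro prob_spaceI) (simp add: eN)
 qed (rule sN)
 interpret N: prob_space N by (rule distributionD[OF dN])
 note [simp] = distributionD(4)[OF dN]
 show ?thesis
 proof (rule that[OF dN])
  fix f :: "'a => real" and B assume f: "borel_fun f" and B: "!!x. abs (f x) <= B"
  show "LINT x|N. f x = limit_mean f"
  proof (rule bounded_measurable_class[where f = f and B = B and R = "%f. LINT x|N. f x = limit_mean f", OF f B])
   show "LINT x|N. indicator A x = limit_mean (indicator A)" if "A \<in> sets borel" for A using that eN[of A] L0[of A] sN by (simp add: L_def measure_def)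
  next
   fix g h :: "'a => real" and c C :: real
   assume gh: "borel_fun g" "borel_fun h" "!!x. abs (g x) <= C" "!!x. abs (h x) <= C"
    and e: "LINT x|N. g x = limit_mean g" "LINT x|N. h x = limit_mean h"
   have "integrable N g" "integrable N h" using gh by (auto intro!: N.integrable_const_bound[where B = C])
   thus "LINT x|N. g x + c * h x = limit_mean (%x. g x + c * h x)" using limit_mean_linear[OF gh(1,3,2,4)] e by simp
  next
   fix u and g :: "'a => real" and B :: real
   assume u: "!!n. u n \<in> borel_measurable borel" "!!n x. abs (u n x) <= B" "!!n. (LINT x|N. u n x) = limit_mean (u n)"
    and lim: "!!x. (%n. u n x) ----> g x"
   have g: "borel_fun g" by (rule borel_measurable_LIMSEQ_real[OF lim u(1)])
   have gB: "abs (g x) <= B" for x by (rule LIMSEQ_le_const2[OF tendsto_rabs[OF lim]]) (use u(2) in blast)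
   have "(%n. limit_mean (%x. u n x + (-1) * g x)) ----> 0"
   proof (rule limit_mean_tendsto_zero[where B = "B + B"])
    show "abs (u n x + (-1) * g x) <= B + B" for n x using u(2)[of n x] gB[of x] by linarith
    show "(%n. u n x + (-1) * g x) ----> 0" for x using tendsto_diff[OF lim[of x] tendsto_const[of "g x"]] by simp
   qed (use u g in measurable)
   moreover have "limit_mean (%x. u n x + (-1) * g x) = (LINT x|N. u n x) - limit_mean g" for n using limit_mean_linear[OF u(1,2) g gB, of n "- 1"] u(3) by simp
   ultimately have "(%n. LINT x|N. u n x) ----> limit_mean g" by (simp add: LIM_zero_iff)
   moreover have "(%n. LINT x|N. u n x) ----> (LINT x|N. g x)" by (rule N.bounded_limits(1)[OF _ u(2) lim]) (use u in simp)
   ultimately show "LINT x|N. g x = limit_mean g" by (rule LIMSEQ_unique[symmetric])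
  qed
 qed
qed

end

lemma past_mono:
 assumes "s <= t"
 shows "sets (past s) \<subseteq> sets (past t :: (real => 'a::topological_space) measure)"
proof -
 have "(%w. restrict w {0..s}) \<in> (past t :: (real => 'a) measure) \<leadsto> (\<Pi>\<^sub>M u\<in>{0..s}. borel)"
  by (rule measurable_PiM_single') (use assms in "auto intro: coordinate_past_measurable")
 hence "(%w. w) \<in> (past t :: (real => 'a) measure) \<leadsto> past s"
  unfolding past_def[of s] by (intro measurable_vimage_algebra2) (auto simp: space_past)
 from measurable_sets[OF this] show ?thesis using sets.sets_into_space by (fastforce simp: space_past Int_absorb2)
qed

text \<open>
Events of the past of some time form a generator of the path events which is closed under intersection; needed for ergodicity.
\<close>

lemma past_generates:
 "sets (path_space :: 'a::metric_space path measure) = sigma_sets (space path_space) (\<Union>s\<in>{0..}. sets (past s))"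
proof
 let ?G = "\<Union>s\<in>{0..}. sets (past s :: (real => 'a) measure)"
 let ?N = "sigma (space path_space) ?G"
 have G: "?G \<subseteq> Pow (space path_space)" using sets.space_closed[of "past _"] by (auto simp: space_past)
 have "(%w. w) \<in> ?N \<leadsto> (path_space :: 'a path measure)"
 proof (rule measurable_path_spaceI)
  fix t :: real assume t: "t >= 0"
  have "(%w. w) \<in> ?N \<leadsto> past t"
  proof (rule measurableI)
   fix A assume A: "A \<in> sets (past t :: (real => 'a) measure)"
   hence "A \<subseteq> space path_space" using sets.sets_into_space[OF A] by (simp add: space_past)
   thus "(%w. w) -` A \<inter> space ?N \<in> sets ?N" using A t G by (auto simp: space_measure_of_conv Int_absorb2)
  qed (auto simp: space_past space_measure_of_conv)
  from measurable_compose[OF this coordinate_past_measurable[OF t order_refl]]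
  show "(%w. w t) \<in> borel_measurable ?N" .
 qed (auto simp: space_measure_of_conv space_path_space)
 from measurable_sets[OF this]
 show "sets (path_space :: 'a path measure) \<subseteq> sigma_sets (space path_space) ?G" using sets.sets_into_space G by (fastforce simp: space_measure_of_conv Int_absorb2)
 show "sigma_sets (space path_space) ?G \<subseteq> sets (path_space :: 'a path measure)" using sets_past_subset by (intro sets.sigma_sets_subset) auto
qed

locale stationary_limit = dissipative P mu kappa epsilon
 for P :: "'a::polish_space => (real => 'a) measure" and mu :: "'a measure" and kappa epsilon :: real +
 fixes mue :: "'a measure"
 assumes distribution_mue: "distribution mue"
  and integral_mue: "!!f B. f \<in> borel_measurable borel ==> (!!x. abs (f x) <= B) ==> (LINT x|mue. f x) = limit_mean f"
begin

sublocale mue: prob_space mue by (rule distributionD[OF distribution_mue])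

lemmas mue_measurable [simp] = distributionD(4)[OF distribution_mue]
lemmas sets_mue [simp] = distributionD(2)[OF distribution_mue]
lemmas space_mue [simp] = distributionD(3)[OF distribution_mue]

lemma measure_UNIV [simp]: "measure mu UNIV = 1" "measure mue UNIV = 1" using mu.prob_space mue.prob_space by simp_all

lemma mean_tendsto:
 fixes f :: "'a => real"
 assumes "borel_fun f" "!!x. abs (f x) <= B"
 shows "((%t. LINT x|mu. S t f x) ---> (LINT x|mue. f x)) at_top"
 unfolding integral_mue[OF assms] by (rule limit_mean(2)[OF assms])

lemma mean_close:
 assumes f [measurable]: "borel_fun f" and B: "!!x. abs (f x) <= B" and t: "t >= 0"
 shows "abs ((LINT x|mu. S t f x) - (LINT x|mue. f x)) <= epsilon / kappa * exp (- kappa * t) * centered_norm mu f"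
proof (rule tendsto_upperbound)
 show "((%u. abs ((LINT x|mu. S t f x) - (LINT x|mu. S u f x))) ---> abs ((LINT x|mu. S t f x) - (LINT x|mue. f x))) at_top" by (intro tendsto_intros mean_tendsto[OF f B])
 show "\<forall>\<^sub>F u in at_top. abs ((LINT x|mu. S t f x) - (LINT x|mu. S u f x)) <= epsilon / kappa * exp (- kappa * t) * centered_norm mu f"
  unfolding eventually_at_top_linorder using bounded_decay(2)[OF f B t] by (auto simp: abs_minus_commute)
qed simp

lemma mue_close_mu:
 assumes f [measurable]: "borel_fun f" and B: "!!x. abs (f x) <= B"
 shows "abs ((LINT x|mu. f x) - (LINT x|mue. f x)) <= epsilon / kappa * centered_norm mu f"
proof -
 have "S 0 f = f" by (simp add: S_zero_time fun_eq_iff)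
 thus ?thesis using mean_close[OF f B order_refl] by simp
qed

text \<open>
The distance to \<open>\<mu>\<^sub>\<epsilon>(f)\<close> is the standard deviation of \<open>S t f\<close> plus the distance of its mean from the limit; both decay.
\<close>

lemma L2_convergence:
 assumes f [measurable]: "borel_fun f" and B: "!!x. abs (f x) <= B" and t: "t >= 0"
 shows "L2_norm mu (%x. S t f x - (LINT y|mue. f y)) <= (1 + epsilon / kappa) * exp (- kappa * t) * centered_norm mu f"
proof -
 define c where "c = LINT y|mue. f y"
 have SL: "S t f \<in> L2 mu" by (rule bounded_L2[where B = B]) (use S_bounded[of f B t] B in auto)
 have SI: "integrable mu (S t f)" by (rule mu.L2_integrable[OF SL])
 have "L2_norm mu (%x. S t f x - c) <= abs (LINT x|mu. S t f x - c) + centered_norm mu (%x. S t f x - c)" by (rule mu.L2_norm_le_centered[OF mu.centered_L2[OF SL]])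
 also have "... = abs ((LINT x|mu. S t f x) - c) + centered_norm mu (S t f)" using SI by simp
 also have "... <= epsilon / kappa * exp (- kappa * t) * centered_norm mu f + exp (- kappa * t) * centered_norm mu f"
  unfolding c_def using mean_close[OF f B t] bounded_decay(1)[OF f B t] by linarith
 also have "... = (1 + epsilon / kappa) * exp (- kappa * t) * centered_norm mu f" by (simp add: algebra_simps)
 finally show ?thesis by (simp add: c_def)
qed

lemma absolutely_continuous_mue: "absolutely_continuous mu mue"
 unfolding absolutely_continuous_def
proof
 fix A assume A: "A \<in> null_sets mu"
 hence [measurable]: "A \<in> sets borel" by (auto simp: null_sets_def)
 have 0: "LINT x|mu. indicator A x = (0::real)" using A by (simp add: measure_eq_0_null_sets)
 have "abs ((LINT x|mu. indicator A x) - (LINT x|mue. (indicator A x :: real))) <= epsilon / kappa * centered_norm mu (indicator A)"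
  by (rule mue_close_mu[of _ 1]) (auto simp: indicator_def)
 moreover have "centered_norm mu (indicator A) = 0"
 proof -
  have "(%x. (indicator A x - (0::real))^2) = indicator A" by (auto simp: indicator_def)
  thus ?thesis unfolding 0 L2_norm_def using 0 by simp
 qed
 ultimately have "measure mue A <= 0" unfolding 0 by simp
 hence "measure mue A = 0" by (simp add: measure_le_0_iff)
 thus "A \<in> null_sets mue" by (simp add: null_sets_def mue.emeasure_eq_measure)
qed

lemma AE_mue:
 assumes "AE x in mu. Q x"
 shows "AE x in mue. Q x" using absolutely_continuous_AE[OF _ absolutely_continuous_mue assms] by simp

lemma invariant_mue: "invariant P mue"
 unfolding invariant_def
proof (intro allI impI)
 fix t :: real assume t: "t >= 0"
 show "dist_at P mue t = mue"
 proof (rule distribution_eqI[OF distribution_dist_at[OF distribution_mue] distribution_mue])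
  fix f :: "'a => real" assume f: "continuous_on UNIV f"
  note assms_f [measurable] = continuous_measurable[OF f]
  obtain B where B: "!!x. abs (f x) <= B" using continuous_bounded[OF f] by blast
  have SB: "abs (S t f x) <= B" for x using S_bounded[of f B t x] B by simp
  have "LINT x|dist_at P mue t. f x = LINT x|mue. S t f x" by (rule integral_dist_at[OF distribution_mue _ B]) simp
  also have "... = LINT x|mue. f x"
  proof (rule tendsto_unique[OF trivial_limit_at_top_linorder])
   have "((%u. LINT x|mu. S u (S t f) x) ---> (LINT x|mue. S t f x)) at_top" by (rule mean_tendsto[OF _ SB]) simp
   moreover have "\<forall>\<^sub>F u in at_top. (LINT x|mu. S u (S t f) x) = LINT x|mu. S (u + t) f x"
    unfolding eventually_at_top_linorder
   proof (intro exI[of _ 0] allI impI)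
    fix u :: real assume u: "0 <= u"
    show "LINT x|mu. S u (S t f) x = LINT x|mu. S (u + t) f x" by (subst S_semigroup[of u t f B, OF u t _ B]) simp_all
   qed
   ultimately show "((%u. LINT x|mu. S (u + t) f x) ---> (LINT x|mue. S t f x)) at_top" by (rule Lim_transform_eventually)
   have "filterlim (%u. u + t) at_top at_top" by (rule filterlim_tendsto_add_at_top[OF tendsto_const filterlim_ident, of t, simplified add.commute])
   thus "((%u. LINT x|mu. S (u + t) f x) ---> (LINT x|mue. f x)) at_top" by (rule filterlim_compose[OF mean_tendsto[OF assms_f B]])
  qed
  finally show "LINT x|dist_at P mue t. f x = LINT x|mue. f x" .
 qed
qed

text \<open>
Convergence in \<open>L\<^sup>2(\<mu>)\<close> gives convergence of the means under any bounded density; the density of \<open>\<nu>\<close> is truncated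
at a level \<open>n\<close> and the uniform bound on \<open>f\<close> controls the rest.
\<close>

lemma integral_tendsto_absolutely_continuous:
 fixes f :: "'a => real"
 assumes nu: "distribution nu" and ac: "absolutely_continuous mu nu"
  and f: "borel_fun f" and B: "!!x. abs (f x) <= B"
 shows "((%t. LINT x|dist_at P nu t. f x) ---> (LINT x|mue. f x)) at_top"
proof -
 note dnu = distributionD[OF nu]
 note f[measurable]
 interpret nu: prob_space nu by (rule dnu)
 obtain D where D: "D \<in> borel_measurable mu" "AE x in mu. RN_deriv mu nu x = ennreal (D x)" "!!x. 0 <= D x"
  using mu.real_RN_deriv[OF nu.finite_measure_axioms ac] dnu(2) sets_mu by metis
 hence [measurable]: "borel_fun D" by simp
 have "nu = density mu (RN_deriv mu nu)" using mu.density_RN_deriv[OF ac] dnu by simp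
 also have "... = density mu D" using D borel_measurable_RN_deriv[of mu nu] by (intro density_cong) auto
 finally have nuD: "nu = density mu D" .
 have Dint: "integrable mu D"
 proof (rule integrableI_nonneg)
  have "nn_integral mu (%x. ennreal (D x)) = emeasure nu UNIV" unfolding nuD by (simp add: emeasure_density)
  also have "... = 1" using nu.emeasure_space_1 dnu by simp
  finally show "nn_integral mu (%x. ennreal (D x)) < \<infinity>" by simp
 qed (use D in auto)
 define c where "c = LINT x|mue. f x"
 have SB: "abs (S t f x) <= B" for t x using S_bounded[of f B t x] B by simp
 have cB: "abs c <= B" unfolding c_def using integral_bounded[OF mue.prob_space_axioms, of f B] B by simp
 define F where "F t x = abs (S t f x - c)" for t x
 have F: "0 <= F t x" "F t x <= 2 * B" for t x using SB[of t x] cB by (auto simp: F_def abs_le_iff)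
 have [measurable]: "borel_fun (F t)" for t unfolding F_def by measurable
 have Fmu: "LINT x|mu. F t x <= (1 + epsilon / kappa) * exp (- kappa * t) * centered_norm mu f" if "t >= 0" for t
 proof -
  have "F t \<in> L2 mu" by (rule bounded_L2[where B = "2 * B"]) (use F in auto)
  hence "LINT x|mu. F t x <= L2_norm mu (F t)" using mu.L2_integral_le by (meson abs_ge_self order.trans)
  also have "L2_norm mu (F t) = L2_norm mu (%x. S t f x - c)" by (simp add: L2_norm_def F_def)
  also have "... <= (1 + epsilon / kappa) * exp (- kappa * t) * centered_norm mu f"
   unfolding c_def by (rule L2_convergence[OF f B that])
  finally show ?thesis .
 qed
 \<comment> \<open>The part of the density above the level \<open>n\<close>.\<close>
 define D' where "D' n x = D x - min (D x) (real n)" for n x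
 have D': "0 <= D' n x" "D' n x <= D x" for n x using D(3)[of x] by (auto simp: D'_def)
 have [measurable]: "borel_fun (D' n)" for n unfolding D'_def by measurable
 have D'int: "integrable mu (D' n)" for n by (rule integrable_dominated[OF Dint]) (use D' D(3) in auto)
 have tail: "(%n. LINT x|mu. D' n x) ----> (LINT x|mu. 0)"
 proof (rule integral_dominated_convergence[where w = D])
  show "AE x in mu. (%n. D' n x) ----> 0"
  proof (intro AE_I2 tendsto_eventually)
   fix x
   obtain N where "D x <= real N" using real_arch_simple by blast
   hence "ALL n>=N. D' n x = 0" by (simp add: D'_def)
   thus "\<forall>\<^sub>F n in sequentially. D' n x = 0" by (auto simp: eventually_sequentially)
  qed
 qed (use Dint D' in auto)
 have B0: "0 <= B" using B[of undefined] by linarith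
 have main: "abs ((LINT x|dist_at P nu t. f x) - c) <= real n * (LINT x|mu. F t x) + 2 * B * (LINT x|mu. D' n x)" for t n
 proof -
  have Si: "integrable nu (S t f)" using SB by (intro nu.integrable_const_bound[where B = B]) (auto simp: dnu)
  have Fi: "integrable mu (F t)" using F[of t] by (intro mu.integrable_const_bound[where B = "2 * B"]) auto
  have pw: "D x * F t x <= real n * F t x + 2 * B * D' n x" for x
  proof -
   have "D x * F t x = min (D x) (real n) * F t x + D' n x * F t x" by (simp add: D'_def algebra_simps)
   also have "... <= real n * F t x + D' n x * (2 * B)" using F[of t x] D' by (intro add_mono mult_right_mono mult_left_mono) auto
   finally show ?thesis by (simp add: mult_ac)
  qed
  have "(LINT x|dist_at P nu t. f x) - c = LINT x|nu. S t f x - c" using integral_dist_at[OF nu f B] Si by (simp add: nu.prob_space)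
  also have "abs (...) <= LINT x|nu. F t x" unfolding F_def by (rule integral_abs_bound)
  also have "... = LINT x|mu. D x * F t x" unfolding nuD using D by (subst integral_density) auto
  also have "... <= LINT x|mu. real n * F t x + 2 * B * D' n x"
  proof (rule integral_mono[OF integrable_dominated])
   show "AE x in mu. norm (D x * F t x) <= norm (real n * F t x + 2 * B * D' n x)" using pw D(3) F(1)[of t] D' B0 by (intro AE_I2) (simp add: abs_mult)
  qed (use Fi D'int pw in auto)
  finally show ?thesis using Fi D'int by simp
 qed
 have "((%t. (LINT x|dist_at P nu t. f x) - c) ---> 0) at_top"
 proof (rule tendstoI)
  fix e :: real assume e: "e > 0"
  have "\<forall>\<^sub>F n in sequentially. 2 * B * (LINT x|mu. D' n x) < e / 2" using order_tendstoD(2)[OF tendsto_mult_left[OF tail, of "2 * B"], of "e / 2"] e by simp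
  then obtain n where n: "2 * B * (LINT x|mu. D' n x) < e / 2" by (auto simp: eventually_sequentially)
  have "\<forall>\<^sub>F t in at_top. real n * ((1 + epsilon / kappa) * centered_norm mu f) * exp (- kappa * t) < e / 2" by (rule order_tendstoD(2)[OF decay_tendsto]) (use e in simp)
  thus "\<forall>\<^sub>F t in at_top. dist ((LINT x|dist_at P nu t. f x) - c) 0 < e" using eventually_ge_at_top[of 0]
  proof eventually_elim
   case (elim t)
   have "real n * (LINT x|mu. F t x) <= real n * ((1 + epsilon / kappa) * exp (- kappa * t) * centered_norm mu f)" using Fmu[OF elim(2)] by (intro mult_left_mono) auto
   moreover have "... = real n * ((1 + epsilon / kappa) * centered_norm mu f) * exp (- kappa * t)" by (simp add: mult_ac)
   ultimately show ?case using main[of t n] n elim(1) unfolding dist_real_def by linarith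
  qed
 qed
 thus ?thesis by (simp add: LIM_zero_iff c_def)
qed

lemma weak_convergence:
 assumes "distribution nu" "absolutely_continuous mu nu"
 shows "weakly_converges (dist_at P nu) mue at_top"
 unfolding weakly_converges_def
proof (intro allI impI)
 fix f :: "'a => real" assume f: "continuous_on UNIV f & bounded (range f)"
 then obtain B where "!!x. abs (f x) <= B" using continuous_bounded by blast
 thus "((%t. LINT x|dist_at P nu t. f x) ---> (LINT x|mue. f x)) at_top" using f by (intro integral_tendsto_absolutely_continuous assms) (auto intro: continuous_measurable)
qed

lemma invariant_unique:
 assumes nu: "distribution nu" and inv: "invariant P nu" and ac: "absolutely_continuous mu nu"
 shows "nu = mue"
proof (rule distribution_eqI[OF nu distribution_mue])
 fix f :: "'a => real" assume "continuous_on UNIV f" "bounded (range f)"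
 hence "((%t. LINT x|dist_at P nu t. f x) ---> (LINT x|mue. f x)) at_top" using weak_convergence[OF nu ac] by (auto simp: weakly_converges_def)
 moreover have "\<forall>\<^sub>F t in at_top. (LINT x|dist_at P nu t. f x) = LINT x|nu. f x" using inv by (auto simp: invariant_def eventually_at_top_linorder intro!: exI[of _ 0])
 ultimately have "((%t::real. LINT x|nu. f x) ---> (LINT x|mue. f x)) at_top" by (rule Lim_transform_eventually)
 thus "LINT x|nu. f x = LINT x|mue. f x" by (rule tendsto_unique[OF trivial_limit_at_top_linorder tendsto_const])
qed

lemma L2_mue_bound:
 assumes f: "f \<in> L2 mu"
 shows "integrable mue f" "LINT x|mue. abs (f x) <= (1 + epsilon / kappa) * L2_norm mu f"
proof -
 define K where "K = 1 + epsilon / kappa"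
 have K: "K >= 0" using epsilon_nonneg kappa_pos by (simp add: K_def)
 have fm [measurable]: "borel_fun f" using L2_measurable[OF f] by simp
 define g where "g n x = min (real n) (abs (f x))" for n x
 have [measurable]: "borel_fun (g n)" for n unfolding g_def by measurable
 have gb: "abs (g n x) <= real n" "0 <= g n x" for n x by (auto simp: g_def)
 have g: "LINT x|mue. g n x <= K * L2_norm mu f" for n
 proof -
  have gL: "g n \<in> L2 mu" by (rule bounded_L2[OF _ gb(1)]) simp
  have le: "L2_norm mu (g n) <= L2_norm mu f" by (rule L2_norm_mono(2)[OF _ f]) (auto simp: g_def)
  have "LINT x|mue. g n x <= (LINT x|mu. g n x) + epsilon / kappa * centered_norm mu (g n)" using mue_close_mu[of "g n" "real n", OF _ gb(1)] by (simp add: abs_le_iff)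
  also have "... <= L2_norm mu (g n) + epsilon / kappa * L2_norm mu (g n)" using mu.L2_integral_le[OF gL] mu.centered_norm_le[OF gL] epsilon_nonneg kappa_pos
   by (intro add_mono mult_left_mono) auto
  also have "... = K * L2_norm mu (g n)" by (simp add: K_def algebra_simps)
  also have "... <= K * L2_norm mu f" using le K by (rule mult_left_mono)
  finally show ?thesis .
 qed
 have nn: "nn_integral mue (%x. ennreal (abs (f x))) <= ennreal (K * L2_norm mu f)"
 proof -
  have "(%n. ennreal (g n x)) ----> ennreal (abs (f x))" for x
  proof (intro tendsto_ennrealI tendsto_eventually)
   obtain N where "abs (f x) <= real N" using real_arch_simple by blast
   thus "\<forall>\<^sub>F n in sequentially. g n x = abs (f x)"
    unfolding eventually_sequentially g_def by (intro exI[of _ N]) auto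
  qed
  hence "(%n. nn_integral mue (%x. ennreal (g n x))) ----> (nn_integral mue (%x. ennreal (abs (f x))))"
   by (intro nn_integral_LIMSEQ) (auto simp: incseq_def le_fun_def g_def intro!: ennreal_leI)
  moreover have "nn_integral mue (%x. ennreal (g n x)) <= ennreal (K * L2_norm mu f)" for n
  proof -
   have "integrable mue (g n)" by (rule mue.integrable_const_bound[where B = "real n"]) (use gb in auto)
   hence "nn_integral mue (%x. ennreal (g n x)) = ennreal (LINT x|mue. g n x)" using gb by (intro nn_integral_eq_integral) auto
   thus ?thesis using g[of n] by (simp add: ennreal_leI)
  qed
  ultimately show ?thesis by (intro LIMSEQ_le_const2) auto
 qed
 thus "integrable mue f" by (intro integrableI_bounded) (auto intro: order.strict_trans1)
 hence "nn_integral mue (%x. ennreal (abs (f x))) = ennreal (LINT x|mue. abs (f x))" by (intro nn_integral_eq_integral) auto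
 thus "LINT x|mue. abs (f x) <= (1 + epsilon / kappa) * L2_norm mu f" using nn K by (simp add: K_def)
qed

text \<open>
For a shift-invariant event \<open>A\<close>, the function \<open>x \<mapsto> P\<^sub>x(A)\<close> is fixed by the semigroup, hence \<open>\<mu>\<close>-almost surely constant by
decay of the variance. Then the Markov property makes \<open>A\<close> independent of every past, and so of itself.
\<close>

lemma time_ergodic_mue: "time_ergodic P mue"
 unfolding time_ergodic_def
proof (intro ballI impI)
 fix A assume A [measurable]: "A \<in> sets (path_space :: 'a path measure)"
  and inv: "ALL t>=0. {w \<in> space path_space. shift t w \<in> A} = A"
 let ?M = "law_from P mue"
 note LM = law_from_kernel[OF distribution_mue]
 interpret M: prob_space ?M by (rule LM)
 have mM [simp]: "measurable ?M N = measurable path_space N" for N by (rule measurable_cong_sets[OF LM(2) refl])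
 define phi where "phi x = measure (P x) A" for x
 have phim [measurable]: "borel_fun phi"
  unfolding phi_def by (rule measurable_compose[OF kernel_subprob measurable_measure_subprob_algebra[OF A]])
 have phib: "abs (phi x) <= 1" for x unfolding phi_def using prob_space.prob_le_1[OF prob_space_P] by simp
 have Sphi: "S t phi x = phi x" if t: "t >= 0" for t x
 proof -
  have "space path_space \<in> sets (past t :: (real => 'a) measure)" using sets.top[of "past t"] by (simp add: space_past)
  from markov_property[OF t this A, of x]
  have "phi x = LINT w|P x. indicator (space path_space) w * phi (w t)" using inv t by (simp add: phi_def)
  also have "... = S t phi x" unfolding markov_semigroup_def by (intro bochner_cong) auto
  finally show ?thesis by simp
 qed
 have "centered_norm mu phi = 0"
 proof -
  have "centered_norm mu phi <= exp (- kappa * 1) * centered_norm mu phi" using bounded_decay(1)[OF phim phib, of 1] Sphi[of 1] by simp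
  hence "(1 - exp (- kappa)) * centered_norm mu phi <= 0" by (simp add: algebra_simps)
  moreover have "1 - exp (- kappa) > 0" using kappa_pos by simp
  ultimately have "centered_norm mu phi <= 0" by (simp add: mult_le_0_iff)
  thus ?thesis by (simp add: order.antisym)
 qed
 define c where "c = LINT x|mu. phi x"
 have "AE x in mu. phi x = c"
 proof -
  have L: "(%x. phi x - c) \<in> L2 mu" by (intro mu.centered_L2 bounded_L2[OF phim phib])
  have "LINT x|mu. (phi x - c)^2 = 0" using \<open>centered_norm mu phi = 0\<close> by (simp add: L2_norm_def c_def)
  hence "AE x in mu. (phi x - c)^2 = 0" by (subst (asm) integral_nonneg_eq_0_iff_AE[OF L2_integrable_square[OF L]]) auto
  thus ?thesis by eventually_elim simp
 qed
 hence phic: "AE x in mue. phi x = c" by (rule AE_mue)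
 have MA: "measure ?M (A \<inter> B) = c * measure ?M B" if s: "s >= 0" and B: "B \<in> sets (past s)" for s B
 proof -
  have B' [measurable]: "B \<in> sets path_space" using B sets_past_subset by blast
  have Bs: "B \<subseteq> space path_space" using sets.sets_into_space[OF B'] .
  have AB: "A \<inter> B = {w \<in> B. shift s w \<in> A}" using inv s Bs by blast
  have "measure ?M (A \<inter> B) = LINT w|?M. indicator (A \<inter> B) w" by (simp add: LM)
  also have "... = LINT x|mue. LINT w|P x. indicator (A \<inter> B) w" by (rule integral_law_from[OF distribution_mue, where B = 1]) (auto simp: indicator_def)
  also have "... = LINT x|mue. measure (P x) (A \<inter> B)" by simp
  also have "... = LINT x|mue. LINT w|P x. indicator B w * phi (w s)"
   unfolding AB markov_property[OF s B A] phi_def ..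
  also have "... = LINT w|?M. indicator B w * phi (w s)" by (rule integral_law_from[OF distribution_mue, where B = 1, symmetric])
    (use phib in "auto simp: indicator_def intro: measurable_compose[OF path_coordinate_measurable phim]")
  also have "... = LINT w|?M. indicator B w * c"
  proof (rule integral_cong_AE)
   have "AE w in ?M. phi (w s) = c"
   proof (rule AE_distrD[of "%w. w s" ?M borel])
    have "distr ?M borel (%w. w s) = mue" using invariant_mue s by (simp add: invariant_def dist_at_def)
    thus "AE x in distr ?M borel (%w. w s). phi x = c" by (subst \<open>distr ?M borel (%w. w s) = mue\<close>) (rule phic)
   qed simp
   thus "AE w in ?M. indicator B w * phi (w s) = indicator B w * c" by eventually_elim simp
   have [measurable]: "(%w. phi (w s)) \<in> borel_measurable path_space" by (rule measurable_compose[OF path_coordinate_measurable phim])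
   show "(%w. indicator B w * phi (w s)) \<in> borel_measurable ?M" by simp
  qed simp
  also have "... = c * measure ?M B" by (simp add: LM mult.commute)
  finally show ?thesis .
 qed
 have c: "measure ?M A = c" using MA[of 0 "space path_space"] sets.top[of "past 0 :: (real => 'a) measure"] sets.sets_into_space[OF A] M.prob_space
  by (simp add: space_past LM Int_absorb2)
 let ?G = "\<Union>s\<in>{0..}. sets (past s :: (real => 'a) measure)"
 have G: "?G \<subseteq> M.events" using sets_past_subset by (auto simp: LM)
 have "Int_stable ?G"
  unfolding Int_stable_def
 proof (intro ballI)
  fix a b assume "a \<in> ?G" "b \<in> ?G"
  then obtain s t where st: "s >= 0" "t >= 0" and "a \<in> sets (past s)" "b \<in> sets (past t)" by auto
  hence "a \<in> sets (past (max s t))" "b \<in> sets (past (max s t))" using past_mono[of s "max s t"] past_mono[of t "max s t"] by auto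
  thus "a \<inter> b \<in> ?G" using st by (intro UN_I[of "max s t"]) auto
 qed
 moreover have "Int_stable {A}" by (simp add: Int_stable_def)
 moreover have "M.indep_set {A} ?G"
 proof (rule M.indep_setI)
  show "M.prob (a \<inter> b) = M.prob a * M.prob b" if "a \<in> {A}" "b \<in> ?G" for a b using that MA c by auto
 qed (use G A in "auto simp: LM")
 ultimately have "M.indep_set (sigma_sets (space ?M) {A}) (sigma_sets (space ?M) ?G)" using M.indep_set_sigma_sets by blast
 moreover have "A \<in> sigma_sets (space ?M) ?G" using A by (simp add: LM past_generates)
 ultimately have "M.prob (A \<inter> A) = M.prob A * M.prob A" using M.indep_setD[of "sigma_sets (space ?M) {A}" _ A A] sigma_sets.Basic[of A "{A}"] by blast
 hence "c = c * c" by (simp add: c)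
 thus "measure ?M A \<in> {0, 1}" unfolding c by auto
qed

end

section \<open>Superpositions of square-integrable functions\<close>

lemma nn_integral_mult_L2:
 assumes f: "f \<in> L2 M" and g: "g \<in> L2 M"
 shows "nn_integral M (%x. ennreal (abs (f x)) * ennreal (abs (g x))) <= ennreal (L2_norm M f * L2_norm M g)"
proof -
 have "nn_integral M (%x. ennreal (abs (f x)) * ennreal (abs (g x))) = nn_integral M (%x. ennreal (abs (f x) * abs (g x)))" by (simp add: ennreal_mult')
 also have "... = ennreal (LINT x|M. abs (f x) * abs (g x))" using L2_integrable_mult[OF L2_abs[OF f] L2_abs[OF g]] by (intro nn_integral_eq_integral) auto
 also have "... <= ennreal (L2_norm M (%x. abs (f x)) * L2_norm M (%x. abs (g x)))" using L2_Cauchy_Schwarz[OF L2_abs[OF f] L2_abs[OF g]] by (intro ennreal_leI) auto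
 also have "L2_norm M (%x. abs (f x)) * L2_norm M (%x. abs (g x)) = L2_norm M f * L2_norm M g" by (simp add: L2_norm_def)
 finally show ?thesis .
qed

lemma minkowski_nn:
 fixes F :: "'n => 'm => real"
 assumes "sigma_finite_measure N" "sigma_finite_measure M"
  and F [measurable]: "(%(s, x). F s x) \<in> borel_measurable (N \<otimes> M)"
  and FC: "!!s. s \<in> space N ==> F s \<in> L2 M & L2_norm M (F s) <= C s" and C: "integrable N C"
 shows "nn_integral M (%x. (nn_integral N (%s. ennreal (abs (F s x))))^2) <= (ennreal (LINT s|N. C s))^2"
proof -
 interpret pair_sigma_finite N M using assms(1,2) by (rule pair_sigma_finite.intro)
 interpret NN: pair_sigma_finite N N using assms(1,1) by (rule pair_sigma_finite.intro)
 interpret P2: pair_sigma_finite "N \<otimes> N" M by (intro pair_sigma_finite.intro NN.sigma_finite_measure_axioms assms)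
 have C0: "0 <= C s" if "s \<in> space N" for s using FC[OF that] L2_norm_nonneg[of M "F s"] by linarith
 have [measurable]: "C \<in> borel_measurable N" using C by simp
 have Fm [measurable]: "(%x. F s x) \<in> borel_measurable M" if "s \<in> space N" for s using measurable_compose[OF measurable_Pair1'[OF that] F] by simp
 have Fm2 [measurable]: "(%s. F s x) \<in> borel_measurable N" if "x \<in> space M" for x using measurable_compose[OF measurable_Pair2'[OF that] F] by simp
 have "nn_integral M (%x. (nn_integral N (%s. ennreal (abs (F s x))))^2) = nn_integral M (%x. nn_integral N (%s. nn_integral N (%u. ennreal (abs (F s x)) * ennreal (abs (F u x)))))"
  by (intro nn_integral_cong) (simp add: power2_eq_square nn_integral_cmult nn_integral_multc)
 also have "... = nn_integral N (%s. nn_integral M (%x. nn_integral N (%u. ennreal (abs (F s x)) * ennreal (abs (F u x)))))" by (rule Fubini') measurable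
 also have "... = nn_integral N (%s. nn_integral N (%u. nn_integral M (%x. ennreal (abs (F s x)) * ennreal (abs (F u x)))))" by (intro nn_integral_cong Fubini') measurable
 also have "... <= nn_integral N (%s. nn_integral N (%u. ennreal (C s) * ennreal (C u)))"
 proof (intro nn_integral_mono)
  fix s u assume s: "s \<in> space N" and u: "u \<in> space N"
  have "nn_integral M (%x. ennreal (abs (F s x)) * ennreal (abs (F u x))) <= ennreal (L2_norm M (F s) * L2_norm M (F u))" using FC[OF s] FC[OF u] by (intro nn_integral_mult_L2) auto
  also have "... <= ennreal (C s * C u)" using FC[OF s] FC[OF u] C0[OF s] by (intro ennreal_leI mult_mono) auto
  also have "... = ennreal (C s) * ennreal (C u)" using C0[OF s] by (rule ennreal_mult')
  finally show "nn_integral M (%x. ennreal (abs (F s x)) * ennreal (abs (F u x))) <= ennreal (C s) * ennreal (C u)" .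
 qed
 also have "... = (nn_integral N (%s. ennreal (C s)))^2" by (simp add: nn_integral_cmult nn_integral_multc power2_eq_square)
 also have "nn_integral N (%s. ennreal (C s)) = ennreal (LINT s|N. C s)" using C C0 by (intro nn_integral_eq_integral) auto
 finally show ?thesis .
qed

text \<open>
The Minkowski integral inequality, in the form needed for time integrals of square-integrable functions.
\<close>

lemma minkowski:
 fixes F :: "'n => 'm => real"
 assumes "sigma_finite_measure N" "sigma_finite_measure M"
  and F [measurable]: "(%(s, x). F s x) \<in> borel_measurable (N \<otimes> M)"
  and FC: "!!s. s \<in> space N ==> F s \<in> L2 M & L2_norm M (F s) <= C s" and C: "integrable N C"
 shows "AE x in M. integrable N (%s. F s x)"
  and "(%x. LINT s|N. F s x) \<in> L2 M" "L2_norm M (%x. LINT s|N. F s x) <= LINT s|N. C s"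
proof -
 interpret pair_sigma_finite N M using assms(1,2) by (rule pair_sigma_finite.intro)
 interpret MN: pair_sigma_finite M N using assms(2,1) by (rule pair_sigma_finite.intro)
 have F' [measurable]: "(%(x, s). F s x) \<in> borel_measurable (M \<otimes> N)" using measurable_compose[OF measurable_pair_swap' F] by (simp add: case_prod_beta')
 have Fm2 [measurable]: "(%s. F s x) \<in> borel_measurable N" if "x \<in> space M" for x using measurable_compose[OF measurable_Pair2'[OF that] F] by simp
 have C0: "0 <= C s" if "s \<in> space N" for s using FC[OF that] L2_norm_nonneg[of M "F s"] by linarith
 define A where "A x = nn_integral N (%s. ennreal (abs (F s x)))" for x
 have [measurable]: "A \<in> borel_measurable M" unfolding A_def by measurable
 note nn = minkowski_nn[OF assms, folded A_def]
 have "nn_integral M (%x. (A x)^2) < \<infinity>" using nn by (auto simp: power2_eq_square ennreal_mult_less_top order.strict_trans1)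
 hence "AE x in M. (A x)^2 ~= \<infinity>" by (intro nn_integral_noteq_infinite) auto
 hence fin: "AE x in M. A x < \<infinity>" by eventually_elim (auto simp: power2_eq_square ennreal_mult_eq_top_iff less_top)
 have sp: "AE x in M. x \<in> space M" by (rule AE_space)
 show "AE x in M. integrable N (%s. F s x)" using fin sp by eventually_elim (auto intro!: integrableI_bounded simp: A_def)
 define T where "T x = LINT s|N. F s x" for x
 have Tm [measurable]: "T \<in> borel_measurable M" unfolding T_def by measurable
 have TA: "ennreal (abs (T x)) <= A x" for x
  unfolding T_def A_def using integral_norm_bound_ennreal[of N "%s. F s x"] by (cases "integrable N (%s. F s x)") (auto simp: not_integrable_integral_eq)
 have "nn_integral M (%x. ennreal ((T x)^2)) <= nn_integral M (%x. (A x)^2)"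
 proof (intro nn_integral_mono)
  fix x
  have "ennreal ((T x)^2) = (ennreal (abs (T x)))^2" by (simp add: ennreal_power)
  also have "... <= (A x)^2" using TA[of x] by (intro power_mono) auto
  finally show "ennreal ((T x)^2) <= (A x)^2" .
 qed
 also note nn
 also have "(ennreal (LINT s|N. C s))^2 = ennreal ((LINT s|N. C s)^2)" using C0 by (intro ennreal_power integral_nonneg_AE AE_I2) auto
 finally have le: "nn_integral M (%x. ennreal ((T x)^2)) <= ennreal ((LINT s|N. C s)^2)" .
 have int: "integrable M (%x. (T x)^2)" by (rule integrableI_bounded) (use le in "auto intro: order.strict_trans1")
 thus "(%x. LINT s|N. F s x) \<in> L2 M" using Tm by (simp add: L2_def T_def)
 have "nn_integral M (%x. ennreal ((T x)^2)) = ennreal (LINT x|M. (T x)^2)" using int by (intro nn_integral_eq_integral) auto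
 hence "LINT x|M. (T x)^2 <= (LINT s|N. C s)^2" using le by (simp add: ennreal_le_iff)
 hence "sqrt (LINT x|M. (T x)^2) <= sqrt ((LINT s|N. C s)^2)" by (rule real_sqrt_le_mono)
 moreover have "0 <= LINT s|N. C s" using C0 by (intro integral_nonneg_AE AE_I2) auto
 ultimately show "L2_norm M (%x. LINT s|N. F s x) <= LINT s|N. C s" by (simp add: L2_norm_def T_def)
qed

section \<open>Jump operators\<close>

lemma infsum_eq_count_space:
 fixes f :: "'a => real"
 shows "infsum f A = LINT x|count_space A. f x"
proof (cases "f summable_on A")
 case True
 hence "Infinite_Set_Sum.abs_summable_on f A" using summable_on_iff_abs_summable_on_real abs_summable_equivalent by blast
 thus ?thesis using infsetsum_infsum[of f A] by (simp add: infsetsum_def)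
next
 case False
 hence "\<not> Infinite_Set_Sum.abs_summable_on f A" using summable_on_iff_abs_summable_on_real abs_summable_equivalent by blast
 thus ?thesis using False by (simp add: infsum_not_exists Infinite_Set_Sum.abs_summable_on_def not_integrable_integral_eq)
qed

lemma summable_on_iff_integrable:
 fixes f :: "'a => real"
 shows "f summable_on A \<longleftrightarrow> integrable (count_space A) f" using summable_on_iff_abs_summable_on_real[of f A] abs_summable_equivalent[of f A]
 by (simp add: Infinite_Set_Sum.abs_summable_on_def)

lemma sigma_finite_count_space_countable: "sigma_finite_measure (count_space (UNIV :: 'a::countable set))" by (rule sigma_finite_measure_count_space_countable) simp

lemma measurable_count_space_pair:
 assumes "!!y :: 'a::countable. f y \<in> M \<leadsto> N"
 shows "(%(y, x). f y x) \<in> count_space UNIV \<otimes> M \<leadsto> N" by (rule measurable_pair_measure_countable1) (use assms in auto)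

lemma translate_continuous: "continuous_on UNIV (translate y :: ('s::topological_space, 'd::finite) config => _)"
 unfolding translate_def by (intro continuous_on_coordinatewise_then_product continuous_on_product_coordinates)

lemma translate_measurable [measurable]: "translate y \<in> borel \<leadsto> (borel :: ('s::topological_space, 'd::finite) config measure)"
 by (rule borel_measurable_continuous_onI[OF translate_continuous])

lemma translate_0 [simp]: "translate 0 eta = eta" by (simp add: translate_def)

lemma compact_config:
 assumes "compact (UNIV :: 's::topological_space set)"
 shows "compact (UNIV :: ('s, 'd::finite) config set)"
proof -
 have "compact_space (product_topology (%_::'d lattice. euclidean :: 's topology) UNIV)"
  unfolding compact_space_product_topology using assms by (simp add: compact_space_def)
 thus ?thesis by (simp add: euclidean_product_topology compact_space_def)
qed

lemma jump_op_eq: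
 fixes f :: "('s, 'd::finite) config => real"
 shows "jump_op h f eta = LINT y|count_space UNIV. h y eta * (f (translate y eta) - f eta)" by (simp add: jump_op_def infsum_eq_count_space)

lemma jump_op_diff_const: "jump_op h (%eta. f eta - c) = jump_op h (f :: ('s, 'd::finite) config => real)" by (simp add: fun_eq_iff jump_op_def)

lemma jump_op_cmult: "jump_op h (%eta. c * f eta) eta = c * jump_op h (f :: ('s, 'd::finite) config => real) eta"
proof -
 have "h y eta * (c * f (translate y eta) - c * f eta) = c * (h y eta * (f (translate y eta) - f eta))" for y by (simp add: algebra_simps)
 thus ?thesis by (simp only: jump_op_eq integral_mult_right_zero)
qed

locale jump_rates =
 fixes h :: "('d::finite) lattice => ('s::polish_space, 'd) config => real"
 assumes compact_S: "compact (UNIV :: 's set)" and continuous_h: "!!y. continuous_on UNIV (h y)"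
  and summable_h: "(%y. SUP eta. abs (h y eta)) summable_on UNIV"
begin

definition sup_h :: "'d lattice => real" where "sup_h y = (SUP eta. abs (h y eta))"

definition total :: real where "total = LINT y|count_space UNIV. sup_h y"

lemma h_measurable [measurable]: "borel_fun (h y)" by (rule borel_measurable_continuous_onI[OF continuous_h])

lemma abs_h_le: "abs (h y eta) <= sup_h y"
proof -
 have "compact (range (%eta. abs (h y eta)))" by (intro compact_continuous_image continuous_intros continuous_h compact_config compact_S)
 hence "bdd_above (range (%eta. abs (h y eta)))" by (intro bounded_imp_bdd_above compact_imp_bounded)
 thus ?thesis unfolding sup_h_def by (intro cSUP_upper) auto
qed

lemma sup_h_nonneg: "0 <= sup_h y" using abs_h_le[of y undefined] by linarith

lemma integrable_sup_h: "integrable (count_space UNIV) sup_h" using summable_h by (simp add: summable_on_iff_integrable sup_h_def[abs_def])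

lemma total_nonneg: "0 <= total"
 unfolding total_def by (intro bochner_nonneg sup_h_nonneg)

lemma jump_op_measurable [measurable (raw)]:
 fixes F :: "'n => ('s, 'd) config => real"
 assumes F: "(%(x, eta). F x eta) \<in> borel_measurable (N \<otimes> borel)"
  and g [measurable]: "g \<in> N \<leadsto> borel"
 shows "(%x. jump_op h (F x) (g x)) \<in> borel_measurable N"
proof -
 interpret C: sigma_finite_measure "count_space (UNIV :: 'd lattice set)" by (rule sigma_finite_count_space_countable)
 have 1: "(%x. F x (k x)) \<in> borel_measurable N" if "k \<in> N \<leadsto> borel" for k using measurable_compose[OF measurable_Pair[OF measurable_ident that] F] by simp
 have meas: "(%(y, x). h y (g x) * (F x (translate y (g x)) - F x (g x))) \<in> borel_measurable (count_space UNIV \<otimes> N)"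
 proof (rule measurable_count_space_pair)
  fix y
  have [measurable]: "(%x. F x (translate y (g x))) \<in> borel_measurable N" "(%x. F x (g x)) \<in> borel_measurable N"
   by (rule 1[OF measurable_compose[OF g translate_measurable]], rule 1[OF g])
  show "(%x. h y (g x) * (F x (translate y (g x)) - F x (g x))) \<in> borel_measurable N" by measurable
 qed
 hence "(%(x, y). h y (g x) * (F x (translate y (g x)) - F x (g x))) \<in> borel_measurable (N \<otimes> count_space UNIV)"
  using measurable_compose[OF measurable_pair_swap' meas] by (simp add: case_prod_beta')
 from C.borel_measurable_lebesgue_integral[OF this]
 show ?thesis by (simp add: jump_op_eq)
qed

lemma jump_op_measurable' [measurable]:
 assumes [measurable]: "borel_fun f"
 shows "jump_op h (f :: ('s, 'd) config => real) \<in> borel_measurable borel"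
proof -
 have "borel_fun (%x. jump_op h ((%_. f) x) ((%x. x) x))" by (rule jump_op_measurable) measurable
 thus ?thesis by simp
qed

lemma jump_op_summable_bounded:
 fixes f :: "('s, 'd) config => 'b::real_normed_vector"
 assumes "!!eta. norm (f eta) <= B"
 shows "(%y. norm (h y eta *\<^sub>R (f (translate y eta) - f eta))) summable_on UNIV"
proof (rule summable_on_comparison_test)
 show "(%y. 2 * B * sup_h y) summable_on UNIV" using integrable_sup_h by (simp add: summable_on_iff_integrable)
 show "norm (h y eta *\<^sub>R (f (translate y eta) - f eta)) <= 2 * B * sup_h y" for y
 proof -
  have "norm (f (translate y eta) - f eta) <= 2 * B" using norm_triangle_ineq4[of "f (translate y eta)" "f eta"] assms[of "translate y eta"] assms[of eta] by linarith
  hence "abs (h y eta) * norm (f (translate y eta) - f eta) <= sup_h y * (2 * B)" using abs_h_le[of y eta] by (intro mult_mono sup_h_nonneg) auto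
  thus ?thesis by (simp add: mult.commute)
 qed
qed auto

lemma jump_op_integrable_bounded:
 fixes f :: "('s, 'd) config => real"
 assumes "!!eta. abs (f eta) <= B"
 shows "integrable (count_space UNIV) (%y. h y eta * (f (translate y eta) - f eta))" using jump_op_summable_bounded[of f B eta] assms
 by (simp add: summable_on_iff_integrable integrable_norm_iff abs_mult[symmetric] flip: real_norm_def)

lemma jump_op_bounded:
 fixes f :: "('s, 'd) config => real"
 assumes B: "!!eta. abs (f eta) <= B"
 shows "abs (jump_op h f eta) <= 2 * B * total"
proof -
 have "abs (jump_op h f eta) <= LINT y|count_space UNIV. abs (h y eta * (f (translate y eta) - f eta))"
  unfolding jump_op_eq by (rule integral_abs_bound)
 also have "... <= LINT y|count_space UNIV. sup_h y * (2 * B)"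
 proof (rule integral_mono)
  fix y
  have "abs (f (translate y eta) - f eta) <= 2 * B" using B[of "translate y eta"] B[of eta] by linarith
  thus "abs (h y eta * (f (translate y eta) - f eta)) <= sup_h y * (2 * B)"
   unfolding abs_mult using abs_h_le[of y eta] by (intro mult_mono sup_h_nonneg) auto
 qed (use integrable_sup_h jump_op_integrable_bounded[of f B eta, OF B] in auto)
 also have "... = 2 * B * total" by (simp add: total_def)
 finally show ?thesis .
qed

lemma jump_op_diff_bounded:
 fixes f g :: "('s, 'd) config => real"
 assumes "!!eta. abs (f eta) <= B" "!!eta. abs (g eta) <= B'"
 shows "jump_op h (%eta. f eta - g eta) eta = jump_op h f eta - jump_op h g eta"
proof -
 have "h y eta * (f (translate y eta) - g (translate y eta) - (f eta - g eta))
  = h y eta * (f (translate y eta) - f eta) - h y eta * (g (translate y eta) - g eta)" for y by (simp add: algebra_simps)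
 thus ?thesis
  unfolding jump_op_eq using jump_op_integrable_bounded[of f B eta, OF assms(1)] jump_op_integrable_bounded[of g B' eta, OF assms(2)] by simp
qed

end

section \<open>Jump operators on square-integrable functions\<close>

locale L2_jump = jump_rates h
 for h :: "('d::finite) lattice => ('s::polish_space, 'd) config => real" +
 fixes mu :: "('s, 'd) config measure"
 assumes distr_mu: "distribution mu" and translation_invariant: "!!x. distr mu borel (translate x) = mu"
begin

sublocale m: prob_space mu by (rule distributionD[OF distr_mu])

lemmas mu_measurable [simp] = distributionD(4)[OF distr_mu]

lemma AE_translate:
 assumes "AE eta in mu. R eta"
 shows "AE eta in mu. R (translate y eta)"
proof (rule AE_distrD[of "translate y" mu borel])
 show "AE eta in distr mu borel (translate y). R eta" by (subst translation_invariant) (rule assms)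
qed simp

lemma translate_L2:
 assumes f: "f \<in> L2 mu"
 shows "(%eta. f (translate y eta)) \<in> L2 mu" "L2_norm mu (%eta. f (translate y eta)) = L2_norm mu f"
proof -
 have [measurable]: "borel_fun f" using L2_measurable[OF f] by simp
 have i: "integrable (distr mu borel (translate y)) (%eta. (f eta)^2)" using L2_integrable_square[OF f] by (simp add: translation_invariant)
 have "integrable mu (%eta. (f (translate y eta))^2)" using i by (subst (asm) integrable_distr_eq) auto
 thus "(%eta. f (translate y eta)) \<in> L2 mu" by (simp add: L2_def)
 have "LINT eta|distr mu borel (translate y). (f eta)^2 = LINT eta|mu. (f (translate y eta))^2" by (rule integral_distr) auto
 thus "L2_norm mu (%eta. f (translate y eta)) = L2_norm mu f" by (simp add: L2_norm_def translation_invariant)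
qed

lemma jump_term_L2:
 assumes f: "f \<in> L2 mu"
 shows "(%eta. h y eta * (f (translate y eta) - f eta)) \<in> L2 mu"
  "L2_norm mu (%eta. h y eta * (f (translate y eta) - f eta)) <= sup_h y * (2 * L2_norm mu f)"
proof -
 define d where "d eta = f (translate y eta) - f eta" for eta
 have d: "d \<in> L2 mu" unfolding d_def by (intro L2_diff translate_L2 f)
 have "L2_norm mu d <= L2_norm mu (%eta. f (translate y eta)) + L2_norm mu (%eta. - 1 * f eta)"
  using L2_norm_triangle[OF translate_L2(1)[OF f] L2_cmult[OF f, of "- 1"]] by (simp add: d_def[abs_def])
 hence dn: "L2_norm mu d <= 2 * L2_norm mu f" by (simp only: L2_norm_cmult translate_L2(2)[OF f])
 have dm [measurable]: "borel_fun d" using L2_measurable[OF d] by simp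
 have *: "(%eta. h y eta * d eta) \<in> borel_measurable mu" "AE eta in mu. abs (h y eta * d eta) <= abs (sup_h y * d eta)"
  using abs_h_le[of y] by (auto simp: abs_mult sup_h_nonneg intro!: mult_right_mono)
 note ** = L2_norm_mono[OF *(1) L2_cmult[OF d, of "sup_h y"] *(2)]
 show "(%eta. h y eta * (f (translate y eta) - f eta)) \<in> L2 mu" using **(1) by (simp add: d_def)
 have "L2_norm mu (%eta. h y eta * d eta) <= sup_h y * L2_norm mu d" using **(2) by (simp add: L2_norm_cmult sup_h_nonneg)
 also have "... <= sup_h y * (2 * L2_norm mu f)" using dn sup_h_nonneg by (rule mult_left_mono)
 finally show "L2_norm mu (%eta. h y eta * (f (translate y eta) - f eta)) <= sup_h y * (2 * L2_norm mu f)" by (simp add: d_def)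
qed

lemma jump_op_L2:
 assumes f: "f \<in> L2 mu"
 shows "AE eta in mu. integrable (count_space UNIV) (%y. h y eta * (f (translate y eta) - f eta))"
  and "jump_op h f \<in> L2 mu" "L2_norm mu (jump_op h f) <= 2 * total * L2_norm mu f"
proof -
 define F where "F y eta = h y eta * (f (translate y eta) - f eta)" for y eta
 have [measurable]: "borel_fun f" using L2_measurable[OF f] by simp
 have "F y \<in> borel_measurable mu" for y unfolding F_def by simp
 hence m: "(%(y, eta). F y eta) \<in> borel_measurable (count_space UNIV \<otimes> mu)" by (rule measurable_count_space_pair)
 have FC: "F y \<in> L2 mu & L2_norm mu (F y) <= sup_h y * (2 * L2_norm mu f)" for y using jump_term_L2[OF f, of y] unfolding F_def by blast
 have C: "integrable (count_space UNIV) (%y. sup_h y * (2 * L2_norm mu f))" using integrable_sup_h by simp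
 note mk = minkowski[OF sigma_finite_count_space_countable m.sigma_finite_measure_axioms m FC C]
 show "AE eta in mu. integrable (count_space UNIV) (%y. h y eta * (f (translate y eta) - f eta))" using mk(1) by (simp add: F_def)
 show "jump_op h f \<in> L2 mu" using mk(2) by (simp add: F_def jump_op_eq[abs_def])
 show "L2_norm mu (jump_op h f) <= 2 * total * L2_norm mu f" using mk(3) by (simp add: F_def jump_op_eq[abs_def] total_def mult_ac)
qed

lemma jump_op_diff_AE:
 assumes f: "f \<in> L2 mu" and g: "g \<in> L2 mu"
 shows "AE eta in mu. jump_op h (%eta. f eta - g eta) eta = jump_op h f eta - jump_op h g eta" using jump_op_L2(1)[OF f] jump_op_L2(1)[OF g]
proof eventually_elim
 case (elim eta)
 have "h y eta * (f (translate y eta) - g (translate y eta) - (f eta - g eta))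
  = h y eta * (f (translate y eta) - f eta) - h y eta * (g (translate y eta) - g eta)" for y by (simp add: algebra_simps)
 thus ?case unfolding jump_op_eq using elim by simp
qed

definition eps :: real where "eps = L2_opnorm mu (jump_op h)"

text \<open>
The operator norm is a supremum over the unit ball. Functions of norm \<open>0\<close> cannot be normalised; for them the bound of the operator by
\<open>2 total\<close> is used, which also shows that the supremum is finite.
\<close>

lemma jump_op_le_eps:
 assumes f: "f \<in> L2 mu"
 shows "L2_norm mu (jump_op h f) <= eps * L2_norm mu f"
proof (cases "L2_norm mu f = 0")
 case True
 thus ?thesis using jump_op_L2(3)[OF f] by simp
next
 case False
 define n where "n = L2_norm mu f"
 have n: "n > 0" using False L2_norm_nonneg[of mu f] unfolding n_def by linarith
 have g: "(%eta. inverse n * f eta) \<in> L2 mu" by (rule L2_cmult[OF f])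
 have gn: "L2_norm mu (%eta. inverse n * f eta) <= 1" using n by (simp only: L2_norm_cmult) (simp add: n_def)
 have "L2_norm mu (jump_op h (%eta. inverse n * f eta)) <= eps"
  unfolding eps_def L2_opnorm_def
 proof (rule cSup_upper)
  show "L2_norm mu (jump_op h (%eta. inverse n * f eta)) \<in> {L2_norm mu (jump_op h f) |f. f \<in> L2 mu & L2_norm mu f <= 1}" using g gn by blast
  show "bdd_above {L2_norm mu (jump_op h f) |f. f \<in> L2 mu & L2_norm mu f <= 1}"
  proof (rule bdd_aboveI[of _ "2 * total * 1"])
   fix x assume "x \<in> {L2_norm mu (jump_op h f) |f. f \<in> L2 mu & L2_norm mu f <= 1}"
   then obtain f where f: "x = L2_norm mu (jump_op h f)" "f \<in> L2 mu" "L2_norm mu f <= 1" by blast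
   have "x <= 2 * total * L2_norm mu f" unfolding f(1) by (rule jump_op_L2(3)[OF f(2)])
   also have "... <= 2 * total * 1" using f(3) total_nonneg by (intro mult_left_mono) auto
   finally show "x <= 2 * total * 1" .
  qed
 qed
 moreover have "jump_op h (%eta. inverse n * f eta) = (%eta. inverse n * jump_op h f eta)" by (simp only: fun_eq_iff jump_op_cmult) simp
 ultimately have "abs (inverse n) * L2_norm mu (jump_op h f) <= eps" by (simp only: L2_norm_cmult)
 thus ?thesis using n by (simp add: n_def field_simps)
qed

lemma eps_nonneg: "0 <= eps"
proof -
 have "L2_norm mu (jump_op h (%_. 1)) <= eps * L2_norm mu (%_. 1)" by (rule jump_op_le_eps[OF L2_const[OF m.finite_measure_axioms]])
 hence "L2_norm mu (jump_op h (%_. 1)) <= eps" by (simp add: m.L2_norm_const)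
 thus ?thesis using L2_norm_nonneg order.trans by blast
qed

lemma jump_op_le_centered:
 assumes f: "f \<in> L2 mu"
 shows "L2_norm mu (jump_op h f) <= eps * centered_norm mu f" using jump_op_le_eps[OF m.centered_L2[OF f, of "LINT y|mu. f y"]] by (simp only: jump_op_diff_const)

text \<open>
The jump operator commutes with time integrals almost everywhere. The terms are only square-integrable, so that Fubini for the sum over
\<open>y\<close> holds outside a null set.
\<close>

lemma jump_op_integral_AE:
 fixes F :: "'n => ('s, 'd) config => real"
 assumes N: "sigma_finite_measure N" and F [measurable]: "(%(s, eta). F s eta) \<in> borel_measurable (N \<otimes> borel)"
  and FC: "!!s. s \<in> space N ==> F s \<in> L2 mu & L2_norm mu (F s) <= C s" and C: "integrable N C"
 shows "AE eta in mu. jump_op h (%eta. LINT s|N. F s eta) eta = LINT s|N. jump_op h (F s) eta"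
proof -
 let ?CS = "count_space (UNIV :: 'd lattice set)"
 have sets: "sets (N \<otimes> mu) = sets (N \<otimes> borel)" by (intro sets_pair_measure_cong refl) (simp add: distributionD[OF distr_mu])
 have Fmu: "(%(s, eta). F s eta) \<in> borel_measurable (N \<otimes> mu)" using F measurable_cong_sets[OF sets refl] by blast
 interpret pair_sigma_finite ?CS N by (rule pair_sigma_finite.intro[OF sigma_finite_count_space_countable N])
 define F' where "F' p eta = h (fst p) eta * (F (snd p) (translate (fst p) eta) - F (snd p) eta)" for p eta
 have "AE eta in mu. integrable (?CS \<otimes> N) (%p. F' p eta)"
 proof (rule minkowski(1)[where C = "%p. sup_h (fst p) * (2 * C (snd p))"])
  show "sigma_finite_measure (?CS \<otimes> N)" by unfold_locales
  show "sigma_finite_measure mu" by unfold_locales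
  have "(%(y, q). h y (snd q) * (F (fst q) (translate y (snd q)) - F (fst q) (snd q))) \<in> borel_measurable (?CS \<otimes> (N \<otimes> borel))"
  proof (rule measurable_count_space_pair)
   fix y
   have "(%q. (fst q, translate y (snd q))) \<in> N \<otimes> borel \<leadsto> N \<otimes> (borel :: ('s, 'd) config measure)" by measurable
   from measurable_compose[OF this F]
   have [measurable]: "(%q. F (fst q) (translate y (snd q))) \<in> borel_measurable (N \<otimes> borel)" by simp
   have [measurable]: "(%q. F (fst q) (snd q)) \<in> borel_measurable (N \<otimes> borel)" using F by (simp add: case_prod_beta')
   show "(%q. h y (snd q) * (F (fst q) (translate y (snd q)) - F (fst q) (snd q))) \<in> borel_measurable (N \<otimes> borel)" by measurable
  qed
  hence m1: "(%(y, q). h y (snd q) * (F (fst q) (translate y (snd q)) - F (fst q) (snd q))) \<in> borel_measurable (?CS \<otimes> (N \<otimes> mu))"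
   using measurable_cong_sets[OF sets_pair_measure_cong[OF refl sets] refl] by blast
  have "(%(p, eta). (fst p, (snd p, eta))) \<in> (?CS \<otimes> N) \<otimes> mu \<leadsto> ?CS \<otimes> (N \<otimes> mu)" by measurable
  from measurable_compose[OF this m1]
  show "(%(p, eta). F' p eta) \<in> borel_measurable ((?CS \<otimes> N) \<otimes> mu)" by (simp add: F'_def case_prod_beta')
 next
  fix p assume "p \<in> space (?CS \<otimes> N)"
  hence s: "snd p \<in> space N" by (auto simp: space_pair_measure)
  have "L2_norm mu (F' p) <= sup_h (fst p) * (2 * L2_norm mu (F (snd p)))" using jump_term_L2(2)[of "F (snd p)" "fst p"] FC[OF s] by (simp add: F'_def[abs_def])
  also have "... <= sup_h (fst p) * (2 * C (snd p))" using FC[OF s] by (intro mult_left_mono sup_h_nonneg) auto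
  finally show "F' p \<in> L2 mu & L2_norm mu (F' p) <= sup_h (fst p) * (2 * C (snd p))" using jump_term_L2(1)[of "F (snd p)" "fst p"] FC[OF s] by (simp add: F'_def[abs_def])
 next
  show "integrable (?CS \<otimes> N) (%p. sup_h (fst p) * (2 * C (snd p)))"
  proof (rule Fubini_integrable)
   have [measurable]: "C \<in> borel_measurable N" using C by simp
   have [measurable]: "sup_h \<in> borel_measurable ?CS" by simp
   show "(%p. sup_h (fst p) * (2 * C (snd p))) \<in> borel_measurable (?CS \<otimes> N)" by measurable
   show "integrable ?CS (%x. LINT y|N. norm (sup_h (fst (x, y)) * (2 * C (snd (x, y)))))" using integrable_sup_h by (simp add: abs_mult sup_h_nonneg)
   show "AE x in ?CS. integrable N (%y. sup_h (fst (x, y)) * (2 * C (snd (x, y))))" using C by simp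
  qed
 qed
 moreover have Fi: "AE eta in mu. integrable N (%s. F s eta)" by (rule minkowski(1)[OF N m.sigma_finite_measure_axioms Fmu FC C])
 moreover have "AE eta in mu. ALL y. integrable N (%s. F s (translate y eta))"
  unfolding AE_all_countable using AE_translate[OF Fi] by blast
 ultimately show ?thesis
 proof eventually_elim
  case (elim eta)
  have "jump_op h (%eta. LINT s|N. F s eta) eta = LINT y|?CS. LINT s|N. F' (y, s) eta"
   unfolding jump_op_eq F'_def using elim by simp
  also have "... = LINT s|N. LINT y|?CS. F' (y, s) eta" using elim(1) by (intro Fubini_integral[symmetric]) (simp add: case_prod_beta')
  also have "... = LINT s|N. jump_op h (F s) eta" by (simp add: jump_op_eq F'_def)
  finally show ?case .
 qed
qed

end

section \<open>Markov semigroups on square-integrable functions\<close>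

context feller
begin

lemma invariant_AE_L2_law:
 assumes nu: "distribution nu" and inv: "invariant P nu" and t: "t >= 0" and f: "f \<in> L2 nu"
 shows "AE x in nu. f \<in> L2 (law t x)"
  and "nn_integral nu (%x. ennreal ((S t f x)^2)) <= nn_integral nu (%x. ennreal ((f x)^2))"
proof -
 note [simp] = distributionD(4)[OF nu]
 have fm [measurable]: "borel_fun f" using L2_measurable[OF f] by simp
 have eq: "nn_integral nu (%x. nn_integral (law t x) (%y. ennreal ((f y)^2))) = nn_integral nu (%x. ennreal ((f x)^2))"
  using nn_integral_dist_at[OF nu, of "%y. ennreal ((f y)^2)" t] inv t by (simp add: invariant_def)
 also have "... < \<infinity>" using L2_integrable_square[OF f] by (simp add: integrable_iff_bounded)
 finally have fin: "(nn_integral nu (%x. nn_integral (law t x) (%y. ennreal ((f y)^2)))) ~= \<infinity>" by simp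
 have [measurable]: "borel_fun (%x. nn_integral (law t x) (%y. ennreal ((f y)^2)))" by (rule measurable_compose[OF law_kernel nn_integral_measurable_subprob_algebra]) measurable
 have "AE x in nu. (nn_integral (law t x) (%y. ennreal ((f y)^2))) ~= \<infinity>" by (rule nn_integral_noteq_infinite[OF _ fin]) simp
 thus L: "AE x in nu. f \<in> L2 (law t x)" by eventually_elim (auto simp: L2_def less_top intro!: integrableI_bounded)
 have "nn_integral nu (%x. ennreal ((S t f x)^2)) <= nn_integral nu (%x. nn_integral (law t x) (%y. ennreal ((f y)^2)))"
 proof (rule nn_integral_mono_AE)
  show "AE x in nu. ennreal ((S t f x)^2) <= nn_integral (law t x) (%y. ennreal ((f y)^2))" using L
  proof eventually_elim
   case (elim x)
   have "abs (S t f x) <= L2_norm (law t x) f"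
    unfolding S_eq_law[OF fm] by (rule prob_space.L2_integral_le[OF prob_space_law elim])
   hence "(abs (S t f x))\<^sup>2 <= (L2_norm (law t x) f)^2" by (intro power_mono) auto
   hence "(S t f x)^2 <= LINT y|law t x. (f y)^2" by (simp add: L2_norm_square)
   hence "ennreal ((S t f x)^2) <= ennreal (LINT y|law t x. (f y)^2)" by (rule ennreal_leI)
   also have "... = nn_integral (law t x) (%y. ennreal ((f y)^2))" using L2_integrable_square[OF elim] by (intro nn_integral_eq_integral[symmetric]) auto
   finally show ?case .
  qed
 qed
 thus "nn_integral nu (%x. ennreal ((S t f x)^2)) <= nn_integral nu (%x. ennreal ((f x)^2))" using eq by simp
qed

lemma S_L2:
 assumes nu: "distribution nu" and inv: "invariant P nu" and t: "t >= 0" and f: "f \<in> L2 nu"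
 shows "S t f \<in> L2 nu" "L2_norm nu (S t f) <= L2_norm nu f"
proof -
 note [simp] = distributionD(4)[OF nu]
 have fm [measurable]: "borel_fun f" using L2_measurable[OF f] by simp
 note le = invariant_AE_L2_law(2)[OF assms]
 have f2: "nn_integral nu (%x. ennreal ((f x)^2)) = ennreal (LINT x|nu. (f x)^2)" using L2_integrable_square[OF f] by (intro nn_integral_eq_integral) auto
 have int: "integrable nu (%x. (S t f x)^2)" by (rule integrableI_bounded) (use le f2 in "auto intro: order.strict_trans1")
 thus "S t f \<in> L2 nu" by (simp add: L2_def)
 have "nn_integral nu (%x. ennreal ((S t f x)^2)) = ennreal (LINT x|nu. (S t f x)^2)" using int by (intro nn_integral_eq_integral) auto
 thus "L2_norm nu (S t f) <= L2_norm nu f" using le f2 by (simp add: L2_norm_def ennreal_le_iff)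
qed

lemma S_diff_AE:
 assumes nu: "distribution nu" and inv: "invariant P nu" and t: "t >= 0" and f: "f \<in> L2 nu" and g: "g \<in> L2 nu"
 shows "AE x in nu. S t (%x. f x - g x) x = S t f x - S t g x"
proof -
 note [simp] = distributionD(4)[OF nu]
 have fm [measurable]: "borel_fun f" "borel_fun g" using L2_measurable[OF f] L2_measurable[OF g] by simp_all
 show ?thesis using invariant_AE_L2_law(1)[OF nu inv t f] invariant_AE_L2_law(1)[OF nu inv t g]
 proof eventually_elim
  case (elim x)
  have "integrable (law t x) f" "integrable (law t x) g" using elim by (auto intro: prob_space.L2_integrable)
  note 1 = Bochner_Integration.integral_diff[OF this]
  show ?case by (subst (1 2 3) S_eq_law) (measurable, rule 1)
 qed
qed

end

section \<open>The perturbation series\<close>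

locale dyson_series = L2_jump h mu
 for h :: "('d::finite) lattice => ('s::polish_space, 'd) config => real" and mu +
 fixes Q :: "('s, 'd) config => (real => ('s, 'd) config) measure" and gamma :: real
 assumes feller_Q: "feller_process Q" and invariant_Q: "invariant Q mu" and gamma_pos: "gamma > 0"
  and gap_continuous: "!!f t. continuous_on UNIV f ==> t >= 0 ==>
   centered_norm mu (markov_semigroup Q t f) <= exp (- gamma * t) * centered_norm mu f"
begin

sublocale Q: feller Q by standard (use feller_Q compact_config[OF compact_S] in auto)

lemma borel_L2: "f \<in> L2 mu ==> borel_fun f" using L2_measurable[of f mu] by simp

lemma gap:
 assumes f: "f \<in> L2 mu" and t: "t >= 0"
 shows "centered_norm mu (Q.S t f) <= exp (- gamma * t) * centered_norm mu f"
proof (rule field_le_epsilon)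
 fix e :: real assume e: "e > 0"
 obtain f' g where f': "C_generator Q f' g" "f' \<in> L2 mu" "L2_norm mu (%x. f x - f' x) <= e / 2" using Q.L2_dense_generator[OF distr_mu f, of "e / 2"] e by auto
 note SL = Q.S_L2[OF distr_mu invariant_Q t]
 have [measurable]: "borel_fun f" "borel_fun f'" using f f'(2) by (auto intro: borel_L2)
 have "centered_norm mu (Q.S t f) <= centered_norm mu (Q.S t f') + L2_norm mu (%x. Q.S t f x - Q.S t f' x)" by (rule m.centered_norm_triangle[OF SL(1)[OF f] SL(1)[OF f'(2)]])
 also have "L2_norm mu (%x. Q.S t f x - Q.S t f' x) = L2_norm mu (Q.S t (%x. f x - f' x))"
  using Q.S_diff_AE[OF distr_mu invariant_Q t f f'(2)] by (intro L2_norm_cong_AE) (simp_all add: eq_commute)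
 also have "... <= e / 2" using SL(2)[OF L2_diff[OF f f'(2)]] f'(3) by linarith
 also have "centered_norm mu (Q.S t f') <= exp (- gamma * t) * centered_norm mu f'" by (rule gap_continuous[OF Q.C_generator_continuous(1)[OF f'(1)] t])
 also have "centered_norm mu f' <= centered_norm mu f + e / 2" using m.centered_norm_triangle[OF f'(2) f] f'(3) by (subst (asm) (2) L2_norm_uminus) linarith
 finally have "centered_norm mu (Q.S t f) <= exp (- gamma * t) * (centered_norm mu f + e / 2) + e / 2" by simp
 also have "... <= exp (- gamma * t) * centered_norm mu f + e"
 proof -
  have "exp (- gamma * t) * (e / 2) <= 1 * (e / 2)" using e t gamma_pos by (intro mult_right_mono) auto
  thus ?thesis by (simp add: distrib_left)
 qed
 finally show "centered_norm mu (Q.S t f) <= exp (- gamma * t) * centered_norm mu f + e" .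
qed

lemma jump_S_bound:
 assumes f: "f \<in> L2 mu" and t: "t >= 0"
 shows "jump_op h (Q.S t f) \<in> L2 mu" "L2_norm mu (jump_op h (Q.S t f)) <= eps * (exp (- gamma * t) * centered_norm mu f)"
proof -
 note S = Q.S_L2(1)[OF distr_mu invariant_Q t f]
 show "jump_op h (Q.S t f) \<in> L2 mu" by (rule jump_op_L2(2)[OF S])
 have "L2_norm mu (jump_op h (Q.S t f)) <= eps * centered_norm mu (Q.S t f)" by (rule jump_op_le_centered[OF S])
 also have "... <= eps * (exp (- gamma * t) * centered_norm mu f)" by (rule mult_left_mono[OF gap[OF f t] eps_nonneg])
 finally show "L2_norm mu (jump_op h (Q.S t f)) <= eps * (exp (- gamma * t) * centered_norm mu f)" .
qed

lemma dyson_step_measurable: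
 fixes F :: "real => ('s, 'd) config => real"
 assumes F [measurable]: "(%(s, eta). F s eta) \<in> borel_measurable (borel \<otimes> borel)"
  and u [measurable]: "u \<in> borel_measurable N" and s [measurable]: "s \<in> borel_measurable N"
  and g [measurable]: "g \<in> N \<leadsto> borel"
 shows "(%p. Q.S (u p) (jump_op h (F (s p))) (g p)) \<in> borel_measurable N"
proof (rule Q.S_measurable)
 have "(%p. jump_op h (%eta. F (s (fst p)) eta) (snd p)) \<in> borel_measurable (N \<otimes> borel)"
 proof (rule jump_op_measurable)
  have "(%q. (s (fst (fst q)), snd q)) \<in> (N \<otimes> borel) \<otimes> borel \<leadsto> borel \<otimes> (borel :: ('s, 'd) config measure)" by measurable
  from measurable_compose[OF this F]
  show "(%(x, eta). F (s (fst x)) eta) \<in> borel_measurable ((N \<otimes> (borel :: ('s, 'd) config measure)) \<otimes> borel)" by (simp add: case_prod_beta')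
 qed measurable
 thus "(%(p, eta). jump_op h (F (s p)) eta) \<in> borel_measurable (N \<otimes> borel)" by (simp add: case_prod_beta')
qed measurable

lemma dyson_measurable:
 fixes f :: "('s, 'd) config => real"
 assumes f [measurable]: "borel_fun f"
 shows "(%(s, eta). dyson Q h n s f eta) \<in> borel_measurable (borel \<otimes> borel)"
proof (induction n)
 case 0
 have "(%p. Q.S (fst p) ((%_. f) p) (snd p)) \<in> borel_measurable (borel \<otimes> borel)" by (rule Q.S_measurable) measurable
 thus ?case by (simp add: case_prod_beta')
next
 case (Suc n)
 have "(%q. Q.S (fst (fst q) - snd q) (jump_op h ((%s eta. dyson Q h n s f eta) (snd q))) (snd (fst q)))
  \<in> borel_measurable ((borel \<otimes> borel) \<otimes> borel)" by (rule dyson_step_measurable[OF Suc]) measurable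
 hence *: "(%q. Q.S (fst (fst q) - snd q) (jump_op h (dyson Q h n (snd q) f)) (snd (fst q)))
  \<in> borel_measurable ((borel \<otimes> borel) \<otimes> borel)" by simp
 note [measurable] = *
 have "(%(p, s). indicator {0..fst p} s *\<^sub>R Q.S (fst p - s) (jump_op h (dyson Q h n s f)) (snd p))
  = (%q. if 0 <= snd q & snd q <= fst (fst q) then Q.S (fst (fst q) - snd q) (jump_op h (dyson Q h n (snd q) f)) (snd (fst q)) else 0)" by (auto simp: fun_eq_iff indicator_def)
 also have "... \<in> borel_measurable ((borel \<otimes> borel) \<otimes> lborel)" by measurable
 finally have "(%p. LINT s|lborel. indicator {0..fst p} s *\<^sub>R Q.S (fst p - s) (jump_op h (dyson Q h n s f)) (snd p))
  \<in> borel_measurable (borel \<otimes> borel)" by (rule lborel.borel_measurable_lebesgue_integral)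
 thus ?case by (simp add: set_lebesgue_integral_def case_prod_beta')
qed

lemma jump_dyson_measurable:
 fixes f :: "('s, 'd) config => real"
 assumes f: "borel_fun f"
 shows "(%(s, eta). jump_op h (dyson Q h n s f) eta) \<in> borel_measurable (borel \<otimes> borel)"
proof -
 have "(%p. jump_op h ((%q eta. dyson Q h n (fst q) f eta) p) (snd p)) \<in> borel_measurable (borel \<otimes> borel)"
 proof (rule jump_op_measurable)
  have "(%q. (fst (fst q), snd q)) \<in> (borel \<otimes> borel) \<otimes> borel \<leadsto> (borel :: real measure) \<otimes> (borel :: ('s, 'd) config measure)"
   by measurable
  from measurable_compose[OF this dyson_measurable[OF f, of n]]
  show "(%(x, eta). dyson Q h n (fst x) f eta) \<in> borel_measurable ((borel \<otimes> (borel :: ('s, 'd) config measure)) \<otimes> borel)" by (simp add: case_prod_beta')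
 qed measurable
 thus ?thesis by (simp add: case_prod_beta')
qed

text \<open>
The weight of the \<open>n\<close>-th term: the density at \<open>s\<close> of the sum of \<open>n + 1\<close> exponential waiting times of rate \<open>\<gamma>\<close>, times
\<open>(\<epsilon>/\<gamma>)\<^sup>n\<^sup>+\<^sup>1\<close>. Convolution with the weight of order \<open>0\<close> raises the order by one.
\<close>

definition dyson_bound :: "nat => real => real" where
 "dyson_bound n s = eps ^ (n + 1) * exp (- gamma * s) * s ^ n / fact n"

lemma dyson_bound_nonneg: "s >= 0 ==> 0 <= dyson_bound n s" by (simp add: dyson_bound_def eps_nonneg)

lemma dyson_bound_convolution:
 assumes t: "t >= 0"
 shows "integrable lborel (%s. indicator {0..t} s * (eps * exp (- gamma * (t - s)) * (dyson_bound n s * c)))"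
  and "LINT s|lborel. indicator {0..t} s * (eps * exp (- gamma * (t - s)) * (dyson_bound n s * c)) = dyson_bound (Suc n) t * c"
proof -
 have e: "indicator {0..t} s * (eps * exp (- gamma * (t - s)) * (dyson_bound n s * c))
  = (eps ^ (n + 2) * exp (- gamma * t) * c / fact n) * (s ^ n * indicator {0..t} s)" for s
  unfolding dyson_bound_def by (simp add: mult_exp_exp algebra_simps flip: exp_add)
 have b: "has_bochner_integral lborel (%x. x ^ n * indicator {0..t} x) ((t ^ Suc n - 0 ^ Suc n) / Suc n)"
 proof -
  have "set_integrable lborel {0..t} (%x. x ^ n)" by (intro borel_integrable_atLeastAtMost' continuous_intros)
  hence "integrable lborel (%x. x ^ n * indicator {0..t} x)" by (simp add: set_integrable_def mult.commute)
  thus ?thesis using integral_power[OF t, of n] by (simp add: has_bochner_integral_iff)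
 qed
 show "integrable lborel (%s. indicator {0..t} s * (eps * exp (- gamma * (t - s)) * (dyson_bound n s * c)))"
  unfolding e using b by (auto simp: has_bochner_integral_iff)
 have "LINT s|lborel. indicator {0..t} s * (eps * exp (- gamma * (t - s)) * (dyson_bound n s * c))
  = (eps ^ (n + 2) * exp (- gamma * t) * c / fact n) * ((t ^ Suc n - 0 ^ Suc n) / Suc n)"
  unfolding e using b by (simp add: has_bochner_integral_iff)
 also have "... = dyson_bound (Suc n) t * c" by (simp add: dyson_bound_def del: of_nat_Suc) (simp add: mult_ac)
 finally show "LINT s|lborel. indicator {0..t} s * (eps * exp (- gamma * (t - s)) * (dyson_bound n s * c)) = dyson_bound (Suc n) t * c" .
qed

lemma dyson_bound_integral:
 shows "set_integrable lborel {0..} (%s. dyson_bound n s * c)"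
  and "(LINT s:{0..}|lborel. dyson_bound n s * c) = (eps / gamma) ^ (n + 1) * c"
proof -
 have e: "indicator {0..} s *\<^sub>R (dyson_bound n s * c) = (eps / gamma) ^ (n + 1) * c * erlang_density n gamma s" for s
  using gamma_pos by (auto simp: dyson_bound_def erlang_density_def indicator_def power_divide field_simps)
 have nn: "nn_integral lborel (%s. ennreal (erlang_density n gamma s)) = 1"
  using prob_space.emeasure_space_1[OF prob_space_erlang_density[OF gamma_pos, of n]] by (simp add: emeasure_density)
 have nonneg: "0 <= erlang_density n gamma s" for s using gamma_pos by simp
 have i: "integrable lborel (erlang_density n gamma)" by (rule integrableI_nonneg) (use nn nonneg in auto)
 have v: "LINT s|lborel. erlang_density n gamma s = 1" using nn nonneg by (subst integral_eq_nn_integral) auto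
 show "set_integrable lborel {0..} (%s. dyson_bound n s * c)"
  unfolding set_integrable_def e using i by simp
 show "(LINT s:{0..}|lborel. dyson_bound n s * c) = (eps / gamma) ^ (n + 1) * c"
  unfolding set_lebesgue_integral_def e using v by simp
qed

text \<open>
The recursive definition of the series is pointwise; this is where the pointwise time integral is shown to be the integral in \<open>L\<^sup>2(\<mu>)\<close>.
\<close>

lemma dyson_step:
 assumes f: "f \<in> L2 mu" and t: "t >= 0"
  and IH: "!!s. s >= 0 ==> jump_op h (dyson Q h n s f) \<in> L2 mu &
   L2_norm mu (jump_op h (dyson Q h n s f)) <= dyson_bound n s * V"
 shows "dyson Q h (Suc n) t f \<in> L2 mu"
  and "L2_norm mu (jump_op h (dyson Q h (Suc n) t f)) <= dyson_bound (Suc n) t * V"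
  and "AE eta in mu. jump_op h (dyson Q h (Suc n) t f) eta
   = LINT s|lborel. indicator {0..t} s * jump_op h (Q.S (t - s) (jump_op h (dyson Q h n s f))) eta"
proof -
 define G where "G s = jump_op h (dyson Q h n s f)" for s
 define H where "H s eta = indicator {0..t} s * Q.S (t - s) (G s) eta" for s eta
 have G: "G s \<in> L2 mu" "L2_norm mu (G s) <= dyson_bound n s * V" if "s >= 0" for s using IH[OF that] by (auto simp: G_def)
 have dH: "dyson Q h (Suc n) t f = (%eta. LINT s|lborel. H s eta)" by (simp add: H_def G_def set_lebesgue_integral_def)
 have JH: "jump_op h (H s) = (%eta. indicator {0..t} s * jump_op h (Q.S (t - s) (G s)) eta)" for s
  unfolding H_def by (simp only: fun_eq_iff jump_op_cmult) simp
 define C where "C s = indicator {0..t} s * (eps * exp (- gamma * (t - s)) * (dyson_bound n s * V))" for s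
 have SG: "(%p. Q.S (t - fst p) (jump_op h ((%s eta. dyson Q h n s f eta) (fst p))) (snd p)) \<in> borel_measurable (borel \<otimes> borel)"
  by (rule dyson_step_measurable[OF dyson_measurable[OF borel_L2[OF f]]]) measurable
 hence Hm: "(%(s, eta). H s eta) \<in> borel_measurable (lborel \<otimes> borel)"
  unfolding H_def G_def by (simp add: case_prod_beta')
 have sets: "sets (lborel \<otimes> mu) = sets (lborel \<otimes> borel)" by (intro sets_pair_measure_cong refl) (simp add: distributionD[OF distr_mu])
 have Hmmu: "(%(s, eta). H s eta) \<in> borel_measurable (lborel \<otimes> mu)" using Hm measurable_cong_sets[OF sets refl] by blast
 have JHm: "(%(s, eta). jump_op h (H s) eta) \<in> borel_measurable (lborel \<otimes> mu)"
 proof -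
  have "(%p. jump_op h ((%q eta. H (fst q) eta) p) (snd p)) \<in> borel_measurable (lborel \<otimes> borel)"
  proof (rule jump_op_measurable)
   have "(%q. (fst (fst q), snd q)) \<in> (lborel \<otimes> borel) \<otimes> borel \<leadsto> (lborel :: real measure) \<otimes> (borel :: ('s, 'd) config measure)"
    by measurable
   from measurable_compose[OF this Hm]
   show "(%(x, eta). H (fst x) eta) \<in> borel_measurable ((lborel \<otimes> (borel :: ('s, 'd) config measure)) \<otimes> borel)" by (simp add: case_prod_beta')
  qed measurable
  hence "(%(s, eta). jump_op h (H s) eta) \<in> borel_measurable (lborel \<otimes> borel)" by (simp add: case_prod_beta')
  thus ?thesis using measurable_cong_sets[OF sets refl] by blast
 qed
 define B where "B s = indicator {0..t} s * (dyson_bound n s * V)" for s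
 have Bi: "integrable lborel B"
 proof -
  have "set_integrable lborel {0..t} (%s. dyson_bound n s * V)" by (rule set_integrable_subset[OF dyson_bound_integral(1)]) auto
  thus ?thesis by (simp add: set_integrable_def B_def[abs_def])
 qed
 have HL: "H s \<in> L2 mu & L2_norm mu (H s) <= B s" for s
 proof (cases "s \<in> {0..t}")
  case True
  hence "H s = Q.S (t - s) (G s)" "B s = dyson_bound n s * V" by (auto simp: H_def B_def)
  thus ?thesis using True Q.S_L2[OF distr_mu invariant_Q _ G(1)[of s], of "t - s"] G(2)[of s] by auto
 next
  case False
  hence "H s = (%_. 0)" "B s = 0" by (auto simp: H_def B_def)
  thus ?thesis using L2_const[OF m.finite_measure_axioms, of 0] by (simp add: m.L2_norm_const)
 qed
 have JHL: "jump_op h (H s) \<in> L2 mu & L2_norm mu (jump_op h (H s)) <= C s" for s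
 proof (cases "s \<in> {0..t}")
  case True
  hence JHs: "jump_op h (H s) = jump_op h (Q.S (t - s) (G s))" by (simp add: JH)
  have ts: "0 <= t - s" "0 <= s" using True by auto
  have "L2_norm mu (jump_op h (Q.S (t - s) (G s))) <= eps * (exp (- gamma * (t - s)) * centered_norm mu (G s))" by (rule jump_S_bound(2)[OF G(1)[OF ts(2)] ts(1)])
  also have "... <= eps * (exp (- gamma * (t - s)) * (dyson_bound n s * V))" using m.centered_norm_le[OF G(1)[OF ts(2)]] G(2)[OF ts(2)] by (intro mult_left_mono eps_nonneg) auto
  also have "... = C s" using True by (simp add: C_def mult.assoc)
  finally show ?thesis using jump_S_bound(1)[OF G(1)[OF ts(2)] ts(1)] by (simp add: JHs)
 next
  case False
  hence "jump_op h (H s) = (%_. 0)" "C s = 0" by (auto simp: JH C_def)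
  thus ?thesis using L2_const[OF m.finite_measure_axioms, of 0] by (simp add: m.L2_norm_const)
 qed
 have Ci: "integrable lborel C" and Cv: "LINT s|lborel. C s = dyson_bound (Suc n) t * V"
  unfolding C_def using dyson_bound_convolution[OF t, of n V] by auto
 have D: "dyson Q h (Suc n) t f \<in> L2 mu"
  unfolding dH by (rule minkowski(2)[OF lborel.sigma_finite_measure_axioms m.sigma_finite_measure_axioms Hmmu HL Bi])
 have AE: "AE eta in mu. jump_op h (%eta. LINT s|lborel. H s eta) eta = LINT s|lborel. jump_op h (H s) eta" by (rule jump_op_integral_AE[OF lborel.sigma_finite_measure_axioms Hm HL Bi])
 thus "AE eta in mu. jump_op h (dyson Q h (Suc n) t f) eta
   = LINT s|lborel. indicator {0..t} s * jump_op h (Q.S (t - s) (jump_op h (dyson Q h n s f))) eta"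
  unfolding dH JH G_def .
 show "dyson Q h (Suc n) t f \<in> L2 mu" by (rule D)
 note mk = minkowski[OF lborel.sigma_finite_measure_axioms m.sigma_finite_measure_axioms JHm JHL Ci]
 have "L2_norm mu (jump_op h (dyson Q h (Suc n) t f)) = L2_norm mu (%eta. LINT s|lborel. jump_op h (H s) eta)"
  unfolding dH using AE by (intro L2_norm_cong_AE L2_measurable[OF mk(2)] L2_measurable[OF jump_op_L2(2)] D[unfolded dH])
 also have "... <= dyson_bound (Suc n) t * V" using mk(3) Cv by simp
 finally show "L2_norm mu (jump_op h (dyson Q h (Suc n) t f)) <= dyson_bound (Suc n) t * V" .
qed

lemma dyson_L2:
 assumes f: "f \<in> L2 mu" and s: "s >= 0"
 shows "dyson Q h n s f \<in> L2 mu & jump_op h (dyson Q h n s f) \<in> L2 mu &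
  L2_norm mu (jump_op h (dyson Q h n s f)) <= dyson_bound n s * centered_norm mu f" using s
proof (induction n arbitrary: s)
 case 0
 have "dyson_bound 0 s = eps * exp (- gamma * s)" by (simp add: dyson_bound_def)
 thus ?case using Q.S_L2(1)[OF distr_mu invariant_Q 0 f] jump_S_bound[OF f 0] by (simp add: mult.assoc)
next
 case (Suc n t)
 show ?case using dyson_step[OF f Suc.prems, of n "centered_norm mu f"] Suc.IH jump_op_L2(2) by blast
qed

lemma jump_dyson_Suc_AE:
 assumes f: "f \<in> L2 mu" and t: "t >= 0"
 shows "AE eta in mu. jump_op h (dyson Q h (Suc n) t f) eta
  = LINT s|lborel. indicator {0..t} s * jump_op h (Q.S (t - s) (jump_op h (dyson Q h n s f))) eta" using dyson_step(3)[OF f t] dyson_L2[OF f] by blast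

end

locale dyson_stationary = dyson_series h mu Q gamma
 for h :: "('d::finite) lattice => ('s::polish_space, 'd) config => real" and mu Q gamma +
 fixes mue :: "('s, 'd) config measure" and K :: real
 assumes distr_mue: "distribution mue" and ac: "absolutely_continuous mu mue" and eps_less: "eps < gamma"
  and integrable_mue: "!!f. f \<in> L2 mu ==> integrable mue f"
  and L1_bound: "!!f. f \<in> L2 mu ==> (LINT x|mue. abs (f x)) <= K * L2_norm mu f"
  and stationarity: "!!f g. C_generator Q f g ==> (LINT x|mue. g x) = - (LINT x|mue. jump_op h f x)"
begin

sublocale me: prob_space mue by (rule distributionD[OF distr_mue])

lemmas mue_measurable [simp] = distributionD(4)[OF distr_mue]

lemma AE_transfer: "AE x in mu. R x ==> AE x in mue. R x" using absolutely_continuous_AE[OF _ ac] distributionD(2)[OF distr_mu] distributionD(2)[OF distr_mue] by metis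

lemma abs_integral_mue:
 assumes "f \<in> L2 mu"
 shows "abs (LINT x|mue. f x) <= K * L2_norm mu f" using integral_abs_bound[of mue f] L1_bound[OF assms] by linarith

lemma K_nonneg: "0 <= K"
proof -
 have "abs (LINT x|mue. 0) <= LINT x|mue. abs (1::real)" by simp
 also have "... <= K * L2_norm mu (%_. 1)" using L1_bound[OF L2_const[OF m.finite_measure_axioms, of 1]] by simp
 also have "... = K" by (simp add: m.L2_norm_const)
 finally show ?thesis by simp
qed

lemma jump_S_mean_bound:
 assumes f: "f \<in> L2 mu" and s: "s >= 0"
 shows "abs (LINT eta|mue. jump_op h (Q.S s f) eta) <= K * (dyson_bound 0 s * centered_norm mu f)"
proof -
 have "abs (LINT eta|mue. jump_op h (Q.S s f) eta) <= K * L2_norm mu (jump_op h (Q.S s f))" by (rule abs_integral_mue[OF jump_S_bound(1)[OF f s]])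
 also have "... <= K * (dyson_bound 0 s * centered_norm mu f)" using jump_S_bound(2)[OF f s] K_nonneg by (intro mult_left_mono) (auto simp: dyson_bound_def mult.assoc)
 finally show ?thesis .
qed

lemma mean_measurable:
 assumes "(%(s, eta). F s eta) \<in> borel_measurable (N \<otimes> borel)" "distribution nu"
 shows "(%s. LINT eta|nu. (F s eta :: real)) \<in> borel_measurable N"
proof -
 interpret nu: prob_space nu by (rule distributionD[OF assms(2)])
 have "sets (N \<otimes> nu) = sets (N \<otimes> borel)" by (intro sets_pair_measure_cong refl distributionD[OF assms(2)])
 hence "(%(s, eta). F s eta) \<in> borel_measurable (N \<otimes> nu)" using assms(1) measurable_cong_sets by blast
 thus ?thesis by (rule nu.borel_measurable_lebesgue_integral)
qed

lemma set_integrable_mean: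
 assumes a [measurable]: "borel_fun a"
  and b: "!!s. s >= 0 ==> abs (a s) <= c * (dyson_bound n s * V)"
 shows "set_integrable lborel {0..} a"
  and "(LINT s:{0..}|lborel. abs (a s)) <= c * ((eps / gamma) ^ (n + 1) * V)"
proof -
 have bi: "integrable lborel (%s. indicator {0..} s *\<^sub>R (c * (dyson_bound n s * V)))" using dyson_bound_integral(1)[of n V] by (simp add: set_integrable_def mult.left_commute)
 have le: "norm (indicator {0..} s *\<^sub>R a s) <= indicator {0..} s *\<^sub>R (c * (dyson_bound n s * V))" for s using b[of s] by (auto simp: indicator_def)
 show i: "set_integrable lborel {0..} a"
  unfolding set_integrable_def
 proof (rule integrable_dominated[OF bi])
  show "AE s in lborel. norm (indicator {0..} s *\<^sub>R a s) <= norm (indicator {0..} s *\<^sub>R (c * (dyson_bound n s * V)))"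
   using le by (intro AE_I2) (metis abs_ge_self order.trans real_norm_def)
 qed simp
 have "(LINT s:{0..}|lborel. abs (a s)) <= (LINT s:{0..}|lborel. c * (dyson_bound n s * V))"
  unfolding set_lebesgue_integral_def
 proof (rule integral_mono[OF _ bi])
  show "integrable lborel (%s. indicator {0..} s *\<^sub>R (abs (a s)))"
   using i integrable_abs[of lborel "%s. indicator {0..} s *\<^sub>R a s"] by (simp add: set_integrable_def abs_mult)
  show "indicator {0..} s *\<^sub>R (abs (a s)) <= indicator {0..} s *\<^sub>R (c * (dyson_bound n s * V))" for s using le[of s] by (simp add: abs_mult)
 qed
 also have "... = c * ((eps / gamma) ^ (n + 1) * V)" using dyson_bound_integral(2)[of n V] by simp
 finally show "(LINT s:{0..}|lborel. abs (a s)) <= c * ((eps / gamma) ^ (n + 1) * V)" .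
qed

lemma abs_LINT_le:
 fixes a :: "real => real"
 shows "abs (LINT s:{0..}|lborel. a s) <= (LINT s:{0..}|lborel. abs (a s))"
 unfolding set_lebesgue_integral_def using integral_abs_bound[of lborel "%s. indicator {0..} s *\<^sub>R a s"] by (simp add: abs_mult)

text \<open>
Invariance of \<open>\<mu>\<^sub>\<epsilon>\<close> under the perturbed generator turns the derivative of \<open>\<mu>\<^sub>\<epsilon>(S(t) f)\<close> into \<open>- \<mu>\<^sub>\<epsilon>(J S(t) f)\<close>,
while \<open>\<mu>\<^sub>\<epsilon>(S(t) f)\<close> tends to \<open>\<mu>(f)\<close>.
\<close>

lemma duhamel_generator:
 assumes g: "C_generator Q f g"
 shows "LINT x|mue. f x = (LINT x|mu. f x) + (LINT s:{0..}|lborel. LINT eta|mue. jump_op h (Q.S s f) eta)"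
proof -
 note fc = Q.C_generator_continuous(1)[OF g] and gc = Q.C_generator_continuous(2)[OF g]
 have fm [measurable]: "borel_fun f" by (rule Q.continuous_measurable[OF fc])
 obtain B where B: "!!x. abs (f x) <= B" using Q.continuous_bounded[OF fc] by blast
 have fL: "f \<in> L2 mu" by (rule m.L2_bounded(1)[OF _ B]) simp
 define a where "a s = LINT eta|mue. jump_op h (Q.S s f) eta" for s
 define mm where "mm t = LINT x|mue. Q.S t f x" for t
 have am: "borel_fun a"
  unfolding a_def using mean_measurable[OF jump_dyson_measurable[OF fm, of 0] distr_mue] by simp
 have ai: "set_integrable lborel {0..} a" by (rule set_integrable_mean(1)[OF am]) (use jump_S_mean_bound[OF fL] in "simp add: a_def")
 have a_eq: "a s = - (LINT x|mue. Q.S s g x)" if "s >= 0" for s using stationarity[OF Q.C_generator_S[OF g that]] by (simp add: a_def)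
 have m0: "mm 0 = LINT x|mue. f x" by (simp add: mm_def Q.S_zero_time)
 have ftc: "LINT s|lborel. indicator {..T} s *\<^sub>R (indicator {0..} s *\<^sub>R a s) = mm 0 - mm T" if T: "T >= 0" for T
 proof -
  have "LINT s|lborel. indicator {0..T} s *\<^sub>R (LINT x|mue. Q.S s g x) = mm T - mm 0"
  proof (rule integral_FTC_Icc[OF T])
   fix s assume s: "0 <= s" "s <= T"
   have "(mm has_real_derivative (LINT x|mue. Q.S s g x)) (at s within {0..})"
    unfolding mm_def by (rule Q.derivative_integral_S[OF distr_mue g s(1)])
   hence "(mm has_vector_derivative (LINT x|mue. Q.S s g x)) (at s within {0..})" by (simp add: has_real_derivative_iff_has_vector_derivative)
   thus "(mm has_vector_derivative (LINT x|mue. Q.S s g x)) (at s within {0..T})" by (rule has_vector_derivative_within_subset) auto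
  next
   show "continuous_on {0..T} (%s. LINT x|mue. Q.S s g x)" by (rule continuous_on_subset[OF Q.continuous_integral_S[OF distr_mue gc]]) auto
  qed
  moreover have "LINT s|lborel. indicator {..T} s *\<^sub>R (indicator {0..} s *\<^sub>R a s) = LINT s|lborel. - (indicator {0..T} s *\<^sub>R (LINT x|mue. Q.S s g x))"
   by (intro bochner_cong refl) (auto simp: indicator_def a_eq)
  ultimately show ?thesis by simp
 qed
 have lim1: "((%T. mm 0 - mm T) ---> (LINT s:{0..}|lborel. a s)) at_top"
 proof (rule Lim_transform_eventually)
  show "((%T. LINT s|lborel. indicator {..T} s *\<^sub>R (indicator {0..} s *\<^sub>R a s)) ---> (LINT s:{0..}|lborel. a s)) at_top"
   unfolding set_lebesgue_integral_def by (rule tendsto_integral_at_top) (use ai in "auto simp: set_integrable_def")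
  show "\<forall>\<^sub>F T in at_top. (LINT s|lborel. indicator {..T} s *\<^sub>R (indicator {0..} s *\<^sub>R a s)) = mm 0 - mm T"
   unfolding eventually_at_top_linorder using ftc by blast
 qed
 have b: "abs (mm T - (LINT x|mu. f x)) <= K * (exp (- gamma * T) * centered_norm mu f)" if T: "T >= 0" for T
 proof -
  note SL = Q.S_L2(1)[OF distr_mu invariant_Q T fL]
  have mean: "LINT x|mu. Q.S T f x = LINT x|mu. f x" using Q.integral_dist_at[OF distr_mu fm B, of T] invariant_Q T by (simp add: invariant_def)
  have "mm T - (LINT x|mu. f x) = LINT x|mue. Q.S T f x - (LINT x|mu. Q.S T f x)" using integrable_mue[OF SL] me.prob_space by (simp add: mm_def mean)
  also have "abs (...) <= K * centered_norm mu (Q.S T f)" by (rule abs_integral_mue[OF m.centered_L2[OF SL]])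
  also have "... <= K * (exp (- gamma * T) * centered_norm mu f)" by (rule mult_left_mono[OF gap[OF fL T] K_nonneg])
  finally show ?thesis .
 qed
 have "((%T. mm T - (LINT x|mu. f x)) ---> 0) at_top"
 proof (rule Lim_null_comparison)
  show "\<forall>\<^sub>F T in at_top. norm (mm T - (LINT x|mu. f x)) <= K * (exp (- gamma * T) * centered_norm mu f)"
   unfolding eventually_at_top_linorder using b by auto
  have "filterlim (%t. gamma * t) at_top at_top" using gamma_pos by (intro filterlim_tendsto_pos_mult_at_top[OF tendsto_const]) (auto simp: filterlim_ident)
  hence "((%t. exp (- (gamma * t))) ---> 0) at_top" by (intro filterlim_compose[OF exp_at_bot]) (simp add: filterlim_uminus_at_bot)
  from tendsto_mult_left[OF this, of "K * centered_norm mu f"]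
  show "((%T. K * (exp (- gamma * T) * centered_norm mu f)) ---> 0) at_top" by (simp add: mult_ac)
 qed
 hence "((%T. mm 0 - (mm T - (LINT x|mu. f x)) - (LINT x|mu. f x)) ---> mm 0 - 0 - (LINT x|mu. f x)) at_top" by (intro tendsto_intros)
 hence "((%T. mm 0 - mm T) ---> mm 0 - (LINT x|mu. f x)) at_top" by simp
 from tendsto_unique[OF trivial_limit_at_top_linorder this lim1]
 show ?thesis by (simp add: m0 a_def)
qed

lemma duhamel:
 assumes f: "f \<in> L2 mu"
 shows "LINT x|mue. f x = (LINT x|mu. f x) + (LINT s:{0..}|lborel. LINT eta|mue. jump_op h (Q.S s f) eta)"
proof -
 define Delta where "Delta f = (LINT x|mue. f x) - (LINT x|mu. f x) - (LINT s:{0..}|lborel. LINT eta|mue. jump_op h (Q.S s f) eta)" for f :: "('s, 'd) config => real"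
 have meas: "borel_fun (%s. LINT eta|mue. jump_op h (Q.S s f) eta)" if "f \<in> L2 mu" for f
  using mean_measurable[OF jump_dyson_measurable[OF borel_L2[OF that], of 0] distr_mue] by simp
 have int: "set_integrable lborel {0..} (%s. LINT eta|mue. jump_op h (Q.S s f) eta)" if "f \<in> L2 mu" for f
  by (rule set_integrable_mean(1)[OF meas[OF that] jump_S_mean_bound[OF that]])
 have "abs (Delta f) <= 0"
 proof (rule field_le_epsilon)
  fix e :: real assume e: "e > 0"
  define R where "R = K + 1 + K * (eps / gamma)"
  have R: "R > 0" using K_nonneg eps_nonneg gamma_pos by (simp add: R_def add_nonneg_pos add_pos_nonneg)
  obtain f' g where f': "C_generator Q f' g" "f' \<in> L2 mu" "L2_norm mu (%x. f x - f' x) <= e / R" using Q.L2_dense_generator[OF distr_mu f, of "e / R"] e R by auto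
  define d where "d x = f x - f' x" for x
  have d: "d \<in> L2 mu" unfolding d_def by (rule L2_diff[OF f f'(2)])
  have dn: "L2_norm mu d <= e / R" using f'(3) by (simp add: d_def[abs_def])
  have "Delta f' = 0" using duhamel_generator[OF f'(1)] by (simp add: Delta_def)
  moreover have "Delta f - Delta f' = (LINT x|mue. d x) - (LINT x|mu. d x) - (LINT s:{0..}|lborel. LINT eta|mue. jump_op h (Q.S s d) eta)"
  proof -
   have J: "LINT eta|mue. jump_op h (Q.S s d) eta = (LINT eta|mue. jump_op h (Q.S s f) eta) - (LINT eta|mue. jump_op h (Q.S s f') eta)"
    if s: "s >= 0" for s
   proof -
    note SL = Q.S_L2(1)[OF distr_mu invariant_Q s]
    have "AE eta in mu. Q.S s d eta = Q.S s f eta - Q.S s f' eta"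
     unfolding d_def by (rule Q.S_diff_AE[OF distr_mu invariant_Q s f f'(2)])
    moreover from this have "AE eta in mu. ALL y. Q.S s d (translate y eta) = Q.S s f (translate y eta) - Q.S s f' (translate y eta)"
     unfolding AE_all_countable using AE_translate by blast
    ultimately have "AE eta in mu. jump_op h (Q.S s d) eta = jump_op h (%eta. Q.S s f eta - Q.S s f' eta) eta" by eventually_elim (simp add: jump_op_eq)
    moreover have "AE eta in mu. jump_op h (%eta. Q.S s f eta - Q.S s f' eta) eta = jump_op h (Q.S s f) eta - jump_op h (Q.S s f') eta"
     by (rule jump_op_diff_AE[OF SL[OF f] SL[OF f'(2)]])
    ultimately have "AE eta in mu. jump_op h (Q.S s d) eta = jump_op h (Q.S s f) eta - jump_op h (Q.S s f') eta" by eventually_elim simp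
    hence "AE eta in mue. jump_op h (Q.S s d) eta = jump_op h (Q.S s f) eta - jump_op h (Q.S s f') eta" by (rule AE_transfer)
    moreover have "jump_op h (Q.S s u) \<in> borel_measurable mue" if "u \<in> L2 mu" for u by (rule borel_measurable_integrable[OF integrable_mue[OF jump_op_L2(2)[OF SL[OF that]]]])
    ultimately have "LINT eta|mue. jump_op h (Q.S s d) eta = LINT eta|mue. jump_op h (Q.S s f) eta - jump_op h (Q.S s f') eta" using d f f'(2) by (intro integral_cong_AE) auto
    thus ?thesis using integrable_mue[OF jump_op_L2(2)[OF SL[OF f]]] integrable_mue[OF jump_op_L2(2)[OF SL[OF f'(2)]]] by simp
   qed
   have "(LINT s:{0..}|lborel. LINT eta|mue. jump_op h (Q.S s d) eta)
    = (LINT s:{0..}|lborel. (LINT eta|mue. jump_op h (Q.S s f) eta) - (LINT eta|mue. jump_op h (Q.S s f') eta))" by (rule set_lebesgue_integral_cong) (auto simp: J)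
   also have "... = (LINT s:{0..}|lborel. LINT eta|mue. jump_op h (Q.S s f) eta) - (LINT s:{0..}|lborel. LINT eta|mue. jump_op h (Q.S s f') eta)"
    by (rule set_integral_diff(2)[OF int[OF f] int[OF f'(2)]])
   finally show ?thesis using integrable_mue[OF f] integrable_mue[OF f'(2)] m.L2_integrable[OF f] m.L2_integrable[OF f'(2)] by (simp add: Delta_def d_def)
  qed
  moreover have "abs (LINT s:{0..}|lborel. LINT eta|mue. jump_op h (Q.S s d) eta) <= K * ((eps / gamma) ^ (0 + 1) * centered_norm mu d)"
   using abs_LINT_le set_integrable_mean(2)[OF meas[OF d] jump_S_mean_bound[OF d]] by (rule order.trans)
  moreover have "K * ((eps / gamma) ^ (0 + 1) * centered_norm mu d) <= K * (eps / gamma) * L2_norm mu d"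
   using m.centered_norm_le[OF d] K_nonneg eps_nonneg gamma_pos by (auto simp: mult.assoc intro!: mult_left_mono divide_right_mono)
  ultimately have "abs (Delta f) <= K * L2_norm mu d + L2_norm mu d + K * (eps / gamma) * L2_norm mu d" using abs_integral_mue[OF d] m.L2_integral_le[OF d] by linarith
  also have "... = R * L2_norm mu d" by (simp add: R_def algebra_simps)
  also have "... <= R * (e / R)" using dn R by (intro mult_left_mono) auto
  also have "... = e" using R by simp
  finally show "abs (Delta f) <= 0 + e" by simp
 qed
 thus ?thesis by (simp add: Delta_def)
qed

lemma fubini_mue:
 fixes F :: "'n => ('s, 'd) config => real"
 assumes N: "sigma_finite_measure N" and F: "(%(s, eta). F s eta) \<in> borel_measurable (N \<otimes> borel)"
  and FC: "!!s. s \<in> space N ==> F s \<in> L2 mu & L2_norm mu (F s) <= C s" and C: "integrable N C"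
 shows "LINT eta|mue. LINT s|N. F s eta = LINT s|N. LINT eta|mue. F s eta"
proof -
 interpret pair_sigma_finite N mue by (rule pair_sigma_finite.intro[OF N me.sigma_finite_measure_axioms])
 have "sets (N \<otimes> mue) = sets (N \<otimes> borel)" by (intro sets_pair_measure_cong refl distributionD[OF distr_mue])
 hence Fm [measurable]: "(%(s, eta). F s eta) \<in> borel_measurable (N \<otimes> mue)" using F measurable_cong_sets by blast
 have "integrable (N \<otimes> mue) (%(s, eta). F s eta)"
 proof (rule Fubini_integrable[OF Fm])
  have "integrable N (%s. LINT eta|mue. abs (F s eta))"
  proof (rule integrable_dominated)
   show "integrable N (%s. K * C s)" using C by simp
   have "(%(s, eta). abs (F s eta)) \<in> borel_measurable (N \<otimes> mue)" by measurable
   thus "(%s. LINT eta|mue. abs (F s eta)) \<in> borel_measurable N" by (rule me.borel_measurable_lebesgue_integral)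
   show "AE s in N. norm (LINT eta|mue. abs (F s eta)) <= norm (K * C s)"
   proof (rule AE_I2)
    fix s assume s: "s \<in> space N"
    have "norm (LINT eta|mue. abs (F s eta)) = LINT eta|mue. abs (F s eta)" by simp
    also have "... <= K * L2_norm mu (F s)" using L1_bound FC[OF s] by blast
    also have "... <= K * C s" using FC[OF s] K_nonneg by (intro mult_left_mono) auto
    finally show "norm (LINT eta|mue. abs (F s eta)) <= norm (K * C s)" by simp
   qed
  qed
  thus "integrable N (%x. LINT y|mue. norm (case (x, y) of (s, eta) => F s eta))" by simp
  show "AE x in N. integrable mue (%y. case (x, y) of (s, eta) => F s eta)" using integrable_mue FC by simp
 qed
 from Fubini_integral[OF this] show ?thesis .
qed

definition stationary_term :: "nat => (('s, 'd) config => real) => real" where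
 "stationary_term n f = (LINT s:{0..}|lborel. LINT eta|mue. jump_op h (dyson Q h n s f) eta)"

lemma jump_dyson_mean:
 assumes f: "f \<in> L2 mu"
 shows "borel_fun (%s. LINT eta|mu. jump_op h (dyson Q h n s f) eta)"
  and "borel_fun (%s. LINT eta|mue. jump_op h (dyson Q h n s f) eta)"
  and "s >= 0 ==> abs (LINT eta|mu. jump_op h (dyson Q h n s f) eta) <= 1 * (dyson_bound n s * centered_norm mu f)"
  and "s >= 0 ==> abs (LINT eta|mue. jump_op h (dyson Q h n s f) eta) <= K * (dyson_bound n s * centered_norm mu f)"
proof -
 show "borel_fun (%s. LINT eta|mu. jump_op h (dyson Q h n s f) eta)"
  "borel_fun (%s. LINT eta|mue. jump_op h (dyson Q h n s f) eta)" by (rule mean_measurable[OF jump_dyson_measurable[OF borel_L2[OF f]]], rule distr_mu distr_mue)+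
 assume s: "s >= 0"
 have J: "jump_op h (dyson Q h n s f) \<in> L2 mu"
  "L2_norm mu (jump_op h (dyson Q h n s f)) <= dyson_bound n s * centered_norm mu f" using dyson_L2[OF f s, of n] by auto
 show "abs (LINT eta|mu. jump_op h (dyson Q h n s f) eta) <= 1 * (dyson_bound n s * centered_norm mu f)" using m.L2_integral_le[OF J(1)] J(2) by linarith
 show "abs (LINT eta|mue. jump_op h (dyson Q h n s f) eta) <= K * (dyson_bound n s * centered_norm mu f)" using abs_integral_mue[OF J(1)] mult_left_mono[OF J(2) K_nonneg] by linarith
qed

text \<open>
The Duhamel identity for \<open>J S\<^sup>(\<^sup>n\<^sup>)\<^sub>\<epsilon>(s) f\<close>, integrated over \<open>s\<close>. Substitution \<open>t = s + u\<close> and Fubini on the region \<open>s \<le> t\<close>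
recombine the double integral to the term of order \<open>n + 1\<close>.
\<close>

lemma stationary_term_step:
 assumes f: "f \<in> L2 mu"
 shows "stationary_term n f = (LINT s:{0..}|lborel. LINT eta|mu. jump_op h (dyson Q h n s f) eta) + stationary_term (Suc n) f"
proof -
 define V where "V = centered_norm mu f"
 have V: "0 <= V" by (simp add: V_def)
 define G where "G s = jump_op h (dyson Q h n s f)" for s
 have G: "G s \<in> L2 mu" "L2_norm mu (G s) <= dyson_bound n s * V" if "s >= 0" for s using dyson_L2[OF f that, of n] by (auto simp: G_def V_def)
 define b where "b s u = LINT eta|mue. jump_op h (Q.S u (G s)) eta" for s u
 have b: "abs (b s u) <= K * (dyson_bound 0 u * (dyson_bound n s * V))" if "s >= 0" "u >= 0" for s u
 proof -
  have "abs (b s u) <= K * (dyson_bound 0 u * centered_norm mu (G s))"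
   unfolding b_def by (rule jump_S_mean_bound[OF G(1)[OF that(1)] that(2)])
  also have "... <= K * (dyson_bound 0 u * (dyson_bound n s * V))"
   using m.centered_norm_le[OF G(1)[OF that(1)]] G(2)[OF that(1)] dyson_bound_nonneg[OF that(2), of 0] K_nonneg by (intro mult_left_mono) auto
  finally show ?thesis .
 qed
 have SGm: "(%p. Q.S (snd (fst p) - fst (fst p)) (G (fst (fst p))) (snd p)) \<in> borel_measurable ((borel \<otimes> borel) \<otimes> borel)"
  using dyson_step_measurable[OF dyson_measurable[OF borel_L2[OF f], of n], of "%p. snd (fst p) - fst (fst p)" "(borel \<otimes> borel) \<otimes> borel" "%p. fst (fst p)" snd]
  by (simp add: G_def)
 have JSGm: "(%p. jump_op h (Q.S (snd (fst p) - fst (fst p)) (G (fst (fst p)))) (snd p)) \<in> borel_measurable ((borel \<otimes> borel) \<otimes> borel)"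
 proof -
  have "(%p. jump_op h ((%q eta. Q.S (snd (fst q) - fst (fst q)) (G (fst (fst q))) eta) p) (snd p)) \<in> borel_measurable ((borel \<otimes> borel) \<otimes> borel)"
  proof (rule jump_op_measurable)
   have "(%q. (fst (fst q), snd q)) \<in> ((borel \<otimes> borel) \<otimes> borel) \<otimes> borel \<leadsto> ((borel :: real measure) \<otimes> (borel :: real measure)) \<otimes> (borel :: ('s, 'd) config measure)"
    by measurable
   from measurable_compose[OF this SGm]
   show "(%(x, eta). Q.S (snd (fst x) - fst (fst x)) (G (fst (fst x))) eta)
     \<in> borel_measurable (((borel \<otimes> borel) \<otimes> (borel :: ('s, 'd) config measure)) \<otimes> borel)" by (simp add: case_prod_beta')
  qed measurable
  thus ?thesis by simp
 qed
 \<comment> \<open>The integrand in the coordinates \<open>(s, t) = (s, s + u)\<close>.\<close>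
 define k where "k s t = indicator {0..t} s * b s (t - s)" for s t
 have km: "(%p. k (fst p) (snd p)) \<in> borel_measurable (lborel \<otimes> lborel)"
 proof -
  have [measurable]: "(%p. b (fst p) (snd p - fst p)) \<in> borel_measurable (borel \<otimes> borel)"
   unfolding b_def using mean_measurable[OF _ distr_mue, of "%q eta. jump_op h (Q.S (snd q - fst q) (G (fst q))) eta" "borel \<otimes> borel"] JSGm by (simp add: case_prod_beta')
  have "(%p. k (fst p) (snd p)) = (%p. if 0 <= fst p & fst p <= snd p then b (fst p) (snd p - fst p) else 0)" by (auto simp: k_def indicator_def fun_eq_iff)
  also have "... \<in> borel_measurable (lborel \<otimes> lborel)" by measurable
  finally show ?thesis .
 qed
 define E where "E u = indicator {0..} u * (K * dyson_bound 0 u)" for u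
 have Ei: "integrable lborel E" and Ev: "LINT u|lborel. E u = K * (eps / gamma)"
  using dyson_bound_integral[of 0 K] unfolding E_def set_integrable_def set_lebesgue_integral_def by (auto simp: mult_ac)
 have En: "0 <= E u" for u using K_nonneg dyson_bound_nonneg by (auto simp: E_def indicator_def)
 have Es: "integrable lborel (%t. E (t - s))" and Esv: "LINT t|lborel. E (t - s) = K * (eps / gamma)" for s
  using lborel_integrable_real_affine[OF Ei, of 1 "- s"] lborel_integral_real_affine[of 1 E "- s"] Ev by (simp_all add: add.commute)
 define W where "W s = indicator {0..} s * (dyson_bound n s * V)" for s
 have Wi: "integrable lborel W" using dyson_bound_integral(1)[of n V] by (simp add: W_def[abs_def] set_integrable_def)
 have Wn: "0 <= W s" for s using V dyson_bound_nonneg by (auto simp: W_def indicator_def)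
 have kb: "abs (k s t) <= W s * E (t - s)" for s t using b[of s "t - s"] by (auto simp: k_def W_def E_def indicator_def mult_ac)
 have kt: "integrable lborel (k s)" for s
 proof (rule integrable_dominated)
  show "integrable lborel (%t. W s * E (t - s))" using Es by simp
  show "k s \<in> borel_measurable lborel" using measurable_compose[OF measurable_Pair1' km, of s] by simp
  show "AE t in lborel. norm (k s t) <= norm (W s * E (t - s))" using kb Wn En by (simp add: abs_mult)
 qed
 have kint: "integrable (lborel \<otimes> lborel) (%p. k (fst p) (snd p))"
 proof (rule lborel_pair.Fubini_integrable[OF km])
  show "AE x in lborel. integrable lborel (%y. k (fst (x, y)) (snd (x, y)))" using kt by simp
  show "integrable lborel (%x. LINT y|lborel. norm (k (fst (x, y)) (snd (x, y))))"
  proof (rule integrable_dominated)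
   show "integrable lborel (%s. W s * (K * (eps / gamma)))" using Wi by simp
   have "(%(s, t). norm (k s t)) \<in> borel_measurable (lborel \<otimes> lborel)" using km by (simp add: case_prod_beta')
   thus "(%x. LINT y|lborel. norm (k (fst (x, y)) (snd (x, y)))) \<in> borel_measurable lborel" using lborel.borel_measurable_lebesgue_integral by fastforce
   have "LINT t|lborel. abs (k s t) <= LINT t|lborel. W s * E (t - s)" for s using kt[of s] Es[of s] kb by (intro integral_mono) auto
   also have "LINT t|lborel. W s * E (t - s) = W s * (K * (eps / gamma))" for s using Esv by simp
   finally show "AE s in lborel. norm (LINT y|lborel. norm (k (fst (s, y)) (snd (s, y)))) <= norm (W s * (K * (eps / gamma)))"
    using Wn K_nonneg eps_nonneg gamma_pos by (auto simp: abs_mult)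
  qed
 qed
 have "LINT s|lborel. LINT t|lborel. k s t = LINT t|lborel. LINT s|lborel. k s t" using lborel_pair.Fubini_integral[of k] kint by (simp add: case_prod_beta')
 moreover have "LINT t|lborel. k s t = indicator {0..} s *\<^sub>R (LINT u:{0..}|lborel. b s u)" for s
 proof -
  have "LINT t|lborel. k s t = LINT u|lborel. k s (s + u)" using lborel_integral_real_affine[of 1 "k s" s] by simp
  also have "... = LINT u|lborel. indicator {0..} s * (indicator {0..} u * b s u)" by (intro bochner_cong) (auto simp: k_def indicator_def)
  finally show ?thesis by (simp add: set_lebesgue_integral_def)
 qed
 moreover have "LINT s|lborel. k s t = indicator {0..} t *\<^sub>R (LINT eta|mue. jump_op h (dyson Q h (Suc n) t f) eta)" for t
 proof (cases "t >= 0")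
  case False
  hence "k s t = 0" for s by (auto simp: k_def)
  thus ?thesis using False by simp
 next
  case t: True
  define L where "L s eta = indicator {0..t} s * jump_op h (Q.S (t - s) (G s)) eta" for s eta
  define C where "C s = indicator {0..t} s * (eps * exp (- gamma * (t - s)) * (dyson_bound n s * V))" for s
  have LL: "L s \<in> L2 mu & L2_norm mu (L s) <= C s" for s
  proof (cases "s \<in> {0..t}")
   case True
   hence ts: "0 <= t - s" "0 <= s" and Ls: "L s = jump_op h (Q.S (t - s) (G s))" by (auto simp: L_def)
   have "L2_norm mu (jump_op h (Q.S (t - s) (G s))) <= eps * (exp (- gamma * (t - s)) * centered_norm mu (G s))" by (rule jump_S_bound(2)[OF G(1)[OF ts(2)] ts(1)])
   also have "... <= eps * (exp (- gamma * (t - s)) * (dyson_bound n s * V))" using m.centered_norm_le[OF G(1)[OF ts(2)]] G(2)[OF ts(2)] by (intro mult_left_mono eps_nonneg) auto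
   also have "... = C s" using True by (simp add: C_def mult.assoc)
   finally show ?thesis using jump_S_bound(1)[OF G(1)[OF ts(2)] ts(1)] by (simp add: Ls)
  next
   case False
   hence "L s = (%_. 0)" "C s = 0" by (auto simp: L_def C_def)
   thus ?thesis using L2_const[OF m.finite_measure_axioms, of 0] by (simp add: m.L2_norm_const)
  qed
  have Ci: "integrable lborel C" unfolding C_def using dyson_bound_convolution(1)[OF t, of n V] .
  have Lm: "(%(s, eta). L s eta) \<in> borel_measurable (lborel \<otimes> borel)"
  proof -
   have "(%q. ((fst q, t), snd q)) \<in> lborel \<otimes> borel \<leadsto> ((borel :: real measure) \<otimes> (borel :: real measure)) \<otimes> (borel :: ('s, 'd) config measure)"
    by measurable
   from measurable_compose[OF this JSGm]
   have [measurable]: "(%q. jump_op h (Q.S (t - fst q) (G (fst q))) (snd q)) \<in> borel_measurable (lborel \<otimes> borel)" by simp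
   show ?thesis unfolding L_def case_prod_beta' by measurable
  qed
  have "LINT s|lborel. k s t = LINT s|lborel. LINT eta|mue. L s eta" by (simp add: k_def b_def L_def)
  also have "... = LINT eta|mue. LINT s|lborel. L s eta" by (rule fubini_mue[OF lborel.sigma_finite_measure_axioms Lm LL Ci, symmetric])
  also have "... = LINT eta|mue. jump_op h (dyson Q h (Suc n) t f) eta"
  proof (rule integral_cong_AE)
   show "AE eta in mue. (LINT s|lborel. L s eta) = jump_op h (dyson Q h (Suc n) t f) eta"
    using AE_transfer[OF jump_dyson_Suc_AE[OF f t, of n]] by eventually_elim (simp add: L_def G_def)
   show "(%eta. LINT s|lborel. L s eta) \<in> borel_measurable mue"
   proof -
    have "(%(eta, s). L s eta) \<in> borel_measurable (borel \<otimes> lborel)" using measurable_compose[OF measurable_pair_swap' Lm] by (simp add: case_prod_beta')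
    from lborel.borel_measurable_lebesgue_integral[OF this] show ?thesis by simp
   qed
   show "jump_op h (dyson Q h (Suc n) t f) \<in> borel_measurable mue" using integrable_mue dyson_L2[OF f t, of "Suc n"] by (blast dest: borel_measurable_integrable)
  qed
  finally show ?thesis using t by simp
 qed
 ultimately have "(LINT s:{0..}|lborel. LINT u:{0..}|lborel. b s u) = stationary_term (Suc n) f" by (simp add: stationary_term_def set_lebesgue_integral_def)
 moreover have "stationary_term n f = (LINT s:{0..}|lborel. (LINT eta|mu. G s eta) + (LINT u:{0..}|lborel. b s u))"
  unfolding stationary_term_def by (rule set_lebesgue_integral_cong) (use duhamel[OF G(1)] in "auto simp: b_def G_def")
 moreover have "(LINT s:{0..}|lborel. (LINT eta|mu. G s eta) + (LINT u:{0..}|lborel. b s u))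
  = (LINT s:{0..}|lborel. LINT eta|mu. G s eta) + (LINT s:{0..}|lborel. LINT u:{0..}|lborel. b s u)"
 proof (rule set_integral_add(2))
  show "set_integrable lborel {0..} (%s. LINT eta|mu. G s eta)"
   unfolding G_def by (rule set_integrable_mean(1)[OF jump_dyson_mean(1)[OF f] jump_dyson_mean(3)[OF f]])
  have "integrable lborel (%s. LINT t|lborel. k s t)" using lborel_pair.integrable_fst'[OF kint] by simp
  thus "set_integrable lborel {0..} (%s. LINT u:{0..}|lborel. b s u)"
   unfolding set_integrable_def by (simp add: \<open>!!s. (LINT t|lborel. k s t) = indicator {0..} s *\<^sub>R (LINT u:{0..}|lborel. b s u)\<close>)
 qed
 ultimately show ?thesis by (simp add: G_def)
qed

theorem series_expansion:
 assumes f: "f \<in> L2 mu"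
 shows "set_integrable lborel {0..} (%s. LINT eta|mu. jump_op h (dyson Q h n s f) eta)"
  and "(LINT s:{0..}|lborel. abs (LINT eta|mu. jump_op h (dyson Q h n s f) eta)) <= (eps / gamma) ^ (n + 1) * centered_norm mu f"
  and "summable (%n. LINT s:{0..}|lborel. LINT eta|mu. jump_op h (dyson Q h n s f) eta)"
  and "LINT x|mue. f x = (LINT x|mu. f x) + (\<Sum>n. LINT s:{0..}|lborel. LINT eta|mu. jump_op h (dyson Q h n s f) eta)"
proof -
 define V where "V = centered_norm mu f"
 define A where "A n = (LINT s:{0..}|lborel. LINT eta|mu. jump_op h (dyson Q h n s f) eta)" for n
 note si = set_integrable_mean[OF jump_dyson_mean(1)[OF f] jump_dyson_mean(3)[OF f]]
 show "set_integrable lborel {0..} (%s. LINT eta|mu. jump_op h (dyson Q h n s f) eta)" by (rule si(1))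
 show b: "(LINT s:{0..}|lborel. abs (LINT eta|mu. jump_op h (dyson Q h n s f) eta)) <= (eps / gamma) ^ (n + 1) * centered_norm mu f" for n using si(2)[of n] by simp
 have q: "0 <= eps / gamma" "eps / gamma < 1" using eps_nonneg eps_less gamma_pos by auto
 have partial: "LINT x|mue. f x = (LINT x|mu. f x) + (\<Sum>k<n. A k) + stationary_term n f" for n
 proof (induction n)
  case 0
  thus ?case using duhamel[OF f] by (simp add: stationary_term_def)
 next
  case (Suc n)
  thus ?case using stationary_term_step[OF f, of n] by (simp add: A_def)
 qed
 have rem: "(%n. stationary_term n f) ----> 0"
 proof (rule Lim_null_comparison)
  show "\<forall>\<^sub>F n in sequentially. norm (stationary_term n f) <= K * ((eps / gamma) ^ (n + 1) * V)"
  proof (rule always_eventually, rule allI)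
   fix n
   show "norm (stationary_term n f) <= K * ((eps / gamma) ^ (n + 1) * V)"
    unfolding stationary_term_def V_def real_norm_def by (rule order.trans[OF abs_LINT_le set_integrable_mean(2)[OF jump_dyson_mean(2)[OF f] jump_dyson_mean(4)[OF f]]])
  qed
  have "(%n. K * V * (eps / gamma) * (eps / gamma) ^ n) ----> K * V * (eps / gamma) * 0" using q by (intro tendsto_intros LIMSEQ_power_zero) auto
  thus "(%n. K * ((eps / gamma) ^ (n + 1) * V)) ----> 0" by (simp add: mult_ac)
 qed
 have "(%n. (LINT x|mue. f x) - (LINT x|mu. f x) - stationary_term n f) ----> (LINT x|mue. f x) - (LINT x|mu. f x) - 0" by (intro tendsto_intros rem)
 moreover have "(LINT x|mue. f x) - (LINT x|mu. f x) - stationary_term n f = (\<Sum>k<n. A k)" for n using partial[of n] by simp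
 ultimately have "A sums ((LINT x|mue. f x) - (LINT x|mu. f x))" by (simp add: sums_def)
 thus "summable (%n. LINT s:{0..}|lborel. LINT eta|mu. jump_op h (dyson Q h n s f) eta)"
  "LINT x|mue. f x = (LINT x|mu. f x) + (\<Sum>n. LINT s:{0..}|lborel. LINT eta|mu. jump_op h (dyson Q h n s f) eta)" by (auto simp: A_def[abs_def] sums_iff)
qed

end

section \<open>Vector-valued observables\<close>

context jump_rates
begin

lemma jump_op_inner:
 fixes F :: "('s, 'd) config => 'b::euclidean_space"
 assumes B: "!!eta. norm (F eta) <= B"
 shows "jump_op h F eta \<bullet> c = jump_op h (%eta. F eta \<bullet> c) eta"
proof -
 have s: "(%y. h y eta *\<^sub>R (F (translate y eta) - F eta)) summable_on UNIV" by (rule abs_summable_summable[OF jump_op_summable_bounded[OF B]])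
 have "jump_op h F eta \<bullet> c = (\<Sum>\<^sub>\<infinity>y. (h y eta *\<^sub>R (F (translate y eta) - F eta)) \<bullet> c)"
  unfolding jump_op_def by (rule infsumI[symmetric, OF has_sum_bounded_linear[OF bounded_linear_inner_left has_sum_infsum[OF s]]])
 thus ?thesis by (simp add: jump_op_def inner_diff_left)
qed

lemma jump_op_norm_bounded:
 fixes F :: "('s, 'd) config => 'b::euclidean_space"
 assumes B: "!!eta. norm (F eta) <= B"
 shows "norm (jump_op h F eta) <= 2 * B * total"
proof -
 define u where "u = jump_op h F eta"
 have c: "abs (F zeta \<bullet> u) <= B * norm u" for zeta using Cauchy_Schwarz_ineq2[of "F zeta" u] mult_right_mono[OF B[of zeta] norm_ge_zero[of u]] by linarith
 have "abs (jump_op h (%eta. F eta \<bullet> u) eta) <= 2 * (B * norm u) * total" using jump_op_bounded[where f = "%eta. F eta \<bullet> u", OF c] by simp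
 hence "norm u * norm u <= (2 * B * total) * norm u"
  using jump_op_inner[of F B eta u, OF B] by (simp add: u_def[symmetric] norm_eq_square power2_norm_eq_inner[symmetric] power2_eq_square mult_ac)
 moreover have "0 <= 2 * B * total" using total_nonneg order.trans[OF norm_ge_zero B] by simp
 ultimately show ?thesis unfolding u_def[symmetric] by (cases "norm u = 0") auto
qed

end

context dyson_series
begin

lemma borel_measurable_inner_iff:
 fixes F :: "'n => 'b::euclidean_space"
 assumes "!!c. (%x. F x \<bullet> c) \<in> borel_measurable N"
 shows "F \<in> borel_measurable N" using borel_measurable_euclidean_space[of F N] assms by blast

lemma dyson_inner:
 fixes F :: "('s, 'd) config => 'b::euclidean_space"
 assumes F [measurable]: "borel_fun F" and B: "!!eta. norm (F eta) <= B"
 shows "(EX B. ALL s<=T. ALL eta. norm (dyson Q h n s F eta) <= B) &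
  (ALL s eta c. dyson Q h n s F eta \<bullet> c = dyson Q h n s (%eta. F eta \<bullet> c) eta)"
proof (induction n arbitrary: T)
 case 0
 have "Q.S s F eta \<bullet> c = Q.S s (%eta. F eta \<bullet> c) eta" for s eta c
 proof -
  have i: "integrable (Q.law s eta) F" using F B by (rule Q.law_integrable)
  have m: "borel_fun (%eta. F eta \<bullet> c)" by measurable
  show ?thesis unfolding Q.S_eq_law[OF F] Q.S_eq_law[OF m] by (rule integral_inner_left[symmetric]) (rule i)
 qed
 moreover have "norm (Q.S s F eta) <= B" for s eta by (rule Q.S_bounded[OF B])
 ultimately show ?case by (intro conjI exI[of _ B]) auto
next
 case (Suc n)
 have Fc [measurable]: "borel_fun (%eta. F eta \<bullet> c)" for c by measurable
 note inner_n = conjunct2[OF Suc.IH, rule_format]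
 have "ALL T. EX B. ALL s<=T. ALL eta. norm (dyson Q h n s F eta) <= B" using Suc.IH by blast
 from choice[OF this] obtain b where b: "!!T s eta. s <= T ==> norm (dyson Q h n s F eta) <= b T" by blast
 define G where "G s = jump_op h (dyson Q h n s F)" for s
 have Gc: "G s eta \<bullet> c = jump_op h (dyson Q h n s (%eta. F eta \<bullet> c)) eta" for s eta c
  unfolding G_def using jump_op_inner[of "dyson Q h n s F" "b s" eta c, OF b[OF order_refl]] by (simp add: inner_n)
 have Gb: "norm (G s eta) <= 2 * b T * total" if "s <= T" for s T eta
  unfolding G_def by (rule jump_op_norm_bounded) (rule b[OF that])
 have Gm: "borel_fun (G s)" for s
 proof (rule borel_measurable_inner_iff)
  fix c
  show "borel_fun (%eta. G s eta \<bullet> c)"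
   unfolding Gc using measurable_compose[OF measurable_Pair1' jump_dyson_measurable[OF Fc, of n c], of s] by simp
 qed
 have Sc: "Q.S u (G s) eta \<bullet> c = Q.S u (jump_op h (dyson Q h n s (%eta. F eta \<bullet> c))) eta" for u s eta c
 proof -
  have i: "integrable (Q.law u eta) (G s)" using Gm Gb[OF order_refl] by (rule Q.law_integrable)
  have m: "borel_fun (%eta. G s eta \<bullet> c)" using Gm[of s] by measurable
  have "Q.S u (G s) eta \<bullet> c = Q.S u (%eta. G s eta \<bullet> c) eta"
   unfolding Q.S_eq_law[OF Gm] Q.S_eq_law[OF m] by (rule integral_inner_left[symmetric]) (rule i)
  thus ?thesis by (simp add: Gc)
 qed
 define k where "k t eta s = indicator {0..t} s *\<^sub>R Q.S (t - s) (G s) eta" for t eta s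
 have dk: "dyson Q h (Suc n) t F eta = LINT s|lborel. k t eta s" for t eta by (simp add: k_def G_def set_lebesgue_integral_def)
 have kc: "k t eta s \<bullet> c = indicator {0..t} s *\<^sub>R Q.S (t - s) (jump_op h (dyson Q h n s (%eta. F eta \<bullet> c))) eta" for t eta s c by (simp add: k_def Sc)
 have km: "k t eta \<in> borel_measurable lborel" for t eta
 proof (rule borel_measurable_inner_iff)
  fix c
  have "borel_fun (%s. Q.S (t - s) (jump_op h ((%s eta. dyson Q h n s (%eta. F eta \<bullet> c) eta) s)) eta)" by (rule dyson_step_measurable[OF dyson_measurable[OF Fc]]) measurable
  thus "(%s. k t eta s \<bullet> c) \<in> borel_measurable lborel" unfolding kc by simp
 qed
 have kb: "norm (k t eta s) <= indicator {0..t} s * (2 * b t * total)" for t eta s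
 proof (cases "s \<in> {0..t}")
  case True
  hence "norm (Q.S (t - s) (G s) eta) <= 2 * b t * total" by (intro Q.S_bounded Gb) auto
  thus ?thesis using True by (simp add: k_def)
 qed (simp add: k_def)
 have ki: "integrable lborel (k t eta)" for t eta
 proof (rule integrable_dominated[OF _ km])
  show "integrable lborel (%s. indicator {0..t} s * (2 * b t * total))" by (intro integrable_mult_left integrable_real_indicator) (auto simp: emeasure_lborel_Icc_eq)
  show "AE s in lborel. norm (k t eta s) <= norm (indicator {0..t} s * (2 * b t * total))" using kb by (intro AE_I2) (metis abs_ge_self order.trans real_norm_def)
 qed
 have "dyson Q h (Suc n) t F eta \<bullet> c = dyson Q h (Suc n) t (%eta. F eta \<bullet> c) eta" for t eta c
 proof -
  have "dyson Q h (Suc n) t F eta \<bullet> c = LINT s|lborel. k t eta s \<bullet> c"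
   unfolding dk by (rule integral_inner_left[symmetric]) (rule ki)
  thus ?thesis unfolding kc by (simp add: set_lebesgue_integral_def)
 qed
 moreover have "EX B. ALL s<=T. ALL eta. norm (dyson Q h (Suc n) s F eta) <= B"
 proof (intro exI allI impI)
  fix s eta assume s: "s <= T"
  have b0: "0 <= 2 * b t * total" for t using total_nonneg order.trans[OF norm_ge_zero b[OF order_refl, of t undefined]] by simp
  have "norm (k s eta u) <= indicator {0..T} u * (2 * b T * total)" for u
  proof (cases "u \<in> {0..s}")
   case True
   hence "norm (Q.S (s - u) (G u) eta) <= 2 * b T * total" using s by (intro Q.S_bounded Gb) auto
   thus ?thesis using True s by (simp add: k_def)
  qed (use b0 in "simp add: k_def")
  hence "LINT u|lborel. norm (k s eta u) <= LINT u|lborel. indicator {0..T} u * (2 * b T * total)"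
   using ki by (intro integral_mono integrable_mult_left integrable_real_indicator integrable_norm) (auto simp: emeasure_lborel_Icc_eq)
  thus "norm (dyson Q h (Suc n) s F eta) <= LINT u|lborel. indicator {0..T} u * (2 * b T * total)"
   unfolding dk using integral_norm_bound[of lborel "k s eta"] by linarith
 qed
 ultimately show ?case by blast
qed

lemma jump_dyson_inner:
 fixes F :: "('s, 'd) config => 'b::euclidean_space"
 assumes F: "borel_fun F" and B: "!!eta. norm (F eta) <= B" and nu: "distribution nu"
 shows "(LINT eta|nu. jump_op h (dyson Q h n s F) eta) \<bullet> c = LINT eta|nu. jump_op h (dyson Q h n s (%eta. F eta \<bullet> c)) eta"
proof -
 obtain b where b: "!!eta. norm (dyson Q h n s F eta) <= b" using dyson_inner[OF F B, of s n] by blast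
 have Jc: "jump_op h (dyson Q h n s F) eta \<bullet> c = jump_op h (dyson Q h n s (%eta. F eta \<bullet> c)) eta" for eta c
  using jump_op_inner[of "dyson Q h n s F" b eta c, OF b] dyson_inner[OF F B, of s n] by simp
 have "jump_op h (dyson Q h n s F) \<in> borel_measurable borel"
 proof (rule borel_measurable_inner_iff)
  fix c
  have Fc: "borel_fun (%eta. F eta \<bullet> c)" using F by measurable
  show "borel_fun (%eta. jump_op h (dyson Q h n s F) eta \<bullet> c)"
   unfolding Jc using measurable_compose[OF measurable_Pair1' jump_dyson_measurable[OF Fc, of n], of s] by simp
 qed
 hence "integrable nu (jump_op h (dyson Q h n s F))" using distributionD[OF nu] jump_op_norm_bounded[OF b] by (intro integrable_bounded[where B = "2 * b * total"]) auto
 thus ?thesis unfolding Jc[symmetric] by (simp add: integral_inner_left)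
qed

end

context dyson_stationary
begin

text \<open>
Taking the inner product with the vector-valued term itself reduces its norm to a scalar estimate, without loss of a dimensional constant.
\<close>

theorem vector_series_expansion:
 fixes F :: "('s, 'd) config => 'b::euclidean_space"
 assumes F: "borel_fun F" and B: "!!eta. norm (F eta) <= B"
 shows "integrable mue F"
  and "set_integrable lborel {0..} (%s. LINT eta|mu. jump_op h (dyson Q h n s F) eta)"
  and "summable (%n. LINT s:{0..}|lborel. LINT eta|mu. jump_op h (dyson Q h n s F) eta)"
  and "LINT eta|mue. F eta = (LINT eta|mu. F eta) + (\<Sum>n. LINT s:{0..}|lborel. LINT eta|mu. jump_op h (dyson Q h n s F) eta)"
  and "s >= 0 ==> norm (LINT eta|mu. jump_op h (dyson Q h n s F) eta) <= dyson_bound n s * B"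
proof -
 note [measurable] = F
 define I where "I n s = LINT eta|mu. jump_op h (dyson Q h n s F) eta" for n s
 define A where "A n = (LINT s:{0..}|lborel. I n s)" for n
 have Ic: "I n s \<bullet> c = LINT eta|mu. jump_op h (dyson Q h n s (%eta. F eta \<bullet> c)) eta" for n s c
  unfolding I_def by (rule jump_dyson_inner[OF F B distr_mu])
 have B0: "0 <= B" using order.trans[OF norm_ge_zero B] .
 have cb: "abs (F eta \<bullet> c) <= B * norm c" for eta c using Cauchy_Schwarz_ineq2[of "F eta" c] mult_right_mono[OF B[of eta] norm_ge_zero[of c]] by linarith
 have FcL: "(%eta. F eta \<bullet> c) \<in> L2 mu" and Fcn: "L2_norm mu (%eta. F eta \<bullet> c) <= B * norm c" for c by (rule m.L2_bounded[OF _ cb]; simp)+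
 have Ib: "norm (I n s) <= dyson_bound n s * B" if s: "s >= 0" for n s
 proof -
  have "norm (I n s) * norm (I n s) = abs (I n s \<bullet> I n s)" by (simp add: power2_norm_eq_inner[symmetric] power2_eq_square)
  also have "... <= dyson_bound n s * centered_norm mu (%eta. F eta \<bullet> I n s)" using jump_dyson_mean(3)[OF FcL s, of n "I n s"] by (simp only: Ic)
  also have "... <= dyson_bound n s * (B * norm (I n s))" using m.centered_norm_le[OF FcL[of "I n s"]] Fcn[of "I n s"] by (intro mult_left_mono dyson_bound_nonneg s) auto
  finally have "norm (I n s) * norm (I n s) <= (dyson_bound n s * B) * norm (I n s)" by (simp add: mult_ac)
  moreover have "0 <= dyson_bound n s * B" using dyson_bound_nonneg[OF s] B0 by simp
  ultimately show ?thesis by (cases "norm (I n s) = 0") auto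
 qed
 thus "s >= 0 ==> norm (LINT eta|mu. jump_op h (dyson Q h n s F) eta) <= dyson_bound n s * B" by (simp add: I_def)
 have Im: "borel_fun (I n)" for n by (rule borel_measurable_inner_iff) (unfold Ic, rule jump_dyson_mean(1)[OF FcL])
 have bi: "integrable lborel (%s. indicator {0..} s *\<^sub>R (dyson_bound n s * B))" for n using dyson_bound_integral(1)[of n B] by (simp add: set_integrable_def)
 have le: "norm (indicator {0..} s *\<^sub>R I n s) <= indicator {0..} s *\<^sub>R (dyson_bound n s * B)" for n s using Ib[of s n] by (auto simp: indicator_def)
 have Ii: "set_integrable lborel {0..} (I n)" for n
  unfolding set_integrable_def
 proof (rule integrable_dominated[OF bi])
  show "(%s. indicator {0..} s *\<^sub>R I n s) \<in> borel_measurable lborel" using Im[of n] by simp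
  show "AE s in lborel. norm (indicator {0..} s *\<^sub>R I n s) <= norm (indicator {0..} s *\<^sub>R (dyson_bound n s * B))"
   using le by (intro AE_I2) (metis abs_ge_self order.trans real_norm_def)
 qed
 thus "set_integrable lborel {0..} (%s. LINT eta|mu. jump_op h (dyson Q h n s F) eta)" by (simp add: I_def[abs_def])
 have An: "norm (A n) <= (eps / gamma) ^ (n + 1) * B" for n
 proof -
  have "norm (A n) <= LINT s|lborel. norm (indicator {0..} s *\<^sub>R I n s)"
   unfolding A_def set_lebesgue_integral_def by (rule integral_norm_bound)
  also have "... <= LINT s|lborel. indicator {0..} s *\<^sub>R (dyson_bound n s * B)" using Ii[of n] by (intro integral_mono bi le integrable_norm) (simp add: set_integrable_def)
  also have "... = (eps / gamma) ^ (n + 1) * B" using dyson_bound_integral(2)[of n B] by (simp add: set_lebesgue_integral_def mult.assoc[symmetric])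
  finally show ?thesis .
 qed
 have q: "0 <= eps / gamma" "eps / gamma < 1" using eps_nonneg eps_less gamma_pos by auto
 have As: "summable A"
 proof (rule summable_comparison_test'[where N = 0])
  have "summable (%n. (eps / gamma) * B * (eps / gamma) ^ n)" using q by (intro summable_mult summable_geometric) auto
  thus "summable (%n. (eps / gamma) ^ (n + 1) * B)" by (simp add: mult_ac)
  show "norm (A n) <= (eps / gamma) ^ (n + 1) * B" for n by (rule An)
 qed
 thus "summable (%n. LINT s:{0..}|lborel. LINT eta|mu. jump_op h (dyson Q h n s F) eta)" by (simp add: A_def[abs_def] I_def[abs_def])
 have Fi: "integrable mue F" "integrable mu F" using B by (auto intro!: me.integrable_const_bound[where B = B] m.integrable_const_bound[where B = B])
 thus "integrable mue F" by simp
 have "LINT eta|mue. F eta = (LINT eta|mu. F eta) + (\<Sum>n. A n)"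
 proof (rule euclidean_eqI)
  fix c :: 'b
  have Ac: "A n \<bullet> c = (LINT s:{0..}|lborel. LINT eta|mu. jump_op h (dyson Q h n s (%eta. F eta \<bullet> c)) eta)" for n
  proof -
   have "A n \<bullet> c = LINT s|lborel. (indicator {0..} s *\<^sub>R I n s) \<bullet> c"
    unfolding A_def set_lebesgue_integral_def using Ii[of n] by (intro integral_inner_left[symmetric]) (simp add: set_integrable_def)
   thus ?thesis by (simp add: set_lebesgue_integral_def Ic)
  qed
  have "(LINT eta|mue. F eta) \<bullet> c = LINT eta|mue. F eta \<bullet> c" using Fi by (intro integral_inner_left[symmetric]) auto
  also have "... = (LINT eta|mu. F eta \<bullet> c) + (\<Sum>n. A n \<bullet> c)" unfolding Ac by (rule series_expansion(4)[OF FcL])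
  also have "LINT eta|mu. F eta \<bullet> c = (LINT eta|mu. F eta) \<bullet> c" using Fi by (intro integral_inner_left) auto
  also have "(\<Sum>n. A n \<bullet> c) = (\<Sum>n. A n) \<bullet> c" by (rule bounded_linear.suminf[OF bounded_linear_inner_left As, symmetric])
  finally show "(LINT eta|mue. F eta) \<bullet> c = ((LINT eta|mu. F eta) + (\<Sum>n. A n)) \<bullet> c" by (simp add: inner_add_left)
 qed
 thus "LINT eta|mue. F eta = (LINT eta|mu. F eta) + (\<Sum>n. LINT s:{0..}|lborel. LINT eta|mu. jump_op h (dyson Q h n s F) eta)" by (simp add: A_def[abs_def] I_def[abs_def])
qed

end

section \<open>A law of large numbers for weakly correlated variables\<close>

lemma AE_tendsto_zero_of_summable_squares:
 fixes Z :: "nat => 'a => real"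
 assumes Z: "!!k. Z k \<in> L2 M" and b: "!!k. (LINT x|M. (Z k x)^2) <= b k" and "summable b"
 shows "AE x in M. (%k. Z k x) ----> 0"
proof -
 have [measurable]: "Z k \<in> borel_measurable M" for k using Z[of k] by (simp add: L2_def)
 have i: "integrable M (%x. (Z k x)^2)" for k using Z[of k] by (simp add: L2_def)
 have b0: "0 <= b k" for k by (rule order.trans[OF bochner_nonneg b]) simp
 have "nn_integral M (%x. (\<Sum>k. ennreal ((Z k x)^2))) = (\<Sum>k. nn_integral M (%x. ennreal ((Z k x)^2)))" by (rule nn_integral_suminf) measurable
 also have "... = (\<Sum>k. ennreal (LINT x|M. (Z k x)^2))" using i by (intro suminf_cong nn_integral_eq_integral) auto
 also have "... <= (\<Sum>k. ennreal (b k))" using b by (intro suminf_le ennreal_leI) auto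
 also have "... = ennreal (\<Sum>k. b k)" using b0 \<open>summable b\<close> by (rule suminf_ennreal2)
 finally have "(nn_integral M (%x. (\<Sum>k. ennreal ((Z k x)^2)))) ~= \<infinity>" by (metis ennreal_neq_top infinity_ennreal_def neq_top_trans)
 hence "AE x in M. (\<Sum>k. ennreal ((Z k x)^2)) ~= \<infinity>" by (intro nn_integral_PInf_AE) auto
 thus ?thesis
 proof eventually_elim
  case (elim x)
  hence "summable (%k. (Z k x)^2)" by (intro summable_suminf_not_top) auto
  hence "(%k. sqrt ((Z k x)^2)) ----> sqrt 0" by (intro tendsto_real_sqrt summable_LIMSEQ_zero)
  thus ?case by (simp add: tendsto_rabs_zero_iff)
 qed
qed

lemma averages_tendsto_zero_along_squares:
 fixes y :: "nat => real"
 assumes 1: "(%k. (\<Sum>j<k^2. y j) / (real k)^2) ----> 0"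
  and 2: "(%k. (\<Sum>j\<in>{k^2..<(Suc k)^2}. abs (y j)) / (real k)^2) ----> 0"
 shows "(%n. (\<Sum>j<n. y j) / real n) ----> 0"
proof -
 define a where "a k = abs ((\<Sum>j<k^2. y j) / (real k)^2) + (\<Sum>j\<in>{k^2..<(Suc k)^2}. abs (y j)) / (real k)^2" for k
 have "a ----> abs 0 + 0" unfolding a_def by (intro tendsto_intros 1 2)
 hence a: "a ----> 0" by simp
 have "filterlim floor_sqrt at_top sequentially"
  unfolding filterlim_at_top
 proof (intro allI eventually_sequentiallyI)
  show "Z <= floor_sqrt n" if "Z^2 <= n" for Z n using that by (rule le_floor_sqrtI)
 qed
 from filterlim_compose[OF a this] have lim: "(%n. a (floor_sqrt n)) ----> 0" by simp
 show ?thesis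
 proof (rule Lim_null_comparison[OF eventually_sequentiallyI lim])
  fix n :: nat assume n: "n >= 1"
  define k where "k = floor_sqrt n"
  have k: "k^2 <= n" "n < (Suc k)^2" "k >= 1" using n by (simp_all add: k_def Suc_floor_sqrt_power2_gt le_floor_sqrtI)
  have kn: "(real k)^2 <= real n" "0 < (real k)^2" using k by (simp_all flip: of_nat_power)
  have "(\<Sum>j<n. y j) = (\<Sum>j<k^2. y j) + (\<Sum>j\<in>{k^2..<n}. y j)" using k(1) by (subst sum.union_disjoint[symmetric]) (auto intro!: sum.cong)
  hence "abs (\<Sum>j<n. y j) <= abs (\<Sum>j<k^2. y j) + abs (\<Sum>j\<in>{k^2..<n}. y j)" by simp
  also have "abs (\<Sum>j\<in>{k^2..<n}. y j) <= (\<Sum>j\<in>{k^2..<n}. abs (y j))" by (rule sum_abs)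
  also have "... <= (\<Sum>j\<in>{k^2..<(Suc k)^2}. abs (y j))" using k by (intro sum_mono2) auto
  finally have "abs (\<Sum>j<n. y j) / real n <= (abs (\<Sum>j<k^2. y j) + (\<Sum>j\<in>{k^2..<(Suc k)^2}. abs (y j))) / (real k)^2" using kn by (intro frac_le) auto
  thus "norm ((\<Sum>j<n. y j) / real n) <= a (floor_sqrt n)" by (simp add: a_def k_def[symmetric] add_divide_distrib)
 qed
qed

context prob_space
begin

text \<open>
The second moments of the partial sums grow linearly. Along the squares \<open>k\<^sup>2\<close> the averages are therefore summable in \<open>L\<^sup>2\<close>, and between
consecutive squares there are only about \<open>2k\<close> terms.
\<close>

lemma second_moment_law_of_large_numbers:
 fixes Y :: "nat => 'a => real"
 assumes Y: "!!k. Y k \<in> L2 M"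
  and cov: "!!j k. j <= k ==> abs (LINT x|M. Y j x * Y k x) <= C * q ^ (k - j)"
  and q: "0 <= q" "q < 1"
 shows "AE x in M. (%n. (\<Sum>k<n. Y k x) / real n) ----> 0"
proof -
 have C0: "0 <= C" using order.trans[OF abs_ge_zero cov[of 0 0]] by simp
 have YY: "integrable M (%x. Y j x * Y k x)" for j k using Y[of j] Y[of k] by (rule L2_integrable_mult)
 have sL: "(%x. \<Sum>k\<in>I. Y k x) \<in> L2 M" for I
 proof (induction I rule: infinite_finite_induct)
  case (insert x F)
  thus ?case using L2_add[OF Y[of x] insert.IH] by simp
 qed (use L2_const[OF finite_measure_axioms, of 0] in auto)
 define K where "K = 2 * C / (1 - q)"
 have geom: "(\<Sum>j\<le>n. q ^ (n - j)) <= 1 / (1 - q)" for n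
 proof -
  have "(\<Sum>j\<le>n. q ^ (n - j)) = (\<Sum>j\<le>n. q ^ j)" by (rule sum.reindex_bij_witness[where i = "%j. n - j" and j = "%j. n - j"]) auto
  also have "... <= (\<Sum>j. q ^ j)" using q by (intro sum_le_suminf) auto
  finally show ?thesis using q by (simp add: suminf_geometric)
 qed
 have second: "LINT x|M. (\<Sum>k<n. Y k x)^2 <= K * real n" for n
 proof (induction n)
  case (Suc n)
  have "(LINT x|M. (\<Sum>k<Suc n. Y k x)^2) =
    (LINT x|M. (\<Sum>k<n. Y k x)^2 + 2 * (\<Sum>k<n. Y k x * Y n x) + Y n x * Y n x)"
   by (intro bochner_cong) (simp_all add: power2_eq_square algebra_simps sum_distrib_left sum_distrib_right)
  also have "... = (LINT x|M. (\<Sum>k<n. Y k x)^2) + 2 * (\<Sum>k<n. LINT x|M. Y k x * Y n x) + (LINT x|M. Y n x * Y n x)" using YY L2_integrable_square[OF sL] by simp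
  also have "... <= K * real n + 2 * (\<Sum>k<n. C * q ^ (n - k)) + C"
   using Suc.IH cov[of _ n] cov[of n n] by (intro add_mono mult_left_mono sum_mono) (auto intro: order.trans[OF abs_ge_self])
  also have "... <= K * real n + 2 * (C * (\<Sum>k\<le>n. q ^ (n - k)))"
  proof -
   have "(\<Sum>k\<le>n. q ^ (n - k)) = (\<Sum>k<n. q ^ (n - k)) + 1" by (simp add: lessThan_Suc_atMost[symmetric])
   thus ?thesis using C0 by (simp add: sum_distrib_left[symmetric] distrib_left)
  qed
  also have "... <= K * real n + 2 * (C * (1 / (1 - q)))" using geom C0 by (intro add_left_mono mult_left_mono) auto
  also have "... = K * real n + K" by (simp add: K_def)
  also have "... = K * real (Suc n)" by (simp add: algebra_simps)
  finally show ?case .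
 qed simp
 define Z1 where "Z1 k x = (\<Sum>j<k^2. Y j x) / (real k)^2" for k x
 define Z2 where "Z2 k x = (\<Sum>j\<in>{k^2..<(Suc k)^2}. abs (Y j x)) / (real k)^2" for k x
 have "AE x in M. (%k. Z1 k x) ----> 0"
 proof (rule AE_tendsto_zero_of_summable_squares)
  show "Z1 k \<in> L2 M" for k unfolding Z1_def using L2_cmult[OF sL, of "1 / (real k)^2"] by simp
  show "LINT x|M. (Z1 k x)^2 <= K * inverse ((real k)^2)" for k
  proof -
   have "LINT x|M. (Z1 k x)^2 = (LINT x|M. (\<Sum>j<k^2. Y j x)^2) / ((real k)^2)^2" by (simp add: Z1_def power_divide)
   also have "... <= (K * real (k^2)) / ((real k)^2)^2" by (intro divide_right_mono second) simp
   finally show ?thesis by (simp add: power2_eq_square field_simps split: if_splits)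
  qed
  show "summable (%k. K * inverse ((real k)^2))" by (intro summable_mult inverse_power_summable) simp
 qed
 moreover have "AE x in M. (%k. Z2 k x) ----> 0"
 proof (rule AE_tendsto_zero_of_summable_squares)
  have aL: "(%x. \<Sum>k\<in>I. abs (Y k x)) \<in> L2 M" for I
  proof (induction I rule: infinite_finite_induct)
   case (insert x F)
   thus ?case using L2_add[OF L2_abs[OF Y[of x]] insert.IH] by simp
  qed (use L2_const[OF finite_measure_axioms, of 0] in auto)
  show "Z2 k \<in> L2 M" for k unfolding Z2_def using L2_cmult[OF aL, of "1 / (real k)^2"] by simp
  show "LINT x|M. (Z2 k x)^2 <= 9 * C * inverse ((real k)^2)" for k
  proof (cases "k = 0")
   case False
   have "LINT x|M. (\<Sum>j\<in>{k^2..<(Suc k)^2}. abs (Y j x))^2 <= LINT x|M. (\<Sum>j\<in>{k^2..<(Suc k)^2}. (abs (Y j x))^2) * card {k^2..<(Suc k)^2}"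
    using L2_integrable_square[OF aL] L2_integrable_square[OF Y] by (intro integral_mono sum_squared_le_sum_of_squares) auto
   also have "... = (\<Sum>j\<in>{k^2..<(Suc k)^2}. LINT x|M. Y j x * Y j x) * card {k^2..<(Suc k)^2}" using L2_integrable_square[OF Y] by (simp add: power2_eq_square)
   also have "... <= (\<Sum>j\<in>{k^2..<(Suc k)^2}. C) * card {k^2..<(Suc k)^2}" using cov[of j j for j] by (intro mult_right_mono sum_mono) (auto intro: order.trans[OF abs_ge_self])
   also have "... = C * (2 * real k + 1)^2" by (simp add: power2_eq_square of_nat_diff algebra_simps)
   also have "... <= C * (3 * real k)^2" using False C0 by (intro mult_left_mono power_mono) auto
   finally have le: "LINT x|M. (\<Sum>j\<in>{k^2..<(Suc k)^2}. abs (Y j x))^2 <= 9 * C * (real k)^2" by (simp add: power_mult_distrib mult_ac)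
   have "LINT x|M. (Z2 k x)^2 = (LINT x|M. (\<Sum>j\<in>{k^2..<(Suc k)^2}. abs (Y j x))^2) / ((real k)^2)^2" by (simp add: Z2_def power_divide)
   also have "... <= (9 * C * (real k)^2) / ((real k)^2)^2" by (intro divide_right_mono le) simp
   finally show ?thesis using False by (simp add: power2_eq_square field_simps)
  qed (simp add: Z2_def)
  show "summable (%k. 9 * C * inverse ((real k)^2))" by (intro summable_mult inverse_power_summable) simp
 qed
 ultimately show ?thesis by eventually_elim (rule averages_tendsto_zero_along_squares, simp_all add: Z1_def Z2_def)
qed

end

section \<open>Resampling one coordinate\<close>

text \<open>
 Integrating out one of the independent coordinates of a point of law \<open>M\<close>, without reordering the product: the coordinate is
 overwritten with an independent copy, and the law does not change.
\<close>

definition resamples :: "'a measure => 'b measure => ('a => 'b => 'a) => bool" where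
 "resamples M N T \<longleftrightarrow> (%(x, y). T x y) \<in> M \<otimes> N \<leadsto> M & distr (M \<otimes> N) M (%(x, y). T x y) = M"

lemma resamples_nn_integral:
 assumes T: "resamples M N T" and N: "prob_space N" and F [measurable]: "F \<in> borel_measurable M"
 shows "nn_integral M (%x. F x) = nn_integral M (%x. nn_integral N (%y. F (T x y)))"
proof -
 interpret N: prob_space N by fact
 have Tm [measurable]: "(%(x, y). T x y) \<in> M \<otimes> N \<leadsto> M" using T by (simp add: resamples_def)
 have "nn_integral M (%x. F x) = nn_integral (distr (M \<otimes> N) M (%(x, y). T x y)) (%x. F x)" using T by (simp add: resamples_def)
 also have "... = nn_integral (M \<otimes> N) (%p. F ((%(x, y). T x y) p))" by (rule nn_integral_distr) measurable
 also have "... = nn_integral M (%x. nn_integral N (%y. F (T x y)))" by (subst N.nn_integral_fst[symmetric]) simp_all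
 finally show ?thesis .
qed

lemma resamplesI:
 assumes Tm [measurable]: "(%(x, y). T x y) \<in> M \<otimes> N \<leadsto> M" and N: "prob_space N"
  and F: "!!F :: 'a => ennreal. F \<in> borel_measurable M ==> (nn_integral M (%x. F x)) = nn_integral M (%x. nn_integral N (%y. F (T x y)))"
 shows "resamples M N T"
 unfolding resamples_def
proof (intro conjI Tm measure_eqI)
 interpret N: prob_space N by fact
 fix A assume "A \<in> sets (distr (M \<otimes> N) M (%(x, y). T x y))"
 hence A [measurable]: "A \<in> sets M" by simp
 have "emeasure M A = nn_integral M (%x. nn_integral N (%y. indicator A (T x y)))" by (subst F[symmetric]) auto
 also have "... = nn_integral (M \<otimes> N) (%p. indicator A ((%(x, y). T x y) p))" by (subst N.nn_integral_fst[symmetric]) simp_all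
 also have "... = nn_integral (distr (M \<otimes> N) M (%(x, y). T x y)) (%x. indicator A x)"  by (rule nn_integral_distr[symmetric]) measurable
 also have "... = emeasure (distr (M \<otimes> N) M (%(x, y). T x y)) A" by simp
 finally show "emeasure (distr (M \<otimes> N) M (%(x, y). T x y)) A = emeasure M A" ..
qed simp

lemma resamples_PiM:
 assumes "prob_space E"
 shows "resamples (\<Pi>\<^sub>M i\<in>(UNIV :: nat set). E) E (%x y. x(k := y))"
proof (rule resamplesI)
 let ?P = "\<Pi>\<^sub>M i\<in>(UNIV :: nat set). E"
 interpret E: prob_space E by fact
 interpret P: prob_space ?P by (intro prob_space_PiM assms)
 interpret pair_sigma_finite E ?P ..
 show m: "(%(x, y). x(k := y)) \<in> ?P \<otimes> E \<leadsto> ?P" by (rule measurable_PiM_single') (auto simp: fun_upd_def case_prod_beta' space_pair_measure space_PiM)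
 show "prob_space E" by fact
 fix F :: "(nat => 'a) => ennreal" assume F [measurable]: "F \<in> borel_measurable ?P"
 have m': "(%(y, x). x(k := y)) \<in> E \<otimes> ?P \<leadsto> ?P" using measurable_compose[OF measurable_pair_swap' m] by (simp add: case_prod_beta')
 have F': "(%(y, x). F (x(k := y))) \<in> borel_measurable (E \<otimes> ?P)" using measurable_compose[OF m' F] by (simp add: case_prod_beta')
 have "nn_integral ?P (%x. F x) = nn_integral (distr (E \<otimes> ?P) ?P (%(y, x). x(k := y))) (%x. F x)" using distr_pair_PiM_eq_PiM[of UNIV "%_. E" k] assms by simp
 also have "... = nn_integral (E \<otimes> ?P) (%p. F ((%(y, x). x(k := y)) p))" by (rule nn_integral_distr[OF m']) simp
 also have "... = nn_integral ?P (%x. nn_integral E (%y. F (x(k := y))))" using nn_integral_snd[OF F'] by (simp add: case_prod_beta')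
 finally show "nn_integral ?P (%x. F x) = nn_integral ?P (%x. nn_integral E (%y. F (x(k := y))))" .
qed

lemma resamples_integral:
 fixes F :: "'a => real"
 assumes T: "resamples M N T" and M: "sigma_finite_measure M" and N: "prob_space N" and F: "integrable M F"
 shows "AE x in M. integrable N (%y. F (T x y))"
  and "LINT x|M. F x = LINT x|M. LINT y|N. F (T x y)"
proof -
 interpret N: prob_space N by fact
 interpret M: sigma_finite_measure M by fact
 interpret pair_sigma_finite M N ..
 have Tm [measurable]: "(%(x, y). T x y) \<in> M \<otimes> N \<leadsto> M" using T by (simp add: resamples_def)
 have d: "distr (M \<otimes> N) M (%(x, y). T x y) = M" using T by (simp add: resamples_def)
 have i: "integrable (M \<otimes> N) (%(x, y). F (T x y))" using integrable_distr[OF Tm, of F] F d by (simp add: case_prod_beta')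
 show "AE x in M. integrable N (%y. F (T x y))" using AE_integrable_fst'[OF i] by simp
 have "LINT x|M. F x = LINT p|(M \<otimes> N). F ((%(x, y). T x y) p)" by (subst d[symmetric], rule integral_distr[OF Tm]) (use F in simp)
 also have "... = LINT x|M. LINT y|N. F (T x y)" using integral_fst'[OF i] by (simp add: case_prod_beta')
 finally show "LINT x|M. F x = LINT x|M. LINT y|N. F (T x y)" .
qed

text \<open>
A martingale difference is described without filtration: the earlier variables are unaffected by resampling the \<open>k\<close>-th randomness, while
the \<open>k\<close>-th one has mean zero after it.
\<close>

lemma (in prob_space) martingale_difference_law_of_large_numbers:
 fixes D :: "nat => 'a => real"
 assumes D: "!!k. D k \<in> L2 M" and C: "!!k. (LINT x|M. (D k x)^2) <= C"
  and N: "prob_space N" and T: "!!k. resamples M N (T k)"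
  and past: "!!j k x y. j < k ==> D j (T k x y) = D j x"
  and centered: "!!k. AE x in M. (LINT y|N. D k (T k x y)) = 0"
 shows "AE x in M. (%n. (\<Sum>k<n. D k x) / real n) ----> 0"
proof (rule second_moment_law_of_large_numbers[OF D, where C = C and q = 0])
 have C0: "0 <= C" by (rule order.trans[OF bochner_nonneg C]) simp
 show "abs (LINT x|M. D j x * D k x) <= C * 0 ^ (k - j)" if "j <= k" for j k
 proof (cases "j = k")
  case True
  thus ?thesis using C[of k] bochner_nonneg[of M "%x. (D k x)^2"] by (simp add: power2_eq_square)
 next
  case False
  hence jk: "j < k" using that by simp
  have "LINT x|M. D j x * D k x = LINT x|M. LINT y|N. D j (T k x y) * D k (T k x y)"
   using T[of k] _ N L2_integrable_mult[OF D D] by (rule resamples_integral(2)) (rule sigma_finite_measure_axioms)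
  also have "... = LINT x|M. D j x * (LINT y|N. D k (T k x y))" by (simp add: past[OF jk])
  also have "... = LINT x|M. 0"
  proof (rule integral_cong_AE)
   have [measurable]: "(%(x, y). T k x y) \<in> M \<otimes> N \<leadsto> M" using T by (simp add: resamples_def)
   have [measurable]: "D j \<in> borel_measurable M" "D k \<in> borel_measurable M" using D by (auto simp: L2_def)
   interpret N: prob_space N by fact
   show "(%x. D j x * (LINT y|N. D k (T k x y))) \<in> borel_measurable M" by measurable
   show "AE x in M. D j x * (LINT y|N. D k (T k x y)) = 0" using centered[of k] by eventually_elim simp
  qed simp
  finally show ?thesis using jk C0 by simp
 qed
qed auto

section \<open>Construction of the walker\<close>

lemma open_lattice: "open (A :: ('d::finite) lattice set)"
proof -
 have "open {x}" for x :: "'d lattice"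
  unfolding open_vec_def
 proof (intro ballI exI conjI allI impI)
  fix y assume "y \<in> {x}"
  show "open {x $ i}" for i by (rule Topological_Spaces.open_discrete)
  show "y $ i \<in> {x $ i}" for i using \<open>y \<in> {x}\<close> by simp
  show "z \<in> {x}" if "ALL i. z $ i \<in> {x $ i}" for z using that by (simp add: vec_eq_iff)
 qed
 hence "open (\<Union>x\<in>A. {x})" by blast
 thus ?thesis by simp
qed

lemma continuous_on_lattice_pair:
 fixes F :: "('d::finite) lattice => 'a::topological_space => 'b::topological_space"
 assumes "!!y. continuous_on UNIV (F y)"
 shows "continuous_on UNIV (%p. F (snd p) (fst p))"
 unfolding continuous_on_open_vimage[OF open_UNIV]
proof (intro allI impI)
 fix B :: "'b set" assume "open B"
 have "(%p. F (snd p) (fst p)) -` B \<inter> UNIV = (\<Union>y. (F y -` B) \<times> {y})" by auto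
 moreover have "open (F y -` B)" for y using continuous_on_open_vimage[OF open_UNIV, of "F y"] assms[of y] \<open>open B\<close> by simp
 ultimately show "open ((%p. F (snd p) (fst p)) -` B \<inter> UNIV)" by (auto intro!: open_Times open_lattice)
qed

lemma continuous_on_lattice: "continuous_on UNIV (f :: ('d::finite) lattice => 'b::topological_space)"
 unfolding continuous_on_open_vimage[OF open_UNIV] by (simp add: open_lattice)

text \<open>
Regularity of the path seen from the walker: between its jumps it is a fixed continuous image of the environment.
\<close>

lemma cadlag_switch:
 fixes w :: "real => 'a::topological_space" and F :: "'k => 'a => 'b::topological_space"
 assumes w: "cadlag w" and F: "!!k. continuous_on UNIV (F k)"
  and right: "!!t. t >= 0 ==> \<forall>\<^sub>F s in at_right t. n s = n t"
  and left: "!!t. t > 0 ==> EX m. \<forall>\<^sub>F s in at_left t. n s = m"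
 shows "cadlag (\<lambda>t\<in>{0..}. F (n t) (w t))"
 unfolding cadlag_def
proof (intro conjI allI impI)
 have tr: "((%s. F k (w s)) ---> F k l) G" if "(w ---> l) G" for k l G using F[of k] that by (rule continuous_on_tendsto_compose) auto
 fix t :: real assume t: "t >= 0"
 have "(w ---> w t) (at_right t)" using w t by (auto simp: cadlag_def continuous_within)
 hence lim: "((%s. F (n t) (w s)) ---> F (n t) (w t)) (at_right t)" by (rule tr)
 have "\<forall>\<^sub>F s in at_right t. F (n t) (w s) = (\<lambda>t\<in>{0..}. F (n t) (w t)) s" using right[OF t] eventually_at_right_less[of t] by eventually_elim (use t in auto)
 moreover have gt: "(\<lambda>t\<in>{0..}. F (n t) (w t)) t = F (n t) (w t)" using t by simp
 ultimately show "continuous (at_right t) (\<lambda>t\<in>{0..}. F (n t) (w t))"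
  unfolding continuous_within gt by (intro Lim_transform_eventually[OF lim])
next
 have tr: "((%s. F k (w s)) ---> F k l) G" if "(w ---> l) G" for k l G using F[of k] that by (rule continuous_on_tendsto_compose) auto
 fix t :: real assume t: "t > 0"
 obtain m where m: "\<forall>\<^sub>F s in at_left t. n s = m" using left[OF t] by blast
 obtain l where "(w ---> l) (at_left t)" using w t by (auto simp: cadlag_def)
 hence lim: "((%s. F m (w s)) ---> F m l) (at_left t)" by (rule tr)
 have "\<forall>\<^sub>F s in at_left t. F m (w s) = (\<lambda>t\<in>{0..}. F (n t) (w t)) s" using m eventually_at_left_real[OF t] by eventually_elim auto
 from Lim_transform_eventually[OF lim this]
 show "EX l. ((\<lambda>t\<in>{0..}. F (n t) (w t)) ---> l) (at_left t)" by blast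
qed

lemma finite_arrivals:
 assumes "filterlim (arrival e) at_top sequentially"
 shows "finite {n. arrival e n <= t}"
proof -
 have "\<forall>\<^sub>F n in sequentially. arrival e n > t" using assms by (simp add: filterlim_at_top_dense)
 then obtain N where "!!n. n >= N ==> arrival e n > t" by (auto simp: eventually_sequentially)
 hence "{n. arrival e n <= t} \<subseteq> {..<N}" by (force simp: not_le[symmetric])
 thus ?thesis by (rule finite_subset) simp
qed

lemma num_arrivals_right: "\<forall>\<^sub>F s in at_right t. num_arrivals e s = num_arrivals e t"
proof (cases "filterlim (arrival e) at_top sequentially")
 case True
 have "\<forall>\<^sub>F s in at_right t. \<forall>n\<in>{n. arrival e n <= t + 1} - {n. arrival e n <= t}. s < arrival e n"
 proof (rule eventually_ball_finite)
  show "\<forall>n\<in>{n. arrival e n <= t + 1} - {n. arrival e n <= t}. \<forall>\<^sub>F s in at_right t. s < arrival e n" by (auto intro!: order_tendstoD(2)[OF tendsto_ident_at])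
 qed (use finite_arrivals[OF True] in simp)
 moreover have "\<forall>\<^sub>F s in at_right t. s < t + 1" by (intro order_tendstoD(2)[OF tendsto_ident_at]) simp
 moreover have "\<forall>\<^sub>F s in at_right t. t < s" by (rule eventually_at_right_less)
 ultimately show ?thesis
 proof eventually_elim
  case (elim s)
  have "arrival e n <= s \<longleftrightarrow> arrival e n <= t" for n
  proof (cases "arrival e n <= t \<or> \<not> arrival e n <= t + 1")
   case False
   hence "s < arrival e n" using elim by blast
   thus ?thesis using False by simp
  qed (use elim in linarith)
  thus ?case using True by (simp add: num_arrivals_def)
 qed
qed (simp add: num_arrivals_def)

lemma num_arrivals_left: "EX m. \<forall>\<^sub>F s in at_left t. num_arrivals e s = m"
proof (cases "filterlim (arrival e) at_top sequentially")
 case True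
 have "finite {n. arrival e n < t}" by (rule finite_subset[OF _ finite_arrivals[OF True, of t]]) auto
 hence "\<forall>\<^sub>F s in at_left t. \<forall>n\<in>{n. arrival e n < t}. arrival e n < s" by (rule eventually_ball_finite) (auto intro!: order_tendstoD(1)[OF tendsto_ident_at])
 moreover have "\<forall>\<^sub>F s in at_left t. s < t" by (simp add: eventually_at_filter)
 ultimately have "\<forall>\<^sub>F s in at_left t. num_arrivals e s = card {n. arrival e n < t}"
 proof eventually_elim
  case (elim s)
  have "arrival e n <= s \<longleftrightarrow> arrival e n < t" for n using elim by force
  thus ?case using True by (simp add: num_arrivals_def)
 qed
 thus ?thesis by blast
qed (simp add: num_arrivals_def)

lemma arrival_measurable [measurable]: "(%e. arrival e n) \<in> borel_measurable (\<Pi>\<^sub>M i\<in>UNIV. density lborel f)"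
 unfolding arrival_def
proof (rule borel_measurable_sum)
 fix i show "(%e. e i) \<in> borel_measurable (\<Pi>\<^sub>M i\<in>UNIV. density lborel f)" using measurable_component_singleton[of i UNIV "%_. density lborel f"] by simp
qed

lemma num_arrivals_measurable [measurable]:
 "(%e. num_arrivals e t) \<in> (\<Pi>\<^sub>M i\<in>UNIV. density lborel f) \<leadsto> count_space UNIV"
proof -
 have lim: "filterlim (arrival e) at_top sequentially \<longleftrightarrow> (ALL Z::nat. EX N. ALL n. n >= N --> real Z <= arrival e n)" for e
 proof
  assume "filterlim (arrival e) at_top sequentially"
  thus "ALL Z::nat. EX N. ALL n. n >= N --> real Z <= arrival e n" by (auto simp: filterlim_at_top eventually_sequentially)
 next
  assume *: "ALL Z::nat. EX N. ALL n. n >= N --> real Z <= arrival e n"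
  show "filterlim (arrival e) at_top sequentially"
   unfolding filterlim_at_top eventually_sequentially
  proof
   fix Z :: real
   obtain k :: nat where "Z <= real k" using real_arch_simple by blast
   with * show "EX N. ALL n>=N. Z <= arrival e n" by (meson order_trans)
  qed
 qed
 show ?thesis unfolding num_arrivals_def lim by measurable
qed

subsection \<open>Sampling a jump\<close>

lemma finite_to_nat_less: "finite {z :: 'a::countable. to_nat z < n}" "finite {z :: 'a::countable. to_nat z <= n}"
 using finite_imageD[of to_nat "{z :: 'a. to_nat z < n}"] finite_imageD[of to_nat "{z :: 'a. to_nat z <= n}"]
  finite_subset[of "to_nat ` {z :: 'a. to_nat z < n}" "{..<n}"] finite_subset[of "to_nat ` {z :: 'a. to_nat z <= n}" "{..n}"] by (force intro: inj_on_subset[OF inj_to_nat])+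

lemma jump_piece_length:
 "(\<Sum>z | to_nat z <= to_nat y. p z) = (\<Sum>z | to_nat z < to_nat (y :: ('d::finite) lattice). p z) + (p y :: real)"
proof -
 have "{z. to_nat z <= to_nat y} = insert y {z. to_nat z < to_nat y}" by (auto simp: le_less)
 thus ?thesis by (simp add: finite_to_nat_less)
qed

lemma jump_piece_disjoint:
 fixes y z :: "('d::finite) lattice"
 assumes p: "!!y. 0 <= p y" and "u \<in> jump_piece p y" "u \<in> jump_piece p z"
 shows "y = z"
proof -
 have *: "\<not> to_nat y < to_nat z" if "u \<in> jump_piece p y" "u \<in> jump_piece p z" for y z
 proof
  assume "to_nat y < to_nat z"
  hence "(\<Sum>x | to_nat x <= to_nat y. p x) <= (\<Sum>x | to_nat x < to_nat z. p x)" by (intro sum_mono2 finite_to_nat_less) (auto simp: p)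
  thus False using that by (auto simp: jump_piece_def)
 qed
 have "to_nat y = to_nat z" using *[OF assms(2,3)] *[OF assms(3,2)] by simp
 thus ?thesis by simp
qed

lemma jump_eq_iff:
 fixes y :: "('d::finite) lattice"
 assumes p: "!!y. 0 <= p y"
 shows "jump p u = y \<longleftrightarrow> u \<in> jump_piece p y \<or> (y = 0 & (ALL z. u \<notin> jump_piece p z))"
proof (cases "EX z. u \<in> jump_piece p z")
 case True
 then obtain z where z: "u \<in> jump_piece p z" by blast
 have "(THE y. u \<in> jump_piece p y) = z"  by (rule the_equality[where P = "%y. u \<in> jump_piece p y", OF z]) (rule jump_piece_disjoint[of p, OF p _ z])
 hence "jump p u = z" using True by (simp add: jump_def)
 thus ?thesis using z by (blast dest: jump_piece_disjoint[of p, OF p])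
qed (auto simp: jump_def)

lemma jump_measurable:
 fixes p :: "'a => ('d::finite) lattice => real"
 assumes p [measurable]: "!!y. (%x. p x y) \<in> borel_measurable M" and p0: "!!x y. 0 <= p x y"
  and u [measurable]: "u \<in> borel_measurable M"
 shows "(%x. jump (p x) (u x)) \<in> M \<leadsto> count_space UNIV"
proof -
 have [measurable]: "Measurable.pred M (%x. u x \<in> jump_piece (p x) y)" for y
  unfolding jump_piece_def atLeastLessThan_iff by measurable
 have "{x \<in> space M. jump (p x) (u x) = y} \<in> sets M" for y
 proof -
  have "{x \<in> space M. jump (p x) (u x) = y} =
    {x \<in> space M. u x \<in> jump_piece (p x) y \<or> (y = 0 & (ALL z. u x \<notin> jump_piece (p x) z))}" by (intro Collect_cong conj_cong refl jump_eq_iff p0)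
  also have "... \<in> sets M" by measurable
  finally show ?thesis .
 qed
 thus ?thesis by (subst measurable_count_space_eq2_countable) (auto simp: vimage_def Int_def conj_commute)
qed

lemma jump_nn_integral:
 fixes p :: "('d::finite) lattice => real" and G :: "'d lattice => ennreal"
 assumes p: "!!y. 0 <= p y" and sum: "p summable_on UNIV" "(\<Sum>\<^sub>\<infinity>y. p y) <= 1" and G0: "G 0 = 0"
 shows "nn_integral (uniform_measure lborel {0..1}) (%u. G (jump p u)) = nn_integral (count_space UNIV) (%y. ennreal (p y) * G y)"
proof -
 let ?U = "uniform_measure lborel {0..1::real}"
 interpret U: prob_space ?U by (rule prob_space_uniform_measure) auto
 interpret C: sigma_finite_measure "count_space (UNIV :: 'd lattice set)" by (rule sigma_finite_count_space_countable)
 interpret pair_sigma_finite "count_space (UNIV :: 'd lattice set)" ?U ..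
 have piece: "emeasure ?U (jump_piece p y) = ennreal (p y)" for y
 proof -
  have s: "(\<Sum>z | to_nat z <= to_nat y. p z) <= 1" using sum(2) finite_sum_le_infsum[OF sum(1), of "{z. to_nat z <= to_nat y}"] p by (force simp: finite_to_nat_less)
  have s0: "0 <= (\<Sum>z | to_nat z < to_nat y. p z)" by (intro sum_nonneg p)
  have "{0..1} \<inter> jump_piece p y = jump_piece p y" using s s0 by (auto simp: jump_piece_def)
  hence "emeasure ?U (jump_piece p y) = emeasure lborel (jump_piece p y)" by (simp add: emeasure_uniform_measure jump_piece_def divide_ennreal_def)
  also have "... = ennreal (p y)" using p[of y] by (simp add: jump_piece_def jump_piece_length)
  finally show ?thesis .
 qed
 have eq: "G (jump p u) = nn_integral (count_space UNIV) (%y. G y * indicator (jump_piece p y) u)" for u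
 proof -
  have "(nn_integral (count_space UNIV) (%y. G y * indicator (jump_piece p y) u)) =
    (nn_integral (count_space UNIV) (%y. G (jump p u) * indicator {jump p u} y))"
  proof (intro nn_integral_cong)
   fix y
   show "G y * indicator (jump_piece p y) u = G (jump p u) * indicator {jump p u} y" using jump_eq_iff[of p u y, OF p] G0 by (auto simp: indicator_def)
  qed
  thus ?thesis by (simp add: nn_integral_cmult_indicator)
 qed
 have m: "(%(y, u). G y * indicator (jump_piece p y) u) \<in> borel_measurable (count_space UNIV \<otimes> ?U)"
  unfolding jump_piece_def by (intro measurable_count_space_pair borel_measurable_times_ennreal borel_measurable_const borel_measurable_indicator) simp
 have "nn_integral ?U (%u. G (jump p u)) = nn_integral ?U (%u. nn_integral (count_space UNIV) (%y. G y * indicator (jump_piece p y) u))" by (intro nn_integral_cong eq)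
 also have "... = nn_integral (count_space UNIV) (%y. nn_integral ?U (%u. G y * indicator (jump_piece p y) u))" by (rule Fubini'[OF m])
 also have "... = nn_integral (count_space UNIV) (%y. ennreal (p y) * G y)"
 proof (intro nn_integral_cong)
  fix y
  have "nn_integral ?U (%u. G y * indicator (jump_piece p y) u) = G y * emeasure ?U (jump_piece p y)" by (rule nn_integral_cmult_indicator) (simp add: jump_piece_def)
  thus "nn_integral ?U (%u. G y * indicator (jump_piece p y) u) = ennreal (p y) * G y" by (simp add: piece mult.commute)
 qed
 finally show ?thesis .
qed

lemma jump_integral:
 fixes p :: "('d::finite) lattice => real" and G :: "'d lattice => real"
 assumes p: "!!y. 0 <= p y" and sum: "p summable_on UNIV" "(\<Sum>\<^sub>\<infinity>y. p y) <= 1" and G0: "G 0 = 0"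
  and i: "integrable (count_space UNIV) (%y. p y * G y)"
 shows "integrable (uniform_measure lborel {0..1}) (%u. G (jump p u))"
  and "LINT u|uniform_measure lborel {0..1}. G (jump p u) = LINT y|count_space UNIV. p y * G y"
proof -
 let ?U = "uniform_measure lborel {0..1::real}"
 have m: "(%u. jump p u) \<in> ?U \<leadsto> count_space UNIV" by (rule jump_measurable) (auto simp: p measurable_cong_sets[OF sets_uniform_measure refl])
 have [measurable]: "(%u. G (jump p u)) \<in> borel_measurable ?U" by (rule measurable_compose[OF m]) simp
 have nn: "nn_integral ?U (%u. ennreal (k (G (jump p u)))) = nn_integral (count_space UNIV) (%y. ennreal (k (p y * G y)))"
  if k: "k 0 = 0" "!!a b. 0 <= a ==> k (a * b) = a * k b" for k :: "real => real" using jump_nn_integral[OF p sum, of "%y. ennreal (k (G y))"] G0 k(1)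
  by (simp add: k(2)[OF p] ennreal_mult'[OF p])
 have "nn_integral ?U (%u. ennreal (norm (G (jump p u)))) = nn_integral (count_space UNIV) (%y. ennreal (norm (p y * G y)))" by (rule nn) (auto simp: abs_mult)
 thus int: "integrable ?U (%u. G (jump p u))" using i by (simp add: integrable_iff_bounded)
 have "nn_integral ?U (%u. ennreal (G (jump p u))) = nn_integral (count_space UNIV) (%y. ennreal (p y * G y))" by (rule nn[of "%x. x"]) auto
 moreover have "nn_integral ?U (%u. ennreal (- G (jump p u))) = nn_integral (count_space UNIV) (%y. ennreal (- (p y * G y)))" by (rule nn[of uminus]) auto
 ultimately show "LINT u|?U. G (jump p u) = LINT y|count_space UNIV. p y * G y" by (simp add: real_lebesgue_integral_def[OF int] real_lebesgue_integral_def[OF i])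
qed

text \<open>
The walker as a function of the driving noise: an environment path, the waiting times of the clock, and uniform variables
that select the jumps.
\<close>

locale random_walk = env: feller P + jump_rates p
 for P :: "('s::polish_space, 'd::finite) config => (real => ('s, 'd) config) measure"
  and p :: "'d lattice => ('s, 'd) config => real" +
 fixes rate :: real
 assumes p_zero: "p 0 eta = 0" and p_nonneg: "0 <= p y eta" and rate_pos: "0 < rate"
  and p_sum: "(\<Sum>\<^sub>\<infinity>y. p y eta) <= rate"
begin

abbreviation "waiting \<equiv> density lborel (exponential_density rate)"
abbreviation "uniform \<equiv> uniform_measure lborel {0..1::real}"
abbreviation "waitings \<equiv> \<Pi>\<^sub>M n\<in>(UNIV :: nat set). waiting"
abbreviation "uniforms \<equiv> \<Pi>\<^sub>M n\<in>(UNIV :: nat set). uniform"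
abbreviation "driving eta \<equiv> driving_measure P rate eta"
abbreviation "driving_space \<equiv> (path_space :: (real => ('s, 'd) config) measure) \<otimes> waitings \<otimes> uniforms"

lemma prob_space_waiting: "prob_space waiting" by (rule prob_space_exponential_density[OF rate_pos])

lemma prob_space_uniform: "prob_space uniform" by (rule prob_space_uniform_measure) auto

lemma prob_space_waitings: "prob_space waitings" by (intro prob_space_PiM prob_space_waiting)

lemma prob_space_uniforms: "prob_space uniforms" by (intro prob_space_PiM prob_space_uniform)

lemma prob_space_noise: "prob_space (waitings \<otimes> uniforms)"
proof -
 interpret e: prob_space waitings by (rule prob_space_waitings)
 interpret u: prob_space uniforms by (rule prob_space_uniforms)
 interpret pair_prob_space waitings uniforms ..
 show ?thesis by unfold_locales
qed

lemma driving_eq: "driving eta = P eta \<otimes> (waitings \<otimes> uniforms)" by (simp add: driving_measure_def)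

lemma prob_space_driving: "prob_space (driving eta)"
proof -
 interpret e: prob_space "waitings \<otimes> uniforms" by (rule prob_space_noise)
 interpret p: prob_space "P eta" by (rule env.prob_space_P)
 interpret pair_prob_space "P eta" "waitings \<otimes> uniforms" ..
 show ?thesis unfolding driving_eq by unfold_locales
qed

lemma sets_driving [measurable_cong]: "sets (driving eta) = sets driving_space"
 unfolding driving_eq by (intro sets_pair_measure_cong env.sets_P refl)

lemma space_driving: "space (driving eta) = space driving_space" by (rule sets_eq_imp_space_eq[OF sets_driving])

lemma waiting_time_measurable [measurable]: "(%e. e n) \<in> borel_measurable waitings" using measurable_component_singleton[of n UNIV "%_. waiting"] by simp

lemma uniform_measurable [measurable]: "(%u. u n) \<in> borel_measurable uniforms" using measurable_component_singleton[of n UNIV "%_. uniform"]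
 by (simp add: measurable_cong_sets[OF refl sets_uniform_measure])

lemma path_of_driving [measurable]: "fst \<in> driving_space \<leadsto> path_space" by (rule measurable_fst)

definition arr :: "nat => ('s, 'd) driving => real" where
 "arr n omega = arrival (fst (snd omega)) n"

definition pos :: "nat => ('s, 'd) driving => 'd lattice" where
 "pos n omega = skeleton rate p 0 (fst omega) (fst (snd omega)) (snd (snd omega)) n"

definition seen_before :: "nat => ('s, 'd) driving => ('s, 'd) config" where
 "seen_before n omega = translate (pos n omega) (Lim (at_left (arr n omega)) (fst omega))"

definition step :: "nat => ('s, 'd) driving => 'd lattice" where
 "step n omega = jump (%y. p y (seen_before n omega) / rate) (snd (snd omega) n)"

definition walk :: "('s, 'd) driving => real => 'd lattice" where
 "walk omega t = pos (num_arrivals (fst (snd omega)) t) omega"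

lemma pos_0: "pos 0 omega = 0" by (simp add: pos_def)

lemma pos_Suc: "pos (Suc n) omega = pos n omega + step n omega" by (simp add: pos_def step_def seen_before_def arr_def Let_def)

lemma arr_measurable [measurable]: "arr n \<in> borel_measurable driving_space"
 unfolding arr_def by measurable

lemma translate_lattice_measurable:
 assumes g: "g \<in> M \<leadsto> count_space UNIV" and f: "f \<in> M \<leadsto> (borel :: ('s, 'd) config measure)"
 shows "(%x. translate (g x) (f x)) \<in> M \<leadsto> borel" by (rule measurable_compose_countable[where f = "%z x. translate z (f x)", OF _ g])
  (rule measurable_compose[OF f translate_measurable])

lemma pos_measurable [measurable]: "pos n \<in> driving_space \<leadsto> count_space UNIV"
 and seen_before_measurable [measurable]: "seen_before n \<in> driving_space \<leadsto> borel"
 and step_measurable [measurable]: "step n \<in> driving_space \<leadsto> count_space UNIV"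
proof -
 have s: "seen_before n \<in> driving_space \<leadsto> borel" if "pos n \<in> driving_space \<leadsto> count_space UNIV" for n
  unfolding seen_before_def by (rule translate_lattice_measurable[OF that]) measurable
 have j: "step n \<in> driving_space \<leadsto> count_space UNIV" if "seen_before n \<in> driving_space \<leadsto> borel" for n
  unfolding step_def
 proof (rule jump_measurable)
  show "(%x. p y (seen_before n x) / rate) \<in> borel_measurable driving_space" for y using measurable_compose[OF that h_measurable[of y]] by simp
 qed (use p_nonneg rate_pos in auto)
 have n: "pos n \<in> driving_space \<leadsto> count_space UNIV" for n
 proof (induction n)
  case 0
  thus ?case by (simp add: pos_0[abs_def])
 next
  case (Suc n)
  thus ?case unfolding pos_Suc using j[OF s[OF Suc]]
   by (intro measurable_compose_countable[where f = "%z x. z + step n x", OF _ Suc] measurable_compose[OF j[OF s[OF Suc]]]) auto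
 qed
 show "pos n \<in> driving_space \<leadsto> count_space UNIV" "seen_before n \<in> driving_space \<leadsto> borel"
  "step n \<in> driving_space \<leadsto> count_space UNIV" using n s j by blast+
qed

lemma walk_measurable [measurable]: "(%omega. walk omega t) \<in> driving_space \<leadsto> count_space UNIV"
 unfolding walk_def by (rule measurable_compose_countable[where f = pos, OF pos_measurable]) measurable

definition joint_path :: "('s, 'd) driving => real => ('s, 'd) config \<times> 'd lattice" where
 "joint_path omega = (\<lambda>t\<in>{0..}. (fst omega t, walk omega t))"

definition seen_path :: "('s, 'd) driving => real => ('s, 'd) config" where
 "seen_path omega = (\<lambda>t\<in>{0..}. translate (walk omega t) (fst omega t))"

lemma walk_right: "\<forall>\<^sub>F s in at_right t. walk omega s = walk omega t" using num_arrivals_right[of "fst (snd omega)" t] unfolding walk_def by eventually_elim simp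

lemma walk_left: "EX m. \<forall>\<^sub>F s in at_left t. walk omega s = m"
proof -
 obtain m where "\<forall>\<^sub>F s in at_left t. num_arrivals (fst (snd omega)) s = m" using num_arrivals_left by blast
 hence "\<forall>\<^sub>F s in at_left t. walk omega s = pos m omega" unfolding walk_def by eventually_elim simp
 thus ?thesis by blast
qed

lemma cadlag_driving: "omega \<in> space driving_space ==> cadlag (fst omega)" by (auto simp: space_pair_measure space_path_space)

lemma joint_path_measurable [measurable]: "joint_path \<in> driving_space \<leadsto> path_space"
proof (rule measurable_path_spaceI)
 show "(%omega. joint_path omega t) \<in> borel_measurable driving_space" if "t >= 0" for t
 proof -
  have "(%omega. (fst omega t, walk omega t)) \<in> borel_measurable driving_space"
  proof (rule measurable_compose_countable[where f = "%z omega. (fst omega t, z)"])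
   fix z :: "'d lattice"
   have "(%eta. (eta, z)) \<in> (borel :: ('s, 'd) config measure) \<leadsto> borel" by (intro borel_measurable_continuous_onI continuous_intros)
   thus "(%omega. (fst omega t, z)) \<in> borel_measurable driving_space" by (rule measurable_compose[rotated]) measurable
  qed measurable
  thus ?thesis using that by (simp add: joint_path_def)
 qed
 show "cadlag (joint_path omega)" if "omega \<in> space driving_space" for omega
  unfolding joint_path_def by (rule cadlag_switch[where F = "%z eta. (eta, z)"]) (intro cadlag_driving that continuous_intros walk_right walk_left)+
qed (simp add: joint_path_def)

lemma seen_path_measurable [measurable]: "seen_path \<in> driving_space \<leadsto> path_space"
proof (rule measurable_path_spaceI)
 show "(%omega. seen_path omega t) \<in> borel_measurable driving_space" if "t >= 0" for t
 proof -
  have "(%omega. translate (walk omega t) (fst omega t)) \<in> borel_measurable driving_space" by (rule translate_lattice_measurable) measurable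
  thus ?thesis using that by (simp add: seen_path_def)
 qed
 show "cadlag (seen_path omega)" if "omega \<in> space driving_space" for omega
  unfolding seen_path_def by (rule cadlag_switch[where F = translate]) (intro cadlag_driving that translate_continuous walk_right walk_left)+
qed (simp add: seen_path_def)

lemma walker_law_eq: "walker_law P rate p eta 0 = distr (driving eta) path_space joint_path" by (simp add: walker_law_def joint_path_def[abs_def] walk_def pos_def case_prod_beta')

lemma seen_from_walker_eq: "seen_from_walker P rate p eta = distr (driving eta) path_space seen_path"
proof -
 have m: "(%w. \<lambda>t\<in>{0..}. translate (snd (w t)) (fst (w t))) \<in>
   (path_space :: (real => ('s, 'd) config \<times> 'd lattice) measure) \<leadsto> path_space"
 proof (rule measurable_path_spaceI)
  have c: "continuous_on UNIV (%p. translate (snd p) (fst p) :: ('s, 'd) config)" by (rule continuous_on_lattice_pair) (rule translate_continuous)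
  show "(%w. (\<lambda>t\<in>{0..}. translate (snd (w t)) (fst (w t))) t)
    \<in> borel_measurable (path_space :: (real => ('s, 'd) config \<times> 'd lattice) measure)" if "t >= 0" for t
   using that measurable_compose[OF path_coordinate_measurable borel_measurable_continuous_onI[OF c]] by simp
  show "cadlag (\<lambda>t\<in>{0..}. translate (snd (w t)) (fst (w t)))"
   if "w \<in> space (path_space :: (real => ('s, 'd) config \<times> 'd lattice) measure)" for w
   using that by (intro cadlag_switch[where F = "%_ p. translate (snd p) (fst p)" and n = "%_. ()"] c)
    (auto simp: space_path_space)
 qed auto
 show ?thesis
  unfolding seen_from_walker_def walker_law_eq by (subst distr_distr) (auto simp: m comp_def joint_path_def seen_path_def cong: measurable_cong_sets restrict_cong
   intro!: distr_cong)
qed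

lemma waiting_gt: "t >= 0 ==> measure waiting {t<..} = exp (- t * rate)"
proof -
 assume t: "t >= 0"
 interpret prob_space waiting by (rule prob_space_waiting)
 have "distributed waiting lborel (%x. x) (exponential_density rate)" by (auto simp: distributed_def exponential_density_nonneg[OF rate_pos] distr_id2)
 from exponential_distributedD_gt[OF this t rate_pos] show ?thesis by (simp add: greaterThan_def)
qed

lemma waiting_pos: "AE e in waitings. ALL k. 0 < e k"
proof -
 interpret product_prob_space "%_. waiting" "UNIV :: nat set" by (intro product_prob_spaceI prob_space_waiting)
 have "AE x in waiting. 0 < x"
 proof (subst AE_density)
  have "AE x in lborel. x ~= (0::real)" by (rule AE_lborel_singleton)
  thus "AE x in lborel. 0 < ennreal (exponential_density rate x) --> 0 < x" by eventually_elim (auto simp: exponential_density_def)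
 qed simp
 thus ?thesis unfolding AE_all_countable by (intro allI AE_component) auto
qed

text \<open>As long as the clock has not rung, the environment seen from the walker is the environment.\<close>

lemma no_arrival:
 assumes t: "t >= 0" and A [measurable]: "A \<in> sets borel"
 shows "exp (- t * rate) * measure (P eta) {w \<in> space path_space. w t \<in> A}
  <= measure (seen_from_walker P rate p eta) {w \<in> space path_space. w t \<in> A}"
proof -
 interpret D: prob_space "driving eta" by (rule prob_space_driving)
 interpret e: prob_space waitings by (rule prob_space_waitings)
 interpret u: prob_space uniforms by (rule prob_space_uniforms)
 interpret eu: prob_space "waitings \<otimes> uniforms" by (rule prob_space_noise)
 interpret W: prob_space waiting by (rule prob_space_waiting)
 interpret PE: product_prob_space "%_. waiting" "UNIV :: nat set" by (intro product_prob_spaceI prob_space_waiting)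
 let ?A = "{w \<in> space path_space. w t \<in> A}"
 have A': "?A \<in> sets path_space" by measurable
 define E where "E = {e \<in> space waitings. t < e 0}"
 define E' where "E' = {e \<in> space waitings. t < e 0 & (ALL k. 0 < e k)}"
 have E [measurable]: "E \<in> sets waitings" "E' \<in> sets waitings" unfolding E_def E'_def by measurable
 have "emeasure waitings E' = emeasure waitings E" by (rule emeasure_eq_AE) (use waiting_pos in "auto simp: E_def E'_def")
 also have "... = emeasure waiting {t<..}" using PE.emeasure_PiM_Collect_single[of 0 "{t<..}"] by (simp add: E_def)
 also have "... = ennreal (exp (- t * rate))" by (simp add: W.emeasure_eq_measure waiting_gt[OF t])
 finally have eE: "emeasure waitings E' = ennreal (exp (- t * rate))" .
 have "emeasure (driving eta) (?A \<times> E' \<times> space uniforms) = emeasure (P eta) ?A * (emeasure waitings E' * emeasure uniforms (space uniforms))"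
  unfolding driving_eq using A' by (subst eu.emeasure_pair_measure_Times, simp_all, subst u.emeasure_pair_measure_Times, simp_all)
 also have "... = ennreal (measure (P eta) ?A * exp (- t * rate))" using prob_space.finite_measure[OF env.prob_space_P, of eta]
  by (simp add: u.emeasure_space_1 eE finite_measure.emeasure_eq_measure ennreal_mult'')
 finally have 1: "emeasure (driving eta) (?A \<times> E' \<times> space uniforms) = ennreal (measure (P eta) ?A * exp (- t * rate))" .
 have "?A \<times> E' \<times> space uniforms \<subseteq> seen_path -` ?A \<inter> space (driving eta)"
 proof
  fix omega assume omega: "omega \<in> ?A \<times> E' \<times> space uniforms"
  hence sp: "omega \<in> space driving_space" by (auto simp: space_pair_measure E'_def)
  have "t < arrival (fst (snd omega)) n" for n
  proof -
   have "fst (snd omega) 0 <= arrival (fst (snd omega)) n"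
    unfolding arrival_def using omega by (intro member_le_sum) (auto simp: E'_def intro: less_imp_le)
   thus ?thesis using omega by (auto simp: E'_def)
  qed
  hence "{n. arrival (fst (snd omega)) n <= t} = {}" by (auto simp: not_le)
  hence "walk omega t = 0" by (simp add: walk_def num_arrivals_def pos_0)
  hence "seen_path omega t = fst omega t" using t by (simp add: seen_path_def)
  thus "omega \<in> seen_path -` ?A \<inter> space (driving eta)" using omega sp measurable_space[OF seen_path_measurable sp] by (auto simp: space_driving)
 qed
 hence "emeasure (driving eta) (?A \<times> E' \<times> space uniforms) <= emeasure (driving eta) (seen_path -` ?A \<inter> space (driving eta))"
  using A' measurable_sets[OF seen_path_measurable A'] by (intro emeasure_mono) (simp_all add: sets_driving space_driving)
 hence "ennreal (measure (P eta) ?A * exp (- t * rate)) <= emeasure (driving eta) (seen_path -` ?A \<inter> space (driving eta))" by (simp only: 1)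
 also have "... = ennreal (measure (seen_from_walker P rate p eta) ?A)"
  unfolding seen_from_walker_eq by (subst measure_distr[OF _ A']) (simp_all add: D.emeasure_eq_measure measurable_cong_sets[OF sets_driving refl])
 finally show ?thesis by (simp add: mult.commute)
qed

end

section \<open>The displacement of the walker\<close>

lemma resamples_measurable:
 assumes "resamples M N T" "f \<in> X \<leadsto> M" "g \<in> X \<leadsto> N"
 shows "(%p. T (f p) (g p)) \<in> X \<leadsto> M" using measurable_compose[OF measurable_Pair[OF assms(2,3)], of "%(x, y). T x y" M] assms(1) by (simp add: resamples_def)

lemma measurable_pair_argument:
 assumes "F \<in> M1 \<otimes> M2 \<leadsto> K" "f \<in> X \<leadsto> M1" "g \<in> X \<leadsto> M2"
 shows "(%p. F (f p, g p)) \<in> X \<leadsto> K" using measurable_compose[OF measurable_Pair[OF assms(2,3)] assms(1)] by simp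

lemma resamples_pair:
 assumes M: "sigma_finite_measure M1" "sigma_finite_measure M2" and N: "prob_space N1" "prob_space N2"
  and T: "resamples M1 N1 T1" "resamples M2 N2 T2"
 shows "resamples (M1 \<otimes> M2) (N1 \<otimes> N2) (%p q. (T1 (fst p) (fst q), T2 (snd p) (snd q)))"
proof (rule resamplesI)
 interpret M1: sigma_finite_measure M1 by fact
 interpret M2: sigma_finite_measure M2 by fact
 interpret N1: prob_space N1 by fact
 interpret N2: prob_space N2 by fact
 interpret N: pair_prob_space N1 N2 ..
 interpret NM: pair_sigma_finite N1 M2 ..
 have m1 [measurable]: "(%(x, y). T1 x y) \<in> M1 \<otimes> N1 \<leadsto> M1" and m2 [measurable]: "(%(x, y). T2 x y) \<in> M2 \<otimes> N2 \<leadsto> M2"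
  using T by (auto simp: resamples_def)
 have "(%x. (T1 (fst (fst x)) (fst (snd x)), T2 (snd (fst x)) (snd (snd x))))
   \<in> (M1 \<otimes> M2) \<otimes> N1 \<otimes> N2 \<leadsto> M1 \<otimes> M2"
  by (intro measurable_Pair resamples_measurable[OF T(1)] resamples_measurable[OF T(2)]) measurable
 thus "(%(p, q). (T1 (fst p) (fst q), T2 (snd p) (snd q))) \<in> (M1 \<otimes> M2) \<otimes> N1 \<otimes> N2 \<leadsto> M1 \<otimes> M2" by (simp add: case_prod_beta')
 show "prob_space (N1 \<otimes> N2)" by (rule N.prob_space_axioms)
 fix F :: "_ => ennreal" assume F: "F \<in> borel_measurable (M1 \<otimes> M2)"
 define H where "H x = nn_integral M2 (%y. F (x, y))" for x
 have H [measurable]: "H \<in> borel_measurable M1"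
  unfolding H_def by (intro M2.borel_measurable_nn_integral) (simp add: case_prod_beta' F)
 have Hx: "H x = nn_integral M2 (%y. nn_integral N2 (%b. F (x, T2 y b)))" if "x \<in> space M1" for x
  unfolding H_def by (rule resamples_nn_integral[OF T(2) N(2)]) (intro measurable_pair_argument[OF F] measurable_const that measurable_ident_sets[OF refl])
 have "nn_integral (M1 \<otimes> M2) (%p. F p) = nn_integral M1 (%x. H x)"
  unfolding H_def by (rule M2.nn_integral_fst[OF F, symmetric])
 also have "... = nn_integral M1 (%x. nn_integral N1 (%a. H (T1 x a)))" by (rule resamples_nn_integral[OF T(1) N(1) H])
 also have "... = nn_integral M1 (%x. nn_integral N1 (%a. nn_integral M2 (%y. nn_integral N2 (%b. F (T1 x a, T2 y b)))))"
  by (intro nn_integral_cong Hx measurable_space[OF m1, of "(x, y)" for x y, simplified]) (auto simp: space_pair_measure)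
 also have "... = nn_integral M1 (%x. nn_integral M2 (%y. nn_integral N1 (%a. nn_integral N2 (%b. F (T1 x a, T2 y b)))))"
 proof (rule nn_integral_cong, rule NM.Fubini'[symmetric])
  fix x assume x: "x \<in> space M1"
  show "(%(a, y). nn_integral N2 (%b. F (T1 x a, T2 y b))) \<in> borel_measurable (N1 \<otimes> M2)"
   unfolding case_prod_beta'
   by (intro N2.borel_measurable_nn_integral) (unfold case_prod_beta', intro measurable_pair_argument[OF F] resamples_measurable[OF T(1)] resamples_measurable[OF T(2)] measurable_const x; measurable)
 qed
 also have "... = nn_integral M1 (%x. nn_integral M2 (%y. nn_integral (N1 \<otimes> N2) (%q. F (T1 x (fst q), T2 y (snd q)))))"
 proof (intro nn_integral_cong)
  fix x y assume "x \<in> space M1" "y \<in> space M2"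
  hence "(%q. F (T1 x (fst q), T2 y (snd q))) \<in> borel_measurable (N1 \<otimes> N2)"
   by (intro measurable_pair_argument[OF F] resamples_measurable[OF T(1)] resamples_measurable[OF T(2)] measurable_const measurable_fst measurable_snd)
  from N2.nn_integral_fst[OF this]
  show "nn_integral N1 (%a. nn_integral N2 (%b. F (T1 x a, T2 y b))) = nn_integral (N1 \<otimes> N2) (%q. F (T1 x (fst q), T2 y (snd q)))" by simp
 qed
 also have "... = nn_integral (M1 \<otimes> M2) (%p. nn_integral (N1 \<otimes> N2) (%q. F (T1 (fst p) (fst q), T2 (snd p) (snd q))))"
 proof -
  have "(%p. nn_integral (N1 \<otimes> N2) (%q. F (T1 (fst p) (fst q), T2 (snd p) (snd q)))) \<in> borel_measurable (M1 \<otimes> M2)"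
   by (intro N.borel_measurable_nn_integral) (unfold case_prod_beta', intro measurable_pair_argument[OF F] resamples_measurable[OF T(1)] resamples_measurable[OF T(2)]; measurable)
  from M2.nn_integral_fst[OF this] show ?thesis by simp
 qed
 finally show "(nn_integral (M1 \<otimes> M2) (%p. F p)) =
   (nn_integral (M1 \<otimes> M2) (%p. nn_integral (N1 \<otimes> N2) (%q. F (T1 (fst p) (fst q), T2 (snd p) (snd q)))))" .
qed

lemma resamples_snd:
 assumes M0: "sigma_finite_measure M0" and M: "sigma_finite_measure M" and N: "prob_space N" and T: "resamples M N T"
 shows "resamples (M0 \<otimes> M) N (%p q. (fst p, T (snd p) q))"
proof (rule resamplesI)
 interpret M0: sigma_finite_measure M0 by fact
 interpret M: sigma_finite_measure M by fact
 interpret N: prob_space N by fact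
 have m [measurable]: "(%(x, y). T x y) \<in> M \<otimes> N \<leadsto> M" using T by (auto simp: resamples_def)
 show "(%(p, q). (fst p, T (snd p) q)) \<in> (M0 \<otimes> M) \<otimes> N \<leadsto> M0 \<otimes> M"
  unfolding case_prod_beta' by (intro measurable_Pair resamples_measurable[OF T]) measurable
 show "prob_space N" by fact
 fix F :: "_ => ennreal" assume F: "F \<in> borel_measurable (M0 \<otimes> M)"
 have "nn_integral (M0 \<otimes> M) (%p. F p) = nn_integral M0 (%x. nn_integral M (%y. F (x, y)))" by (rule M.nn_integral_fst[OF F, symmetric])
 also have "... = nn_integral M0 (%x. nn_integral M (%y. nn_integral N (%b. F (x, T y b))))"
 proof (rule nn_integral_cong)
  fix x assume "x \<in> space M0"
  hence "(%y. F (x, y)) \<in> borel_measurable M" by (intro measurable_pair_argument[OF F] measurable_const measurable_ident_sets[OF refl])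
  from resamples_nn_integral[OF T N this] show "nn_integral M (%y. F (x, y)) = nn_integral M (%y. nn_integral N (%b. F (x, T y b)))" .
 qed
 also have "... = nn_integral (M0 \<otimes> M) (%p. nn_integral N (%q. F (fst p, T (snd p) q)))"
 proof -
  have "(%p. nn_integral N (%q. F (fst p, T (snd p) q))) \<in> borel_measurable (M0 \<otimes> M)"
   by (intro N.borel_measurable_nn_integral) (unfold case_prod_beta', intro measurable_pair_argument[OF F] resamples_measurable[OF T]; measurable)
  from M.nn_integral_fst[OF this] show ?thesis by simp
 qed
 finally show "nn_integral (M0 \<otimes> M) (%p. F p) = nn_integral (M0 \<otimes> M) (%p. nn_integral N (%q. F (fst p, T (snd p) q)))" .
qed

context random_walk
begin

text \<open>
The expectation of the left limit at an exponential time equals, up to the rate, that of the integral up to this time: the compensator of a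
Poisson process at its first point.
\<close>

lemma expectation_at_arrival:
 fixes phi phi' :: "real => real"
 assumes phi [measurable]: "borel_fun phi" and phi' [measurable]: "borel_fun phi'"
  and B: "!!s. abs (phi s) <= B" and lim: "!!a. (%n. phi (a - 1 / real (Suc n))) ----> phi' a"
 shows "integrable waiting (%a. LINT s|lborel. (if 0 <= s & s <= a then phi s else 0))"
  and "LINT a|waiting. phi' a / rate = LINT a|waiting. (LINT s|lborel. (if 0 <= s & s <= a then phi s else 0))"
proof -
 interpret W: prob_space waiting by (rule prob_space_waiting)
 interpret pair_sigma_finite waiting lborel ..
 have B0: "0 <= B" using order.trans[OF abs_ge_zero B] .
 have D: "distributed waiting lborel (%x. x) (exponential_density rate)" by (auto simp: distributed_def exponential_density_nonneg[OF rate_pos] distr_id2)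
 have mean: "integrable waiting (%a. a)" using W.exponential_distributed_expectation[OF rate_pos D] rate_pos not_integrable_integral_eq[of waiting "%a. a"] by fastforce
 have tail: "measure waiting {s..} = exp (- s * rate)" if "s >= 0" for s
 proof -
  have "AE x in waiting. x ~= s" by (subst AE_density) (use AE_lborel_singleton[of s] in "auto elim: eventually_mono")
  hence "measure waiting {s..} = measure waiting {s<..}" by (intro W.finite_measure_eq_AE) (auto simp: less_le)
  thus ?thesis using waiting_gt[OF that] by simp
 qed
 define f where "f a s = (if 0 <= s & s <= a then phi s else 0)" for a s
 have fm [measurable]: "(%(a, s). f a s) \<in> borel_measurable (waiting \<otimes> lborel)" unfolding f_def by measurable
 have fb: "abs (f a s) <= indicator {0..a} s * B" for a s using B[of s] B0 by (auto simp: f_def)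
 have ind: "integrable lborel (%s. indicator {0..a} s * B)" for a :: real by (intro integrable_mult_left integrable_real_indicator) (auto simp: emeasure_lborel_Icc_eq)
 have fi: "integrable lborel (f a)" for a by (rule integrable_dominated[OF ind[of a]])
   (use fb[of a] B0 in "auto simp: f_def abs_mult intro!: AE_I2")
 have nb: "LINT s|lborel. abs (f a s) <= B * abs a" for a
 proof -
  have "LINT s|lborel. abs (f a s) <= LINT s|lborel. indicator {0..a} s * B" using fi fb by (intro integral_mono ind integrable_abs)
  also have "... <= B * abs a" using B0 by (cases "0 <= a") (auto simp: mult.commute mult_nonneg_nonpos)
  finally show ?thesis .
 qed
 have f2: "integrable (waiting \<otimes> lborel) (%(a, s). f a s)"
 proof (rule Fubini_integrable[OF fm])
  show "integrable waiting (%a. LINT s|lborel. norm (case (a, s) of (a, s) => f a s))"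
  proof (rule integrable_dominated)
   show "integrable waiting (%a. B * abs a)" using mean by simp
   show "AE a in waiting. norm (LINT s|lborel. norm (case (a, s) of (a, s) => f a s)) <= norm (B * abs a)" using nb B0 by (intro AE_I2) (simp add: abs_mult)
  qed measurable
  show "AE a in waiting. integrable lborel (%s. case (a, s) of (a, s) => f a s)" using fi by simp
 qed
 show "integrable waiting (%a. LINT s|lborel. (if 0 <= s & s <= a then phi s else 0))" using integrable_fst'[OF f2] by (simp add: f_def)
 define k where "k s = indicator {0..} s * exp (- s * rate)" for s :: real
 have ki: "integrable lborel k"
 proof -
  have "integrable lborel (%a. exponential_density rate a * 1)"
   using W.integrable_const[of 1] by (subst (asm) integrable_real_density) (auto simp: exponential_density_nonneg[OF rate_pos])
  hence "integrable lborel (%a. exponential_density rate a / rate)" by simp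
  also have "(%a. exponential_density rate a / rate) = k" using rate_pos by (auto simp: k_def exponential_density_def)
  finally show ?thesis .
 qed
 have "LINT a|waiting. (LINT s|lborel. f a s) = LINT s|lborel. (LINT a|waiting. f a s)" using Fubini_integral[OF f2] by simp
 also have "... = LINT s|lborel. k s * phi s"
 proof (intro bochner_cong refl)
  fix s
  show "LINT a|waiting. f a s = k s * phi s"
  proof (cases "0 <= s")
   case True
   hence "LINT a|waiting. f a s = LINT a|waiting. phi s * indicator {s..} a" by (intro bochner_cong) (auto simp: f_def)
   also have "... = phi s * measure waiting {s..}" by simp
   finally show ?thesis using True by (simp add: tail k_def)
  qed (simp add: f_def k_def)
 qed
 finally have right: "LINT a|waiting. (LINT s|lborel. f a s) = LINT s|lborel. k s * phi s" .
 have left: "LINT a|waiting. phi' a / rate = LINT a|lborel. k a * phi' a"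
 proof -
  have "LINT a|waiting. phi' a / rate = LINT a|lborel. exponential_density rate a * (phi' a / rate)"
   by (subst integral_real_density) (auto simp: exponential_density_nonneg[OF rate_pos])
  also have "... = LINT a|lborel. k a * phi' a" using rate_pos by (intro bochner_cong) (auto simp: k_def exponential_density_def)
  finally show ?thesis .
 qed
 have [measurable]: "borel_fun k" using borel_measurable_integrable[OF ki] by simp
 define h where "h n = 1 / real (Suc n)" for n
 have h: "h ----> 0" "0 < h n" "h n <= 1" for n
  unfolding h_def using LIMSEQ_Suc[OF lim_1_over_n] by (auto simp: divide_simps)
 have "(%n. LINT a|lborel. k a * phi (a - h n)) ----> (LINT a|lborel. k a * phi' a)"
 proof (rule integral_dominated_convergence[where w = "%a. k a * B"])
  show "AE a in lborel. (%n. k a * phi (a - h n)) ----> k a * phi' a" using lim by (intro AE_I2 tendsto_mult_left) (simp add: h_def)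
  show "AE a in lborel. norm (k a * phi (a - h n)) <= k a * B" for n using B by (intro AE_I2) (auto simp: k_def abs_mult mult_left_mono)
 qed (use ki in auto)
 moreover have "(%n. LINT a|lborel. k a * phi (a - h n)) ----> (LINT s|lborel. k s * phi s)"
 proof -
  have eq: "LINT a|lborel. k a * phi (a - h n) = LINT s|lborel. k (h n + s) * phi s" for n using lborel_integral_real_affine[of 1 "%a. k a * phi (a - h n)" "h n"] by simp
  define k' where "k' s = exp rate * k (s + 1)" for s
  have k'i: "integrable lborel k'"
   unfolding k'_def using lborel_integrable_real_affine[OF ki, of 1 1] by (simp add: add.commute)
  show ?thesis unfolding eq
  proof (rule integral_dominated_convergence[where w = "%a. k' a * B"])
   have "AE s in lborel. s ~= (0::real)" by (rule AE_lborel_singleton)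
   thus "AE s in lborel. (%n. k (h n + s) * phi s) ----> k s * phi s"
   proof eventually_elim
    case (elim s)
    have hs: "(%n. h n + s) ----> 0 + s" by (intro tendsto_intros h)
    have "isCont k s"
    proof (cases "0 < s")
     case True
     hence "\<forall>\<^sub>F x in nhds s. k x = exp (- x * rate)" by (intro eventually_nhds_in_open[THEN eventually_mono, of "{0<..}"]) (auto simp: k_def)
     thus ?thesis by (subst isCont_cong) (auto intro!: continuous_intros)
    next
     case False
     hence "\<forall>\<^sub>F x in nhds s. k x = 0" using elim by (intro eventually_nhds_in_open[THEN eventually_mono, of "{..<0}"]) (auto simp: k_def)
     thus ?thesis by (subst isCont_cong) (auto intro!: continuous_intros)
    qed
    hence "(%n. k (h n + s)) ----> k s" using hs by (intro isCont_tendsto_compose[of s k]) auto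
    thus ?case by (intro tendsto_mult_right)
   qed
   show "AE s in lborel. norm (k (h n + s) * phi s) <= k' s * B" for n
   proof (intro AE_I2)
    fix s
    have "k (h n + s) <= k' s" using h(2,3)[of n] rate_pos by (auto simp: k_def k'_def indicator_def exp_add[symmetric] algebra_simps)
    moreover have "0 <= k (h n + s)" by (simp add: k_def)
    ultimately show "norm (k (h n + s) * phi s) <= k' s * B" using B[of s] by (simp add: abs_mult mult_mono)
   qed
  qed (use k'i in auto)
 qed
 ultimately have "LINT a|lborel. k a * phi' a = LINT s|lborel. k s * phi s" by (rule LIMSEQ_unique)
 with left right show "LINT a|waiting. phi' a / rate = LINT a|waiting. (LINT s|lborel. (if 0 <= s & s <= a then phi s else 0))" by (simp add: f_def)
qed

end

text \<open>
An additive function \<open>G\<close> of the position stands for a coordinate of the walker, which reduces the velocity to scalar statements.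
\<close>

locale walk_observable = random_walk P p rate
 for P :: "('s::polish_space, 'd::finite) config => (real => ('s, 'd) config) measure"
  and p :: "'d lattice => ('s, 'd) config => real" and rate :: real +
 fixes G :: "'d lattice => real"
 assumes G_add: "G (x + y) = G x + G y"
  and square_moment: "integrable (count_space UNIV) (%y. sup_h y * (G y)^2)"
begin

lemma G_zero: "G 0 = 0" using G_add[of 0 0] by simp

lemma first_moment: "integrable (count_space UNIV) (%y. sup_h y * abs (G y))"
proof (rule integrable_dominated)
 show "integrable (count_space UNIV) (%y. sup_h y + sup_h y * (G y)^2)" using integrable_sup_h square_moment by simp
 have "abs (G y) <= 1 + (G y)^2" for y using power2_diff[of "abs (G y)" 1] zero_le_power2[of "abs (G y) - 1"] by (simp add: power2_eq_square)
 hence "sup_h y * abs (G y) <= sup_h y * (1 + (G y)^2)" for y by (intro mult_left_mono sup_h_nonneg)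
 thus "AE y in count_space UNIV. norm (sup_h y * abs (G y)) <= norm (sup_h y + sup_h y * (G y)^2)" by (intro AE_I2) (simp add: abs_mult sup_h_nonneg algebra_simps)
qed simp

definition g :: "('s, 'd) config => real" where
 "g eta = LINT y|count_space UNIV. p y eta * G y"

definition g_bound :: real where
 "g_bound = LINT y|count_space UNIV. sup_h y * abs (G y)"

definition G_square :: real where
 "G_square = LINT y|count_space UNIV. sup_h y * (G y)^2"

lemma term_le: "abs (p y eta * G y) <= sup_h y * abs (G y)" using abs_h_le[of y eta] by (simp add: abs_mult mult_right_mono)

lemma term_integrable: "integrable (count_space UNIV) (%y. p y eta * G y)" by (rule integrable_dominated[OF first_moment])
  (use term_le[of _ eta] in "auto intro!: AE_I2 simp: abs_mult sup_h_nonneg")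

lemma g_le: "abs (g eta) <= g_bound"
proof -
 have "abs (g eta) <= LINT y|count_space UNIV. abs (p y eta * G y)" unfolding g_def by (rule integral_abs_bound)
 also have "... <= g_bound" unfolding g_bound_def by (intro integral_mono integrable_abs term_integrable first_moment term_le)
 finally show ?thesis .
qed

lemma g_continuous: "continuous_on UNIV g"
proof (rule continuous_on_sequentiallyI)
 fix u a assume u: "u ----> (a :: ('s, 'd) config)"
 show "(%n. g (u n)) ----> g a"
  unfolding g_def
 proof (rule integral_dominated_convergence[where w = "%y. sup_h y * abs (G y)"])
  have "(%n. p y (u n)) ----> p y a" for y by (rule continuous_on_tendsto_compose[OF continuous_h u]) auto
  thus "AE y in count_space UNIV. (%n. p y (u n) * G y) ----> p y a * G y" by (intro AE_I2 tendsto_mult_right)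
  show "AE y in count_space UNIV. norm (p y (u n) * G y) <= sup_h y * abs (G y)" for n using term_le by (intro AE_I2) simp
 qed (use first_moment in auto)
qed

lemma g_measurable [measurable]: "borel_fun g" by (rule borel_measurable_continuous_onI[OF g_continuous])

lemma p_summable: "(%y. p y eta) summable_on UNIV"
 unfolding summable_on_iff_integrable by (rule integrable_dominated[OF integrable_sup_h])
  (use abs_h_le[of _ eta] in "auto intro!: AE_I2 simp: sup_h_nonneg")

lemma jump_probabilities: "0 <= p y zeta / rate" "(%y. p y zeta / rate) summable_on UNIV" "(\<Sum>\<^sub>\<infinity>y. p y zeta / rate) <= 1"
proof -
 show "0 <= p y zeta / rate" using p_nonneg rate_pos by simp
 have "((%y. p y zeta * (1 / rate)) has_sum ((\<Sum>\<^sub>\<infinity>y. p y zeta) * (1 / rate))) UNIV" by (intro has_sum_cmult_left has_sum_infsum p_summable)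
 hence *: "((%y. p y zeta / rate) has_sum ((\<Sum>\<^sub>\<infinity>y. p y zeta) / rate)) UNIV" by simp
 thus "(%y. p y zeta / rate) summable_on UNIV" by (rule has_sum_imp_summable)
 show "(\<Sum>\<^sub>\<infinity>y. p y zeta / rate) <= 1" unfolding infsumI[OF *] using p_sum[of zeta] rate_pos by (simp add: divide_simps)
qed

lemma step_mean:
 shows "integrable uniform (%u. G (jump (%y. p y zeta / rate) u))"
  and "LINT u|uniform. G (jump (%y. p y zeta / rate) u) = g zeta / rate"
proof -
 have i: "integrable (count_space UNIV) (%y. p y zeta / rate * G y)" using term_integrable[of zeta] by simp
 note j = jump_integral[where p = "%y. p y zeta / rate" and G = G, OF jump_probabilities G_zero i]
 show "integrable uniform (%u. G (jump (%y. p y zeta / rate) u))" by (rule j)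
 show "LINT u|uniform. G (jump (%y. p y zeta / rate) u) = g zeta / rate" unfolding j g_def by simp
qed

lemma step_square:
 "nn_integral uniform (%u. ennreal ((G (jump (%y. p y zeta / rate) u))^2)) <= ennreal (G_square / rate)"
proof -
 have "nn_integral uniform (%u. ennreal ((G (jump (%y. p y zeta / rate) u))^2))
   = nn_integral (count_space UNIV) (%y. ennreal (p y zeta / rate) * ennreal ((G y)^2))"
  by (rule jump_nn_integral[where p = "%y. p y zeta / rate" and G = "%y. ennreal ((G y)^2)", OF jump_probabilities])
   (simp add: G_zero)
 also have "... <= nn_integral (count_space UNIV) (%y. ennreal (sup_h y * (G y)^2 / rate))"
 proof (intro nn_integral_mono)
  fix y
  have "p y zeta / rate * (G y)^2 <= sup_h y / rate * (G y)^2" using abs_h_le[of y zeta] rate_pos by (intro mult_right_mono divide_right_mono) auto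
  thus "ennreal (p y zeta / rate) * ennreal ((G y)^2) <= ennreal (sup_h y * (G y)^2 / rate)"
   using jump_probabilities(1)[of y zeta] by (subst ennreal_mult[symmetric]) (auto intro!: ennreal_leI)
 qed
 also have "... = ennreal (LINT y|count_space UNIV. sup_h y * (G y)^2 / rate)" using square_moment rate_pos by (intro nn_integral_eq_integral) (auto simp: sup_h_nonneg intro!: AE_I2)
 finally show ?thesis by (simp add: G_square_def)
qed

lemma G_square_nonneg: "0 <= G_square"
 unfolding G_square_def by (intro bochner_nonneg) (simp add: sup_h_nonneg)

definition wait :: "nat => ('s, 'd) driving => real" where
 "wait k omega = fst (snd omega) k"

definition prev :: "nat => ('s, 'd) driving => real" where
 "prev k omega = (\<Sum>i<k. wait i omega)"

definition resample :: "nat => ('s, 'd) driving => real \<times> real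
  => ('s, 'd) driving" where
 "resample k omega q = (fst omega, (fst (snd omega))(k := fst q), (snd (snd omega))(k := snd q))"

definition drift_between :: "nat => ('s, 'd) driving => real" where
 "drift_between k omega = LINT s|lborel. (if 0 <= s & s <= wait k omega then g (translate (pos k omega) (fst omega (prev k omega + s))) else 0)"

text \<open>
The \<open>k\<close>-th jump minus the drift accumulated since the previous arrival, a martingale difference.
\<close>

definition increment :: "nat => ('s, 'd) driving => real" where
 "increment k omega = G (step k omega) - drift_between k omega"

lemma arr_prev: "arr k omega = prev k omega + wait k omega" by (simp add: arr_def arrival_def prev_def wait_def lessThan_Suc_atMost[symmetric])

lemma wait_resample: "j < k ==> wait j (resample k omega q) = wait j omega" "wait k (resample k omega q) = fst q" by (simp_all add: wait_def resample_def)

lemma prev_resample: "j <= k ==> prev j (resample k omega q) = prev j omega"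
 unfolding prev_def by (intro sum.cong refl wait_resample) auto

lemma pos_resample: "j <= k ==> pos j (resample k omega q) = pos j omega"
proof (induction j)
 case (Suc j)
 hence "seen_before j (resample k omega q) = seen_before j omega" by (simp add: seen_before_def arr_prev prev_resample wait_resample) (simp add: resample_def)
 hence "step j (resample k omega q) = step j omega" using Suc.prems by (simp add: step_def resample_def)
 thus ?case using Suc by (simp add: pos_Suc)
qed (simp add: pos_0)

lemma step_resample_past: "j < k ==> step j (resample k omega q) = step j omega" using pos_resample[of "Suc j" k omega q] pos_resample[of j k omega q] by (simp add: pos_Suc)

lemma step_resample:
 "step k (resample k omega q) =
  jump (%y. p y (translate (pos k omega) (Lim (at_left (prev k omega + fst q)) (fst omega))) / rate) (snd q)"
 by (simp add: step_def seen_before_def arr_prev prev_resample wait_resample pos_resample) (simp add: resample_def)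

lemma fst_resample: "fst (resample k omega q) = fst omega" by (simp add: resample_def)

lemma drift_between_resample_past:
 assumes "j < k"
 shows "drift_between j (resample k omega q) = drift_between j omega"
 unfolding drift_between_def fst_resample wait_resample(1)[OF assms]
  prev_resample[OF less_imp_le[OF assms]] pos_resample[OF less_imp_le[OF assms]] ..

lemma drift_between_resample: "drift_between k (resample k omega q) =
 (LINT s|lborel. (if 0 <= s & s <= fst q then g (translate (pos k omega) (fst omega (prev k omega + s))) else 0))"
 unfolding drift_between_def fst_resample wait_resample(2) prev_resample[OF order_refl] pos_resample[OF order_refl] ..

lemma wait_measurable [measurable]: "wait k \<in> borel_measurable driving_space"
 unfolding wait_def by measurable

lemma prev_measurable [measurable]: "prev k \<in> borel_measurable driving_space"
 unfolding prev_def by measurable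

lemma drift_between_measurable [measurable]: "drift_between k \<in> borel_measurable driving_space"
 unfolding drift_between_def
proof (rule lborel.borel_measurable_lebesgue_integral)
 have [measurable]: "(%x. translate (pos k (fst x)) (fst (fst x) (prev k (fst x) + snd x))) \<in> driving_space \<otimes> lborel \<leadsto> borel"
 proof (rule translate_lattice_measurable)
  show "(%x. pos k (fst x)) \<in> driving_space \<otimes> lborel \<leadsto> count_space UNIV" by measurable
  show "(%x. fst (fst x) (prev k (fst x) + snd x)) \<in> driving_space \<otimes> lborel \<leadsto> borel" by (rule path_evaluation_measurable') measurable
 qed
 show "(%(omega, s). if 0 <= s & s <= wait k omega then g (translate (pos k omega) (fst omega (prev k omega + s))) else 0)
   \<in> borel_measurable (driving_space \<otimes> lborel)"
  unfolding case_prod_beta' by measurable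
qed

lemma increment_measurable [measurable]: "increment k \<in> borel_measurable driving_space"
 unfolding increment_def using measurable_compose[OF step_measurable, of G borel k] by measurable

lemma g_bound_nonneg: "0 <= g_bound" using order.trans[OF abs_ge_zero g_le] .

lemma drift_between_le: "abs (drift_between k omega) <= g_bound * abs (wait k omega)"
proof -
 let ?f = "%s. if 0 <= s & s <= wait k omega then g (translate (pos k omega) (fst omega (prev k omega + s))) else 0"
 have b: "abs (?f s) <= indicator {0..wait k omega} s * g_bound" for s using g_le[of "translate (pos k omega) (fst omega (prev k omega + s))"] by auto
 have i: "integrable lborel (%s. indicator {0..wait k omega} s * g_bound)" by (intro integrable_mult_left integrable_real_indicator) (auto simp: emeasure_lborel_Icc_eq)
 have "abs (drift_between k omega) <= LINT s|lborel. indicator {0..wait k omega} s * g_bound"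
  unfolding drift_between_def
 proof (cases "integrable lborel ?f")
  case True
  have "abs (LINT s|lborel. ?f s) <= LINT s|lborel. abs (?f s)" by (rule integral_abs_bound)
  also have "... <= LINT s|lborel. indicator {0..wait k omega} s * g_bound" using True b by (intro integral_mono integrable_abs i)
  finally show "abs (LINT s|lborel. ?f s) <= LINT s|lborel. indicator {0..wait k omega} s * g_bound" .
 qed (simp add: not_integrable_integral_eq g_bound_nonneg)
 also have "... <= g_bound * abs (wait k omega)" using g_bound_nonneg by (cases "0 <= wait k omega") (auto simp: mult.commute mult_nonneg_nonpos)
 finally show ?thesis .
qed

lemma prob_space_fresh: "prob_space (waiting \<otimes> uniform)"
proof -
 interpret e: prob_space waiting by (rule prob_space_waiting)
 interpret u: prob_space uniform by (rule prob_space_uniform)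
 interpret pair_prob_space waiting uniform ..
 show ?thesis by unfold_locales
qed

lemma resamples_driving: "resamples (driving eta) (waiting \<otimes> uniform) (resample k)"
proof -
 have "resamples (driving eta) (waiting \<otimes> uniform)
  (%x q. (fst x, (fst (snd x))(k := fst q), (snd (snd x))(k := snd q)))"
  unfolding driving_eq by (rule resamples_snd[OF _ _ prob_space_fresh resamples_pair[OF _ _ prob_space_waiting prob_space_uniform
    resamples_PiM[OF prob_space_waiting] resamples_PiM[OF prob_space_uniform]]])
   (rule prob_space_imp_sigma_finite, rule env.prob_space_P prob_space_noise prob_space_waitings prob_space_uniforms)+
 thus ?thesis by (simp add: resample_def[abs_def])
qed

lemma waiting_moments:
 shows "integrable waiting (%a. a)" "LINT a|waiting. a = 1 / rate" "integrable waiting (%a. a^2)"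
proof -
 interpret W: prob_space waiting by (rule prob_space_waiting)
 have D: "distributed waiting lborel (%x. x) (exponential_density rate)" by (auto simp: distributed_def exponential_density_nonneg[OF rate_pos] distr_id2)
 show m: "LINT a|waiting. a = 1 / rate" by (rule W.exponential_distributed_expectation[OF rate_pos D])
 thus "integrable waiting (%a. a)" using rate_pos not_integrable_integral_eq[of waiting "%a. a"] by fastforce
 have "LINT a|waiting. a^2 = 2 / rate^2" using W.erlang_ith_moment[OF rate_pos D, of 2] by (simp add: numeral_2_eq_2)
 thus "integrable waiting (%a. a^2)" using rate_pos not_integrable_integral_eq[of waiting "%a. a^2"] by fastforce
qed

end

context walk_observable
begin

text \<open>
Integrating out the uniform variable replaces the jump by \<open>g / rate\<close> at the left limit of the arrival time; integrating out the waiting time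
turns this into the drift accumulated until then.
\<close>

lemma increment_centered:
 assumes omega: "omega \<in> space driving_space" and i: "integrable (waiting \<otimes> uniform) (%q. increment k (resample k omega q))"
 shows "LINT q|(waiting \<otimes> uniform). increment k (resample k omega q) = 0"
proof -
 interpret W: prob_space waiting by (rule prob_space_waiting)
 interpret U: prob_space uniform by (rule prob_space_uniform)
 interpret pair_prob_space waiting uniform ..
 define phi where "phi s = g (translate (pos k omega) (fst omega (prev k omega + s)))" for s
 define phi' where "phi' a = g (translate (pos k omega) (Lim (at_left (prev k omega + a)) (fst omega)))" for a
 have w: "fst omega \<in> space (path_space :: (real => ('s, 'd) config) measure)" using omega by (auto simp: space_pair_measure)
 have w': "(%_ :: real. fst omega) \<in> borel \<leadsto> (path_space :: (real => ('s, 'd) config) measure)" using w by (intro measurable_const) simp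
 have phim: "borel_fun phi"
  unfolding phi_def by (rule measurable_compose[OF measurable_compose[OF path_evaluation_measurable'[OF w'] translate_measurable] g_measurable]) measurable
 have phi'm [measurable]: "borel_fun phi'"
  unfolding phi'_def by (rule measurable_compose[OF measurable_compose[OF path_left_limit_measurable'[OF w'] translate_measurable] g_measurable]) measurable
 have b: "abs (phi s) <= g_bound" for s unfolding phi_def by (rule g_le)
 have b': "abs (phi' s) <= g_bound" for s unfolding phi'_def by (rule g_le)
 have lim: "(%n. phi (a - 1 / real (Suc n))) ----> phi' a" for a
  unfolding phi_def phi'_def using path_left_limit_sequence[OF w, of "prev k omega + a"]
  by (intro continuous_on_tendsto_compose[OF g_continuous] continuous_on_tendsto_compose[OF translate_continuous])
   (auto simp: algebra_simps)
 define J where "J a = LINT s|lborel. (if 0 <= s & s <= a then phi s else 0)" for a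
 note e = expectation_at_arrival[OF phim phi'm b lim, folded J_def]
 have "LINT q|(waiting \<otimes> uniform). increment k (resample k omega q) = LINT a|waiting. LINT u|uniform. increment k (resample k omega (a, u))"
  by (rule integral_fst'[OF i, symmetric])
 also have "... = LINT a|waiting. phi' a / rate - J a"
 proof (intro bochner_cong refl)
  fix a
  have "(LINT u|uniform. increment k (resample k omega (a, u))) =
   (LINT u|uniform. G (jump (%y. p y (translate (pos k omega) (Lim (at_left (prev k omega + a)) (fst omega))) / rate) u) - J a)"
   unfolding increment_def step_resample drift_between_resample J_def phi_def fst_conv snd_conv ..
  also have "... = phi' a / rate - J a" by (subst Bochner_Integration.integral_diff) (simp_all add: step_mean phi'_def U.prob_space[simplified])
  finally show "LINT u|uniform. increment k (resample k omega (a, u)) = phi' a / rate - J a" .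
 qed
 also have "... = 0"
 proof -
  have "integrable waiting (%a. phi' a / rate)" using b' rate_pos by (intro W.integrable_const_bound[where B = "g_bound / rate"]) (auto simp: divide_right_mono intro!: AE_I2)
  thus ?thesis using e by simp
 qed
 finally show ?thesis .
qed

text \<open>
The square of the jump has a bounded mean by the second moment condition, that of the drift by the second moment of the waiting time.
\<close>

lemma increment_square:
 "nn_integral (driving eta) (%omega. ennreal ((increment k omega)^2)) <= ennreal (2 * G_square / rate + 2 * g_bound^2 * (LINT a|waiting. a^2))"
proof -
 interpret W: prob_space waiting by (rule prob_space_waiting)
 interpret U: prob_space uniform by (rule prob_space_uniform)
 interpret pair_prob_space waiting uniform ..
 interpret D: prob_space "driving eta" by (rule prob_space_driving)
 let ?C = "2 * G_square / rate + 2 * g_bound^2 * (LINT a|waiting. a^2)"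
 have [measurable]: "(%omega. ennreal ((increment k omega)^2)) \<in> borel_measurable (driving eta)" by measurable
 have "(nn_integral (driving eta) (%omega. ennreal ((increment k omega)^2))) =
   (nn_integral (driving eta) (%omega. nn_integral (waiting \<otimes> uniform) (%q. ennreal ((increment k (resample k omega q))^2))))"
  by (rule resamples_nn_integral[OF resamples_driving prob_space_fresh]) measurable
 also have "... <= nn_integral (driving eta) (%omega. ennreal ?C)"
 proof (intro nn_integral_mono)
  fix omega assume omega: "omega \<in> space (driving eta)"
  have [measurable]: "(%q. resample k omega q) \<in> waiting \<otimes> uniform \<leadsto> driving eta"
   using resamples_measurable[OF resamples_driving measurable_const[OF omega] measurable_ident_sets[OF refl]] by simp
  have "nn_integral (waiting \<otimes> uniform) (%q. ennreal ((increment k (resample k omega q))^2))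
    = nn_integral waiting (%a. nn_integral uniform (%u. ennreal ((increment k (resample k omega (a, u)))^2)))" by (rule U.nn_integral_fst[symmetric]) measurable
  also have "... <= nn_integral waiting (%a. ennreal (2 * G_square / rate + 2 * g_bound^2 * a^2))"
  proof (intro nn_integral_mono)
   fix a
   define p' where "p' = (%y. p y (translate (pos k omega) (Lim (at_left (prev k omega + a)) (fst omega))) / rate)"
   have m: "(%u. jump p' u) \<in> uniform \<leadsto> count_space UNIV"
    unfolding p'_def by (rule jump_measurable) (auto simp: jump_probabilities(1) measurable_cong_sets[OF sets_uniform_measure refl])
   have [measurable]: "(%u. G (jump p' u)) \<in> borel_measurable uniform" by (rule measurable_compose[OF m]) simp
   have "nn_integral uniform (%u. ennreal ((increment k (resample k omega (a, u)))^2))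
     <= nn_integral uniform (%u. 2 * ennreal ((G (jump p' u))^2) + ennreal (2 * g_bound^2 * a^2))"
   proof (intro nn_integral_mono)
    fix u
    have s: "step k (resample k omega (a, u)) = jump p' u" by (simp add: step_resample p'_def)
    have d: "abs (drift_between k (resample k omega (a, u))) <= g_bound * abs a" using drift_between_le[of k "resample k omega (a, u)"] by (simp add: wait_resample)
    define v where "v = drift_between k (resample k omega (a, u))"
    define z where "z = G (jump p' u)"
    have "(abs v)\<^sup>2 <= (g_bound * abs a)^2" unfolding v_def by (rule power_mono[OF d]) simp
    hence 1: "v^2 <= g_bound^2 * a^2" unfolding power_mult_distrib power2_abs .
    have 2: "(z - v)^2 <= 2 * z^2 + 2 * v^2" using zero_le_power2[of "z + v"] unfolding power2_sum power2_diff by linarith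
    have "(increment k (resample k omega (a, u)))^2 = (z - v)^2" by (simp only: increment_def s z_def v_def)
    also have "... <= 2 * z^2 + 2 * g_bound^2 * a^2" using order.trans[OF 2 add_left_mono[OF mult_left_mono[OF 1, of 2]]] by (simp add: mult.assoc)
    finally have "(increment k (resample k omega (a, u)))^2 <= 2 * (G (jump p' u))^2 + 2 * g_bound^2 * a^2" unfolding z_def .
    hence "ennreal ((increment k (resample k omega (a, u)))^2) <= ennreal (2 * (G (jump p' u))^2 + 2 * g_bound^2 * a^2)" by (rule ennreal_leI)
    also have "... = 2 * ennreal ((G (jump p' u))^2) + ennreal (2 * g_bound^2 * a^2)" by (simp add: ennreal_plus ennreal_mult')
    finally show "ennreal ((increment k (resample k omega (a, u)))^2) <= 2 * ennreal ((G (jump p' u))^2) + ennreal (2 * g_bound^2 * a^2)" .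
   qed
   also have "... = 2 * nn_integral uniform (%u. ennreal ((G (jump p' u))^2)) + ennreal (2 * g_bound^2 * a^2)"
    by (subst nn_integral_add) (auto simp: nn_integral_cmult U.emeasure_space_1[simplified])
   also have "... <= 2 * ennreal (G_square / rate) + ennreal (2 * g_bound^2 * a^2)"
    unfolding p'_def by (intro add_right_mono mult_left_mono step_square) simp
   also have "... = ennreal (2 * G_square / rate + 2 * g_bound^2 * a^2)"
    using G_square_nonneg rate_pos by (simp add: ennreal_plus ennreal_mult' times_divide_eq_right[symmetric] del: times_divide_eq_right)
   finally show "nn_integral uniform (%u. ennreal ((increment k (resample k omega (a, u)))^2)) <= ennreal (2 * G_square / rate + 2 * g_bound^2 * a^2)" .
  qed
  also have "... = ennreal (LINT a|waiting. 2 * G_square / rate + 2 * g_bound^2 * a^2)"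
   using waiting_moments(3) G_square_nonneg rate_pos by (intro nn_integral_eq_integral) (auto intro!: AE_I2)
  also have "LINT a|waiting. 2 * G_square / rate + 2 * g_bound^2 * a^2 = ?C" using waiting_moments(3) W.prob_space by (subst Bochner_Integration.integral_add) auto
  finally show "nn_integral (waiting \<otimes> uniform) (%q. ennreal ((increment k (resample k omega q))^2)) <= ennreal ?C" .
 qed
 also have "... = ennreal ?C" using D.emeasure_space_1 by simp
 finally show ?thesis .
qed

lemma L2_of_nn_integral_square:
 assumes f [measurable]: "f \<in> borel_measurable M" and le: "nn_integral M (%x. ennreal ((f x)^2)) <= ennreal C" and C: "0 <= C"
 shows "f \<in> L2 M" "LINT x|M. (f x)^2 <= C"
proof -
 have int: "integrable M (%x. (f x)^2)" by (rule integrableI_bounded) (use le in "auto intro: order.strict_trans1")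
 thus "f \<in> L2 M" by (simp add: L2_def)
 have "nn_integral M (%x. ennreal ((f x)^2)) = ennreal (LINT x|M. (f x)^2)" using int by (intro nn_integral_eq_integral) auto
 thus "LINT x|M. (f x)^2 <= C" using le C by (simp add: ennreal_le_iff)
qed

lemma increments_average:
 "AE omega in driving eta. (%n. (\<Sum>k<n. increment k omega) / real n) ----> 0"
proof -
 interpret D: prob_space "driving eta" by (rule prob_space_driving)
 let ?C = "2 * G_square / rate + 2 * g_bound^2 * (LINT a|waiting. a^2)"
 have C0: "0 <= ?C" using G_square_nonneg rate_pos by (intro add_nonneg_nonneg mult_nonneg_nonneg bochner_nonneg) auto
 have m: "increment k \<in> borel_measurable (driving eta)" for k by measurable
 note L2 = L2_of_nn_integral_square[OF m increment_square C0]
 show ?thesis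
 proof (rule D.martingale_difference_law_of_large_numbers[OF L2 prob_space_fresh resamples_driving])
  show "increment j (resample k omega q) = increment j omega" if "j < k" for j k omega q using that by (simp add: increment_def step_resample_past drift_between_resample_past)
  fix k
  have "AE omega in driving eta. integrable (waiting \<otimes> uniform) (%q. increment k (resample k omega q))"
   by (rule resamples_integral(1)[OF resamples_driving D.sigma_finite_measure_axioms prob_space_fresh D.L2_integrable[OF L2(1)]])
  thus "AE omega in driving eta. (LINT q|(waiting \<otimes> uniform). increment k (resample k omega q)) = 0"
   using AE_space[of "driving eta"] by eventually_elim (auto intro: increment_centered simp: space_driving)
 qed
qed

lemma waits_average:
 "AE omega in driving eta. (%n. prev n omega / real n) ----> 1 / rate"
proof -
 interpret D: prob_space "driving eta" by (rule prob_space_driving)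
 interpret W: prob_space waiting by (rule prob_space_waiting)
 interpret U: prob_space uniform by (rule prob_space_uniform)
 interpret pair_prob_space waiting uniform ..
 define d where "d k omega = wait k omega - 1 / rate" for k and omega :: "('s, 'd) driving"
 let ?C = "LINT a|waiting. (a - 1 / rate)^2"
 have sq: "integrable waiting (%a. (a - 1 / rate)^2)" using waiting_moments by (simp add: power2_diff)
 have m [measurable]: "d k \<in> borel_measurable (driving eta)" for k unfolding d_def by measurable
 have le: "nn_integral (driving eta) (%omega. ennreal ((d k omega)^2)) <= ennreal ?C" for k
 proof -
  have "(nn_integral (driving eta) (%omega. ennreal ((d k omega)^2))) =
   (nn_integral (driving eta) (%omega. nn_integral (waiting \<otimes> uniform) (%q. ennreal ((d k (resample k omega q))^2))))"
   by (rule resamples_nn_integral[OF resamples_driving prob_space_fresh]) measurable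
  also have "... = nn_integral (driving eta) (%omega. nn_integral (waiting \<otimes> uniform) (%q. ennreal ((fst q - 1 / rate)^2)))" by (simp add: d_def wait_resample)
  also have "... = nn_integral (waiting \<otimes> uniform) (%q. ennreal ((fst q - 1 / rate)^2))" using D.emeasure_space_1 by simp
  also have "... = nn_integral waiting (%a. nn_integral uniform (%u. ennreal ((a - 1 / rate)^2)))" by (subst U.nn_integral_fst[symmetric]) simp_all
  also have "... = nn_integral waiting (%a. ennreal ((a - 1 / rate)^2))" by (simp add: U.emeasure_space_1[simplified])
  also have "... = ennreal ?C" using sq by (intro nn_integral_eq_integral) auto
  finally show ?thesis by simp
 qed
 note L2 = L2_of_nn_integral_square[OF m le bochner_nonneg[OF zero_le_power2]]
 have "AE omega in driving eta. (%n. (\<Sum>k<n. d k omega) / real n) ----> 0"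
 proof (rule D.martingale_difference_law_of_large_numbers[OF L2 prob_space_fresh resamples_driving])
  show "d j (resample k omega q) = d j omega" if "j < k" for j k omega q using that by (simp add: d_def wait_resample)
  fix k
  have i: "integrable (waiting \<otimes> uniform) (%(a, u). a - 1 / rate)"
  proof (rule Fubini_integrable)
   show "AE a in waiting. integrable uniform (%u. case (a, u) of (a, u) => a - 1 / rate)" by simp
   show "integrable waiting (%a. LINT u|uniform. norm (case (a, u) of (a, u) => a - 1 / rate))" using waiting_moments(1) U.prob_space by simp
  qed measurable
  have "LINT q|(waiting \<otimes> uniform). fst q - 1 / rate = LINT a|waiting. LINT u|uniform. a - 1 / rate" using integral_fst'[OF i] by (simp add: case_prod_beta')
  also have "... = LINT a|waiting. a - 1 / rate" using U.prob_space by simp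
  also have "... = 0" using waiting_moments W.prob_space by simp
  finally show "AE omega in driving eta. (LINT q|(waiting \<otimes> uniform). d k (resample k omega q)) = 0" by (simp add: d_def wait_resample)
 qed
 thus ?thesis
 proof eventually_elim
  case (elim omega)
  hence "(%n. (\<Sum>k<n. d k omega) / real n + 1 / rate) ----> 0 + 1 / rate" by (intro tendsto_intros)
  moreover have "\<forall>\<^sub>F n in sequentially. (\<Sum>k<n. d k omega) / real n + 1 / rate = prev n omega / real n"
   using eventually_gt_at_top[of 0] by eventually_elim (simp add: d_def prev_def sum_subtractf diff_divide_distrib)
  ultimately show ?case by (simp add: tendsto_cong)
 qed
qed

lemma waits_positive: "AE omega in driving eta. ALL k. 0 < wait k omega"
proof -
 interpret p: prob_space "P eta" by (rule env.prob_space_P)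
 interpret e: prob_space waitings by (rule prob_space_waitings)
 interpret u: prob_space uniforms by (rule prob_space_uniforms)
 interpret eu: pair_prob_space waitings uniforms ..
 interpret peu: pair_prob_space "P eta" "waitings \<otimes> uniforms" ..
 have "AE x in waitings \<otimes> uniforms. ALL k. 0 < fst x k"
 proof (rule eu.AE_pair_measure)
  show "{x \<in> space (waitings \<otimes> uniforms). ALL k. 0 < fst x k} \<in> sets (waitings \<otimes> uniforms)" by measurable
  show "AE x in waitings. AE y in uniforms. ALL k. 0 < fst (x, y) k" using waiting_pos by eventually_elim simp
 qed
 hence "AE omega in P eta \<otimes> (waitings \<otimes> uniforms). ALL k. 0 < wait k omega"
 proof (intro peu.AE_pair_measure)
  show "{omega \<in> space (P eta \<otimes> (waitings \<otimes> uniforms)). ALL k. 0 < wait k omega} \<in> sets (P eta \<otimes> (waitings \<otimes> uniforms))"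
   unfolding wait_def by measurable
 qed (auto simp: wait_def)
 thus ?thesis by (simp only: driving_eq)
qed

end

lemma set_integrable_bounded_interval:
 fixes h :: "real => real"
 assumes h [measurable]: "borel_fun h" and B: "!!s. abs (h s) <= B"
 shows "set_integrable lborel {a..<b} h"
 unfolding set_integrable_def
proof (rule integrable_dominated)
 show "integrable lborel (%s. indicator {a..<b} s * B)" by (intro integrable_mult_left integrable_real_indicator) (cases "a <= b"; simp add: emeasure_lborel_Ico)+
 show "AE s in lborel. norm (indicator {a..<b} s *\<^sub>R h s) <= norm (indicator {a..<b} s * B)" using order.trans[OF B abs_ge_self] by (intro AE_I2) (auto simp: indicator_def)
 show "(%s. indicator {a..<b} s *\<^sub>R h s) \<in> borel_measurable lborel" using h by (intro borel_measurable_scaleR borel_measurable_indicator) simp_all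
qed

lemma set_integral_interval_le:
 fixes h :: "real => real"
 assumes h: "borel_fun h" and B: "!!s. abs (h s) <= B" and ab: "a <= b"
 shows "abs (LINT s:{a..<b}|lborel. h s) <= B * (b - a)"
proof -
 have i: "set_integrable lborel {a..<b} h" by (rule set_integrable_bounded_interval[OF h B])
 have c: "integrable lborel (%s. indicator {a..<b} s * B)" by (intro integrable_mult_left integrable_real_indicator) (cases "a <= b"; simp add: emeasure_lborel_Ico)+
 have "abs (LINT s:{a..<b}|lborel. h s) <= LINT s|lborel. abs (indicator {a..<b} s *\<^sub>R h s)"
  unfolding set_lebesgue_integral_def by (rule integral_abs_bound)
 also have "... <= LINT s|lborel. indicator {a..<b} s * B" using i B by (intro integral_mono integrable_abs c) (auto simp: set_integrable_def indicator_def)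
 also have "... = B * (b - a)" using ab by (simp add: mult.commute)
 finally show ?thesis .
qed

lemma set_integral_interval_split:
 fixes h :: "real => real"
 assumes h: "borel_fun h" and B: "!!s. abs (h s) <= B" and ab: "a <= b" "b <= c"
 shows "(LINT s:{a..<c}|lborel. h s) = (LINT s:{a..<b}|lborel. h s) + (LINT s:{b..<c}|lborel. h s)"
proof -
 have "{a..<c} = {a..<b} \<union> {b..<c}" using ab by auto
 thus ?thesis using set_integral_Un[of "{a..<b}" "{b..<c}" lborel h] set_integrable_bounded_interval[OF h B] by simp
qed

context walk_observable
begin

lemma prev_mono:
 assumes "ALL k. 0 < wait k omega" "m <= n"
 shows "prev m omega <= prev n omega"
 unfolding prev_def using assms by (intro sum_mono2) (auto intro: less_imp_le)

lemma prev_Suc: "prev (Suc n) omega = prev n omega + wait n omega" by (simp add: prev_def)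

lemma num_arrivals_between:
 assumes w: "ALL k. 0 < wait k omega" and lim: "filterlim (%n. prev n omega) at_top sequentially"
  and t: "prev n omega <= t" "t < prev (Suc n) omega"
 shows "num_arrivals (fst (snd omega)) t = n"
proof -
 have a: "arrival (fst (snd omega)) = (%n. prev (Suc n) omega)" using arr_prev[of _ omega] by (simp add: fun_eq_iff arr_def prev_Suc)
 have "filterlim (arrival (fst (snd omega))) at_top sequentially"
  unfolding a by (rule filterlim_compose[OF lim filterlim_Suc])
 moreover have "{j. arrival (fst (snd omega)) j <= t} = {..<n}"
 proof (intro set_eqI)
  fix j
  show "j \<in> {j. arrival (fst (snd omega)) j <= t} \<longleftrightarrow> j \<in> {..<n}"
  proof (cases "j < n")
   case True
   thus ?thesis using prev_mono[OF w, of "Suc j" n] t by (simp add: a)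
  next
   case False
   thus ?thesis using prev_mono[OF w, of "Suc n" "Suc j"] t by (simp add: a)
  qed
 qed
 ultimately show ?thesis by (simp add: num_arrivals_def)
qed

lemma num_arrivals_bounds:
 assumes w: "ALL k. 0 < wait k omega" and lim: "filterlim (%n. prev n omega) at_top sequentially" and t: "0 <= t"
 shows "prev (num_arrivals (fst (snd omega)) t) omega <= t" "t < prev (Suc (num_arrivals (fst (snd omega)) t)) omega"
proof -
 have "\<forall>\<^sub>F n in sequentially. t < prev n omega" using lim by (simp add: filterlim_at_top_dense)
 then obtain N where "t < prev N omega" by (auto simp: eventually_sequentially)
 hence ex: "EX n. t < prev (Suc n) omega" using prev_mono[OF w, of N "Suc N"] by (intro exI[of _ N]) simp
 define n where "n = (LEAST n. t < prev (Suc n) omega)"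
 have 1: "t < prev (Suc n) omega" unfolding n_def by (rule LeastI_ex[OF ex])
 have 2: "prev n omega <= t"
 proof (cases n)
  case 0
  thus ?thesis using t by (simp add: prev_def)
 next
  case (Suc m)
  hence "\<not> t < prev (Suc m) omega" using not_less_Least[of m "%n. t < prev (Suc n) omega"] by (simp add: n_def)
  thus ?thesis using Suc by simp
 qed
 have "num_arrivals (fst (snd omega)) t = n" by (rule num_arrivals_between[OF w lim 2 1])
 thus "prev (num_arrivals (fst (snd omega)) t) omega <= t" "t < prev (Suc (num_arrivals (fst (snd omega)) t)) omega" using 1 2 by simp_all
qed

lemma G_pos: "G (pos n omega) = (\<Sum>k<n. G (step k omega))" by (induction n) (simp_all add: pos_0 pos_Suc G_zero G_add)

lemma seen_drift_measurable:
 assumes omega: "omega \<in> space driving_space"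
 shows "borel_fun (%s. g (seen_path omega s))"
proof -
 have "(%_ :: real. seen_path omega) \<in> borel \<leadsto> (path_space :: (real => ('s, 'd) config) measure)"
  using measurable_space[OF seen_path_measurable omega] by (intro measurable_const) simp
 from measurable_compose[OF path_evaluation_measurable'[OF this measurable_ident_sets[OF refl]] g_measurable]
 show ?thesis by simp
qed

lemma drift_between_eq:
 assumes omega: "omega \<in> space driving_space" and w: "ALL k. 0 < wait k omega" and lim: "filterlim (%n. prev n omega) at_top sequentially"
 shows "drift_between n omega = (LINT s:{prev n omega..<prev (Suc n) omega}|lborel. g (seen_path omega s))"
proof -
 note [measurable] = seen_drift_measurable[OF omega]
 have "(%_ :: real. fst omega) \<in> borel \<leadsto> (path_space :: (real => ('s, 'd) config) measure)"
  using omega by (intro measurable_const) (auto simp: space_pair_measure)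
 from measurable_compose[OF measurable_compose[OF path_evaluation_measurable'[OF this measurable_ident_sets[OF refl]] translate_measurable[of "pos n omega"]] g_measurable]
 have gm: "(%x. g (translate (pos n omega) (fst omega x))) \<in> borel_measurable lborel" by simp
 have "drift_between n omega = LINT x|lborel. (if prev n omega <= x & x <= prev (Suc n) omega then g (translate (pos n omega) (fst omega x)) else 0)"
  unfolding drift_between_def prev_Suc
  by (subst lborel_integral_real_affine[of 1 "%x. if prev n omega <= x & x <= prev n omega + wait n omega then g (translate (pos n omega) (fst omega x)) else 0" "prev n omega"]) (simp_all cong: if_cong)
 also have "... = LINT x|lborel. indicator {prev n omega..<prev (Suc n) omega} x *\<^sub>R g (seen_path omega x)"
 proof (rule integral_cong_AE)
  have "AE x in lborel. x ~= prev (Suc n) omega" by (rule AE_lborel_singleton)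
  thus "AE x in lborel. (if prev n omega <= x & x <= prev (Suc n) omega then g (translate (pos n omega) (fst omega x)) else 0)
    = indicator {prev n omega..<prev (Suc n) omega} x *\<^sub>R g (seen_path omega x)"
  proof eventually_elim
   case (elim x)
   show ?case
   proof (cases "prev n omega <= x & x < prev (Suc n) omega")
    case True
    have "0 <= x" using prev_mono[OF w, of 0 n] True by (simp add: prev_def)
    moreover have "walk omega x = pos n omega"
     unfolding walk_def using num_arrivals_between[OF w lim conjunct1[OF True] conjunct2[OF True]] by simp
    ultimately have "seen_path omega x = translate (pos n omega) (fst omega x)" by (simp add: seen_path_def)
    thus ?thesis using True by simp
   next
    case False
    hence "\<not> (prev n omega <= x & x <= prev (Suc n) omega)" "x \<notin> {prev n omega..<prev (Suc n) omega}" using elim by auto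
    thus ?thesis by (auto simp: indicator_def)
   qed
  qed
 next
  show "(%x. if prev n omega <= x & x <= prev (Suc n) omega then g (translate (pos n omega) (fst omega x)) else 0) \<in> borel_measurable lborel"
   by (rule measurable_If[OF gm measurable_const]) simp_all
  show "(%x. indicator {prev n omega..<prev (Suc n) omega} x *\<^sub>R g (seen_path omega x)) \<in> borel_measurable lborel"
   using seen_drift_measurable[OF omega] by (intro borel_measurable_scaleR borel_measurable_indicator) simp_all
 qed
 finally show ?thesis by (simp add: set_lebesgue_integral_def)
qed

lemma displacement_decomposition:
 assumes omega: "omega \<in> space driving_space" and w: "ALL k. 0 < wait k omega" and lim: "filterlim (%n. prev n omega) at_top sequentially"
  and t: "0 <= t" and n: "n = num_arrivals (fst (snd omega)) t"
 shows "abs (G (walk omega t) - (LINT s:{0..<t}|lborel. g (seen_path omega s)))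
  <= abs (\<Sum>k<n. increment k omega) + g_bound * (prev (Suc n) omega - prev n omega)"
proof -
 note m = seen_drift_measurable[OF omega]
 have b: "abs (g (seen_path omega s)) <= g_bound" for s by (rule g_le)
 note split = set_integral_interval_split[where h = "%s. g (seen_path omega s)", OF m b]
 note nt = num_arrivals_bounds[OF w lim t, folded n]
 have p0: "0 <= prev k omega" for k using prev_mono[OF w, of 0 k] by (simp add: prev_def)
 have sum: "(LINT s:{0..<prev k omega}|lborel. g (seen_path omega s)) = (\<Sum>i<k. drift_between i omega)" for k
 proof (induction k)
  case 0
  thus ?case by (simp add: prev_def set_lebesgue_integral_def)
 next
  case (Suc k)
  have "(LINT s:{0..<prev (Suc k) omega}|lborel. g (seen_path omega s)) =
    (LINT s:{0..<prev k omega}|lborel. g (seen_path omega s)) + (LINT s:{prev k omega..<prev (Suc k) omega}|lborel. g (seen_path omega s))"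
   by (rule split) (use p0 prev_mono[OF w] in auto)
  thus ?case by (simp add: Suc.IH drift_between_eq[OF omega w lim])
 qed
 have "(LINT s:{0..<t}|lborel. g (seen_path omega s)) =
   (LINT s:{0..<prev n omega}|lborel. g (seen_path omega s)) + (LINT s:{prev n omega..<t}|lborel. g (seen_path omega s))" by (rule split) (use p0 nt in auto)
 hence "G (walk omega t) - (LINT s:{0..<t}|lborel. g (seen_path omega s)) =
   (\<Sum>k<n. increment k omega) - (LINT s:{prev n omega..<t}|lborel. g (seen_path omega s))" by (simp add: walk_def n[symmetric] G_pos sum increment_def sum_subtractf)
 moreover have "abs (LINT s:{prev n omega..<t}|lborel. g (seen_path omega s)) <= g_bound * (t - prev n omega)" by (rule set_integral_interval_le[OF m b nt(1)])
 moreover have "g_bound * (t - prev n omega) <= g_bound * (prev (Suc n) omega - prev n omega)" using nt by (intro mult_left_mono g_bound_nonneg) auto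
 ultimately show ?thesis by linarith
qed

text \<open>
The number of arrivals up to \<open>t\<close> is of order \<open>rate t\<close>, so that averages over arrivals are averages over time, and the drift
since the last arrival is negligible.
\<close>

lemma displacement_limit:
 "AE omega in driving eta. ((%t. (G (walk omega t) - (LINT s:{0..<t}|lborel. g (seen_path omega s))) / t) ---> 0) at_top"
 using increments_average[of eta] waits_average[of eta] waits_positive[of eta] AE_space[of "driving eta"]
proof eventually_elim
 case (elim omega)
 have omega: "omega \<in> space driving_space" using elim(4) by (simp add: space_driving)
 have r: "0 < 1 / rate" using rate_pos by simp
 have "filterlim (%n. prev n omega / real n * real n) at_top sequentially" by (rule filterlim_tendsto_pos_mult_at_top[OF elim(2) r filterlim_real_sequentially])
 moreover have "\<forall>\<^sub>F n in sequentially. prev n omega / real n * real n = prev n omega" using eventually_gt_at_top[of 0] by eventually_elim simp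
 ultimately have lim: "filterlim (%n. prev n omega) at_top sequentially" by (simp cong: filterlim_cong)
 let ?n = "%t. num_arrivals (fst (snd omega)) t"
 have nlim: "filterlim ?n at_top at_top"
  unfolding filterlim_at_top
 proof
  fix N
  have "\<forall>\<^sub>F t in at_top. max 0 (prev (Suc N) omega) <= t" by (rule eventually_ge_at_top)
  thus "\<forall>\<^sub>F t in at_top. N <= ?n t"
  proof eventually_elim
   case (elim t)
   hence "prev (Suc N) omega < prev (Suc (?n t)) omega" using num_arrivals_bounds(2)[OF _ lim, of t] \<open>ALL k. 0 < wait k omega\<close> by auto
   hence "\<not> Suc (?n t) <= Suc N" using prev_mono[OF \<open>ALL k. 0 < wait k omega\<close>, of "Suc (?n t)" "Suc N"] by linarith
   thus ?case by simp
  qed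
 qed
 define q where "q n = (abs ((\<Sum>k<n. increment k omega) / real n) + g_bound * (prev (Suc n) omega / real n - prev n omega / real n)) / (prev n omega / real n)" for n
 have "(%n. prev (Suc n) omega / real (Suc n) * (1 + 1 / real n)) ----> 1 / rate * (1 + 0)" by (intro tendsto_intros LIMSEQ_Suc elim(2) lim_1_over_n)
 moreover have "\<forall>\<^sub>F n in sequentially. prev (Suc n) omega / real (Suc n) * (1 + 1 / real n) = prev (Suc n) omega / real n" using eventually_gt_at_top[of 0]
 proof eventually_elim
  case (elim n)
  have "1 + 1 / real n = real (Suc n) / real n" using elim by (simp add: field_simps)
  thus ?case by (simp del: of_nat_Suc)
 qed
 ultimately have "(%n. prev (Suc n) omega / real n) ----> 1 / rate" by (simp add: tendsto_cong)
 from tendsto_divide[OF tendsto_add[OF tendsto_rabs[OF elim(1)]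
    tendsto_mult[OF tendsto_const[of g_bound] tendsto_diff[OF this elim(2)]]] elim(2)] r
 have "q ----> (abs 0 + g_bound * (1 / rate - 1 / rate)) / (1 / rate)" unfolding q_def by simp
 have q0: "q ----> 0" using \<open>q ----> _\<close> by simp
 have qt: "((%t. q (?n t)) ---> 0) at_top" by (rule filterlim_compose[OF q0 nlim])
 show ?case
 proof (rule Lim_null_comparison[OF _ qt])
  show "\<forall>\<^sub>F t in at_top. norm ((G (walk omega t) - (LINT s:{0..<t}|lborel. g (seen_path omega s))) / t) <= q (?n t)"
   using filterlim_at_top[THEN iffD1, OF nlim, rule_format, of 1] eventually_gt_at_top[of 0]
  proof eventually_elim
   case (elim t)
   define n where "n = ?n t"
   have n: "0 < real n" using elim by (simp add: n_def)
   have w: "ALL k. 0 < wait k omega" by fact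
   have pn: "0 < prev n omega"
   proof -
    have "0 < wait 0 omega" using w by blast
    hence "0 < prev 1 omega" by (simp add: prev_def)
    thus ?thesis using prev_mono[OF w, of 1 n] elim by (simp add: n_def)
   qed
   have pt: "prev n omega <= t" using num_arrivals_bounds(1)[OF w lim, of t] elim by (simp add: n_def)
   have pS: "prev n omega <= prev (Suc n) omega" by (rule prev_mono[OF w]) simp
   have "norm ((G (walk omega t) - (LINT s:{0..<t}|lborel. g (seen_path omega s))) / t) =
     abs (G (walk omega t) - (LINT s:{0..<t}|lborel. g (seen_path omega s))) / t" using elim by simp
   also have "... <= (abs (\<Sum>k<n. increment k omega) + g_bound * (prev (Suc n) omega - prev n omega)) / prev n omega"
    using displacement_decomposition[OF omega w lim _ n_def] elim pn pt pS g_bound_nonneg by (intro frac_le add_nonneg_nonneg mult_nonneg_nonneg) auto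
   also have "... = q n"
   proof -
    have "q n = ((abs (\<Sum>k<n. increment k omega) + g_bound * (prev (Suc n) omega - prev n omega)) / real n) / (prev n omega / real n)"
     using n unfolding q_def by (simp add: add_divide_distrib diff_divide_distrib right_diff_distrib)
    thus ?thesis using n by simp
   qed
   finally show ?case by (simp add: n_def)
  qed
 qed
qed

end

section \<open>Time averages\<close>

lemma (in feller) AE_law_from:
 assumes nu: "distribution nu" and ae: "AE w in law_from P nu. Pr w"
 shows "AE x in nu. AE w in P x. Pr w"
proof -
 obtain N where N: "!!w. w \<in> space (law_from P nu) - N ==> Pr w" "N \<in> null_sets (law_from P nu)" using AE_E3[OF ae] by blast
 have Nm: "N \<in> sets path_space" using N(2) law_from_kernel[OF nu] by (auto simp: null_sets_def)
 have K: "P \<in> nu \<leadsto> subprob_algebra path_space" using kernel_subprob measurable_cong_sets[OF distributionD(2)[OF nu] refl] by blast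
 have "emeasure (law_from P nu) N = 0" using N(2) by auto
 hence "nn_integral nu (%x. emeasure (P x) N) = 0"
  unfolding law_from_def by (subst (asm) emeasure_bind[OF _ K Nm]) (simp_all add: distributionD(3)[OF nu])
 moreover have "(%x. emeasure (P x) N) \<in> borel_measurable nu" by (rule measurable_compose[OF K measurable_emeasure_subprob_algebra[OF Nm]])
 ultimately have "AE x in nu. emeasure (P x) N = 0" by (simp add: nn_integral_0_iff_AE)
 thus ?thesis
 proof eventually_elim
  case (elim x)
  hence "N \<in> null_sets (P x)" using Nm by (auto simp: null_sets_def)
  thus ?case by (rule AE_I') (use N(1) law_from_kernel(3)[OF nu] in auto)
 qed
qed

context stationary_limit
begin

text \<open>
For the process started from \<open>\<mu>\<close>, the later factor is replaced by its conditional mean, which is exponentially small in \<open>L\<^sup>2(\<mu>)\<close>.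
The law of the process at the earlier time is not \<open>\<mu>\<close>, but its mean is bounded by the \<open>L\<^sup>2(\<mu>)\<close> norm.
\<close>

lemma two_times_decay:
 assumes f [measurable]: "borel_fun f" and B: "!!x. abs (f x) <= B" and z: "LINT x|mue. f x = 0"
  and s: "0 <= s" and u: "0 <= u"
 shows "abs (LINT w|law_from P mu. f (w s) * f (w (s + u))) <= ((1 + epsilon / kappa) * B)^2 * exp (- kappa * u)"
proof -
 have B0: "0 <= B" using order.trans[OF abs_ge_zero B] .
 have e0: "0 <= 1 + epsilon / kappa" using epsilon_nonneg kappa_pos by simp
 have SB: "abs (S u f x) <= B" for x using S_bounded[of f B u x] B by simp
 have Sm [measurable]: "borel_fun (S u f)" using f by (rule S_measurable')
 define h where "h y = f y * S u f y" for y
 have hm [measurable]: "borel_fun h" unfolding h_def by measurable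
 have hB: "abs (h y) <= B * B" for y unfolding h_def abs_mult using B SB B0 by (intro mult_mono) auto
 have fL: "f \<in> L2 mu" and fn: "L2_norm mu f <= B" by (rule mu.L2_bounded[where B = B]; use B in auto)+
 have SL: "S u f \<in> L2 mu" by (rule mu.L2_bounded[where B = B]) (use SB in auto)
 have "LINT w|law_from P mu. f (w s) * f (w (s + u)) = LINT x|mu. LINT w|P x. f (w s) * f (w (s + u))"
 proof (rule integral_law_from[OF distribution_mu, where B = "B * B"])
  show "(%w. f (w s) * f (w (s + u))) \<in> borel_measurable path_space" by (intro borel_measurable_times measurable_compose[OF path_coordinate_measurable f])
  show "abs (f (w s) * f (w (s + u))) <= B * B" for w unfolding abs_mult using B B0 by (intro mult_mono) auto
 qed
 also have "... = LINT x|mu. S s h x"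
 proof (intro bochner_cong refl)
  fix x
  have "LINT w|P x. f (w s) * f (w (s + u)) = S s (%y. S u (%z. f y * f z) y) x" using two_times_integral[OF s u, of "%p. f (fst p) * f (snd p)" "B * B" x] B B0
   by (simp add: abs_mult mult_mono)
  also have "(%y. S u (%z. f y * f z) y) = h" unfolding h_def by (simp add: markov_semigroup_def)
  finally show "LINT w|P x. f (w s) * f (w (s + u)) = S s h x" .
 qed
 finally have eq: "LINT w|law_from P mu. f (w s) * f (w (s + u)) = LINT x|mu. S s h x" .
 have "L2_norm mu h <= L2_norm mu (%y. B * S u f y)"
 proof (rule L2_norm_mono(2)[OF _ L2_cmult[OF SL]])
  show "h \<in> borel_measurable mu" by simp
  show "AE y in mu. abs (h y) <= abs (B * S u f y)" using B B0 by (intro AE_I2) (simp add: h_def abs_mult mult_right_mono)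
 qed
 also have "... = B * L2_norm mu (S u f)" using B0 by (simp add: L2_norm_cmult)
 also have "... <= B * ((1 + epsilon / kappa) * exp (- kappa * u) * B)"
 proof (intro mult_left_mono B0)
  have "L2_norm mu (S u f) <= (1 + epsilon / kappa) * exp (- kappa * u) * centered_norm mu f" using L2_convergence[OF f B u] by (simp add: z)
  also have "... <= (1 + epsilon / kappa) * exp (- kappa * u) * B" using e0 mu.centered_norm_le[OF fL] fn by (intro mult_left_mono) auto
  finally show "L2_norm mu (S u f) <= (1 + epsilon / kappa) * exp (- kappa * u) * B" .
 qed
 finally have "(1 + epsilon / kappa) * L2_norm mu h <= (1 + epsilon / kappa) * (B * ((1 + epsilon / kappa) * exp (- kappa * u) * B))" by (rule mult_left_mono[OF _ e0])
 also have "... = ((1 + epsilon / kappa) * B)^2 * exp (- kappa * u)" by (simp add: power2_eq_square)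
 finally show ?thesis using start_mean_le[OF hm hB s] unfolding eq by linarith
qed

definition time_block :: "('a => real) => nat => (real => 'a) => real" where
 "time_block f k w = LINT s|lborel. indicator {real k..<real k + 1} s *\<^sub>R f (w s)"

lemma path_observable_measurable:
 assumes f: "borel_fun f" and w: "w \<in> space (path_space :: 'a path measure)"
 shows "borel_fun (%s. f (w s))"
proof -
 have "(%_ :: real. w) \<in> borel \<leadsto> (path_space :: 'a path measure)" using w by (rule measurable_const)
 from measurable_compose[OF path_evaluation_measurable'[OF this measurable_ident_sets[OF refl]] f] show ?thesis by simp
qed

text \<open>
The law of large numbers applies to the times \<open>k + u\<close> for each fixed \<open>u\<close>; integration over \<open>u\<close> in \<open>[0, 1)\<close> gives the integral over time.
\<close>

lemma centered_time_average:
 assumes f: "borel_fun f" and B: "!!x. abs (f x) <= B" and z: "LINT x|mue. f x = 0"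
 shows "AE w in law_from P mu. (%n. (\<Sum>k<n. time_block f k w) / real n) ----> 0"
proof -
 let ?L = "law_from P mu"
 note law = law_from_kernel[OF distribution_mu]
 interpret L: prob_space ?L by (rule law)
 interpret LL: pair_sigma_finite ?L "lborel :: real measure" ..
 have B0: "0 <= B" using order.trans[OF abs_ge_zero B] .
 define X where "X k u w = f (w (real k + u))" for k u w
 define A where "A n w u = (\<Sum>k<n. X k u w) / real n" for n w u
 \<comment> \<open>For fixed \<open>u\<close> the correlations decay exponentially in \<open>k - j\<close>.\<close>
 have fixed: "AE w in ?L. (%n. A n w u) ----> 0" if u: "u >= 0" for u
  unfolding A_def
 proof (rule L.second_moment_law_of_large_numbers[where C = "((1 + epsilon / kappa) * B)^2" and q = "exp (- kappa)"])
  have "X k u \<in> borel_measurable ?L" for k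
   unfolding X_def measurable_cong_sets[OF law(2) refl] by (rule measurable_compose[OF path_coordinate_measurable f])
  thus "X k u \<in> L2 ?L" for k by (rule L.L2_bounded(1)) (use B in "simp add: X_def")
  show "abs (LINT w|?L. X j u w * X k u w) <= ((1 + epsilon / kappa) * B)^2 * exp (- kappa) ^ (k - j)" if jk: "j <= k" for j k
   using two_times_decay[OF f B z, of "real j + u" "real (k - j)"] u jk exp_of_nat_mult[of "k - j" "- kappa"] by (simp add: X_def of_nat_diff add_ac mult_ac)
 qed (use kappa_pos in auto)
 have "(%p. X k (snd p) (fst p)) \<in> borel_measurable ((path_space :: 'a path measure) \<otimes> lborel)" for k
  unfolding X_def by (rule measurable_compose[OF path_evaluation_measurable' f]) measurable
 hence [measurable]: "(%p. X k (snd p) (fst p)) \<in> borel_measurable (?L \<otimes> lborel)" for k by (simp add: measurable_cong_sets[OF sets_pair_measure_cong[OF law(2) refl] refl])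
 have "AE w in ?L. AE u in lborel. u >= 0 --> (%n. A n w u) ----> 0"
 proof (subst LL.AE_commute)
  show "{p \<in> space (?L \<otimes> lborel). snd p >= 0 --> (%n. A n (fst p) (snd p)) ----> 0} \<in> sets (?L \<otimes> lborel)"
   unfolding A_def by measurable
  show "AE u in lborel. AE w in ?L. u >= 0 --> (%n. A n w u) ----> 0"
  proof (rule AE_I2)
   show "AE w in ?L. u >= 0 --> (%n. A n w u) ----> 0" for u by (cases "u >= 0") (use fixed in auto)
  qed
 qed
 thus ?thesis using AE_space
 proof eventually_elim
  case (elim w)
  hence w: "w \<in> space path_space" by (simp add: law)
  note fw = path_observable_measurable[OF f w]
  have Xm: "borel_fun (%u. X k u w)" for k
   unfolding X_def by (rule measurable_compose[OF _ fw]) measurable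
  have AB: "abs (A n w u) <= B" for n u
  proof -
   have "abs (\<Sum>k<n. X k u w) <= (\<Sum>k<n. B)" by (rule order.trans[OF sum_abs sum_mono]) (simp add: X_def B)
   thus ?thesis using B0 by (cases "n = 0") (auto simp: A_def field_simps)
  qed
  have "(%n. LINT u:{0..<1}|lborel. A n w u) ----> (LINT u:{0..<1::real}|lborel. 0)"
   unfolding set_lebesgue_integral_def
  proof (rule integral_dominated_convergence[where w = "%u. indicator {0..<1} u * B"])
   show "AE u in lborel. (%n. indicator {0..<1} u *\<^sub>R A n w u) ----> indicator {0..<1} u *\<^sub>R 0"
    using elim(1) by eventually_elim (auto intro!: tendsto_eq_intros split: split_indicator)
   show "AE u in lborel. norm (indicator {0..<1} u *\<^sub>R A n w u) <= indicator {0..<1} u * B" for n using AB by (intro AE_I2) (simp split: split_indicator)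
   show "(%u. indicator {0..<1} u *\<^sub>R A n w u) \<in> borel_measurable lborel" for n
    unfolding A_def by (intro borel_measurable_scaleR borel_measurable_divide borel_measurable_sum) (use Xm in simp_all)
  qed auto
  moreover have "(LINT u:{0..<1}|lborel. A n w u) = (\<Sum>k<n. time_block f k w) / real n" for n
  proof -
   have "set_integrable lborel {0..<1} (%u. X k u w)" for k by (rule set_integrable_bounded_interval[OF Xm, where B = B]) (simp add: X_def B)
   moreover have "time_block f k w = (LINT u:{0..<1}|lborel. X k u w)" for k
    unfolding time_block_def set_lebesgue_integral_def X_def by (subst lborel_integral_real_affine[of 1 _ "real k"])
     (auto intro!: bochner_cong split: split_indicator)
   moreover have "(LINT u:{0..<1}|lborel. A n w u) = LINT u|lborel. (\<Sum>k<n. indicator {0..<1} u *\<^sub>R X k u w) / real n"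
    unfolding set_lebesgue_integral_def A_def by (simp only: sum_distrib_left real_scaleR_def times_divide_eq_right)
   ultimately show ?thesis
    unfolding set_lebesgue_integral_def set_integrable_def by (simp only: integral_divide_zero Bochner_Integration.integral_sum)
  qed
  ultimately show ?case by simp
 qed
qed

lemma time_average_along_integers:
 assumes f: "borel_fun f" and B: "!!x. abs (f x) <= B" and w: "w \<in> space path_space"
  and lim: "(%n. (\<Sum>k<n. time_block (%x. f x - c) k w) / real n) ----> 0"
 shows "((%t. (LINT s:{0..<t}|lborel. f (w s)) / t) ---> c) at_top"
proof -
 have B0: "0 <= B" using order.trans[OF abs_ge_zero B] .
 define h where "h s = f (w s) - c" for s
 have fm: "borel_fun (%x. f x - c)" using f by measurable
 have hm: "borel_fun h" unfolding h_def by (rule path_observable_measurable[OF fm w])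
 have hB: "abs (h s) <= B + abs c" for s unfolding h_def using B[of "w s"] by linarith
 have sum: "(\<Sum>k<n. time_block (%x. f x - c) k w) = (LINT s:{0..<real n}|lborel. h s)" for n
 proof (induction n)
  case (Suc n)
  have "(LINT s:{0..<real (Suc n)}|lborel. h s) = (LINT s:{0..<real n}|lborel. h s) + (LINT s:{real n..<real (Suc n)}|lborel. h s)" by (rule set_integral_interval_split[OF hm hB]) auto
  moreover have "time_block (%x. f x - c) n w = (LINT s:{real n..<real (Suc n)}|lborel. h s)" by (simp add: time_block_def h_def set_lebesgue_integral_def add.commute)
  ultimately show ?case using Suc.IH by simp
 qed (simp add: set_lebesgue_integral_def)
 define q where "q n = abs ((\<Sum>k<n. time_block (%x. f x - c) k w) / real n) + (B + abs c) * (1 / real n)" for n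
 have "q ----> abs 0 + (B + abs c) * 0" unfolding q_def by (intro tendsto_intros lim lim_1_over_n)
 hence q: "q ----> 0" by simp
 have nlim: "filterlim (%t. nat \<lfloor>t :: real\<rfloor>) at_top at_top" by (rule filterlim_compose[OF filterlim_nat_sequentially filterlim_floor_sequentially])
 have "((%t. (LINT s:{0..<t}|lborel. h s) / t) ---> 0) at_top"
 proof (rule Lim_null_comparison[OF _ filterlim_compose[OF q nlim]])
  show "\<forall>\<^sub>F t in at_top. norm ((LINT s:{0..<t}|lborel. h s) / t) <= q (nat \<lfloor>t\<rfloor>)" using eventually_ge_at_top[of 1]
  proof eventually_elim
   case (elim t)
   define n where "n = nat \<lfloor>t\<rfloor>"
   have n: "1 <= n" "real n <= t" "t <= real n + 1" using elim by (auto simp: n_def) linarith+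
   have "(LINT s:{0..<t}|lborel. h s) = (LINT s:{0..<real n}|lborel. h s) + (LINT s:{real n..<t}|lborel. h s)" by (rule set_integral_interval_split[OF hm hB]) (use n in auto)
   hence "abs (LINT s:{0..<t}|lborel. h s) <= abs (LINT s:{0..<real n}|lborel. h s) + abs (LINT s:{real n..<t}|lborel. h s)" by simp
   also have "abs (LINT s:{real n..<t}|lborel. h s) <= (B + abs c) * (t - real n)" by (rule set_integral_interval_le[OF hm hB n(2)])
   also have "(B + abs c) * (t - real n) <= (B + abs c) * 1" using B0 n by (intro mult_left_mono) auto
   finally have "abs (LINT s:{0..<t}|lborel. h s) <= abs (LINT s:{0..<real n}|lborel. h s) + (B + abs c)" by simp
   hence "abs (LINT s:{0..<t}|lborel. h s) / t <= (abs (LINT s:{0..<real n}|lborel. h s) + (B + abs c)) / real n" using n B0 by (intro frac_le) auto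
   thus ?case using elim n by (simp add: q_def sum n_def[symmetric] add_divide_distrib)
  qed
 qed
 moreover have "\<forall>\<^sub>F t in at_top. (LINT s:{0..<t}|lborel. h s) / t = (LINT s:{0..<t}|lborel. f (w s)) / t - c" using eventually_gt_at_top[of 0]
 proof eventually_elim
  case (elim t)
  have 1: "set_integrable lborel {0..<t} (%s. f (w s))" by (rule set_integrable_bounded_interval[OF path_observable_measurable[OF f w] B])
  have 2: "set_integrable lborel {0..<t} (%s. c)" by (rule set_integrable_bounded_interval[where B = "abs c"]) auto
  have "(LINT s:{0..<t}|lborel. h s) = (LINT s:{0..<t}|lborel. f (w s)) - (LINT s:{0..<t}|lborel. c)"
   unfolding h_def by (rule set_integral_diff(2)[OF 1 2])
  also have "(LINT s:{0..<t}|lborel. c) = t * c" using elim by (simp add: set_lebesgue_integral_def)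
  finally show ?case using elim by (simp add: diff_divide_distrib)
 qed
 ultimately have "((%t. (LINT s:{0..<t}|lborel. f (w s)) / t - c) ---> 0) at_top" by (simp add: tendsto_cong)
 thus ?thesis by (simp add: LIM_zero_iff)
qed

lemma time_average:
 assumes f: "borel_fun f" and B: "!!x. abs (f x) <= B"
 shows "AE x in mu. AE w in P x. ((%t. (LINT s:{0..<t}|lborel. f (w s)) / t) ---> (LINT x|mue. f x)) at_top"
proof -
 define c where "c = LINT x|mue. f x"
 have i: "integrable mue f" by (rule mue.integrable_const_bound[where B = B]) (use f B in auto)
 have "AE w in law_from P mu. (%n. (\<Sum>k<n. time_block (%x. f x - c) k w) / real n) ----> 0"
 proof (rule centered_time_average[where B = "B + abs c"])
  show "borel_fun (%x. f x - c)" using f by measurable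
  show "abs (f x - c) <= B + abs c" for x using B[of x] by linarith
  show "LINT x|mue. f x - c = 0" using i mue.prob_space by (simp add: c_def)
 qed
 from AE_law_from[OF distribution_mu this] show ?thesis
 proof eventually_elim
  case (elim x)
  thus ?case using AE_space[of "P x"] by eventually_elim (rule time_average_along_integers[OF f B], auto simp: c_def)
 qed
qed

end

section \<open>The velocity\<close>

context jump_rates
begin

lemma drift_summable:
 assumes "integrable (count_space UNIV) (%y. sup_h y * norm (zvec y))"
 shows "(%y. norm (h y eta *\<^sub>R zvec y)) summable_on UNIV"
proof (rule summable_on_comparison_test)
 show "(%y. sup_h y * norm (zvec y)) summable_on UNIV" using assms by (simp add: summable_on_iff_integrable)
 show "norm (h y eta *\<^sub>R zvec y) <= sup_h y * norm (zvec y)" for y using abs_h_le[of y eta] by (simp add: mult_right_mono)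
qed auto

lemma drift_component:
 assumes "integrable (count_space UNIV) (%y. sup_h y * norm (zvec y))"
 shows "drift h eta $ i = LINT y|count_space UNIV. h y eta * real_of_int (y $ i)"
proof -
 have "bounded_linear (%v :: real ^ 'd. v $ i)" by (rule bounded_linear_vec_nth)
 from infsumI[OF has_sum_bounded_linear[OF this has_sum_infsum[OF abs_summable_summable[OF drift_summable[OF assms, of eta]]]]]
 show ?thesis by (simp add: drift_def infsum_eq_count_space zvec_def)
qed

lemma drift_norm_le:
 assumes "integrable (count_space UNIV) (%y. sup_h y * norm (zvec y))"
 shows "norm (drift h eta) <= LINT y|count_space UNIV. sup_h y * norm (zvec y)"
proof -
 have "norm (drift h eta) <= (\<Sum>\<^sub>\<infinity>y. norm (h y eta *\<^sub>R zvec y))"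
  unfolding drift_def by (rule norm_infsum_bound[OF drift_summable[OF assms]])
 also have "... <= LINT y|count_space UNIV. sup_h y * norm (zvec y)"
  unfolding infsum_eq_count_space using drift_summable[OF assms, of eta] abs_h_le[of _ eta] assms
  by (intro integral_mono) (auto simp: summable_on_iff_integrable mult_right_mono)
 finally show ?thesis .
qed

lemma drift_measurable:
 assumes "integrable (count_space UNIV) (%y. sup_h y * norm (zvec y))"
 shows "borel_fun (drift h)"
proof -
 interpret C: sigma_finite_measure "count_space (UNIV :: 'd lattice set)" by (rule sigma_finite_count_space_countable)
 have "borel_fun (%eta. drift h eta $ i)" for i
 proof -
  have m: "(%(y, eta). h y eta * real_of_int (y $ i)) \<in> borel_measurable (count_space UNIV \<otimes> borel)"
   by (rule measurable_count_space_pair) (intro borel_measurable_times h_measurable borel_measurable_const)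
  have "(%(eta, y). h y eta * real_of_int (y $ i)) \<in> borel_measurable (borel \<otimes> count_space UNIV)"
   using measurable_compose[OF measurable_pair_swap' m] by (simp add: case_prod_beta')
  from C.borel_measurable_lebesgue_integral[OF this] show ?thesis by (simp add: drift_component[OF assms])
 qed
 thus ?thesis by (subst borel_measurable_euclidean_space) (auto simp: Basis_vec_def inner_axis)
qed

end

text \<open>
Paths are right-continuous, so that convergence along rational times suffices; this makes the event of convergence measurable.
\<close>

lemma has_velocityI:
 fixes X :: "'a => real => ('s::polish_space, 'd::finite) config \<times> 'd lattice"
 assumes X: "X \<in> M \<leadsto> path_space"
  and v: "AE x in M. ((%t. zvec (snd (X x t)) /\<^sub>R t) ---> v) at_top"
 shows "has_velocity (distr M path_space X) v"
proof -
 define dev where "dev w t = norm (zvec (snd (w t)) /\<^sub>R t - v)" for w :: "real => ('s, 'd) config \<times> 'd lattice" and t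
 define close where "close w \<longleftrightarrow> (ALL n::nat. EX N::nat. ALL q::rat. real N <= of_rat q --> dev w (of_rat q) <= 1 / real (Suc n))" for w
 have devm: "(%w. dev w t) \<in> borel_measurable path_space" for t
 proof -
  have "continuous_on UNIV (%p :: ('s, 'd) config \<times> 'd lattice. norm (zvec (snd p) /\<^sub>R t - v))"
   by (rule continuous_on_lattice_pair[where F = "%y _. norm (zvec y /\<^sub>R t - v)"]) (rule continuous_on_const)
  from measurable_compose[OF path_coordinate_measurable borel_measurable_continuous_onI[OF this]]
  show ?thesis by (simp add: dev_def)
 qed
 have cm: "{w \<in> space path_space. close w} \<in> sets path_space"
  unfolding close_def using devm by measurable
 have fwd: "close w" if "((%t. zvec (snd (w t)) /\<^sub>R t) ---> v) at_top" for w
  unfolding close_def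
 proof
  fix n :: nat
  have "\<forall>\<^sub>F t in at_top. dist (zvec (snd (w t)) /\<^sub>R t) v < 1 / real (Suc n)" by (rule tendstoD[OF that]) simp
  then obtain T where T: "!!t. t >= T ==> dev w t < 1 / real (Suc n)" by (auto simp: eventually_at_top_linorder dev_def dist_norm)
  obtain N :: nat where "T <= real N" using real_arch_simple by blast
  thus "EX N::nat. ALL q::rat. real N <= of_rat q --> dev w (of_rat q) <= 1 / real (Suc n)" using T by (meson less_imp_le order_trans)
 qed
 have bwd: "((%t. zvec (snd (w t)) /\<^sub>R t) ---> v) at_top" if w: "w \<in> space path_space" and c: "close w" for w
 proof (rule tendstoI)
  fix e :: real assume "e > 0"
  then obtain n where n: "1 / real (Suc n) < e" by (metis nat_approx_posE)
  obtain N :: nat where N: "!!q. real N <= of_rat q ==> dev w (of_rat q) <= 1 / real (Suc n)" using c unfolding close_def by blast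
  have "dev w t <= 1 / real (Suc n)" if t: "max (real N) 1 <= t" for t
  proof (rule ccontr)
   assume gt: "\<not> dev w t <= 1 / real (Suc n)"
   have "(w ---> w t) (at_right t)" by (rule path_right_continuous[OF w])
   hence "((%s. snd (w s)) ---> snd (w t)) (at_right t)" by (rule tendsto_snd)
   from continuous_on_tendsto_compose[OF continuous_on_lattice[of zvec] this]
   have "((%s. zvec (snd (w s))) ---> zvec (snd (w t))) (at_right t)" by simp
   hence "((%s. dev w s) ---> dev w t) (at_right t)"
    unfolding dev_def using t by (intro tendsto_intros) auto
   hence "\<forall>\<^sub>F s in at_right t. 1 / real (Suc n) < dev w s" using gt by (intro order_tendstoD(1)) auto
   then obtain b where b: "b > t" "!!s. t < s ==> s < b ==> 1 / real (Suc n) < dev w s" by (auto simp: eventually_at_right_field)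
   obtain q where q: "t < of_rat q" "of_rat q < b" using of_rat_dense[OF b(1)] by blast
   hence "dev w (of_rat q) <= 1 / real (Suc n)" using t by (intro N) auto
   thus False using b(2)[OF q] by linarith
  qed
  hence "dist (zvec (snd (w t)) /\<^sub>R t) v < e" if "max (real N) 1 <= t" for t
   unfolding dist_norm dev_def[symmetric] using that n by (meson le_less_trans)
  thus "\<forall>\<^sub>F t in at_top. dist (zvec (snd (w t)) /\<^sub>R t) v < e" by (rule eventually_at_top_linorderI)
 qed
 have "AE x in M. close (X x)" using v by eventually_elim (rule fwd)
 hence "AE w in distr M path_space X. close w" by (subst AE_distr_iff[OF X cm])
 thus ?thesis unfolding has_velocity_def using AE_space[of "distr M path_space X"] by eventually_elim (auto intro: bwd)
qed

lemma (in random_walk) velocity: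
 assumes moment: "integrable (count_space UNIV) (%y. sup_h y * (norm (zvec y))^2)"
  and avg: "!!i. AE w in seen_from_walker P rate p eta. ((%t. (LINT s:{0..<t}|lborel. drift p (w s) $ i) / t) ---> v $ i) at_top"
 shows "has_velocity (walker_law P rate p eta 0) v"
proof -
 have first: "integrable (count_space UNIV) (%y. sup_h y * norm (zvec y))"
 proof (rule integrable_dominated)
  show "integrable (count_space UNIV) (%y. sup_h y + sup_h y * (norm (zvec y))^2)" using integrable_sup_h moment by simp
  have "x <= 1 + x^2" for x :: real using power2_diff[of x "1"] zero_le_power2[of "x - 1/2"] by (simp add: power2_eq_square algebra_simps)
  hence "sup_h y * norm (zvec y) <= sup_h y * (1 + (norm (zvec y))^2)" for y by (intro mult_left_mono sup_h_nonneg)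
  thus "AE y in count_space UNIV. norm (sup_h y * norm (zvec y)) <= norm (sup_h y + sup_h y * (norm (zvec y))^2)" by (intro AE_I2) (simp add: abs_mult sup_h_nonneg algebra_simps)
 qed simp
 have "AE omega in driving eta. ((%t. real_of_int (walk omega t $ i) / t) ---> v $ i) at_top" for i
 proof -
  interpret w: walk_observable P p rate "%y. real_of_int (y $ i)"
  proof
   show "real_of_int ((x + y) $ i) = real_of_int (x $ i) + real_of_int (y $ i)" for x y :: "'d lattice" by simp
   show "integrable (count_space UNIV) (%y. sup_h y * (real_of_int (y $ i))^2)"
   proof (rule integrable_dominated[OF moment])
    have "(real_of_int (y $ i))^2 <= (norm (zvec y))^2" for y :: "'d lattice"
     using component_le_norm_cart[of "zvec y" i] power_mono[of "abs (zvec y $ i)" "norm (zvec y)" 2] by (simp add: zvec_def)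
    thus "AE y in count_space UNIV. norm (sup_h y * (real_of_int (y $ i))^2) <= norm (sup_h y * (norm (zvec y))^2)" by (intro AE_I2) (simp add: abs_mult sup_h_nonneg mult_left_mono)
   qed simp
  qed
  have g: "w.g = (%eta. drift p eta $ i)" by (simp add: fun_eq_iff w.g_def drift_component[OF first])
  have "AE w in distr (driving eta) path_space seen_path. ((%t. (LINT s:{0..<t}|lborel. drift p (w s) $ i) / t) ---> v $ i) at_top" using avg[of i] by (simp only: seen_from_walker_eq)
  hence "AE omega in driving eta. ((%t. (LINT s:{0..<t}|lborel. drift p (seen_path omega s) $ i) / t) ---> v $ i) at_top"
   by (rule AE_distrD[rotated]) (simp add: measurable_cong_sets[OF sets_driving refl])
  with w.displacement_limit[of eta] show ?thesis
  proof eventually_elim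
   case (elim omega)
   from tendsto_add[OF this] show ?case by (simp add: g diff_divide_distrib)
  qed
 qed
 hence "AE omega in driving eta. \<forall>i\<in>UNIV. ((%t. real_of_int (walk omega t $ i) / t) ---> v $ i) at_top" by (intro eventually_ball_finite) auto
 hence "AE omega in driving eta. ((%t. zvec (snd (joint_path omega t)) /\<^sub>R t) ---> v) at_top"
 proof eventually_elim
  case (elim omega)
  show ?case
  proof (rule vec_tendstoI)
   fix i
   have "\<forall>\<^sub>F t in at_top. real_of_int (walk omega t $ i) / t = (zvec (snd (joint_path omega t)) /\<^sub>R t) $ i"
    using eventually_ge_at_top[of 0] by eventually_elim (simp add: joint_path_def zvec_def divide_inverse)
   from Lim_transform_eventually[OF _ this] elim
   show "((%t. (zvec (snd (joint_path omega t)) /\<^sub>R t) $ i) ---> v $ i) at_top" by blast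
  qed
 qed
 thus ?thesis
  unfolding walker_law_eq by (rule has_velocityI[rotated]) (simp add: measurable_cong_sets[OF sets_driving refl])
qed

section \<open>Mutual absolute continuity\<close>

text \<open>
\<open>A\<close> is the zero set of the density. The hypothesis says that it cannot be entered by the process \<open>P\<close> from its complement; by invariance
of \<open>\<mu>\<close> it cannot be left either, so that its indicator is fixed by the semigroup.
\<close>

lemma (in feller) mutually_ac_of_domination:
 assumes mu: "distribution mu" "invariant P mu" and mue: "distribution mue" "absolutely_continuous mu mue" and gamma: "gamma > 0"
  and poincare: "!!f g. L2_generator mu P f g ==> (LINT eta|mu. f eta) = 0 ==>
     gamma * (L2_norm mu f)^2 <= - (LINT eta|mu. f eta * g eta)"
  and null: "!!A t. A \<in> sets borel ==> t > 0 ==> measure mue A = 0 ==> AE x in mue. S t (indicator A :: 'a => real) x = 0"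
 shows "mutually_ac mu mue"
proof -
 interpret m: prob_space mu by (rule distributionD[OF mu(1)])
 interpret e: prob_space mue by (rule distributionD[OF mue(1)])
 have sets: "sets mue = sets mu" by (simp add: distributionD(2)[OF mu(1)] distributionD(2)[OF mue(1)])
 define f where "f = RN_deriv mu mue"
 have d: "density mu f = mue" unfolding f_def by (rule m.density_RN_deriv[OF mue(2) sets])
 have fm: "borel_fun f" using borel_measurable_RN_deriv[of mu mue] by (simp add: f_def distributionD(4)[OF mu(1)])
 have fm' [measurable]: "f \<in> borel_measurable mu" by (simp add: fm distributionD(4)[OF mu(1)])
 have ae: "(AE x in mue. Q x) \<longleftrightarrow> (AE x in mu. f x ~= 0 --> Q x)" for Q
  unfolding d[symmetric] by (simp add: AE_density zero_less_iff_neq_zero)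
 define A where "A = {x. f x = 0}"
 have A: "A \<in> sets borel" unfolding A_def using fm by measurable
 have Amu: "A \<in> sets mu" "A \<in> sets mue" using A by (simp_all add: distributionD(2)[OF mu(1)] distributionD(2)[OF mue(1)])
 have "AE x in mue. x \<notin> A" unfolding ae by (simp add: A_def)
 hence eA: "measure mue A = 0" using e.prob_eq_0[of A] Amu by simp
 let ?I = "indicator A :: 'a => real"
 have Im: "?I \<in> borel_measurable borel" using A by simp
 have Ib: "abs (?I x) <= 1" for x by (auto simp: indicator_def)
 have iI: "integrable mu ?I" by (rule m.integrable_const_bound[where B = 1]) (use Amu Ib in auto)
 define a where "a = measure mu A"
 have fixed: "AE x in mu. S t ?I x = ?I x" if t: "t > 0" for t
 proof -
  have S01: "0 <= S t ?I x" "S t ?I x <= 1" for x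
  proof -
   show "0 <= S t ?I x" unfolding markov_semigroup_def by (intro bochner_nonneg) simp
   show "S t ?I x <= 1" using S_bounded[of ?I 1 t x] Ib by (simp add: abs_le_iff)
  qed
  have "AE x in mu. f x ~= 0 --> S t ?I x = 0" using null[OF A t eA] by (simp only: ae)
  hence le: "AE x in mu. S t ?I x <= ?I x" by eventually_elim (use S01 in "auto simp: A_def indicator_def")
  have Sm: "S t ?I \<in> borel_measurable mu" using S_measurable'[OF Im] by (simp add: distributionD(4)[OF mu(1)])
  have iS: "integrable mu (S t ?I)" by (rule m.integrable_const_bound[where B = 1]) (use Sm S01 in auto)
  have "LINT x|mu. S t ?I x = LINT x|dist_at P mu t. ?I x" by (rule integral_dist_at[OF mu(1) Im Ib, symmetric])
  also have "dist_at P mu t = mu" using mu(2) t by (simp add: invariant_def)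
  finally have "LINT x|mu. ?I x - S t ?I x = 0" using iS iI by simp
  moreover have "AE x in mu. 0 <= ?I x - S t ?I x" using le by eventually_elim simp
  moreover have "integrable mu (%x. ?I x - S t ?I x)" using iS iI by simp
  ultimately have "AE x in mu. ?I x - S t ?I x = 0" using integral_nonneg_eq_0_iff_AE by blast
  thus ?thesis by eventually_elim simp
 qed
 let ?f = "%x. ?I x - a"
 have fL: "?f \<in> L2 mu" by (rule m.L2_bounded[where B = "1 + a"]) (use Amu in "auto simp: a_def indicator_def measure_nonneg")
 have "L2_generator mu P ?f (%x. 0)"
  unfolding L2_generator_def
 proof (intro conjI fL)
  show "(%x. 0) \<in> L2 mu" by (rule L2_const[OF m.finite_measure_axioms])
  have "\<forall>\<^sub>F t in at_right 0. L2_norm mu (%x. (S t ?f x - ?f x) / t - 0) = 0"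
  proof (rule eventually_mono[OF eventually_at_right_less[of 0]])
   fix t :: real assume t: "0 < t"
   have Sf: "S t ?f x = S t ?I x - a" for x using S_diff[of ?I "%_. a" 1 "abs a" t x] S_const[of t a x] Im Ib by simp
   have "AE x in mu. (S t ?f x - ?f x) / t - 0 = 0" using fixed[OF t] by eventually_elim (simp add: Sf)
   hence "L2_norm mu (%x. (S t ?f x - ?f x) / t - 0) = L2_norm mu (%x. 0)"
   proof (intro L2_norm_cong_AE)
    show "(%x. (S t ?f x - ?f x) / t - 0) \<in> borel_measurable mu"
     unfolding Sf using S_measurable'[OF Im, of t] Im by (simp add: distributionD(4)[OF mu(1)])
   qed auto
   thus "L2_norm mu (%x. (S t ?f x - ?f x) / t - 0) = 0" by (simp add: L2_norm_def)
  qed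
  thus "((%t. L2_norm mu (%x. (S t ?f x - ?f x) / t - 0)) ---> 0) (at_right 0)" by (rule tendsto_eventually)
 qed
 moreover have "LINT x|mu. ?f x = 0" using Amu iI m.prob_space by (simp add: a_def)
 ultimately have "gamma * (L2_norm mu ?f)^2 <= 0" using poincare[of ?f "%x. 0"] by simp
 hence "(L2_norm mu ?f)^2 <= 0" using gamma by (simp add: mult_le_0_iff)
 hence "L2_norm mu ?f = 0" by simp
 hence n0: "LINT x|mu. (?f x)^2 = 0" by (simp add: L2_norm_def)
 have "AE x in mu. ?f x = 0"
 proof -
  have "integrable mu (%x. (?f x)^2)" using fL by (simp add: L2_def)
  hence "AE x in mu. (?f x)^2 = 0" using n0 by (subst (asm) integral_nonneg_eq_0_iff_AE) auto
  thus ?thesis by eventually_elim simp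
 qed
 hence two: "AE x in mu. indicator A x = a" by eventually_elim simp
 have out: "AE x in mu. x \<notin> A"
 proof (rule ccontr)
  assume n: "\<not> (AE x in mu. x \<notin> A)"
  have "a = 1"
  proof (rule ccontr)
   assume "a ~= 1"
   with two have "AE x in mu. x \<notin> A" by (auto elim: eventually_mono)
   thus False using n by simp
  qed
  with two have "AE x in mu. x \<in> A" by (auto elim!: eventually_mono simp: indicator_def split: if_splits)
  hence "AE x in mue. False" unfolding ae by eventually_elim (simp add: A_def)
  thus False by simp
 qed
 have "absolutely_continuous mue mu"
  unfolding absolutely_continuous_def
 proof
  fix N assume N: "N \<in> null_sets mue"
  hence "AE x in mue. x \<notin> N" by (rule AE_not_in)
  hence "AE x in mu. x \<notin> N" unfolding ae using out by eventually_elim (auto simp: A_def)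
  moreover have "N \<in> sets mu" using N sets by auto
  ultimately show "N \<in> null_sets mu" by (simp add: AE_iff_null_sets)
 qed
 thus ?thesis using mue(2) by (simp add: mutually_ac_def)
qed

section \<open>Generators of the environment and of its views from the walkers\<close>

context feller
begin

lemma invariant_generator_mean:
 assumes nu: "distribution nu" "invariant P nu" and g: "C_generator P f g"
 shows "LINT x|nu. g x = 0"
proof -
 note f = C_generator_continuous[OF g]
 obtain B where B: "!!x. abs (f x) <= B" using continuous_bounded[OF f(1)] by blast
 have const: "LINT x|nu. S t f x = LINT x|nu. f x" if "t >= 0" for t using integral_dist_at[OF nu(1) continuous_measurable[OF f(1)] B, of t] nu(2) that by (simp add: invariant_def)
 have "((%t. LINT x|nu. S t f x) has_real_derivative (LINT x|nu. S 0 g x)) (at 0 within {0..})" by (rule derivative_integral_S[OF nu(1) g]) simp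
 hence "((%t. LINT x|nu. f x) has_real_derivative (LINT x|nu. S 0 g x)) (at 0 within {0..})" by (rule has_field_derivative_transform_within[where d = 1]) (use const in auto)
 hence "((%y. 0) ---> (LINT x|nu. S 0 g x)) (at_right (0::real))" by (simp add: has_field_derivative_iff at_within_Ici_at_right)
 hence "LINT x|nu. S 0 g x = 0" by (simp add: tendsto_const_iff)
 thus ?thesis by (simp add: S_zero_time[OF continuous_measurable[OF f(2)]])
qed

lemma C_generator_L2_generator:
 assumes nu: "distribution nu" and g: "C_generator P f g"
 shows "L2_generator nu P f g"
proof -
 interpret prob_space nu by (rule distributionD[OF nu])
 note c = C_generator_continuous[OF g]
 note m = continuous_measurable[OF c(1)] continuous_measurable[OF c(2)]
 have L: "f \<in> L2 nu" if "continuous_on UNIV f" for f :: "'a => real"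
 proof -
  obtain B where B: "!!x. abs (f x) <= B" using continuous_bounded[OF \<open>continuous_on UNIV f\<close>] by blast
  show ?thesis by (rule L2_bounded[OF _ B]) (simp add: distributionD(4)[OF nu] continuous_measurable that)
 qed
 have "((%t. L2_norm nu (%x. (S t f x - f x) / t - g x)) ---> 0) (at_right 0)"
 proof (rule tendstoI)
  fix e :: real assume e: "e > 0"
  have "\<forall>\<^sub>F t in at_right 0. \<forall>x\<in>UNIV. dist ((S t f x - f x) / t) (g x) < e / 2" using g e unfolding C_generator_def by (intro uniform_limitD) auto
  thus "\<forall>\<^sub>F t in at_right 0. dist (L2_norm nu (%x. (S t f x - f x) / t - g x)) 0 < e"
  proof eventually_elim
   case (elim t)
   have b: "abs ((S t f x - f x) / t - g x) <= e / 2" for x using elim by (auto simp: dist_real_def intro: less_imp_le)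
   have "L2_norm nu (%x. (S t f x - f x) / t - g x) <= e / 2" by (rule L2_bounded(2)[OF _ b]) (use m S_measurable'[OF m(1), of t] in "simp add: distributionD(4)[OF nu]")
   thus ?case using e L2_norm_nonneg[of nu "%x. (S t f x - f x) / t - g x"] by simp
  qed
 qed
 thus ?thesis using L c by (simp add: L2_generator_def)
qed

lemma C_generator_diff_const:
 assumes g: "C_generator P f g"
 shows "C_generator P (%x. f x - c) g"
proof -
 note f = C_generator_continuous[OF g]
 obtain B where B: "!!x. abs (f x) <= B" using continuous_bounded[OF f(1)] by blast
 have "S t (%x. f x - c) x = S t f x - c" for t x using S_diff[of f "%_. c" B "abs c" t x] continuous_measurable[OF f(1)] B by simp
 thus ?thesis using g by (auto simp: C_generator_def intro!: continuous_intros)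
qed

text \<open>
The generator on continuous functions is contained in the one on \<open>L\<^sup>2(\<mu>)\<close>, and adding a constant changes neither side.
\<close>

lemma poincare_C_generator:
 assumes nu: "distribution nu"
  and poincare: "!!f g. L2_generator nu P f g ==> (LINT eta|nu. f eta) = 0 ==>
     gamma * (L2_norm nu f)^2 <= - (LINT eta|nu. f eta * g eta)"
  and g: "C_generator P f g"
 shows "(LINT x|nu. f x * g x) - (LINT x|nu. f x) * (LINT x|nu. g x) <= - gamma * (centered_norm nu f)^2"
proof -
 interpret prob_space nu by (rule distributionD[OF nu])
 define c where "c = LINT x|nu. f x"
 have L: "f \<in> L2 nu" "g \<in> L2 nu" using C_generator_L2_generator[OF nu g] by (auto simp: L2_generator_def)
 note i = L2_integrable[OF L(1)] L2_integrable[OF L(2)] L2_integrable_mult[OF L]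
 have "LINT x|nu. f x - c = 0" using i prob_space by (simp add: c_def)
 from poincare[OF C_generator_L2_generator[OF nu C_generator_diff_const[OF g]] this]
 have "gamma * (centered_norm nu f)^2 <= - (LINT x|nu. (f x - c) * g x)" by (simp add: c_def)
 also have "LINT x|nu. (f x - c) * g x = (LINT x|nu. f x * g x) - c * (LINT x|nu. g x)" using i by (simp add: left_diff_distrib)
 finally show ?thesis by (simp add: c_def)
qed

end

text \<open>
\<open>2 f L f \<le> L f\<^sup>2\<close> pointwise for a jump operator \<open>L\<close> with nonnegative rates, and the right-hand side has mean zero.
\<close>

lemma (in L2_jump) jump_symmetric_part:
 fixes f :: "('s, 'd) config => real"
 assumes nonneg: "!!y eta. 0 <= h y eta"
  and stationary: "!!f :: ('s, 'd) config => real. continuous_on UNIV f ==> (LINT x|mu. jump_op h f x) = 0"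
  and f: "continuous_on UNIV f"
 shows "LINT x|mu. f x * jump_op h f x <= 0"
proof -
 have "bounded (range f)" using compact_continuous_image[OF f compact_config[OF compact_S]] by (rule compact_imp_bounded)
 then obtain B where B: "!!x. abs (f x) <= B" by (auto simp: bounded_iff)
 have B2: "abs ((f x)\<^sup>2) <= B^2" for x using power_mono[OF B abs_ge_zero, of x 2] by simp
 have f2: "continuous_on UNIV (%x. (f x)^2)" using f by (intro continuous_intros)
 have fm: "borel_fun f" by (rule borel_measurable_continuous_onI[OF f])
 have fL: "f \<in> L2 mu" by (rule m.L2_bounded[OF _ B]) (simp add: fm)
 have f2L: "(%x. (f x)^2) \<in> L2 mu" by (rule m.L2_bounded[OF _ B2]) (simp add: borel_measurable_power[OF fm])
 have le: "2 * (f x * jump_op h f x) <= jump_op h (%x. (f x)^2) x" for x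
 proof -
  have "2 * (f x * jump_op h f x) = LINT y|count_space UNIV. 2 * f x * (h y x * (f (translate y x) - f x))"
   unfolding jump_op_eq by (simp only: integral_mult_right_zero mult.assoc)
  also have "... <= LINT y|count_space UNIV. h y x * ((f (translate y x))^2 - (f x)^2)"
  proof (rule integral_mono)
   show "integrable (count_space UNIV) (%y. 2 * f x * (h y x * (f (translate y x) - f x)))" using jump_op_integrable_bounded[of f B x, OF B] by simp
   show "integrable (count_space UNIV) (%y. h y x * ((f (translate y x))^2 - (f x)^2))" using jump_op_integrable_bounded[of "%x. (f x)^2" "B^2" x, OF B2] by simp
   fix y
   have "0 <= h y x * (f (translate y x) - f x)^2" using nonneg by simp
   thus "2 * f x * (h y x * (f (translate y x) - f x)) <= h y x * ((f (translate y x))^2 - (f x)^2)" by (simp add: power2_eq_square algebra_simps)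
  qed
  finally show ?thesis unfolding jump_op_eq .
 qed
 have "LINT x|mu. 2 * (f x * jump_op h f x) <= LINT x|mu. jump_op h (%x. (f x)^2) x"
  using le L2_integrable_mult[OF fL jump_op_L2(2)[OF fL]] m.L2_integrable[OF jump_op_L2(2)[OF f2L]] by (intro integral_mono) auto
 thus ?thesis using stationary[OF f2] by simp
qed

section \<open>Moments of the jump rates\<close>

lemma norm_zvec_ge_1:
 assumes "y ~= 0"
 shows "1 <= norm (zvec (y :: ('d::finite) lattice))"
proof -
 obtain i where "y $ i ~= 0" using assms by (auto simp: vec_eq_iff)
 hence "1 <= abs (y $ i)" by linarith
 hence "1 <= abs (zvec y $ i)" by (simp add: zvec_def)
 thus ?thesis using component_le_norm_cart[of "zvec y" i] by linarith
qed

lemma rate_le_SUP: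
 fixes f :: "('d::finite) lattice => ('s::polish_space, 'd) config => real"
 assumes "compact (UNIV :: 's set)" "continuous_on UNIV (f y)"
 shows "abs (f y eta) <= (SUP eta. abs (f y eta))"
proof -
 have "compact (range (%eta. abs (f y eta)))" by (intro compact_continuous_image continuous_intros assms compact_config)
 hence "bdd_above (range (%eta. abs (f y eta)))" by (intro bounded_imp_bdd_above compact_imp_bounded)
 thus ?thesis by (intro cSUP_upper) auto
qed

lemma moment_condition_weaken:
 fixes f :: "('d::finite) lattice => ('s::polish_space, 'd) config => real"
 assumes S: "compact (UNIV :: 's set)" and c: "!!y. continuous_on UNIV (f y)" and z: "!!eta. f 0 eta = 0"
  and f: "moment_condition n f" and mn: "m <= n"
 shows "moment_condition m f"
 unfolding moment_condition_def
proof (rule summable_on_comparison_test[OF f[unfolded moment_condition_def]])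
 have p: "0 <= (SUP eta. abs (f y eta))" for y using order.trans[OF abs_ge_zero rate_le_SUP[of f y, OF S c]] .
 show "norm (zvec y) ^ m * (SUP eta. abs (f y eta)) <= norm (zvec y) ^ n * (SUP eta. abs (f y eta))" for y
 proof (cases "y = 0")
  case False
  thus ?thesis using p mn norm_zvec_ge_1[OF False] by (intro mult_right_mono power_increasing) auto
 qed (simp add: z)
 show "0 <= norm (zvec y) ^ m * (SUP eta. abs (f y eta))" for y using p by simp
qed

lemma moment_condition_add:
 fixes f g k :: "('d::finite) lattice => ('s::polish_space, 'd) config => real"
 assumes S: "compact (UNIV :: 's set)" and c: "!!y. continuous_on UNIV (f y)" "!!y. continuous_on UNIV (g y)"
  and k: "!!y eta. k y eta = f y eta + g y eta"
  and fg: "moment_condition n f" "moment_condition n g"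
 shows "moment_condition n k"
 unfolding moment_condition_def
proof (rule summable_on_comparison_test[OF summable_on_add[OF fg[unfolded moment_condition_def]]])
 fix y
 have ck: "continuous_on UNIV (k y)"
 proof -
  have "k y = (%eta. f y eta + g y eta)" by (simp add: fun_eq_iff k)
  thus ?thesis using c by (simp add: continuous_on_add)
 qed
 have "(SUP eta. abs (k y eta)) <= (SUP eta. abs (f y eta)) + (SUP eta. abs (g y eta))"
 proof (rule cSUP_least)
  show "abs (k y eta) <= (SUP eta. abs (f y eta)) + (SUP eta. abs (g y eta))" for eta using rate_le_SUP[of f y eta, OF S c(1)] rate_le_SUP[of g y eta, OF S c(2)] unfolding k by linarith
 qed simp
 thus "norm (zvec y) ^ n * (SUP eta. abs (k y eta)) <= norm (zvec y) ^ n * (SUP eta. abs (f y eta)) + norm (zvec y) ^ n * (SUP eta. abs (g y eta))"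
  unfolding distrib_left[symmetric] by (intro mult_left_mono) auto
 show "0 <= norm (zvec y) ^ n * (SUP eta. abs (k y eta))" using order.trans[OF abs_ge_zero rate_le_SUP[of k y, OF S ck]] by simp
qed

lemma jump_rates_of_moment:
 fixes f :: "('d::finite) lattice => ('s::polish_space, 'd) config => real"
 assumes S: "compact (UNIV :: 's set)" and c: "!!y. continuous_on UNIV (f y)" and z: "!!eta. f 0 eta = 0"
  and f: "moment_condition n f"
 shows "jump_rates f" using moment_condition_weaken[OF S c z f, of 0] by unfold_locales (simp_all add: S c moment_condition_def)

lemma (in jump_rates) moment_condition_integrable:
 assumes "moment_condition n h"
 shows "integrable (count_space UNIV) (%y. sup_h y * norm (zvec y) ^ n)" using assms by (simp add: moment_condition_def summable_on_iff_integrable sup_h_def mult.commute)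

theorem theorem1:
  fixes P :: "('s::polish_space, 'd::finite) config \<Rightarrow> (real \<Rightarrow> ('s, 'd) config) measure"
    and \<mu> :: "('s, 'd) config measure"
    and r re rh :: "'d lattice \<Rightarrow> ('s, 'd) config \<Rightarrow> real"
    and Q Qe :: "('s, 'd) config \<Rightarrow> (real \<Rightarrow> ('s, 'd) config) measure"
    and \<gamma> \<epsilon> rate :: real
  assumes compact: "compact (UNIV :: 's set)"
    \<comment> \<open>(1)\<close>
    and env_feller: "feller_process P"
    and mu: "distribution \<mu>" "invariant P \<mu>" "\<And>x. distr \<mu> borel (translate x) = \<mu>"
    \<comment> \<open>(2)\<close>
    and env_translation: "\<And>f t x. f \<in> L2 \<mu> \<Longrightarrow> t \<ge> 0 \<Longrightarrow>
          AE \<eta> in \<mu>. markov_semigroup P t (\<lambda>\<zeta>. f (translate x \<zeta>)) \<eta> = markov_semigroup P t f (translate x \<eta>)"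
    and gap_pos: "\<gamma> > 0"
    and poincare: "\<And>f g. L2_generator \<mu> P f g \<Longrightarrow> (\<integral>\<eta>. f \<eta> \<partial>\<mu>) = 0 \<Longrightarrow>
          \<gamma> * (L2_norm \<mu> f)\<^sup>2 \<le> - (\<integral>\<eta>. f \<eta> * g \<eta> \<partial>\<mu>)"
    \<comment> \<open>(3)\<close>
    and rates_continuous: "\<And>y. continuous_on UNIV (r y)" "\<And>y. continuous_on UNIV (re y)"
          "\<And>y. continuous_on UNIV (rh y)"
    and rates_zero: "\<And>\<eta>. r 0 \<eta> = 0" "\<And>\<eta>. re 0 \<eta> = 0" "\<And>\<eta>. rh 0 \<eta> = 0"
    and rates_nonneg: "\<And>y \<eta>. r y \<eta> \<ge> 0" "\<And>y \<eta>. re y \<eta> \<ge> 0"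
    and rates_sum: "\<And>y \<eta>. re y \<eta> = r y \<eta> + rh y \<eta>"
    and moment: "\<exists>n\<ge>1. moment_condition n r \<and> moment_condition n rh"
    \<comment> \<open>rate of the Poisson process, large enough for both walkers\<close>
    and rate: "rate > 0" "\<And>\<eta>. (\<Sum>\<^sub>\<infinity>y. r y \<eta>) \<le> rate" "\<And>\<eta>. (\<Sum>\<^sub>\<infinity>y. re y \<eta>) \<le> rate"
    \<comment> \<open>environments seen from the unperturbed and the perturbed walker\<close>
    and Q: "Q = seen_from_walker P rate r"
    and Qe: "Qe = seen_from_walker P rate re"
    \<comment> \<open>(4)\<close>
    and seen_feller: "feller_process Q" "feller_process Qe"
    and seen_generator: "\<And>f g. C_generator Q f g \<longleftrightarrow>
          (\<exists>h. C_generator P f h \<and> g = (\<lambda>\<eta>. h \<eta> + jump_op r f \<eta>))"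
    and seen_generator_perturbed: "\<And>f g. C_generator Qe f g \<longleftrightarrow>
          (\<exists>h. C_generator P f h \<and> g = (\<lambda>\<eta>. h \<eta> + jump_op r f \<eta> + jump_op rh f \<eta>))"
    \<comment> \<open>(5)\<close>
    and mu_seen: "invariant Q \<mu>"
    \<comment> \<open>(6)\<close>
    and eps: "\<epsilon> = L2_opnorm \<mu> (jump_op rh)" "\<epsilon> < \<gamma>"
  shows "\<exists>\<mu>e.
    \<comment> \<open>(i)\<close>
    (distribution \<mu>e \<and> invariant Qe \<mu>e \<and> absolutely_continuous \<mu> \<mu>e) \<and>
    (\<forall>\<nu>. distribution \<nu> \<and> invariant Qe \<nu> \<and> absolutely_continuous \<mu> \<nu> \<longrightarrow> \<nu> = \<mu>e) \<and>
    (\<forall>\<nu>. distribution \<nu> \<and> absolutely_continuous \<mu> \<nu> \<longrightarrow>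
       weakly_converges (dist_at Qe \<nu>) \<mu>e at_top) \<and>
    time_ergodic Qe \<mu>e \<and>
    (\<forall>f\<in>L2 \<mu>.
       integrable \<mu>e f \<and>
       (\<forall>n. set_integrable lborel {0..} (\<lambda>s. \<integral>\<eta>. jump_op rh (dyson Q rh n s f) \<eta> \<partial>\<mu>) \<and>
            (LINT s:{0..}|lborel. \<bar>\<integral>\<eta>. jump_op rh (dyson Q rh n s f) \<eta> \<partial>\<mu>\<bar>)
              \<le> (\<epsilon> / \<gamma>) ^ (n + 1) * L2_norm \<mu> (\<lambda>\<eta>. f \<eta> - (\<integral>\<zeta>. f \<zeta> \<partial>\<mu>))) \<and>
       summable (\<lambda>n. LINT s:{0..}|lborel. \<integral>\<eta>. jump_op rh (dyson Q rh n s f) \<eta> \<partial>\<mu>) \<and>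
       (\<integral>\<eta>. f \<eta> \<partial>\<mu>e) = (\<integral>\<eta>. f \<eta> \<partial>\<mu>) +
         (\<Sum>n. LINT s:{0..}|lborel. \<integral>\<eta>. jump_op rh (dyson Q rh n s f) \<eta> \<partial>\<mu>)) \<and>
    \<comment> \<open>(ii)\<close>
    ((\<forall>y \<eta>. r y \<eta> > 0 \<longrightarrow> re y \<eta> > 0) \<longrightarrow> mutually_ac \<mu> \<mu>e) \<and>
    ((\<exists>V Ve. (\<forall>y \<eta>. r y \<eta> > 0 \<longleftrightarrow> y \<in> V) \<and> (\<forall>y \<eta>. rh y \<eta> > 0 \<longleftrightarrow> y \<in> Ve) \<and>
        (\<forall>y\<in>V. \<exists>ys. set ys \<subseteq> Ve \<and> y = sum_list ys)) \<longrightarrow> mutually_ac \<mu> \<mu>e) \<and>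
    \<comment> \<open>(iii)\<close>
    (moment_condition 2 r \<and> moment_condition 2 rh \<longrightarrow>
       (AE \<eta> in \<mu>e. has_velocity (walker_law P rate re \<eta> 0) (\<integral>\<zeta>. drift re \<zeta> \<partial>\<mu>e)) \<and>
       (\<exists>A\<in>sets \<mu>. measure \<mu> A \<ge> 1 - \<epsilon>\<^sup>2 / (\<gamma> - \<epsilon>)\<^sup>2 \<and>
          (\<forall>\<eta>\<in>A. has_velocity (walker_law P rate re \<eta> 0) (\<integral>\<zeta>. drift re \<zeta> \<partial>\<mu>e))) \<and>
       (mutually_ac \<mu> \<mu>e \<longrightarrow>
          (AE \<eta> in \<mu>. has_velocity (walker_law P rate re \<eta> 0) (\<integral>\<zeta>. drift re \<zeta> \<partial>\<mu>e)))) \<and>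
    \<comment> \<open>(iv)\<close>
    integrable \<mu>e (drift re) \<and>
    (\<forall>n. set_integrable lborel {0..} (\<lambda>s. \<integral>\<eta>. jump_op rh (dyson Q rh n s (drift re)) \<eta> \<partial>\<mu>)) \<and>
    summable (\<lambda>n. LINT s:{0..}|lborel. \<integral>\<eta>. jump_op rh (dyson Q rh n s (drift re)) \<eta> \<partial>\<mu>) \<and>
    (\<integral>\<eta>. drift re \<eta> \<partial>\<mu>e) = (\<integral>\<eta>. drift re \<eta> \<partial>\<mu>) +
      (\<Sum>n. LINT s:{0..}|lborel. \<integral>\<eta>. jump_op rh (dyson Q rh n s (drift re)) \<eta> \<partial>\<mu>) \<and>
    (\<forall>n. \<forall>s\<ge>0. norm (\<integral>\<eta>. jump_op rh (dyson Q rh n s (drift re)) \<eta> \<partial>\<mu>)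
        \<le> \<epsilon> ^ (n + 1) * exp (- \<gamma> * s) * s ^ n * (SUP \<eta>. norm (drift re \<eta>)) / fact n)"
proof -
 note S = compact and seen = Qe
 obtain n where n: "n >= 1" "moment_condition n r" "moment_condition n rh" using moment by blast
 have re_n: "moment_condition n re" by (rule moment_condition_add[OF S rates_continuous(1,3) rates_sum n(2,3)])
 have rates: "jump_rates r" "jump_rates rh" "jump_rates re" by (rule jump_rates_of_moment[OF S rates_continuous(1) rates_zero(1) n(2)]
    jump_rates_of_moment[OF S rates_continuous(3) rates_zero(3) n(3)]
    jump_rates_of_moment[OF S rates_continuous(2) rates_zero(2) re_n])+
 have compact_\<Omega>: "compact (UNIV :: ('s, 'd) config set)" by (rule compact_config[OF S])
 interpret env: feller P by unfold_locales (use env_feller compact_\<Omega> in auto)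
 interpret Q: feller Q by unfold_locales (use seen_feller compact_\<Omega> in auto)
 interpret Qe: feller Qe by unfold_locales (use seen_feller compact_\<Omega> in auto)
 interpret R: L2_jump r \<mu> by (intro L2_jump.intro L2_jump_axioms.intro rates mu)
 interpret J: L2_jump rh \<mu> by (intro L2_jump.intro L2_jump_axioms.intro rates mu)
 interpret Re: jump_rates re by (rule rates)
 have J_eps: "J.eps = \<epsilon>" by (simp add: J.eps_def eps)
 have \<epsilon>0: "0 <= \<epsilon>" using J.eps_nonneg by (simp add: J_eps)

 have L2_continuous: "f \<in> L2 \<mu>" if f: "continuous_on UNIV f" for f :: "('s, 'd) config => real"
 proof -
  obtain B where B: "!!x. abs (f x) <= B" using env.continuous_bounded[OF f] by blast
  show ?thesis by (rule R.m.L2_bounded[OF _ B]) (simp add: env.continuous_measurable[OF f])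
 qed

 have domain_mean: "LINT x|\<mu>. jump_op r f x = 0" if f: "C_generator P f h" for f h
 proof -
  have "C_generator Q f (%\<eta>. h \<eta> + jump_op r f \<eta>)" using f seen_generator by blast
  hence "LINT x|\<mu>. h x + jump_op r f x = 0" by (rule Q.invariant_generator_mean[OF mu(1) mu_seen])
  moreover have "LINT x|\<mu>. h x = 0" by (rule env.invariant_generator_mean[OF mu(1,2) f])
  moreover have "integrable \<mu> h" "integrable \<mu> (jump_op r f)" using env.C_generator_continuous[OF f] L2_continuous R.jump_op_L2(2)[of f] by (auto intro: R.m.L2_integrable)
  ultimately show ?thesis by simp
 qed
 \<comment> \<open>The jump part is a difference of two generators with invariant measure \<open>\<mu>\<close>; its mean extends from the domain to all continuous functions by density.\<close>
 have jump_mean: "LINT x|\<mu>. jump_op r f x = 0" if f: "continuous_on UNIV f" for f :: "('s, 'd) config => real"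
 proof -
  obtain B where B: "!!x. abs (f x) <= B" using env.continuous_bounded[OF f] by blast
  have "abs (LINT x|\<mu>. jump_op r f x) <= 0 + e" if e: "e > 0" for e
  proof -
   define d where "d = e / (2 * R.total + 1)"
   have d: "d > 0" "2 * d * R.total <= e" using e R.total_nonneg by (auto simp: d_def field_simps)
   obtain f' h where f': "C_generator P f' h" "!!x. abs (f' x - f x) <= d" using env.C_generator_dense[OF f d(1)] by blast
   have c: "continuous_on UNIV f'" using env.C_generator_continuous[OF f'(1)] by simp
   obtain B' where B': "!!x. abs (f' x) <= B'" using env.continuous_bounded[OF c] by blast
   have i: "integrable \<mu> (jump_op r f)" "integrable \<mu> (jump_op r f')" using R.m.L2_integrable[OF R.jump_op_L2(2)[OF L2_continuous]] f c by auto
   have "LINT x|\<mu>. jump_op r f x = LINT x|\<mu>. jump_op r f x - jump_op r f' x" using i domain_mean[OF f'(1)] by simp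
   also have "abs (...) <= LINT x|\<mu>. abs (jump_op r f x - jump_op r f' x)" by (rule integral_abs_bound)
   also have "... <= LINT x|\<mu>. e"
   proof (rule integral_mono)
    fix x
    have "abs (jump_op r (%x. f x - f' x) x) <= 2 * d * R.total" using R.jump_op_bounded[of "%x. f x - f' x" d x] f'(2) by (simp add: abs_minus_commute)
    thus "abs (jump_op r f x - jump_op r f' x) <= e" using R.jump_op_diff_bounded[of f B f' B' x, OF B B'] d(2) by simp
   qed (use i in auto)
   also have "... = e" using R.m.prob_space by simp
   finally show ?thesis by simp
  qed
  hence "abs (LINT x|\<mu>. jump_op r f x) <= 0" by (rule field_le_epsilon)
  thus ?thesis by simp
 qed

 have dissipation_jump: "(LINT x|\<mu>. f x * (h x + jump_op r f x)) - (LINT x|\<mu>. f x) * (LINT x|\<mu>. h x + jump_op r f x)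
   <= - \<gamma> * (centered_norm \<mu> f)^2"
  if f: "C_generator P f h" for f h
 proof -
  note c = env.C_generator_continuous[OF f]
  have L: "f \<in> L2 \<mu>" "h \<in> L2 \<mu>" "jump_op r f \<in> L2 \<mu>" using c L2_continuous R.jump_op_L2(2) by auto
  have "LINT x|\<mu>. f x * (h x + jump_op r f x) = (LINT x|\<mu>. f x * h x) + (LINT x|\<mu>. f x * jump_op r f x)"
   using L2_integrable_mult[OF L(1,2)] L2_integrable_mult[OF L(1,3)] by (simp add: distrib_left)
  moreover have "LINT x|\<mu>. h x + jump_op r f x = LINT x|\<mu>. h x" using R.m.L2_integrable[OF L(2)] R.m.L2_integrable[OF L(3)] jump_mean[OF c(1)] by simp
  moreover have "LINT x|\<mu>. f x * jump_op r f x <= 0" by (rule R.jump_symmetric_part[OF rates_nonneg(1) jump_mean c(1)])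
  ultimately show ?thesis using env.poincare_C_generator[OF mu(1) poincare f] by simp
 qed

 \<comment> \<open>The unperturbed process: \<open>\<epsilon> = 0\<close>.\<close>
 interpret DQ: dissipative Q \<mu> \<gamma> 0
 proof
  show "distribution \<mu>" "\<gamma> > 0" "(0::real) <= 0" by (simp_all add: mu gap_pos)
  fix f g assume "C_generator Q f g"
  then obtain h where h: "C_generator P f h" and g: "g = (%\<eta>. h \<eta> + jump_op r f \<eta>)" using seen_generator by blast
  show "(LINT x|\<mu>. f x * g x) - (LINT x|\<mu>. f x) * (LINT x|\<mu>. g x) <= - \<gamma> * (centered_norm \<mu> f)^2"
   unfolding g by (rule dissipation_jump[OF h])
  show "abs (LINT x|\<mu>. g x) <= 0 * centered_norm \<mu> f" using Q.invariant_generator_mean[OF mu(1) mu_seen \<open>C_generator Q f g\<close>] by simp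
 qed

 interpret DQe: dissipative Qe \<mu> "\<gamma> - \<epsilon>" \<epsilon>
 proof
  show "distribution \<mu>" "0 < \<gamma> - \<epsilon>" "0 <= \<epsilon>" using mu eps \<epsilon>0 by simp_all
  fix f g assume "C_generator Qe f g"
  then obtain h where h: "C_generator P f h" and g: "g = (%\<eta>. h \<eta> + jump_op r f \<eta> + jump_op rh f \<eta>)" using seen_generator_perturbed by blast
  note c = env.C_generator_continuous[OF h]
  have L: "f \<in> L2 \<mu>" "h \<in> L2 \<mu>" "jump_op r f \<in> L2 \<mu>" "jump_op rh f \<in> L2 \<mu>" using c L2_continuous R.jump_op_L2(2) J.jump_op_L2(2) by auto
  have Lhr: "(%x. h x + jump_op r f x) \<in> L2 \<mu>" by (rule L2_add[OF L(2,3)])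
  define a where "a = LINT x|\<mu>. f x"
  have fa: "(%x. f x - a) \<in> L2 \<mu>" by (rule R.m.centered_L2[OF L(1)])
  have mean: "LINT x|\<mu>. h x + jump_op r f x = 0"
  proof -
   have "C_generator Q f (%\<eta>. h \<eta> + jump_op r f \<eta>)" using h seen_generator by blast
   thus ?thesis by (rule Q.invariant_generator_mean[OF mu(1) mu_seen])
  qed
  have gm: "LINT x|\<mu>. g x = LINT x|\<mu>. jump_op rh f x"
   unfolding g using R.m.L2_integrable[OF Lhr] R.m.L2_integrable[OF L(4)] mean by simp
  have Jn: "L2_norm \<mu> (jump_op rh f) <= \<epsilon> * centered_norm \<mu> f" using J.jump_op_le_centered[OF L(1)] by (simp add: J_eps)
  show "abs (LINT x|\<mu>. g x) <= \<epsilon> * centered_norm \<mu> f"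
   unfolding gm using R.m.L2_integral_le[OF L(4)] Jn by linarith
  have "LINT x|\<mu>. f x * g x = (LINT x|\<mu>. f x * (h x + jump_op r f x)) + (LINT x|\<mu>. f x * jump_op rh f x)"
   unfolding g using L2_integrable_mult[OF L(1) Lhr] L2_integrable_mult[OF L(1,4)] by (simp add: distrib_left)
  moreover have "(LINT x|\<mu>. f x * jump_op rh f x) - a * (LINT x|\<mu>. jump_op rh f x) <= \<epsilon> * (centered_norm \<mu> f)^2"
  proof -
   have "(LINT x|\<mu>. f x * jump_op rh f x) - a * (LINT x|\<mu>. jump_op rh f x) = LINT x|\<mu>. (f x - a) * jump_op rh f x"
    using L2_integrable_mult[OF L(1,4)] R.m.L2_integrable[OF L(4)] by (simp add: left_diff_distrib)
   also have "... <= L2_norm \<mu> (%x. f x - a) * L2_norm \<mu> (jump_op rh f)" using L2_Cauchy_Schwarz[OF fa L(4)] by linarith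
   also have "... <= L2_norm \<mu> (%x. f x - a) * (\<epsilon> * L2_norm \<mu> (%x. f x - a))" using Jn by (intro mult_left_mono L2_norm_nonneg) (simp add: a_def)
   finally show ?thesis by (simp add: a_def power2_eq_square mult_ac)
  qed
  ultimately show "(LINT x|\<mu>. f x * g x) - (LINT x|\<mu>. f x) * (LINT x|\<mu>. g x) <= - (\<gamma> - \<epsilon>) * (centered_norm \<mu> f)^2"
   using dissipation_jump[OF h] unfolding gm mean a_def[symmetric] by (simp add: left_diff_distrib)
 qed

 obtain \<mu>e where \<mu>e: "distribution \<mu>e"
  "!!f B. f \<in> borel_measurable borel ==> (!!x. abs (f x) <= B) ==> (LINT x|\<mu>e. f x) = DQe.limit_mean f" using DQe.invariant_distribution_exists by blast
 interpret SL: stationary_limit Qe \<mu> "\<gamma> - \<epsilon>" \<epsilon> \<mu>e by unfold_locales (rule \<mu>e(1), rule \<mu>e(2))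
 interpret DS: dyson_stationary rh \<mu> Q \<gamma> \<mu>e "1 + \<epsilon> / (\<gamma> - \<epsilon>)"
 proof
  show "centered_norm \<mu> (markov_semigroup Q t f) <= exp (- \<gamma> * t) * centered_norm \<mu> f"
   if "continuous_on UNIV f" "t >= 0" for f t
  proof -
   note c = that(1)
   obtain B where "!!x. abs (f x) <= B" using env.continuous_bounded[OF c] by blast
   thus ?thesis by (rule DQ.bounded_decay(1)[OF env.continuous_measurable[OF that(1)]]) (rule that(2))
  qed
  show "J.eps < \<gamma>" using eps by (simp add: J_eps)
  fix f g assume f: "C_generator Q f g"
  then obtain h where h: "C_generator P f h" "g = (%\<eta>. h \<eta> + jump_op r f \<eta>)" using seen_generator by blast
  hence "C_generator Qe f (%\<eta>. g \<eta> + jump_op rh f \<eta>)" using seen_generator_perturbed by blast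
  hence "LINT x|\<mu>e. g x + jump_op rh f x = 0" by (rule Qe.invariant_generator_mean[OF \<mu>e(1) SL.invariant_mue])
  moreover have "integrable \<mu>e g" "integrable \<mu>e (jump_op rh f)" using Q.C_generator_continuous[OF f]
   by (blast intro: SL.L2_mue_bound(1) L2_continuous, blast intro: SL.L2_mue_bound(1) J.jump_op_L2(2) L2_continuous)
  ultimately show "LINT x|\<mu>e. g x = - (LINT x|\<mu>e. jump_op rh f x)" by simp
 qed (use seen_feller mu_seen gap_pos \<mu>e SL.absolutely_continuous_mue SL.L2_mue_bound in auto)

 interpret W: random_walk P re rate by unfold_locales (use rates_zero rates_nonneg rate in auto)

 have mac: "mutually_ac \<mu> \<mu>e"
 proof (rule env.mutually_ac_of_domination[OF mu(1,2) \<mu>e(1) SL.absolutely_continuous_mue gap_pos poincare])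
  fix A t assume A: "A \<in> sets (borel :: ('s, 'd) config measure)" and t: "(0::real) < t" and null: "measure \<mu>e A = 0"
  let ?I = "indicator A :: _ => real" and ?W = "{w \<in> space path_space. w t \<in> A}"
  have S_eq: "markov_semigroup K t ?I x = measure (K x) ?W"
   if "feller K" for K :: "('s, 'd) config => (real => ('s, 'd) config) measure" and x
  proof -
   interpret K: feller K by fact
   have "markov_semigroup K t ?I x = LINT w|K x. indicator ?W w"
    unfolding markov_semigroup_def by (intro bochner_cong) (auto simp: indicator_def)
   also have "... = measure (K x) (?W \<inter> space (K x))" by (rule Bochner_Integration.integral_indicator)
   also have "?W \<inter> space (K x) = ?W" by auto
   finally show ?thesis .
  qed
  have Ib: "abs (indicator A x :: real) <= 1" for x by (auto simp: indicator_def)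
  have "LINT x|\<mu>e. Qe.S t ?I x = LINT x|dist_at Qe \<mu>e t. indicator A x" by (rule Qe.integral_dist_at[OF \<mu>e(1) _ Ib, symmetric]) (use A in simp)
  also have "dist_at Qe \<mu>e t = \<mu>e" using SL.invariant_mue t by (simp add: invariant_def)
  also have "LINT x|\<mu>e. indicator A x = (0::real)" using null A by simp
  finally have 0: "LINT x|\<mu>e. Qe.S t ?I x = 0" .
  have nn: "0 <= Qe.S t ?I x" for x by (simp add: S_eq[OF Qe.feller_axioms])
  have "integrable \<mu>e (Qe.S t ?I)"
  proof (rule SL.mue.integrable_const_bound[where B = 1])
   show "AE x in \<mu>e. norm (Qe.S t ?I x) <= 1" using Qe.S_bounded[of ?I 1 t] Ib by simp
   show "Qe.S t ?I \<in> borel_measurable \<mu>e" using Qe.S_measurable'[of ?I t] A by simp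
  qed
  hence "AE x in \<mu>e. Qe.S t ?I x = 0" using 0 nn by (subst (asm) integral_nonneg_eq_0_iff_AE) auto
  thus "AE x in \<mu>e. env.S t ?I x = 0"
  proof eventually_elim
   case (elim x)
   have "exp (- t * rate) * env.S t ?I x <= Qe.S t ?I x"
    unfolding S_eq[OF Qe.feller_axioms] S_eq[OF env.feller_axioms] using W.no_arrival[of t A x] t A by (simp add: seen)
   hence "env.S t ?I x <= 0" using elim by (simp add: mult_le_0_iff)
   moreover have "0 <= env.S t ?I x" by (simp add: S_eq[OF env.feller_axioms])
   ultimately show ?case by simp
  qed
 qed

 have re_1: "integrable (count_space UNIV) (%y. Re.sup_h y * norm (zvec y))"
  using Re.moment_condition_integrable[OF moment_condition_weaken[OF S rates_continuous(2) rates_zero(2) re_n n(1)]] by simp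
 note drift_m = Re.drift_measurable[OF re_1]
 define D where "D = (SUP \<eta>. norm (drift re \<eta>))"
 have D: "norm (drift re \<eta>) <= D" for \<eta>
  unfolding D_def by (intro cSUP_upper bdd_aboveI2[where M = "LINT y|count_space UNIV. Re.sup_h y * norm (zvec y)"] Re.drift_norm_le[OF re_1]) auto
 note velocity_series = DS.vector_series_expansion[OF drift_m D]
 have i_drift: "integrable \<mu>e (drift re)" by (rule velocity_series(1))

 have velocity: "AE \<eta> in \<mu>. has_velocity (walker_law P rate re \<eta> 0) (LINT \<zeta>|\<mu>e. drift re \<zeta>)"
  if m2: "moment_condition 2 r" "moment_condition 2 rh"
 proof -
  have re_2: "integrable (count_space UNIV) (%y. Re.sup_h y * (norm (zvec y))^2)"
   by (rule Re.moment_condition_integrable[OF moment_condition_add[OF S rates_continuous(1,3) rates_sum m2]])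
  have "AE \<eta> in \<mu>. \<forall>i\<in>UNIV. AE w in Qe \<eta>.
    ((%t. (LINT s:{0..<t}|lborel. drift re (w s) $ i) / t) ---> (LINT \<zeta>|\<mu>e. drift re \<zeta>) $ i) at_top"
  proof (rule eventually_ball_finite; (intro ballI)?)
   fix i
   have "(LINT \<zeta>|\<mu>e. drift re \<zeta>) $ i = LINT \<zeta>|\<mu>e. drift re \<zeta> $ i" by (rule integral_bounded_linear[OF bounded_linear_vec_nth i_drift, symmetric])
   moreover have "borel_fun (%\<eta>. drift re \<eta> $ i)" by (rule measurable_compose[OF drift_m borel_measurable_continuous_onI])
     (rule continuous_on_component[OF continuous_on_id])
   ultimately show "AE \<eta> in \<mu>. AE w in Qe \<eta>.
    ((%t. (LINT s:{0..<t}|lborel. drift re (w s) $ i) / t) ---> (LINT \<zeta>|\<mu>e. drift re \<zeta>) $ i) at_top"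
    using SL.time_average[of "%\<eta>. drift re \<eta> $ i" D] order.trans[OF component_le_norm_cart D] by simp
  qed simp
  thus ?thesis by eventually_elim (rule W.velocity[OF re_2], unfold seen[symmetric], simp)
 qed

 note series = SL.L2_mue_bound(1) DS.series_expansion[unfolded J_eps]

 \<comment> \<open>A set of full measure serves for the required bound.\<close>
 have full_measure: "\<exists>A\<in>sets \<mu>. measure \<mu> A >= 1 - \<epsilon>\<^sup>2 / (\<gamma> - \<epsilon>)^2 & (\<forall>\<eta>\<in>A. Pr \<eta>)"
  if ae: "AE \<eta> in \<mu>. Pr \<eta>" for Pr
 proof -
  obtain N where N: "!!x. x \<in> space \<mu> - N ==> Pr x" "N \<in> null_sets \<mu>" using AE_E3[OF ae] by blast
  have "measure \<mu> (space \<mu> - N) = 1" using N(2) R.m.prob_compl[of N] by (auto simp: measure_def null_sets_def)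
  hence "measure \<mu> (space \<mu> - N) >= 1 - \<epsilon>\<^sup>2 / (\<gamma> - \<epsilon>)^2" by simp
  moreover have "space \<mu> - N \<in> sets \<mu>" using N(2) by auto
  ultimately show ?thesis using N(1) by blast
 qed

 have bound: "norm (LINT \<eta>|\<mu>. jump_op rh (dyson Q rh n s (drift re)) \<eta>)
    <= \<epsilon> ^ (n + 1) * exp (- \<gamma> * s) * s ^ n * (SUP \<eta>. norm (drift re \<eta>)) / fact n" if "s >= 0" for n s
  using velocity_series(5)[OF that, of n] by (simp add: DS.dyson_bound_def J_eps D_def)

 show ?thesis
 proof (intro exI[of _ \<mu>e] conjI impI allI ballI)
  show "distribution \<mu>e" "invariant Qe \<mu>e" "absolutely_continuous \<mu> \<mu>e" "time_ergodic Qe \<mu>e"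
   by (rule \<mu>e SL.invariant_mue SL.absolutely_continuous_mue SL.time_ergodic_mue)+
  show "\<nu> = \<mu>e" if "distribution \<nu> & invariant Qe \<nu> & absolutely_continuous \<mu> \<nu>" for \<nu> using that by (auto intro: SL.invariant_unique)
  show "weakly_converges (dist_at Qe \<nu>) \<mu>e at_top" if "distribution \<nu> & absolutely_continuous \<mu> \<nu>" for \<nu> using that by (auto intro: SL.weak_convergence)
  show "mutually_ac \<mu> \<mu>e" "mutually_ac \<mu> \<mu>e" by (rule mac)+
 qed (erule series | use velocity velocity_series bound full_measure SL.AE_mue in blast)+
qed

end
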